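(* Consider the asymptotic regime $n\to\infty$ with $k=cn+\frac{\widetilde s}{\tau}\sqrt n+o(\sqrt n)$, where $\widetilde s$ is a parameter and $\tau=\frac1{\sqrt{\|f\|_2^2+c\|g^{-1}\|_2^2}}$ is a normalization constant, with the specialization $x_i=f(i/n)$, $y_j=g(j/k)$. Take $m=\lfloor cn+\frac{\widetilde s}\tau\sqrt n\rfloor-l+\frac12$ and $m'=\lfloor cn+\frac{\widetilde s}\tau\sqrt n\rfloor-l'+\frac12$, so that $l,l'\in\mathbb Z$. Assume $$\int_0^1f(t)\,dt=c\int_0^1\frac{dt}{g(t)}.$$ Alternatively, these conditions can be written as $$\lim_{n,k\to\infty}\frac kn=c,\qquad \sum_{i=0}^{n-1}f(i/n)=c\sum_{j=0}^{k-1}g(j/k)^{-1}+\frac{\widetilde s}\tau\sqrt n .$$ With this scaling and these conditions one has the full support case $t_+=c$, and the correlation kernel converges to the discrete Hermite kernel with parameter $s:=\widetilde s\int_0^1\frac{dt}{g(t)}$: $$\lim_{n\to\infty}n^{\frac{l-l'}2}\,\mathcal K(m,m')=\tau^{\,l-l'}\sqrt{\frac{(l-1)!}{(l'-1)!}}\;\mathcal K^{\mathrm{He}}_s(l,l').$$ For $\Delta\in\mathbb N$, the probability distribution of the length of the first row of the diagram is given by the determinant $$\lim_{n\to\infty}\mathbb P(\lambda_1-k\le-\Delta)=\det_{1\le l,l'\le\Delta}\bigl[\delta_{l,l'}-\mathcal K^{\mathrm{He}}_s(l,l')\bigr].$$ Similarly, if $$\int_0^1\frac{dt}{f(t)}=c\int_0^1g(t)\,dt,$$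 then $t_-=-1$ and the fluctuations in the left corner of the rectangle are described by the discrete Hermite kernel.
   Context: $f,g:[0,1]\to\mathbb R_{\ge0}$ are piecewise $\mathcal C^1$ with $f(s)>0$, $g(s)\ge0$; $c>0$; $\|h\|_2^2=\int_0^1h(t)^2dt$, $g^{-1}=1/g$, and the norms defining $\tau$ are finite. $\lambda$ is a random partition in the $n\times k$ rectangle (at most $n$ parts, each at most $k$) with law $s_\lambda(x_1,\dots,x_n)s_{\lambda'}(y_1,\dots,y_k)/\prod_{i,j}(1+x_iy_j)$, where $s_\lambda$ is the Schur polynomial and $\lambda'$ the conjugate partition. $\mathcal K$ is the correlation kernel of $\{\lambda_i-i+\frac12\}$: $$\mathcal K(m,m')=\oint\oint_{|w|<|z|}\frac{dz}{2\pi\mathbf i z}\frac{dw}{2\pi\mathbf i w}\frac{K(z)}{K(w)}z^{-m}w^{m'}\frac{\sqrt{zw}}{z-w},\quad K(z)=\prod_{i=1}^n\frac1{1-x_iz}\prod_{j=1}^k\frac1{1+y_j/z},$$ $\mathbf i=\sqrt{-1}$, where the $z$-contour contains all $-y_j$ and no $x_i^{-1}$, and the $w$-contour encircles $0$. The discrete Hermite kernel, for $l,l'\ge1$, is $$\mathcal K^{\mathrm{He}}_s(l,l')=\frac1{\sqrt{2\pi(l-1)!\,(l'-1)!}}\int_s^\infty e^{-t^2/2}\,\mathrm{He}_{l-1}(t)\,\mathrm{He}_{l'-1}(t)\,dt,$$ with $\mathrm{He}_l$ the probabilist's Hermite polynomials. $t_+$ and $t_-$ are the right and left endpoints of the support interval,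 the interval of $t\in[-1,c]$ on which the equation $\int_0^1\frac{f(s)z}{1-f(s)z}ds+c\int_0^1\frac{g(s)}{z+g(s)}ds-t=0$ has a pair of complex conjugate roots $z$; $t_+=c$ (resp. $t_-=-1$) means the limit shape ends at the right (resp. left) corner of the rectangle.
   Formalization: The kernel limit uses m=k−l+1/2 for every k in the regime, and the printed floor when k equals it; the alternative condition is corrected to Σf(i/n)=Σ1/g(j/k)−(s/τ)√n+o(√n); piecewise C^1 is read as C^1 up to the ends of pieces, with one-sided limits as break values. *)

theory Defs
  imports
    "HOL-Complex_Analysis.Complex_Analysis"
    "HOL-Probability.Probability"
    "HOL-Library.Landau_Symbols"
    "Jordan_Normal_Form.Determinant"
begin

section \<open>Piecewise smooth profiles and norms\<close>

text \<open>
  [0,1] is a finite union of nondegenerate intervals (open, closed or half-open) and on each of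
  them the function is the restriction of a function that is continuously differentiable up to
  and including the endpoints. Jumps are allowed, with the value at a break point being one of the
  two one-sided limits. The library predicate \<open>piecewise_C1_differentiable_on\<close> forbids jumps and,
  on the other hand, lets the derivative blow up at the break points.
\<close>

definition piecewise_C1 :: "(real \<Rightarrow> real) \<Rightarrow> bool" where
  "piecewise_C1 f \<longleftrightarrow>
     (\<exists>\<I>. finite \<I> \<and> \<Union>\<I> = {0..1} \<and>
        (\<forall>I\<in>\<I>. is_interval I \<and> interior I \<noteq> {} \<and>
           (\<exists>h. h C1_differentiable_on UNIV \<and> (\<forall>t\<in>I. f t = h t))))"

definition sqnorm2 :: "(real \<Rightarrow> real) \<Rightarrow> real" where
  "sqnorm2 h = integral {0..1} (\<lambda>t. (h t)\<^sup>2)"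

text \<open>
  Finiteness of the L2 norms of \<open>h\<close> and of \<open>1/h\<close> for a nonnegative \<open>h\<close>. The second one uses
  the inverse of \<^typ>\<open>ennreal\<close>, where \<open>inverse 0 = \<infinity>\<close>, so that it fails when \<open>h\<close> vanishes on a
  set of positive measure; the real convention \<open>1/0 = 0\<close> would hide this.
\<close>

definition finite_norm2 :: "(real \<Rightarrow> real) \<Rightarrow> bool" where
  "finite_norm2 h \<longleftrightarrow> (\<integral>\<^sup>+ t\<in>{0..1}. (ennreal (h t))\<^sup>2 \<partial>lborel) < \<infinity>"

definition finite_norm2_inverse :: "(real \<Rightarrow> real) \<Rightarrow> bool" where
  "finite_norm2_inverse h \<longleftrightarrow> (\<integral>\<^sup>+ t\<in>{0..1}. (inverse (ennreal (h t)))\<^sup>2 \<partial>lborel) < \<infinity>"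

definition tau_right :: "(real \<Rightarrow> real) \<Rightarrow> (real \<Rightarrow> real) \<Rightarrow> real \<Rightarrow> real" where
  "tau_right f g c = 1 / sqrt (sqnorm2 f + c * sqnorm2 (\<lambda>t. 1 / g t))"

text \<open>The normalization for the left corner: the roles of the two profiles are exchanged.\<close>

definition tau_left :: "(real \<Rightarrow> real) \<Rightarrow> (real \<Rightarrow> real) \<Rightarrow> real \<Rightarrow> real" where
  "tau_left f g c = 1 / sqrt (sqnorm2 (\<lambda>t. 1 / f t) + c * sqnorm2 g)"

text \<open>\<open>k = c n + (s / \<tau>) sqrt n + o(sqrt n)\<close>\<close>

definition regime :: "real \<Rightarrow> real \<Rightarrow> real \<Rightarrow> (nat \<Rightarrow> nat) \<Rightarrow> bool" where
  "regime c \<tau> s k \<longleftrightarrow>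
     (\<lambda>n. real (k n) - (c * real n + s / \<tau> * sqrt (real n))) \<in> o(\<lambda>n. sqrt (real n))"


section \<open>Support interval of the limit shape\<close>

definition action_equation ::
    "(real \<Rightarrow> real) \<Rightarrow> (real \<Rightarrow> real) \<Rightarrow> real \<Rightarrow> real \<Rightarrow> complex \<Rightarrow> bool" where
  "action_equation f g c t z \<longleftrightarrow>
     integral {0..1} (\<lambda>s. complex_of_real (f s) * z / (1 - complex_of_real (f s) * z))
     + complex_of_real c * integral {0..1} (\<lambda>s. complex_of_real (g s) / (z + complex_of_real (g s)))
     - complex_of_real t = 0"

definition limit_support :: "(real \<Rightarrow> real) \<Rightarrow> (real \<Rightarrow> real) \<Rightarrow> real \<Rightarrow> real set" where
  "limit_support f g c =
     {t \<in> {-1..c}. \<exists>z. z \<notin> \<real> \<and> action_equation f g c t z \<and> action_equation f g c t (cnj z)}"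

definition t_plus :: "(real \<Rightarrow> real) \<Rightarrow> (real \<Rightarrow> real) \<Rightarrow> real \<Rightarrow> real" where
  "t_plus f g c = Sup (limit_support f g c)"

definition t_minus :: "(real \<Rightarrow> real) \<Rightarrow> (real \<Rightarrow> real) \<Rightarrow> real \<Rightarrow> real" where
  "t_minus f g c = Inf (limit_support f g c)"


section \<open>The random partition\<close>

text \<open>
  A partition is a nonincreasing sequence indexed from 0: \<open>\<mu> 0\<close> is the first row. The variables
  \<open>x\<close> and \<open>y\<close> are indexed from 1.
\<close>

definition box_partitions :: "nat \<Rightarrow> nat \<Rightarrow> (nat \<Rightarrow> nat) set" where
  "box_partitions n k = {\<mu>. antimono \<mu> \<and> (\<forall>i\<ge>n. \<mu> i = 0) \<and> (\<forall>i. \<mu> i \<le> k)}"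

definition conj_partition :: "(nat \<Rightarrow> nat) \<Rightarrow> nat \<Rightarrow> nat" where
  "conj_partition \<mu> j = card {i. j < \<mu> i}"

definition young_cells :: "(nat \<Rightarrow> nat) \<Rightarrow> (nat \<times> nat) set" where
  "young_cells \<mu> = {(i, j). j < \<mu> i}"

definition ssyt :: "nat \<Rightarrow> (nat \<Rightarrow> nat) \<Rightarrow> (nat \<times> nat \<Rightarrow> nat) set" where
  "ssyt n \<mu> = {T \<in> young_cells \<mu> \<rightarrow>\<^sub>E {1..n}.
     (\<forall>i j j'. (i, j') \<in> young_cells \<mu> \<and> j \<le> j' \<longrightarrow> T (i, j) \<le> T (i, j')) \<and>
     (\<forall>i i' j. (i', j) \<in> young_cells \<mu> \<and> i < i' \<longrightarrow> T (i, j) < T (i', j))}"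

definition schur :: "nat \<Rightarrow> (nat \<Rightarrow> real) \<Rightarrow> (nat \<Rightarrow> nat) \<Rightarrow> real" where
  "schur n x \<mu> = (\<Sum>T\<in>ssyt n \<mu>. \<Prod>u\<in>young_cells \<mu>. x (T u))"

definition skew_howe_pmf ::
    "nat \<Rightarrow> nat \<Rightarrow> (nat \<Rightarrow> real) \<Rightarrow> (nat \<Rightarrow> real) \<Rightarrow> (nat \<Rightarrow> nat) pmf" where
  "skew_howe_pmf n k x y = embed_pmf (\<lambda>\<mu>.
     if \<mu> \<in> box_partitions n k
     then schur n x \<mu> * schur k y (conj_partition \<mu>) / (\<Prod>i=1..n. \<Prod>j=1..k. 1 + x i * y j)
     else 0)"


section \<open>The correlation kernel\<close>

definition kernel_factor ::
    "nat \<Rightarrow> nat \<Rightarrow> (nat \<Rightarrow> real) \<Rightarrow> (nat \<Rightarrow> real) \<Rightarrow> complex \<Rightarrow> complex" where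
  "kernel_factor n k x y z =
     (\<Prod>i=1..n. 1 / (1 - complex_of_real (x i) * z)) * (\<Prod>j=1..k. 1 / (1 + complex_of_real (y j) / z))"

text \<open>
  Both contours run once counterclockwise around 0 and \<open>|w| < |z|\<close>, so the \<open>z\<close>-contour also encircles the
  \<open>w\<close>-contour. It moreover encircles every \<open>-y j\<close> and no \<open>1 / x i\<close>; such a contour need not be
  a circle centred at 0.
\<close>

definition kernel_contours ::
    "nat \<Rightarrow> nat \<Rightarrow> (nat \<Rightarrow> real) \<Rightarrow> (nat \<Rightarrow> real)
      \<Rightarrow> (real \<Rightarrow> complex) \<Rightarrow> (real \<Rightarrow> complex) \<Rightarrow> bool" where
  "kernel_contours n k x y \<gamma>z \<gamma>w \<longleftrightarrow>
     valid_path \<gamma>z \<and> pathfinish \<gamma>z = pathstart \<gamma>z \<and>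
     valid_path \<gamma>w \<and> pathfinish \<gamma>w = pathstart \<gamma>w \<and>
     (\<forall>z\<in>path_image \<gamma>z. \<forall>w\<in>path_image \<gamma>w. norm w < norm z) \<and>
     0 \<notin> path_image \<gamma>w \<and> winding_number \<gamma>w 0 = 1 \<and>
     0 \<notin> path_image \<gamma>z \<and> winding_number \<gamma>z 0 = 1 \<and>
     (\<forall>j\<in>{1..k}. - complex_of_real (y j) \<notin> path_image \<gamma>z \<and>
        winding_number \<gamma>z (- complex_of_real (y j)) = 1) \<and>
     (\<forall>i\<in>{1..n}. 1 / complex_of_real (x i) \<notin> path_image \<gamma>z \<and>
        winding_number \<gamma>z (1 / complex_of_real (x i)) = 0)"

text \<open>
  The value at the half-integers \<open>m = a + 1/2\<close> and \<open>m' = a' + 1/2\<close>. The square root cancels the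
  half-integer powers: \<open>z^(-m) sqrt z = z^(-a)\<close> and \<open>w^(m') sqrt w = w^(a' + 1)\<close>, hence the
  integer exponents.
\<close>

definition corr_kernel ::
    "(real \<Rightarrow> complex) \<Rightarrow> (real \<Rightarrow> complex) \<Rightarrow> nat \<Rightarrow> nat \<Rightarrow> (nat \<Rightarrow> real) \<Rightarrow> (nat \<Rightarrow> real)
      \<Rightarrow> int \<Rightarrow> int \<Rightarrow> complex" where
  "corr_kernel \<gamma>z \<gamma>w n k x y a a' =
     contour_integral \<gamma>z (\<lambda>z. contour_integral \<gamma>w (\<lambda>w.
       1 / (2 * of_real pi * \<i> * z) * (1 / (2 * of_real pi * \<i> * w)) *
       (kernel_factor n k x y z / kernel_factor n k x y w) *
       z powi (- a) * w powi (a' + 1) / (z - w)))"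

lemma kernel_contours_exist:
  assumes x: "\<And>i. i \<in> {1..n} \<Longrightarrow> x i > 0" and y: "\<And>j. j \<in> {1..k} \<Longrightarrow> y j \<ge> 0"
  shows "\<exists>\<gamma>z \<gamma>w. kernel_contours n k x y \<gamma>z \<gamma>w"
proof -
  define e where "e = Min (insert 1 ((\<lambda>i. 1 / x i) ` {1..n})) / 2"
  define R where "R = Max (insert 1 (y ` {1..k}))"
  have m0: "Min (insert 1 ((\<lambda>i. 1 / x i) ` {1..n})) > 0"
    by (subst Min_gr_iff) (auto simp: x)
  have e0: "e > 0" using m0 by (simp add: e_def)
  have ex: "e < 1 / x i" if "i \<in> {1..n}" for i
  proof -
    have "Min (insert 1 ((\<lambda>i. 1 / x i) ` {1..n})) \<le> 1 / x i"
      by (rule Min_le) (use that in auto)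
    then show ?thesis using m0 unfolding e_def by linarith
  qed
  have R1: "R \<ge> 1" unfolding R_def by (rule Max_ge) auto
  have Ry: "y j \<le> R" if "j \<in> {1..k}" for j
    unfolding R_def by (rule Max_ge) (use that in auto)
  let ?c = "complex_of_real (- R)" and ?r = "R + e"
  let ?z = "circlepath ?c ?r" and ?w = "circlepath 0 (e / 2)"
  have r0: "?r > 0" using R1 e0 by simp
  have inside: "complex_of_real t \<notin> path_image ?z \<and> winding_number ?z (complex_of_real t) = 1"
    if "\<bar>t + R\<bar> < ?r" for t
  proof -
    have "norm (complex_of_real t - ?c) = \<bar>t + R\<bar>"
      by (metis (no_types) diff_minus_eq_add norm_of_real of_real_diff)
    then show ?thesis
      using that r0 by (auto simp: winding_number_circlepath dist_norm norm_minus_commute)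
  qed
  have norm_z: "e \<le> norm z" if "z \<in> path_image ?z" for z
  proof -
    have "norm (z - ?c) = ?r" using that r0 by (auto simp: dist_norm norm_minus_commute)
    moreover have "norm (z - ?c) \<le> norm z + norm ?c" by (rule norm_triangle_ineq4)
    moreover have "norm ?c = R" using R1 by simp
    ultimately show ?thesis by linarith
  qed
  have norm_w: "norm w = e / 2" if "w \<in> path_image ?w" for w
    using that e0 by auto
  have outside: "1 / complex_of_real (x i) \<notin> path_image ?z \<and>
      winding_number ?z (1 / complex_of_real (x i)) = 0" if i: "i \<in> {1..n}" for i
  proof -
    have "1 / complex_of_real (x i) - ?c = complex_of_real (1 / x i + R)" by simp
    then have "norm (1 / complex_of_real (x i) - ?c) = 1 / x i + R"
      using x[OF i] R1 by (simp only: norm_of_real) simp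
    then have *: "norm (1 / complex_of_real (x i) - ?c) > ?r" using ex[OF i] by simp
    then have n: "1 / complex_of_real (x i) \<notin> cball ?c ?r"
      by (simp only: mem_cball dist_norm norm_minus_commute not_le)
    then have "1 / complex_of_real (x i) \<notin> path_image ?z" using r0 by (auto simp: dist_norm)
    moreover have "winding_number ?z (1 / complex_of_real (x i)) = 0"
      by (rule winding_number_zero_outside[where s = "cball ?c ?r"])
         (use n r0 in \<open>auto simp: dist_norm\<close>)
    ultimately show ?thesis by blast
  qed
  have "kernel_contours n k x y ?z ?w"
    unfolding kernel_contours_def
  proof (intro conjI ballI)
    show "norm w < norm z" if "z \<in> path_image ?z" "w \<in> path_image ?w" for z w
      using norm_z[OF that(1)] norm_w[OF that(2)] e0 by simp
    show "winding_number ?w 0 = 1" using e0 by (simp add: winding_number_circlepath)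
    show "0 \<notin> path_image ?w" using norm_w[of 0] e0 by auto
    show "0 \<notin> path_image ?z" "winding_number ?z 0 = 1" using inside[of 0] R1 e0 by auto
    fix j assume j: "j \<in> {1..k}"
    show "- complex_of_real (y j) \<notin> path_image ?z"
         "winding_number ?z (- complex_of_real (y j)) = 1"
      using inside[of "- y j"] Ry[OF j] y[OF j] e0 by auto
  qed (use outside in auto)
  then show ?thesis by blast
qed


section \<open>The discrete Hermite kernel\<close>

fun hermite_He :: "nat \<Rightarrow> real \<Rightarrow> real" where
  "hermite_He 0 t = 1"
| "hermite_He (Suc 0) t = t"
| "hermite_He (Suc (Suc r)) t = t * hermite_He (Suc r) t - real (Suc r) * hermite_He r t"

definition hermite_kernel :: "real \<Rightarrow> nat \<Rightarrow> nat \<Rightarrow> real" where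
  "hermite_kernel s l l' =
     1 / sqrt (2 * pi * fact (l - 1) * fact (l' - 1)) *
     integral {s..} (\<lambda>t. exp (- t\<^sup>2 / 2) * hermite_He (l - 1) t * hermite_He (l' - 1) t)"

text \<open>The rows and columns of \<^const>\<open>Matrix.mat\<close> are numbered from 0.\<close>

definition hermite_gap_det :: "real \<Rightarrow> nat \<Rightarrow> real" where
  "hermite_gap_det s \<Delta> = Determinant.det (Matrix.mat \<Delta> \<Delta>
     (\<lambda>(i, j). (if i = j then 1 else 0) - hermite_kernel s (i + 1) (j + 1)))"

end

(*
  The sum of the weights over the partitions with first row at most k - D is, by the bialternant
  formula and branching in the y_j, the determinant of an n x n matrix which is a rank D perturbation
  of a Vandermonde matrix. Lagrange interpolation inverts the Vandermonde matrix, and Sylvester's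
  identity det(1 - GC) = det(1 - CG) leaves the D x D determinant of 1 minus a kernel whose entries
  are sums of residues at the points 1/x_i. The double contour integral gives the same kernel: its
  w-integral only extracts coefficients of 1/K(w), and the z-contour can be deformed to a vertical
  line Re z = e to the left of all the 1/x_i. With the x_i and the -1/y_j merged into one family b,
  the integrand is a power of z over the product of the 1 - b_i z. On the scale
  z = (tau / sqrt n) (1 + iu) the critical condition cancels the terms of order sqrt n in its
  logarithm, so that the line integrals tend to Gaussian moments by dominated convergence and the
  coefficients of 1/K to Hermite polynomials; differentiation in s identifies the resulting finite
  sum with the discrete Hermite kernel. Coinciding x_i are separated by a small perturbation. The
  left corner is the right corner of the conjugate partition, with the two families of variables
  exchanged.
*)
theory Submission
  imports Defs "HOL-Real_Asymp.Real_Asymp"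
begin

section \<open>Partitions and branching of Schur polynomials\<close>

text \<open>After the determinantal identity, everything is a statement about one array, the
  \<open>x i\<close> together with the numbers - 1 / \<open>y j\<close>, and the limit sees only its
  first two power sums. This needs bounded entries. For 1 / \<open>g\<close> boundedness is not
  assumed: a C1 piece that tends to 0 does so at most linearly, and then 1 / g^2 is not integrable.
  The same bound makes Riemann sums of the profiles correct up to O(1), negligible against the scale
  sqrt n of the regime.

  Lagrange interpolation needs distinct nodes 1 / \<open>x i\<close>, and no uniform separation is
  available. But distinctness enters only identities at fixed n, while the line integrals do not see
  it, so the size of the perturbation may depend on n.

  The other obstacle is domination of the line integrals: no single factor decays uniformly in n,
  and the decay has to be collected from the sum of squares of the whole array.

  For the endpoints of the support only accumulation at the corner is shown. This suffices, since
  the support is a subset of [-1, c] by definition.\<close>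

lemma young_cells_box:
  assumes "\<mu> \<in> box_partitions n k"
  shows "young_cells \<mu> = Sigma {..<n} (\<lambda>i. {..<\<mu> i})"
proof -
  have "i < n" if "j < \<mu> i" for i j
  proof -
    have "\<not> n \<le> i" using assms that by (auto simp: box_partitions_def)
    then show ?thesis by simp
  qed
  then show ?thesis by (auto simp: young_cells_def)
qed

lemma finite_young_cells: "\<mu> \<in> box_partitions n k \<Longrightarrow> finite (young_cells \<mu>)"
  by (simp add: young_cells_box)

lemma card_young_cells: "\<mu> \<in> box_partitions n k \<Longrightarrow> card (young_cells \<mu>) = (\<Sum>i<n. \<mu> i)"
  by (simp add: young_cells_box)

lemma finite_box_partitions: "finite (box_partitions n k)"
proof -
  have "finite {\<mu>. \<forall>i. (i \<in> {..<n} \<longrightarrow> \<mu> i \<in> {..k}) \<and> (i \<notin> {..<n} \<longrightarrow> \<mu> i = (0::nat))}"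
    by (rule finite_set_of_finite_funs) auto
  then show ?thesis by (rule rev_finite_subset) (auto simp: box_partitions_def)
qed

lemma box_partitions_mono:
  assumes "\<mu> \<in> box_partitions n k" "n \<le> n'" "k \<le> k'"
  shows "\<mu> \<in> box_partitions n' k'"
  using assms unfolding box_partitions_def by (auto intro: order_trans[of _ k k'])

lemma box_partitions_width:
  "m \<le> k \<Longrightarrow> box_partitions n m = {\<mu> \<in> box_partitions n k. \<mu> 0 \<le> m}"
  by (auto simp: box_partitions_def antimono_def dest: order_trans)

lemma box_partitions_0: "box_partitions 0 k = {\<lambda>_. 0}"
  by (auto simp: box_partitions_def antimono_def)

text \<open>Since \<open>\<mu>\<close> decreases, the rows longer than \<open>j\<close> form an
  initial segment, whose length is the first row that fails; the box supplies such a row, namely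
  \<open>n\<close>. All later facts on conjugation are read off from this symmetric relation between
  cells.\<close>

lemma less_conj_partition_iff:
  assumes "\<mu> \<in> box_partitions n k"
  shows "i < conj_partition \<mu> j \<longleftrightarrow> j < \<mu> i"
proof -
  define c where "c = (LEAST i. \<not> j < \<mu> i)"
  have "\<not> j < \<mu> n" using assms by (auto simp: box_partitions_def)
  then have c: "\<not> j < \<mu> c" unfolding c_def by (rule LeastI)
  have "{i. j < \<mu> i} = {..<c}"
  proof (intro equalityI subsetI)
    fix i assume i: "i \<in> {i. j < \<mu> i}"
    show "i \<in> {..<c}"
    proof (rule ccontr)
      assume "i \<notin> {..<c}"
      then have "\<mu> i \<le> \<mu> c" using assms by (auto simp: box_partitions_def antimono_def)
      with i c show False by simp
    qed
  next
    fix i assume "i \<in> {..<c}"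
    then show "i \<in> {i. j < \<mu> i}" unfolding c_def using not_less_Least by blast
  qed
  then show ?thesis by (auto simp: conj_partition_def)
qed

lemma le_if_all_less: "(\<And>j::nat. j < a \<Longrightarrow> j < b) \<Longrightarrow> a \<le> b"
  by (meson linorder_not_less order_less_irrefl)

lemma conj_partition_box:
  assumes "\<mu> \<in> box_partitions n k"
  shows "conj_partition \<mu> \<in> box_partitions k n"
proof -
  note [simp] = less_conj_partition_iff[OF assms]
  have "antimono (conj_partition \<mu>)"
  proof (intro antimonoI le_if_all_less)
    fix j j' i assume "j \<le> j'" "i < conj_partition \<mu> j'"
    then have "j' < \<mu> i" "j \<le> j'" by simp_all
    then show "i < conj_partition \<mu> j" by simp
  qed
  moreover have "conj_partition \<mu> j = 0" if "j \<ge> k" for j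
  proof -
    have "\<not> 0 < conj_partition \<mu> j"
      using assms that by (auto simp: box_partitions_def not_less intro: order_trans[of _ k j])
    then show ?thesis using gr0I by blast
  qed
  moreover have "conj_partition \<mu> j \<le> n" for j
  proof (rule le_if_all_less)
    fix i assume "i < conj_partition \<mu> j"
    then have "\<mu> i \<noteq> 0" by simp
    then have "\<not> n \<le> i" using assms by (auto simp: box_partitions_def)
    then show "i < n" by simp
  qed
  ultimately show ?thesis by (auto simp: box_partitions_def)
qed

lemma conj_conj_partition:
  assumes "\<mu> \<in> box_partitions n k"
  shows "conj_partition (conj_partition \<mu>) = \<mu>"
proof
  fix i
  have "j < conj_partition (conj_partition \<mu>) i \<longleftrightarrow> j < \<mu> i" for j
    using less_conj_partition_iff[OF assms] less_conj_partition_iff[OF conj_partition_box[OF assms]]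
    by simp
  then show "conj_partition (conj_partition \<mu>) i = \<mu> i"
    by (meson le_antisym le_if_all_less)
qed

lemma card_young_cells_conj:
  assumes "\<mu> \<in> box_partitions n k"
  shows "card (young_cells (conj_partition \<mu>)) = card (young_cells \<mu>)"
proof -
  have "young_cells (conj_partition \<mu>) = prod.swap ` young_cells \<mu>"
    by (auto simp: young_cells_def less_conj_partition_iff[OF assms])
  then show ?thesis by (simp add: card_image)
qed

section \<open>Horizontal strips (interlacing rows) and vertical strips (at most one new cell per
  row)\<close>

definition hstrip :: "(nat \<Rightarrow> nat) \<Rightarrow> (nat \<Rightarrow> nat) \<Rightarrow> bool" where
  "hstrip \<kappa> \<nu> \<longleftrightarrow> (\<forall>i. \<nu> (Suc i) \<le> \<kappa> i \<and> \<kappa> i \<le> \<nu> i)"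

definition vstrip :: "(nat \<Rightarrow> nat) \<Rightarrow> (nat \<Rightarrow> nat) \<Rightarrow> bool" where
  "vstrip \<mu> \<nu> \<longleftrightarrow> (\<forall>i. \<mu> i \<le> \<nu> i \<and> \<nu> i \<le> Suc (\<mu> i))"

lemma hstrip_box:
  assumes "hstrip \<kappa> \<nu>" "\<nu> \<in> box_partitions n k"
  shows "\<kappa> \<in> box_partitions n k"
proof -
  have "\<kappa> (Suc i) \<le> \<kappa> i" for i
    using assms(1) order_trans[of "\<kappa> (Suc i)" "\<nu> (Suc i)" "\<kappa> i"] by (auto simp: hstrip_def)
  then have "antimono \<kappa>" by (simp add: decseq_SucI)
  then show ?thesis
    using assms order_trans[of "\<kappa> _" "\<nu> _" k] by (auto simp: box_partitions_def hstrip_def) (metis le_zero_eq)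
qed

lemma finite_hstrip: "\<nu> \<in> box_partitions n k \<Longrightarrow> finite {\<kappa>. hstrip \<kappa> \<nu>}"
  by (rule finite_subset[OF _ finite_box_partitions]) (auto intro: hstrip_box)

text \<open>Both conditions are compared cell by cell: an inequality \<open>a \<le> b\<close> is an
  inclusion of initial segments, so each inequality between columns becomes an implication between
  cells, in which the shift by one moves from one index to the other.\<close>

lemma hstrip_conj_iff:
  assumes "\<mu> \<in> box_partitions n k" "\<nu> \<in> box_partitions n k"
  shows "hstrip (conj_partition \<mu>) (conj_partition \<nu>) \<longleftrightarrow> vstrip \<mu> \<nu>"
proof -
  have le: "(a \<le> b) \<longleftrightarrow> (\<forall>i<a. i < b)" for a b :: nat
    using le_if_all_less by (auto intro: order.strict_trans2)
  note [simp] = less_conj_partition_iff[OF assms(1)] less_conj_partition_iff[OF assms(2)]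
  have "hstrip (conj_partition \<mu>) (conj_partition \<nu>) \<longleftrightarrow>
     (\<forall>j i. (Suc j < \<nu> i \<longrightarrow> j < \<mu> i) \<and> (j < \<mu> i \<longrightarrow> j < \<nu> i))"
    by (auto simp: hstrip_def le)
  also have "\<dots> \<longleftrightarrow> vstrip \<mu> \<nu>"
  proof
    assume *: "\<forall>j i. (Suc j < \<nu> i \<longrightarrow> j < \<mu> i) \<and> (j < \<mu> i \<longrightarrow> j < \<nu> i)"
    show "vstrip \<mu> \<nu>"
      unfolding vstrip_def
    proof safe
      fix i
      show "\<mu> i \<le> \<nu> i" using * by (intro le_if_all_less) auto
      show "\<nu> i \<le> Suc (\<mu> i)"
        using * by (metis Suc_lessD lessI linorder_not_less less_irrefl)
    qed
  next
    assume "vstrip \<mu> \<nu>"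
    then have "\<mu> i \<le> \<nu> i" "\<nu> i \<le> Suc (\<mu> i)" for i by (auto simp: vstrip_def)
    then show "\<forall>j i. (Suc j < \<nu> i \<longrightarrow> j < \<mu> i) \<and> (j < \<mu> i \<longrightarrow> j < \<nu> i)"
      by (meson Suc_less_SucD order.strict_trans2)
  qed
  finally show ?thesis .
qed

section \<open>Semistandard tableaux and the branching rule\<close>

lemma ssyt_range: "T \<in> ssyt n \<mu> \<Longrightarrow> u \<in> young_cells \<mu> \<Longrightarrow> T u \<in> {1..n}"
  unfolding ssyt_def by (cases u) blast

lemma ssyt_outside: "T \<in> ssyt n \<mu> \<Longrightarrow> u \<notin> young_cells \<mu> \<Longrightarrow> T u = undefined"
  unfolding ssyt_def by (blast intro: PiE_arb)

lemma ssyt_row: "T \<in> ssyt n \<mu> \<Longrightarrow> (i, j') \<in> young_cells \<mu> \<Longrightarrow> j \<le> j' \<Longrightarrow> T (i, j) \<le> T (i, j')"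
  by (auto simp: ssyt_def)

lemma ssyt_col: "T \<in> ssyt n \<mu> \<Longrightarrow> (i', j) \<in> young_cells \<mu> \<Longrightarrow> i < i' \<Longrightarrow> T (i, j) < T (i', j)"
  by (auto simp: ssyt_def)

lemma finite_ssyt: "\<mu> \<in> box_partitions n k \<Longrightarrow> finite (ssyt m \<mu>)"
  unfolding ssyt_def
  by (rule finite_subset[OF Collect_restrict]) (simp add: finite_PiE finite_young_cells)

lemma schur_nonneg: "(\<And>i. i \<in> {1..n} \<Longrightarrow> x i \<ge> 0) \<Longrightarrow> schur n x \<mu> \<ge> 0"
  unfolding schur_def by (intro sum_nonneg prod_nonneg) (use ssyt_range in blast)

lemma schur_empty_diagram: "schur n x (\<lambda>_. 0) = 1"
proof -
  have "ssyt n (\<lambda>_. 0) = {\<lambda>_. undefined}" by (auto simp: ssyt_def young_cells_def)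
  then show ?thesis by (simp add: schur_def young_cells_def)
qed

text \<open>The first column increases strictly from an entry at least 1, so its entry in row
  \<open>i\<close> is at least i + 1. In row \<open>n\<close>, counted from 0, this exceeds the
  largest allowed entry.\<close>

lemma schur_too_many_rows:
  assumes "antimono \<kappa>" "\<kappa> n > 0"
  shows "schur n x \<kappa> = 0"
proof -
  have "ssyt n \<kappa> = {}"
  proof (rule ccontr)
    assume "ssyt n \<kappa> \<noteq> {}"
    then obtain T where T: "T \<in> ssyt n \<kappa>" by auto
    have cell: "(i, 0) \<in> young_cells \<kappa>" if "i \<le> n" for i
      using assms that by (auto simp: young_cells_def antimono_def intro: order.strict_trans2)
    have "T (i, 0) \<ge> Suc i" if "i \<le> n" for i
      using that
    proof (induction i)
      case 0
      then show ?case using ssyt_range[OF T cell[of 0]] by simp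
    next
      case (Suc i)
      have "T (i, 0) < T (Suc i, 0)" using ssyt_col[OF T cell[OF Suc.prems]] by simp
      then show ?case using Suc by simp
    qed
    from this[of n] have "T (n, 0) \<ge> Suc n" by simp
    moreover have "T (n, 0) \<le> n" using ssyt_range[OF T cell[of n]] by simp
    ultimately show False by simp
  qed
  then show ?thesis by (simp add: schur_def)
qed

text \<open>The entries \<open>Suc n\<close> of a tableau occupy a horizontal strip at the rim of the diagram.\<close>

definition inner_shape :: "nat \<Rightarrow> (nat \<Rightarrow> nat) \<Rightarrow> (nat \<times> nat \<Rightarrow> nat) \<Rightarrow> nat \<Rightarrow> nat" where
  "inner_shape n \<nu> T i = card {j. j < \<nu> i \<and> T (i, j) \<le> n}"

text \<open>Rows increase weakly, so the cells of a row with entry at most \<open>n\<close> form an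
  initial segment, and counting them is the same as locating its end.\<close>

lemma less_inner_shape_iff:
  assumes T: "T \<in> ssyt (Suc n) \<nu>"
  shows "j < inner_shape n \<nu> T i \<longleftrightarrow> j < \<nu> i \<and> T (i, j) \<le> n"
proof -
  let ?A = "{j. j < \<nu> i \<and> T (i, j) \<le> n}"
  define c where "c = (LEAST j. j \<notin> ?A)"
  have "\<nu> i \<notin> ?A" by simp
  then have c: "c \<notin> ?A" unfolding c_def by (rule LeastI)
  have "?A = {..<c}"
  proof (intro equalityI subsetI)
    fix j assume j: "j \<in> ?A"
    show "j \<in> {..<c}"
    proof (rule ccontr)
      assume "j \<notin> {..<c}"
      then have "c \<le> j" by simp
      moreover have "T (i, c) \<le> T (i, j)"
        using ssyt_row[OF T _ \<open>c \<le> j\<close>] j by (simp add: young_cells_def)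
      ultimately have "c \<in> ?A" using j by auto
      with c show False ..
    qed
  next
    fix j assume "j \<in> {..<c}"
    then show "j \<in> ?A" unfolding c_def using not_less_Least by blast
  qed
  then show ?thesis by (auto simp: inner_shape_def)
qed

text \<open>A cell with another cell of the diagram below it carries a smaller entry than that one,
  hence at most \<open>n\<close>. So the next row of \<open>\<nu>\<close> fits under the inner
  shape.\<close>

lemma inner_shape_hstrip:
  assumes T: "T \<in> ssyt (Suc n) \<nu>" and anti: "antimono \<nu>"
  shows "hstrip (inner_shape n \<nu> T) \<nu>"
  unfolding hstrip_def
proof (intro allI conjI)
  fix i
  show "inner_shape n \<nu> T i \<le> \<nu> i"
    by (rule le_if_all_less) (simp add: less_inner_shape_iff[OF T])
  show "\<nu> (Suc i) \<le> inner_shape n \<nu> T i"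
  proof (rule le_if_all_less)
    fix j assume j: "j < \<nu> (Suc i)"
    then have "(Suc i, j) \<in> young_cells \<nu>" by (simp add: young_cells_def)
    then have "T (i, j) < T (Suc i, j)" "T (Suc i, j) \<le> Suc n"
      using ssyt_col[OF T] ssyt_range[OF T, of "(Suc i, j)"] by auto
    moreover have "j < \<nu> i"
      using j antimonoD[OF anti, of i "Suc i"] by linarith
    ultimately show "j < inner_shape n \<nu> T i" by (simp add: less_inner_shape_iff[OF T])
  qed
qed


text \<open>Tableaux are sorted by the shape of their entries at most \<open>n\<close>. For a fixed
  inner shape the remaining cells are forced to contain \<open>Suc n\<close>, so restriction to the
  inner shape is a bijection, and every forced cell contributes a factor
  \<open>x (Suc n)\<close>.\<close>

lemma schur_Suc:
  assumes \<nu>: "\<nu> \<in> box_partitions N k"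
  shows "schur (Suc n) x \<nu> = (\<Sum>\<kappa> | hstrip \<kappa> \<nu>.
    schur n x \<kappa> * x (Suc n) ^ (card (young_cells \<nu>) - card (young_cells \<kappa>)))"
proof -
  have anti: "antimono \<nu>" using \<nu> by (simp add: box_partitions_def)
  have "schur (Suc n) x \<nu> = (\<Sum>\<kappa> | hstrip \<kappa> \<nu>.
      \<Sum>T | T \<in> ssyt (Suc n) \<nu> \<and> inner_shape n \<nu> T = \<kappa>. \<Prod>u\<in>young_cells \<nu>. x (T u))"
    unfolding schur_def
  proof (rule sum.group[symmetric])
    show "inner_shape n \<nu> ` ssyt (Suc n) \<nu> \<subseteq> {\<kappa>. hstrip \<kappa> \<nu>}"
      by (intro image_subsetI CollectI inner_shape_hstrip[OF _ anti])
  qed (rule finite_ssyt[OF \<nu>] finite_hstrip[OF \<nu>])+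
  also have "\<dots> = (\<Sum>\<kappa> | hstrip \<kappa> \<nu>.
    schur n x \<kappa> * x (Suc n) ^ (card (young_cells \<nu>) - card (young_cells \<kappa>)))"
  proof (intro sum.cong refl)
    fix \<kappa> assume "\<kappa> \<in> {\<kappa>. hstrip \<kappa> \<nu>}"
    then have h: "hstrip \<kappa> \<nu>" by simp
    let ?C = "young_cells \<nu>" and ?D = "young_cells \<kappa>"
    let ?S = "{T. T \<in> ssyt (Suc n) \<nu> \<and> inner_shape n \<nu> T = \<kappa>}"
    have DC: "?D \<subseteq> ?C"
      using h by (auto simp: hstrip_def young_cells_def intro: order.strict_trans2)
    have finC: "finite ?C" by (rule finite_young_cells[OF \<nu>])
    have D_iff: "u \<in> ?D \<longleftrightarrow> u \<in> ?C \<and> T u \<le> n" if "T \<in> ?S" for T u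
      using that less_inner_shape_iff[of T n \<nu>] by (cases u) (auto simp: young_cells_def)
    \<comment> \<open>Tableaux are extensional functions, so the value off the diagram has to be
      \<open>undefined\<close> for restriction and extension to be inverse to each other.\<close>
    define extd where "extd T u = (if u \<in> ?D then T u else if u \<in> ?C then Suc n else undefined)"
      for T :: "nat \<times> nat \<Rightarrow> nat" and u
    have extd_S: "extd T \<in> ?S" if T: "T \<in> ssyt n \<kappa>" for T
    proof -
      have le: "T u \<in> {1..n}" if "u \<in> ?D" for u using ssyt_range[OF T that] .
      have "extd T \<in> ?C \<rightarrow>\<^sub>E {1..Suc n}"
        using le DC by (fastforce simp: extd_def)
      moreover have "extd T (i, j) \<le> extd T (i, j')" if "(i, j') \<in> ?C" "j \<le> j'" for i j j'
      proof (cases "(i, j') \<in> ?D")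
        case True
        then have "(i, j) \<in> ?D" using that(2) by (auto simp: young_cells_def)
        with True show ?thesis using ssyt_row[OF T True that(2)] by (simp add: extd_def)
      next
        case False
        moreover have "(i, j) \<in> ?C" using that by (auto simp: young_cells_def)
        ultimately show ?thesis using that le[of "(i, j)"] by (auto simp: extd_def)
      qed
      moreover have "extd T (i, j) < extd T (i', j)" if "(i', j) \<in> ?C" "i < i'" for i i' j
      proof -
        \<comment> \<open>Interlacing places the upper of two cells of a column inside the inner
          shape, so two entries \<open>Suc n\<close> never meet in one column.\<close>
        have "\<nu> i' \<le> \<nu> (Suc i)" using that(2) by (intro antimonoD[OF anti]) simp
        also have "\<dots> \<le> \<kappa> i" using h by (simp add: hstrip_def)
        finally have D: "(i, j) \<in> ?D" using that(1) by (simp add: young_cells_def)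
        show ?thesis
          using that D le[OF D] ssyt_col[OF T _ that(2), of j] by (auto simp: extd_def)
      qed
      ultimately have S: "extd T \<in> ssyt (Suc n) \<nu>" unfolding ssyt_def by blast
      have "j < inner_shape n \<nu> (extd T) i \<longleftrightarrow> j < \<kappa> i" for i j
      proof -
        have "j < inner_shape n \<nu> (extd T) i \<longleftrightarrow> (i, j) \<in> ?C \<and> extd T (i, j) \<le> n"
          by (simp add: less_inner_shape_iff[OF S] young_cells_def)
        also have "\<dots> \<longleftrightarrow> (i, j) \<in> ?D" using DC le[of "(i, j)"] by (auto simp: extd_def)
        finally show ?thesis by (simp add: young_cells_def)
      qed
      then have "inner_shape n \<nu> (extd T) = \<kappa>"
        by (intro ext) (meson le_antisym le_if_all_less)
      with S show ?thesis by simp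
    qed
    have res_S: "restrict T ?D \<in> ssyt n \<kappa>" if T: "T \<in> ?S" for T
    proof -
      have S: "T \<in> ssyt (Suc n) \<nu>" using T by simp
      have "restrict T ?D \<in> ?D \<rightarrow>\<^sub>E {1..n}"
        using D_iff[OF T] ssyt_range[OF S] by fastforce
      moreover have "restrict T ?D (i, j) \<le> restrict T ?D (i, j')" if "(i, j') \<in> ?D" "j \<le> j'" for i j j'
      proof -
        have "(i, j) \<in> ?D" using that by (auto simp: young_cells_def)
        moreover have "(i, j') \<in> ?C" using that(1) DC by blast
        ultimately show ?thesis using that(1) ssyt_row[OF S _ that(2), of i] by simp
      qed
      moreover have "restrict T ?D (i, j) < restrict T ?D (i', j)" if "(i', j) \<in> ?D" "i < i'" for i i' j
      proof -
        have "(i', j) \<in> ?C" using that(1) DC by blast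
        then have "T (i, j) < T (i', j)" by (rule ssyt_col[OF S _ that(2)])
        moreover have "\<nu> i' \<le> \<nu> i" using that(2) by (intro antimonoD[OF anti]) simp
        then have "(i, j) \<in> ?C" using \<open>(i', j) \<in> ?C\<close> by (simp add: young_cells_def)
        moreover have "T (i', j) \<le> n" using that(1) D_iff[OF T] by blast
        ultimately have "(i, j) \<in> ?D" using D_iff[OF T, of "(i, j)"] by simp
        then show ?thesis using that(1) \<open>T (i, j) < T (i', j)\<close> by simp
      qed
      ultimately show ?thesis unfolding ssyt_def by blast
    qed
    have "(\<Sum>T\<in>?S. \<Prod>u\<in>?C. x (T u)) =
        (\<Sum>T\<in>ssyt n \<kappa>. (\<Prod>u\<in>?D. x (T u)) * x (Suc n) ^ (card ?C - card ?D))"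
    proof (rule sum.reindex_bij_witness[where i = extd and j = "\<lambda>T. restrict T ?D"])
      fix T assume T: "T \<in> ?S"
      then have S: "T \<in> ssyt (Suc n) \<nu>" by simp
      have big: "T u = Suc n" if "u \<in> ?C - ?D" for u
        using that D_iff[OF T, of u] ssyt_range[OF S, of u] by auto
      show "extd (restrict T ?D) = T"
      proof
        fix u
        show "extd (restrict T ?D) u = T u"
          using big[of u] ssyt_outside[OF S, of u] by (simp add: extd_def)
      qed
      show "restrict T ?D \<in> ssyt n \<kappa>" by (rule res_S[OF T])
      have "(\<Prod>u\<in>?C. x (T u)) = (\<Prod>u\<in>?C - ?D. x (T u)) * (\<Prod>u\<in>?D. x (T u))"
        by (rule prod.subset_diff[OF DC finC])
      also have "(\<Prod>u\<in>?C - ?D. x (T u)) = (\<Prod>u\<in>?C - ?D. x (Suc n))"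
        by (rule prod.cong) (use big in auto)
      finally show "(\<Prod>u\<in>?D. x (restrict T ?D u)) * x (Suc n) ^ (card ?C - card ?D) = (\<Prod>u\<in>?C. x (T u))"
        using DC finC by (simp add: card_Diff_subset finite_subset)
    next
      fix T assume T: "T \<in> ssyt n \<kappa>"
      show "extd T \<in> ?S" by (rule extd_S[OF T])
      show "restrict (extd T) ?D = T"
        by (rule ext) (use ssyt_outside[OF T] in \<open>simp add: extd_def restrict_def\<close>)
    qed
    then show "(\<Sum>T\<in>?S. \<Prod>u\<in>?C. x (T u)) =
        schur n x \<kappa> * x (Suc n) ^ (card ?C - card ?D)"
      by (simp add: schur_def sum_distrib_right)
  qed
  finally show ?thesis .
qed

section \<open>Determinants of Schur functions\<close>

abbreviation fdet :: "nat \<Rightarrow> (nat \<Rightarrow> nat \<Rightarrow> 'a) \<Rightarrow> 'a::comm_ring_1" where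
  "fdet n A \<equiv> Determinant.det (Matrix.mat n n (\<lambda>(i, j). A i j))"

lemma fdet_cong:
  "(\<And>i j. i < n \<Longrightarrow> j < n \<Longrightarrow> A i j = B i j) \<Longrightarrow> fdet n A = fdet n B"
  by (rule arg_cong[where f = Determinant.det]) (auto intro!: eq_matI)

lemma fdet_col:
  "fdet n A = (\<Sum>p | p permutes {0..<n}. signof p * (\<Prod>j<n. A (p j) j))"
proof -
  have "fdet n A = (\<Sum>p | p permutes {0..<n}.
      signof p * (\<Prod>j<n. Matrix.mat n n (\<lambda>(i, j). A i j) $$ (p j, j)))"
    by (rule det_col) simp
  also have "\<dots> = (\<Sum>p | p permutes {0..<n}. signof p * (\<Prod>j<n. A (p j) j))"
  proof (intro sum.cong refl arg_cong2[where f = times] prod.cong)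
    fix p j assume "p \<in> {p. p permutes {0..<n}}" "j \<in> {..<n}"
    then have "p j < n" "j < n" using permutes_in_image[of p "{0..<n}" j] by auto
    then show "Matrix.mat n n (\<lambda>(i, j). A i j) $$ (p j, j) = A (p j) j" by simp
  qed
  finally show ?thesis .
qed

lemma fdet_transpose: "fdet n (\<lambda>i j. A j i) = fdet n A"
proof -
  have "transpose_mat (Matrix.mat n n (\<lambda>(i, j). A i j)) = Matrix.mat n n (\<lambda>(i, j). A j i)"
    by (auto intro!: eq_matI)
  then show ?thesis
    using det_transpose[of "Matrix.mat n n (\<lambda>(i, j). A i j)" n] by simp
qed

lemma fdet_sum_cols:
  assumes "\<And>j. j < n \<Longrightarrow> finite (S j)"
  shows "fdet n (\<lambda>i j. \<Sum>p\<in>S j. F i j p) = (\<Sum>P\<in>PiE {..<n} S. fdet n (\<lambda>i j. F i j (P j)))"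
proof -
  have "fdet n (\<lambda>i j. \<Sum>p\<in>S j. F i j p) =
     (\<Sum>p | p permutes {0..<n}. \<Sum>P\<in>PiE {..<n} S. signof p * (\<Prod>j<n. F (p j) j (P j)))"
    unfolding fdet_col using assms
    by (intro sum.cong refl) (subst prod_sum_PiE, auto simp: sum_distrib_left)
  also have "\<dots> = (\<Sum>P\<in>PiE {..<n} S. fdet n (\<lambda>i j. F i j (P j)))"
    unfolding fdet_col by (rule sum.swap)
  finally show ?thesis .
qed

lemma fdet_scale_cols: "fdet n (\<lambda>i j. c j * A i j) = (\<Prod>j<n. c j) * fdet n A"
  unfolding fdet_col by (simp add: prod.distrib sum_distrib_left mult_ac)

lemma fdet_scale_rows: "fdet n (\<lambda>i j. c i * A i j) = (\<Prod>i<n. c i) * fdet n A"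
  using fdet_scale_cols[of n c "\<lambda>i j. A j i"] fdet_transpose[of n A]
    fdet_transpose[of n "\<lambda>i j. c i * A i j"] by simp

lemma fdet_zero_col:
  assumes "j < n" "\<And>i. i < n \<Longrightarrow> A i j = 0"
  shows "fdet n A = 0"
proof -
  have "fdet n A = fdet n (\<lambda>i j'. (if j' = j then 0 else 1) * A i j')"
    by (rule fdet_cong) (use assms(2) in auto)
  also have "\<dots> = 0"
    unfolding fdet_scale_cols using assms(1) by (simp add: prod_zero_iff)
  finally show ?thesis .
qed

lemma fdet_equal_cols:
  assumes "j < n" "j' < n" "j \<noteq> j'" "\<And>i. i < n \<Longrightarrow> A i j = A i j'"
  shows "fdet n A = 0"
  by (rule det_identical_columns[of _ n j j']) (use assms in \<open>auto intro!: eq_vecI\<close>)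

text \<open>The simultaneous subtraction is right multiplication by a lower triangular matrix with
  unit diagonal; the subtracted columns are therefore the original ones.\<close>

lemma fdet_subtract_next_col:
  "fdet (Suc n) (\<lambda>i j. if j < n then A i j - c j * A i (Suc j) else A i j) = fdet (Suc n) A"
proof -
  let ?A = "Matrix.mat (Suc n) (Suc n) (\<lambda>(i, j). A i j)"
  let ?U = "Matrix.mat (Suc n) (Suc n) (\<lambda>(i, j). if i = j then 1 else if i = Suc j then - c j else 0)"
  have "?A * ?U = Matrix.mat (Suc n) (Suc n)
      (\<lambda>(i, j). if j < n then A i j - c j * A i (Suc j) else A i j)"
  proof (rule eq_matI, goal_cases)
    case (1 i j)
    then have ij: "i < Suc n" "j < Suc n" by auto
    have "(?A * ?U) $$ (i, j) =
        (\<Sum>r\<in>{0..<Suc n}. A i r * (if r = j then 1 else if r = Suc j then - c j else 0))"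
      using ij by (simp add: scalar_prod_def del: sum.op_ivl_Suc)
    also have "\<dots> = (\<Sum>r\<in>{0..<Suc n}. (if r = j then A i r else 0) + (if r = Suc j then A i r * - c j else 0))"
      by (rule sum.cong) auto
    also have "\<dots> = (if j < n then A i j - c j * A i (Suc j) else A i j)"
      unfolding sum.distrib using ij by (simp add: sum.delta' del: sum.op_ivl_Suc)
    finally show ?case using ij by simp
  qed auto
  moreover have "Determinant.det ?U = 1"
  proof -
    have "Determinant.det ?U = prod_list (diag_mat ?U)"
      by (rule det_lower_triangular[of "Suc n"]) auto
    also have "diag_mat ?U = replicate (Suc n) 1"
      by (rule nth_equalityI) (auto simp: diag_mat_def simp del: upt_Suc replicate_Suc)
    finally show ?thesis by simp
  qed
  moreover have "Determinant.det (?A * ?U) = Determinant.det ?A * Determinant.det ?U"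
    by (rule det_mult[of _ "Suc n"]) auto
  ultimately show ?thesis by simp
qed

lemma fdet_last_row:
  assumes "\<And>j. j < n \<Longrightarrow> A n j = 0"
  shows "fdet (Suc n) A = A n n * fdet n A"
proof -
  let ?A = "Matrix.mat (Suc n) (Suc n) (\<lambda>(i, j). A i j)"
  have "Determinant.det ?A = (\<Sum>j<Suc n. ?A $$ (n, j) * cofactor ?A n j)"
    by (rule laplace_expansion_row) auto
  also have "\<dots> = A n n * cofactor ?A n n" using assms by simp
  also have "mat_delete ?A n n = Matrix.mat n n (\<lambda>(i, j). A i j)"
    by (rule eq_matI) (auto simp: mat_delete_def)
  then have "cofactor ?A n n = fdet n A" by (simp add: cofactor_def)
  finally show ?thesis .
qed

section \<open>The bialternant formula\<close>

lemma difference_sum_powers: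
  fixes a t :: "'a::comm_ring_1"
  shows "(a - t) * (\<Sum>p\<in>{q..<q+d}. a ^ p * t ^ (q + d - Suc p)) = a ^ (q + d) - t ^ d * a ^ q"
proof (induction d)
  case (Suc d)
  have "(\<Sum>p\<in>{q..<q+d}. a ^ p * t ^ (q + Suc d - Suc p)) = t * (\<Sum>p\<in>{q..<q+d}. a ^ p * t ^ (q + d - Suc p))"
    unfolding sum_distrib_left
  proof (rule sum.cong)
    fix p assume "p \<in> {q..<q+d}"
    then have "q + Suc d - Suc p = Suc (q + d - Suc p)" by auto
    then show "a ^ p * t ^ (q + Suc d - Suc p) = t * (a ^ p * t ^ (q + d - Suc p))" by simp
  qed simp
  then have "(a - t) * (\<Sum>p\<in>{q..<q+Suc d}. a ^ p * t ^ (q + Suc d - Suc p)) =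
     t * ((a - t) * (\<Sum>p\<in>{q..<q+d}. a ^ p * t ^ (q + d - Suc p))) + (a - t) * a ^ (q + d)"
    by (simp add: algebra_simps)
  then show ?case unfolding Suc.IH by (simp add: algebra_simps)
qed simp

text \<open>Put t = \<open>x (Suc n)\<close>. Subtracting from each column the next one times a
  suitable power of t clears the last row except for its last entry, and every other entry becomes
  x_i - t times a sum of monomials, with exponents ranging between those of two neighbouring
  columns. Multilinearity expands the determinant over one exponent per column; without the
  staircase these choices are exactly the horizontal strips.\<close>

lemma alternant_branching:
  fixes x :: "nat \<Rightarrow> real"
  assumes "\<nu> \<in> box_partitions (Suc n) k"
  shows "fdet (Suc n) (\<lambda>i j. x (Suc i) ^ (\<nu> j + (n - j))) =
    (\<Prod>i<n. x (Suc i) - x (Suc n)) *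
    (\<Sum>\<kappa> | hstrip \<kappa> \<nu> \<and> \<kappa> n = 0. x (Suc n) ^ (card (young_cells \<nu>) - card (young_cells \<kappa>)) *
       fdet n (\<lambda>i j. x (Suc i) ^ (\<kappa> j + (n - 1 - j))))"
proof -
  define t where "t = x (Suc n)"
  define el where "el j = \<nu> j + (n - j)" for j
  have anti: "\<nu> (Suc j) \<le> \<nu> j" for j
    using assms by (auto simp: box_partitions_def antimono_def)
  define d where "d j = el j - el (Suc j)" for j
  have d: "el j = el (Suc j) + d j" if "j < n" for j
    using that anti[of j] by (simp add: el_def d_def)
  let ?G = "\<lambda>i j. \<Sum>p\<in>{el (Suc j)..<el (Suc j) + d j}. x (Suc i) ^ p * t ^ (el (Suc j) + d j - Suc p)"
  have "fdet (Suc n) (\<lambda>i j. x (Suc i) ^ el j) =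
     fdet (Suc n) (\<lambda>i j. if j < n then x (Suc i) ^ el j - t ^ d j * x (Suc i) ^ el (Suc j) else x (Suc i) ^ el j)"
    by (rule fdet_subtract_next_col[symmetric])
  also have "\<dots> = fdet (Suc n) (\<lambda>i j. if j < n then (x (Suc i) - t) * ?G i j else x (Suc i) ^ el j)"
    by (rule fdet_cong) (simp add: difference_sum_powers d)
  also have "\<dots> = t ^ el n * fdet n (\<lambda>i j. (x (Suc i) - t) * ?G i j)"
    by (subst fdet_last_row) (auto simp: t_def cong: fdet_cong intro!: fdet_cong)
  also have "fdet n (\<lambda>i j. (x (Suc i) - t) * ?G i j) = (\<Prod>i<n. x (Suc i) - t) * fdet n ?G"
    by (rule fdet_scale_rows)
  also have "fdet n ?G = (\<Sum>P\<in>PiE {..<n} (\<lambda>j. {el (Suc j)..<el (Suc j) + d j}).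
      fdet n (\<lambda>i j. x (Suc i) ^ P j * t ^ (el (Suc j) + d j - Suc (P j))))"
    by (rule fdet_sum_cols) simp
  also have "\<dots> = (\<Sum>P\<in>PiE {..<n} (\<lambda>j. {el (Suc j)..<el (Suc j) + d j}).
      (\<Prod>j<n. t ^ (el (Suc j) + d j - Suc (P j))) * fdet n (\<lambda>i j. x (Suc i) ^ P j))"
    unfolding fdet_scale_cols[symmetric] by (simp only: mult.commute)
  also have "t ^ el n * ((\<Prod>i<n. x (Suc i) - t) * \<dots>) = (\<Prod>i<n. x (Suc i) - t) *
     (\<Sum>P\<in>PiE {..<n} (\<lambda>j. {el (Suc j)..<el (Suc j) + d j}).
      t ^ el n * (\<Prod>j<n. t ^ (el (Suc j) + d j - Suc (P j))) * fdet n (\<lambda>i j. x (Suc i) ^ P j))"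
    by (simp add: sum_distrib_left mult_ac)
  also have "(\<Sum>P\<in>PiE {..<n} (\<lambda>j. {el (Suc j)..<el (Suc j) + d j}).
      t ^ el n * (\<Prod>j<n. t ^ (el (Suc j) + d j - Suc (P j))) * fdet n (\<lambda>i j. x (Suc i) ^ P j)) =
    (\<Sum>\<kappa> | hstrip \<kappa> \<nu> \<and> \<kappa> n = 0. t ^ (card (young_cells \<nu>) - card (young_cells \<kappa>)) *
       fdet n (\<lambda>i j. x (Suc i) ^ (\<kappa> j + (n - 1 - j))))"
  \<comment> \<open>The exponent chosen in column \<open>j\<close> is
    \<open>\<kappa> j + (n - 1 - j)\<close>. The staircase drops from n - j to n - 1 - j, which
    turns the half-open range of exponents into
    \<open>\<nu> (Suc j) \<le> \<kappa> j \<le> \<nu> j\<close>.\<close>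
  proof (rule sum.reindex_bij_witness[where
        j = "\<lambda>P i. if i < n then P i - (n - 1 - i) else 0" and
        i = "\<lambda>\<kappa>. \<lambda>i\<in>{..<n}. \<kappa> i + (n - 1 - i)"])
    fix P assume P: "P \<in> PiE {..<n} (\<lambda>j. {el (Suc j)..<el (Suc j) + d j})"
    let ?\<kappa> = "\<lambda>i. if i < n then P i - (n - 1 - i) else 0"
    have Pj: "\<nu> (Suc j) + (n - 1 - j) \<le> P j" "P j \<le> \<nu> j + (n - 1 - j)" if "j < n" for j
    proof -
      have "P j \<in> {el (Suc j)..<el (Suc j) + d j}"
        using PiE_mem[OF P] that by blast
      with d[OF that] have "el (Suc j) \<le> P j" "P j < el j" by auto
      then show "\<nu> (Suc j) + (n - 1 - j) \<le> P j" "P j \<le> \<nu> j + (n - 1 - j)"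
        using that by (auto simp: el_def)
    qed
    have z: "\<nu> (Suc j) = 0" if "\<not> j < n" for j
      using assms that by (auto simp: box_partitions_def)
    have hs: "hstrip ?\<kappa> \<nu>"
      unfolding hstrip_def
    proof (intro allI)
      fix j show "\<nu> (Suc j) \<le> ?\<kappa> j \<and> ?\<kappa> j \<le> \<nu> j"
        using Pj[of j] z[of j] by (cases "j < n") auto
    qed
    then show "?\<kappa> \<in> {\<kappa>. hstrip \<kappa> \<nu> \<and> \<kappa> n = 0}" by simp
    show "(\<lambda>i\<in>{..<n}. ?\<kappa> i + (n - 1 - i)) = P"
    proof
      fix i show "(\<lambda>i\<in>{..<n}. ?\<kappa> i + (n - 1 - i)) i = P i"
        using P Pj(1)[of i] by (cases "i < n") (auto simp: PiE_def extensional_def)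
    qed
    have P_eq: "P j = ?\<kappa> j + (n - 1 - j)" if "j < n" for j using Pj(1)[OF that] that by simp
    have box: "?\<kappa> \<in> box_partitions (Suc n) k" by (rule hstrip_box[OF hs assms])
    have le: "?\<kappa> j \<le> \<nu> j" for j using hs by (simp add: hstrip_def)
    \<comment> \<open>The exponents of t add up to the number of cells of the strip;
      \<open>el n\<close> is \<open>\<nu> n\<close> and accounts for the last row, where
      \<open>\<kappa>\<close> is empty.\<close>
    have "el n + (\<Sum>j<n. el (Suc j) + d j - Suc (P j)) = \<nu> n + (\<Sum>j<n. \<nu> j - ?\<kappa> j)"
    proof -
      have "(\<Sum>j<n. el (Suc j) + d j - Suc (P j)) = (\<Sum>j<n. \<nu> j - ?\<kappa> j)"
      proof (rule sum.cong[OF refl])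
        fix j assume "j \<in> {..<n}"
        then have j: "j < n" by simp
        show "el (Suc j) + d j - Suc (P j) = \<nu> j - ?\<kappa> j"
          unfolding d[OF j, symmetric] using Pj[OF j] j by (simp add: el_def)
      qed
      then show ?thesis by (simp add: el_def)
    qed
    also have "(\<Sum>j<n. \<nu> j - ?\<kappa> j) = (\<Sum>j<n. \<nu> j) - (\<Sum>j<n. ?\<kappa> j)"
      by (rule sum_subtractf_nat) (rule le)
    also have "\<nu> n + ((\<Sum>j<n. \<nu> j) - (\<Sum>j<n. ?\<kappa> j)) = card (young_cells \<nu>) - card (young_cells ?\<kappa>)"
      unfolding card_young_cells[OF assms] card_young_cells[OF box]
      using sum_mono[of "{..<n}" ?\<kappa> \<nu>, OF le] by (simp only: sum.lessThan_Suc) simp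
    finally have eq1: "t ^ el n * (\<Prod>j<n. t ^ (el (Suc j) + d j - Suc (P j))) =
        t ^ (card (young_cells \<nu>) - card (young_cells ?\<kappa>))"
      by (simp only: power_sum[symmetric] power_add[symmetric])
    have eq2: "fdet n (\<lambda>i j. x (Suc i) ^ P j) = fdet n (\<lambda>i j. x (Suc i) ^ (?\<kappa> j + (n - 1 - j)))"
      by (rule fdet_cong, rule arg_cong[where f = "\<lambda>p. _ ^ p"], rule P_eq)
    show "t ^ (card (young_cells \<nu>) - card (young_cells ?\<kappa>)) *
        fdet n (\<lambda>i j. x (Suc i) ^ (?\<kappa> j + (n - 1 - j))) =
      t ^ el n * (\<Prod>j<n. t ^ (el (Suc j) + d j - Suc (P j))) * fdet n (\<lambda>i j. x (Suc i) ^ P j)"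
      by (rule arg_cong2[where f = times, OF eq1[symmetric] eq2[symmetric]])
  next
    fix \<kappa> assume "\<kappa> \<in> {\<kappa>. hstrip \<kappa> \<nu> \<and> \<kappa> n = 0}"
    then have hs: "hstrip \<kappa> \<nu>" and k0: "\<kappa> n = 0" by auto
    have "antimono \<kappa>" using hstrip_box[OF hs assms] by (simp add: box_partitions_def)
    then have k0': "\<kappa> i = 0" if "i \<ge> n" for i using k0 antimonoD[OF \<open>antimono \<kappa>\<close> that] by simp
    show "(\<lambda>i. if i < n then (\<lambda>i\<in>{..<n}. \<kappa> i + (n - 1 - i)) i - (n - 1 - i) else 0) = \<kappa>"
      using k0' by auto
    show "(\<lambda>i\<in>{..<n}. \<kappa> i + (n - 1 - i)) \<in> PiE {..<n} (\<lambda>j. {el (Suc j)..<el (Suc j) + d j})"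
    proof (rule restrict_PiE_iff[THEN iffD2], rule ballI)
      fix j assume "j \<in> {..<n}"
      then have j: "j < n" by simp
      have "\<nu> (Suc j) \<le> \<kappa> j" "\<kappa> j \<le> \<nu> j" using hs by (auto simp: hstrip_def)
      then show "\<kappa> j + (n - 1 - j) \<in> {el (Suc j)..<el (Suc j) + d j}"
        unfolding atLeastLessThan_iff d[OF j, symmetric] unfolding el_def using j by (intro conjI; linarith)
    qed
  qed
  finally show ?thesis unfolding el_def t_def .
qed

text \<open>Induction on the number of variables: tableaux and alternants branch over the same
  horizontal strips with the same weights, and the Vandermonde determinant branches as the alternant
  of the empty shape. Strips with more than \<open>n\<close> rows occur only on the tableau side,
  where they contribute 0.\<close>

theorem schur_bialternant:
  fixes x :: "nat \<Rightarrow> real"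
  assumes "\<nu> \<in> box_partitions n k"
  shows "schur n x \<nu> * fdet n (\<lambda>i j. x (Suc i) ^ (n - 1 - j)) = fdet n (\<lambda>i j. x (Suc i) ^ (\<nu> j + (n - 1 - j)))"
  using assms
proof (induction n arbitrary: \<nu>)
  case 0
  then have "\<nu> = (\<lambda>_. 0)" by (simp add: box_partitions_0)
  then show ?case by (simp only: schur_empty_diagram mult_1 add_0)
next
  case (Suc n)
  have zero: "(\<lambda>_. 0) \<in> box_partitions (Suc n) k" for n k by (auto simp: box_partitions_def)
  let ?V = "fdet n (\<lambda>i j. x (Suc i) ^ (n - 1 - j))"
  let ?w = "\<lambda>\<kappa>. x (Suc n) ^ (card (young_cells \<nu>) - card (young_cells \<kappa>))"
  have S: "{\<kappa>. hstrip \<kappa> (\<lambda>_. 0) \<and> \<kappa> n = 0} = {\<lambda>_. 0}"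
    unfolding hstrip_def by auto
  have V: "fdet (Suc n) (\<lambda>i j. x (Suc i) ^ (n - j)) = (\<Prod>i<n. x (Suc i) - x (Suc n)) * ?V"
    using alternant_branching[OF zero[of n 0], where x = x, unfolded S] by (simp only: sum.insert finite.emptyI sum.empty empty_iff not_False_eq_True
      diff_self_eq_0 power_0 add_0 mult_1 add_0_right)
  have "schur (Suc n) x \<nu> = (\<Sum>\<kappa> | hstrip \<kappa> \<nu>. schur n x \<kappa> * ?w \<kappa>)"
    by (rule schur_Suc[OF Suc.prems])
  also have "\<dots> = (\<Sum>\<kappa> | hstrip \<kappa> \<nu> \<and> \<kappa> n = 0. schur n x \<kappa> * ?w \<kappa>)"
  proof (rule sum.mono_neutral_right)
    show "\<forall>\<kappa>\<in>{\<kappa>. hstrip \<kappa> \<nu>} - {\<kappa>. hstrip \<kappa> \<nu> \<and> \<kappa> n = 0}. schur n x \<kappa> * ?w \<kappa> = 0"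
    proof
      fix \<kappa> assume "\<kappa> \<in> {\<kappa>. hstrip \<kappa> \<nu>} - {\<kappa>. hstrip \<kappa> \<nu> \<and> \<kappa> n = 0}"
      then have "hstrip \<kappa> \<nu>" "\<kappa> n > 0" by auto
      then have "schur n x \<kappa> = 0"
        using hstrip_box[OF _ Suc.prems] by (intro schur_too_many_rows) (auto simp: box_partitions_def)
      then show "schur n x \<kappa> * ?w \<kappa> = 0" by simp
    qed
  qed (use finite_hstrip[OF Suc.prems] in auto)
  finally have "schur (Suc n) x \<nu> * ?V =
      (\<Sum>\<kappa> | hstrip \<kappa> \<nu> \<and> \<kappa> n = 0. ?w \<kappa> * (schur n x \<kappa> * ?V))"
    by (simp add: sum_distrib_left sum_distrib_right mult_ac)
  also have "\<dots> = (\<Sum>\<kappa> | hstrip \<kappa> \<nu> \<and> \<kappa> n = 0. ?w \<kappa> * fdet n (\<lambda>i j. x (Suc i) ^ (\<kappa> j + (n - 1 - j))))"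
  proof (rule sum.cong[OF refl])
    fix \<kappa> assume "\<kappa> \<in> {\<kappa>. hstrip \<kappa> \<nu> \<and> \<kappa> n = 0}"
    then have hs: "hstrip \<kappa> \<nu>" and k0: "\<kappa> n = 0" by auto
    have b: "\<kappa> \<in> box_partitions (Suc n) k" by (rule hstrip_box[OF hs Suc.prems])
    have "antimono \<kappa>" using b by (simp add: box_partitions_def)
    then have "\<kappa> i = 0" if "i \<ge> n" for i using k0 antimonoD[of \<kappa> n i] that by simp
    then have "\<kappa> \<in> box_partitions n k" using b by (auto simp: box_partitions_def)
    from Suc.IH[OF this] show "?w \<kappa> * (schur n x \<kappa> * ?V) = ?w \<kappa> * fdet n (\<lambda>i j. x (Suc i) ^ (\<kappa> j + (n - 1 - j)))"
      by (rule arg_cong)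
  qed
  finally have *: "schur (Suc n) x \<nu> * ?V = (\<Sum>\<kappa> | hstrip \<kappa> \<nu> \<and> \<kappa> n = 0.
      ?w \<kappa> * fdet n (\<lambda>i j. x (Suc i) ^ (\<kappa> j + (n - 1 - j))))" .
  have "schur (Suc n) x \<nu> * fdet (Suc n) (\<lambda>i j. x (Suc i) ^ (n - j)) =
      (\<Prod>i<n. x (Suc i) - x (Suc n)) * (schur (Suc n) x \<nu> * ?V)"
    by (simp only: V mult.left_commute)
  also have "\<dots> = fdet (Suc n) (\<lambda>i j. x (Suc i) ^ (\<nu> j + (n - j)))"
    unfolding * alternant_branching[OF Suc.prems] ..
  finally show ?case by (simp only: diff_Suc_1)
qed

section \<open>The dual Cauchy sum with a bounded first row\<close>

primrec shifted :: "nat \<Rightarrow> (nat \<Rightarrow> real) \<Rightarrow> (nat \<Rightarrow> real) \<Rightarrow> nat \<Rightarrow> real" where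
  "shifted 0 y \<phi> = \<phi>"
| "shifted (Suc k) y \<phi> = shifted k y (\<lambda>p. \<phi> p + y (Suc k) * \<phi> (Suc p))"

text \<open>Each column is a sum of two terms, so the determinant expands over the sets of rows that
  are lengthened by one cell. A set that does not give a partition lengthens row j + 1 but not row j
  although both have equal length, and then two columns coincide.\<close>

lemma det_vstrip_sum:
  fixes \<phi> :: "nat \<Rightarrow> nat \<Rightarrow> real"
  assumes \<mu>: "\<mu> \<in> box_partitions n k"
  shows "(\<Sum>\<nu> | \<nu> \<in> box_partitions n (Suc k) \<and> vstrip \<mu> \<nu>.
      t ^ (card (young_cells \<nu>) - card (young_cells \<mu>)) * fdet n (\<lambda>i j. \<phi> i (\<nu> j + (n - 1 - j)))) =
    fdet n (\<lambda>i j. \<phi> i (\<mu> j + (n - 1 - j)) + t * \<phi> i (Suc (\<mu> j + (n - 1 - j))))"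
proof -
  let ?E = "PiE {..<n} (\<lambda>_. {0, 1::nat})"
  let ?d = "\<lambda>\<epsilon>. fdet n (\<lambda>i j. \<phi> i (\<mu> j + \<epsilon> j + (n - 1 - j)))"
  have two: "(\<Sum>e\<in>{0, 1::nat}. t ^ e * \<phi> i (a + e + b)) = \<phi> i (a + b) + t * \<phi> i (Suc (a + b))"
    for i a b by simp
  have "fdet n (\<lambda>i j. \<phi> i (\<mu> j + (n - 1 - j)) + t * \<phi> i (Suc (\<mu> j + (n - 1 - j)))) =
      fdet n (\<lambda>i j. \<Sum>e\<in>{0, 1::nat}. t ^ e * \<phi> i (\<mu> j + e + (n - 1 - j)))"
    by (rule fdet_cong) (simp only: two)
  also have "\<dots> = (\<Sum>\<epsilon>\<in>?E. fdet n (\<lambda>i j. t ^ \<epsilon> j * \<phi> i (\<mu> j + \<epsilon> j + (n - 1 - j))))"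
    by (rule fdet_sum_cols) simp
  also have "\<dots> = (\<Sum>\<epsilon>\<in>?E. t ^ (\<Sum>j<n. \<epsilon> j) * ?d \<epsilon>)"
    by (simp only: fdet_scale_cols power_sum)
  also have "\<dots> = (\<Sum>\<epsilon>\<in>{\<epsilon>\<in>?E. \<forall>j. Suc j < n \<longrightarrow> \<mu> (Suc j) + \<epsilon> (Suc j) \<le> \<mu> j + \<epsilon> j}. t ^ (\<Sum>j<n. \<epsilon> j) * ?d \<epsilon>)"
  proof (rule sum.mono_neutral_right)
    show "\<forall>\<epsilon>\<in>?E - {\<epsilon>\<in>?E. \<forall>j. Suc j < n \<longrightarrow> \<mu> (Suc j) + \<epsilon> (Suc j) \<le> \<mu> j + \<epsilon> j}. t ^ (\<Sum>j<n. \<epsilon> j) * ?d \<epsilon> = 0"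
    proof
      fix \<epsilon> assume "\<epsilon> \<in> ?E - {\<epsilon>\<in>?E. \<forall>j. Suc j < n \<longrightarrow> \<mu> (Suc j) + \<epsilon> (Suc j) \<le> \<mu> j + \<epsilon> j}"
      then obtain j where \<epsilon>: "\<epsilon> \<in> ?E" and j: "Suc j < n" "\<not> \<mu> (Suc j) + \<epsilon> (Suc j) \<le> \<mu> j + \<epsilon> j" by blast
      have "\<mu> (Suc j) \<le> \<mu> j" using \<mu> by (auto simp: box_partitions_def antimono_def)
      moreover have "\<epsilon> (Suc j) \<in> {0, 1}" "\<epsilon> j \<in> {0, 1}" using \<epsilon> j(1) by (auto simp: PiE_iff)
      ultimately have "\<mu> (Suc j) + \<epsilon> (Suc j) = Suc (\<mu> j + \<epsilon> j)" using j(2) by auto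
      moreover have "n - 1 - j = Suc (n - 1 - Suc j)" using j(1) by simp
      ultimately have eq: "\<mu> j + \<epsilon> j + (n - 1 - j) = \<mu> (Suc j) + \<epsilon> (Suc j) + (n - 1 - Suc j)" by simp
      have "?d \<epsilon> = 0"
        by (rule fdet_equal_cols[of j n "Suc j"]) (use j(1) eq in auto)
      then show "t ^ (\<Sum>j<n. \<epsilon> j) * ?d \<epsilon> = 0" by simp
    qed
  qed (auto intro: finite_PiE)
  also have "\<dots> = (\<Sum>\<nu> | \<nu> \<in> box_partitions n (Suc k) \<and> vstrip \<mu> \<nu>.
      t ^ (card (young_cells \<nu>) - card (young_cells \<mu>)) * fdet n (\<lambda>i j. \<phi> i (\<nu> j + (n - 1 - j))))"
  proof (rule sum.reindex_bij_witness[where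
        i = "\<lambda>\<nu>. \<lambda>j\<in>{..<n}. \<nu> j - \<mu> j" and j = "\<lambda>\<epsilon> j. if j < n then \<mu> j + \<epsilon> j else 0"])
    fix \<epsilon> assume \<epsilon>: "\<epsilon> \<in> {\<epsilon>\<in>?E. \<forall>j. Suc j < n \<longrightarrow> \<mu> (Suc j) + \<epsilon> (Suc j) \<le> \<mu> j + \<epsilon> j}"
    define \<nu> where "\<nu> = (\<lambda>j. if j < n then \<mu> j + \<epsilon> j else 0)"
    have e01: "\<epsilon> j = 0 \<or> \<epsilon> j = 1" if "j < n" for j using \<epsilon> that by (auto simp: PiE_iff)
    have "\<nu> (Suc j) \<le> \<nu> j" for j using \<epsilon> by (auto simp: \<nu>_def)
    then have "antimono \<nu>" by (simp add: decseq_SucI)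
    moreover have "\<nu> j \<le> Suc k" for j
    proof -
      have "\<mu> j \<le> k" using \<mu> by (auto simp: box_partitions_def)
      then show ?thesis using e01[of j] by (auto simp: \<nu>_def)
    qed
    ultimately have box: "\<nu> \<in> box_partitions n (Suc k)" by (auto simp: box_partitions_def \<nu>_def)
    moreover have "vstrip \<mu> \<nu>"
      unfolding vstrip_def
    proof
      fix j show "\<mu> j \<le> \<nu> j \<and> \<nu> j \<le> Suc (\<mu> j)"
        using e01[of j] \<mu> by (cases "j < n") (auto simp: \<nu>_def box_partitions_def)
    qed
    ultimately show "(\<lambda>j. if j < n then \<mu> j + \<epsilon> j else 0) \<in> {\<nu>. \<nu> \<in> box_partitions n (Suc k) \<and> vstrip \<mu> \<nu>}"
      by (simp add: \<nu>_def)
    show "(\<lambda>j\<in>{..<n}. (if j < n then \<mu> j + \<epsilon> j else 0) - \<mu> j) = \<epsilon>"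
      using \<epsilon> by (auto simp: PiE_def extensional_def)
    have "(\<Sum>j<n. \<epsilon> j) = card (young_cells \<nu>) - card (young_cells \<mu>)"
      unfolding card_young_cells[OF box] card_young_cells[OF \<mu>] by (simp add: \<nu>_def sum.distrib)
    moreover have "?d \<epsilon> = fdet n (\<lambda>i j. \<phi> i (\<nu> j + (n - 1 - j)))"
      by (rule fdet_cong) (simp add: \<nu>_def)
    ultimately show "t ^ (card (young_cells (\<lambda>j. if j < n then \<mu> j + \<epsilon> j else 0)) - card (young_cells \<mu>)) *
        fdet n (\<lambda>i j. \<phi> i ((if j < n then \<mu> j + \<epsilon> j else 0) + (n - 1 - j))) = t ^ (\<Sum>j<n. \<epsilon> j) * ?d \<epsilon>"
      unfolding \<nu>_def by (simp only:)
  next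
    fix \<nu> assume "\<nu> \<in> {\<nu>. \<nu> \<in> box_partitions n (Suc k) \<and> vstrip \<mu> \<nu>}"
    then have box: "\<nu> \<in> box_partitions n (Suc k)" and "vstrip \<mu> \<nu>" by auto
    then have v: "\<mu> j \<le> \<nu> j" "\<nu> j \<le> Suc (\<mu> j)" for j by (auto simp: vstrip_def)
    have "\<nu> (Suc j) \<le> \<nu> j" for j using box by (auto simp: box_partitions_def antimono_def)
    moreover have "\<nu> j - \<mu> j \<in> {0, 1}" for j using v[of j] by auto
    ultimately show "(\<lambda>j\<in>{..<n}. \<nu> j - \<mu> j) \<in>
        {\<epsilon>\<in>?E. \<forall>j. Suc j < n \<longrightarrow> \<mu> (Suc j) + \<epsilon> (Suc j) \<le> \<mu> j + \<epsilon> j}"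
      using v(1) by (simp add: Suc_lessD)
    show "(\<lambda>j. if j < n then \<mu> j + (\<lambda>j\<in>{..<n}. \<nu> j - \<mu> j) j else 0) = \<nu>"
      using v(1) box by (auto simp: box_partitions_def)
  qed
  finally show ?thesis ..
qed

text \<open>Induction on \<open>k\<close>. Removing the last variable from the conjugate Schur
  function removes a vertical strip from \<open>\<nu>\<close>. Once the order of summation is
  exchanged, the sum over these strips only replaces \<open>\<phi> p\<close> by
  \<open>\<phi> p + y (Suc k) * \<phi> (Suc p)\<close>; this is why \<open>\<phi>\<close> is an
  arbitrary family of functions and not just powers.\<close>

theorem schur_conj_det_sum:
  fixes \<phi> :: "nat \<Rightarrow> nat \<Rightarrow> real"
  shows "(\<Sum>\<nu>\<in>box_partitions n k. fdet n (\<lambda>i j. \<phi> i (\<nu> j + (n - 1 - j))) * schur k y (conj_partition \<nu>)) =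
    fdet n (\<lambda>i j. shifted k y (\<phi> i) (n - 1 - j))"
proof (induction k arbitrary: \<phi>)
  case 0
  have "box_partitions n 0 = {\<lambda>_. 0}" by (auto simp: box_partitions_def antimono_def)
  moreover have "conj_partition (\<lambda>_. 0) = (\<lambda>_. 0)" by (auto simp: conj_partition_def)
  ultimately show ?case by (simp add: schur_empty_diagram)
next
  case (Suc k)
  let ?B = "box_partitions n (Suc k)"
  let ?D = "\<lambda>\<nu>. fdet n (\<lambda>i j. \<phi> i (\<nu> j + (n - 1 - j)))"
  let ?w = "\<lambda>\<nu> \<mu>. y (Suc k) ^ (card (young_cells \<nu>) - card (young_cells \<mu>))"
  have fin: "finite ?B" by (rule finite_box_partitions)
  have branch: "schur (Suc k) y (conj_partition \<nu>) =
      (\<Sum>\<mu> | \<mu> \<in> ?B \<and> vstrip \<mu> \<nu>. schur k y (conj_partition \<mu>) * ?w \<nu> \<mu>)" if \<nu>: "\<nu> \<in> ?B" for \<nu>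
  proof -
    have "schur (Suc k) y (conj_partition \<nu>) = (\<Sum>\<kappa> | hstrip \<kappa> (conj_partition \<nu>).
       schur k y \<kappa> * y (Suc k) ^ (card (young_cells (conj_partition \<nu>)) - card (young_cells \<kappa>)))"
      by (rule schur_Suc[OF conj_partition_box[OF \<nu>]])
    also have "\<dots> = (\<Sum>\<mu> | \<mu> \<in> ?B \<and> vstrip \<mu> \<nu>. schur k y (conj_partition \<mu>) * ?w \<nu> \<mu>)"
    proof (rule sum.reindex_bij_witness[where i = conj_partition and j = conj_partition])
      fix \<kappa> assume "\<kappa> \<in> {\<kappa>. hstrip \<kappa> (conj_partition \<nu>)}"
      then have hs: "hstrip \<kappa> (conj_partition \<nu>)" by simp
      have box: "\<kappa> \<in> box_partitions (Suc k) n" by (rule hstrip_box[OF hs conj_partition_box[OF \<nu>]])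
      show cc: "conj_partition (conj_partition \<kappa>) = \<kappa>" by (rule conj_conj_partition[OF box])
      have "conj_partition \<kappa> \<in> ?B" by (rule conj_partition_box[OF box])
      moreover have "vstrip (conj_partition \<kappa>) \<nu>"
        using hs unfolding hstrip_conj_iff[OF \<open>conj_partition \<kappa> \<in> ?B\<close> \<nu>, symmetric] cc .
      ultimately show "conj_partition \<kappa> \<in> {\<mu>. \<mu> \<in> ?B \<and> vstrip \<mu> \<nu>}" by simp
      show "schur k y (conj_partition (conj_partition \<kappa>)) * ?w \<nu> (conj_partition \<kappa>) =
          schur k y \<kappa> * y (Suc k) ^ (card (young_cells (conj_partition \<nu>)) - card (young_cells \<kappa>))"
        by (simp only: cc card_young_cells_conj[OF box] card_young_cells_conj[OF \<nu>])
    next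
      fix \<mu> assume "\<mu> \<in> {\<mu>. \<mu> \<in> ?B \<and> vstrip \<mu> \<nu>}"
      then have \<mu>: "\<mu> \<in> ?B" "vstrip \<mu> \<nu>" by auto
      show "conj_partition (conj_partition \<mu>) = \<mu>" by (rule conj_conj_partition[OF \<mu>(1)])
      show "conj_partition \<mu> \<in> {\<kappa>. hstrip \<kappa> (conj_partition \<nu>)}"
        using \<mu> hstrip_conj_iff[OF \<mu>(1) \<nu>] by simp
    qed
    finally show ?thesis .
  qed
  have "(\<Sum>\<nu>\<in>?B. ?D \<nu> * schur (Suc k) y (conj_partition \<nu>)) =
      (\<Sum>\<nu>\<in>?B. \<Sum>\<mu> | \<mu> \<in> ?B \<and> vstrip \<mu> \<nu>. schur k y (conj_partition \<mu>) * (?w \<nu> \<mu> * ?D \<nu>))"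
    by (intro sum.cong refl) (simp add: branch sum_distrib_left mult_ac)
  also have "\<dots> = (\<Sum>\<mu>\<in>?B. \<Sum>\<nu> | \<nu> \<in> ?B \<and> vstrip \<mu> \<nu>. schur k y (conj_partition \<mu>) * (?w \<nu> \<mu> * ?D \<nu>))"
    by (rule sum.swap_restrict[OF fin fin])
  also have "\<dots> = (\<Sum>\<mu>\<in>box_partitions n k. \<Sum>\<nu> | \<nu> \<in> ?B \<and> vstrip \<mu> \<nu>. schur k y (conj_partition \<mu>) * (?w \<nu> \<mu> * ?D \<nu>))"
  proof (rule sum.mono_neutral_right[OF fin])
    show "box_partitions n k \<subseteq> ?B" by (auto intro: box_partitions_mono)
    \<comment> \<open>A first row of length k + 1 gives the conjugate k + 1 rows, too many for
      \<open>k\<close> variables.\<close>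
    show "\<forall>\<mu>\<in>?B - box_partitions n k.
        (\<Sum>\<nu> | \<nu> \<in> ?B \<and> vstrip \<mu> \<nu>. schur k y (conj_partition \<mu>) * (?w \<nu> \<mu> * ?D \<nu>)) = 0"
    proof
      fix \<mu> assume "\<mu> \<in> ?B - box_partitions n k"
      then have \<mu>: "\<mu> \<in> ?B" and "\<not> \<mu> 0 \<le> k" using box_partitions_width[of k "Suc k" n] by auto
      then have "conj_partition \<mu> k > 0" using less_conj_partition_iff[OF \<mu>] by simp
      then have "schur k y (conj_partition \<mu>) = 0"
        using conj_partition_box[OF \<mu>] by (intro schur_too_many_rows) (auto simp: box_partitions_def)
      then show "(\<Sum>\<nu> | \<nu> \<in> ?B \<and> vstrip \<mu> \<nu>. schur k y (conj_partition \<mu>) * (?w \<nu> \<mu> * ?D \<nu>)) = 0" by simp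
    qed
  qed
  also have "\<dots> = (\<Sum>\<mu>\<in>box_partitions n k.
      fdet n (\<lambda>i j. \<phi> i (\<mu> j + (n - 1 - j)) + y (Suc k) * \<phi> i (Suc (\<mu> j + (n - 1 - j)))) * schur k y (conj_partition \<mu>))"
    by (intro sum.cong refl) (simp only: sum_distrib_left[symmetric] det_vstrip_sum mult.commute)
  also have "\<dots> = fdet n (\<lambda>i j. shifted (Suc k) y (\<phi> i) (n - 1 - j))"
    using Suc.IH[of "\<lambda>i p. \<phi> i p + y (Suc k) * \<phi> i (Suc p)"] by simp
  finally show ?case .
qed

text \<open>\<open>shifted\<close> applies the product of the operators 1 + y_j E, with E the shift
  of the index; expanding the product in powers of E gives the coefficients of the
  polynomial.\<close>

lemma shifted_eq:
  "shifted k y \<phi> p = (\<Sum>r\<le>k. coeff (\<Prod>j=1..k. [:1, y j:]) r * \<phi> (p + r))"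
proof (induction k arbitrary: \<phi> p)
  case (Suc k)
  let ?P = "\<Prod>j=1..k. [:1, y j:]"
  have "degree ?P \<le> (\<Sum>j\<in>{1..k}. degree [:1, y j:])"
    using degree_prod_sum_le[of "{1..k}" "\<lambda>j. [:1, y j:]"] by (simp add: o_def)
  also have "\<dots> \<le> (\<Sum>j\<in>{1..k}. 1)" by (rule sum_mono) simp
  finally have deg: "degree ?P \<le> k" by simp
  have top: "coeff ?P (Suc k) = 0" using deg by (intro coeff_eq_0) simp
  have c: "coeff (\<Prod>j=1..Suc k. [:1, y j:]) r = coeff ?P r + y (Suc k) * (case r of 0 \<Rightarrow> 0 | Suc r \<Rightarrow> coeff ?P r)" for r
  proof -
    have "(\<Prod>j=1..Suc k. [:1, y j:]) = ?P + Polynomial.smult (y (Suc k)) (pCons 0 ?P)"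
      by (simp add: prod.nat_ivl_Suc' mult.commute)
    then show ?thesis by (cases r) (simp_all)
  qed
  have "(\<Sum>r\<le>Suc k. coeff (\<Prod>j=1..Suc k. [:1, y j:]) r * \<phi> (p + r)) =
     (\<Sum>r\<le>Suc k. coeff ?P r * \<phi> (p + r)) + y (Suc k) * (\<Sum>r\<le>Suc k. (case r of 0 \<Rightarrow> 0 | Suc r \<Rightarrow> coeff ?P r) * \<phi> (p + r))"
    unfolding c by (simp only: distrib_right sum.distrib sum_distrib_left mult.assoc)
  also have "(\<Sum>r\<le>Suc k. coeff ?P r * \<phi> (p + r)) = (\<Sum>r\<le>k. coeff ?P r * \<phi> (p + r))"
    using top by simp
  also have "(\<Sum>r\<le>Suc k. (case r of 0 \<Rightarrow> 0 | Suc r \<Rightarrow> coeff ?P r) * \<phi> (p + r)) = (\<Sum>r\<le>k. coeff ?P r * \<phi> (Suc (p + r)))"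
    unfolding sum.atMost_Suc_shift by simp
  also have "(\<Sum>r\<le>k. coeff ?P r * \<phi> (p + r)) + y (Suc k) * \<dots> = shifted (Suc k) y \<phi> p"
    unfolding shifted.simps Suc.IH by (simp add: sum.distrib sum_distrib_left algebra_simps)
  finally show ?case ..
qed simp

text \<open>The bound on the first row is encoded in the functions whose alternants are taken: with
  powers cut off at exponent n + m, a partition whose first row exceeds \<open>m\<close> has an
  alternant with a zero first column. The sum may then be extended to the whole n x k box, where it
  is a single determinant.\<close>

theorem truncated_dual_Cauchy:
  fixes x y :: "nat \<Rightarrow> real"
  assumes "m \<le> k"
  shows "(\<Sum>\<nu>\<in>box_partitions n m. schur n x \<nu> * schur k y (conj_partition \<nu>)) *
      fdet n (\<lambda>i j. x (Suc i) ^ (n - 1 - j)) =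
    fdet n (\<lambda>i j. \<Sum>r\<le>k. coeff (\<Prod>j=1..k. [:1, y j:]) r *
      (if n - 1 - j + r < n + m then x (Suc i) ^ (n - 1 - j + r) else 0))"
proof -
  define \<phi> where "\<phi> i p = (if p < n + m then x (Suc i) ^ p else 0)" for i p :: nat
  let ?D = "\<lambda>\<nu>. fdet n (\<lambda>i j. \<phi> i (\<nu> j + (n - 1 - j)))"
  have "(\<Sum>\<nu>\<in>box_partitions n m. schur n x \<nu> * schur k y (conj_partition \<nu>)) *
      fdet n (\<lambda>i j. x (Suc i) ^ (n - 1 - j)) =
    (\<Sum>\<nu>\<in>box_partitions n m. fdet n (\<lambda>i j. x (Suc i) ^ (\<nu> j + (n - 1 - j))) * schur k y (conj_partition \<nu>))"
    unfolding sum_distrib_right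
    by (intro sum.cong refl) (simp only: schur_bialternant[symmetric] mult.assoc mult.commute[of "schur k y _"])
  also have "\<dots> = (\<Sum>\<nu>\<in>box_partitions n m. ?D \<nu> * schur k y (conj_partition \<nu>))"
  proof (intro sum.cong refl arg_cong2[where f = times] fdet_cong)
    fix \<nu> i j assume "\<nu> \<in> box_partitions n m" and j: "j < n"
    then have "\<nu> j \<le> m" by (auto simp: box_partitions_def)
    then show "x (Suc i) ^ (\<nu> j + (n - 1 - j)) = \<phi> i (\<nu> j + (n - 1 - j))" using j by (simp add: \<phi>_def)
  qed
  also have "\<dots> = (\<Sum>\<nu>\<in>box_partitions n k. ?D \<nu> * schur k y (conj_partition \<nu>))"
  proof (rule sum.mono_neutral_left[OF finite_box_partitions])
    show "box_partitions n m \<subseteq> box_partitions n k" using assms by (auto intro: box_partitions_mono)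
    show "\<forall>\<nu>\<in>box_partitions n k - box_partitions n m. ?D \<nu> * schur k y (conj_partition \<nu>) = 0"
    proof
      fix \<nu> assume \<nu>: "\<nu> \<in> box_partitions n k - box_partitions n m"
      then have "n > 0" using box_partitions_0 by (cases n) auto
      moreover have "\<nu> \<notin> {\<mu> \<in> box_partitions n k. \<mu> 0 \<le> m}"
        using \<nu> box_partitions_width[OF assms, of n] by blast
      then have "m < \<nu> 0" using \<nu> by simp
      ultimately have "?D \<nu> = 0" by (intro fdet_zero_col[of 0]) (auto simp: \<phi>_def)
      then show "?D \<nu> * schur k y (conj_partition \<nu>) = 0" by simp
    qed
  qed
  also have "\<dots> = fdet n (\<lambda>i j. shifted k y (\<phi> i) (n - 1 - j))" by (rule schur_conj_det_sum)
  finally show ?thesis unfolding shifted_eq \<phi>_def .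
qed

section \<open>Sylvester's identity and the gap determinant\<close>

lemma mat_mult_fun:
  "Matrix.mat n m (\<lambda>(i, j). f i j) * Matrix.mat m k (\<lambda>(i, j). g i j) =
   Matrix.mat n k (\<lambda>(i, j). \<Sum>l<m. f i l * g l j)"
  by (rule eq_matI) (auto simp: scalar_prod_def lessThan_atLeast0)

lemma fdet_mult: "fdet n A * fdet n B = fdet n (\<lambda>i j. \<Sum>l<n. A i l * B l j)"
  using det_mult[of "Matrix.mat n n (\<lambda>(i, j). A i j)" n "Matrix.mat n n (\<lambda>(i, j). B i j)"]
  by (simp add: mat_mult_fun)

lemma fdet_one: "fdet n (\<lambda>i j. if i = j then 1 else 0) = (1 :: 'a::comm_ring_1)"
proof -
  have "Matrix.mat n n (\<lambda>(i, j). if i = j then 1 else 0 :: 'a) = 1\<^sub>m n" by (auto intro!: eq_matI)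
  then show ?thesis by simp
qed

text \<open>Both sides are the determinant of the block matrix with rows (1, A) and (B, 1): the
  unipotent block matrix with B in the lower left corner can be split off on the left or on the
  right.\<close>

theorem det_Sylvester:
  fixes A B :: "'a::idom mat"
  assumes A: "A \<in> carrier_mat n m" and B: "B \<in> carrier_mat m n"
  shows "Determinant.det (1\<^sub>m n - A * B) = Determinant.det (1\<^sub>m m - B * A)"
proof -
  let ?X = "four_block_mat (1\<^sub>m n) A B (1\<^sub>m m)"
  let ?L = "four_block_mat (1\<^sub>m n) (0\<^sub>m n m) B (1\<^sub>m m)"
  have c: "1\<^sub>m n \<in> carrier_mat n n" "1\<^sub>m m \<in> carrier_mat m m"
    "(1\<^sub>m n - A * B) \<in> carrier_mat n n" "(1\<^sub>m m - B * A) \<in> carrier_mat m m"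
    "A * B \<in> carrier_mat n n" "B * A \<in> carrier_mat m m"
    using A B by auto
  have L: "?L \<in> carrier_mat (n + m) (n + m)" by (rule four_block_carrier_mat) auto
  have detL: "Determinant.det ?L = 1"
    by (subst det_four_block_mat_upper_right_zero[of _ n _ m]) (use B in auto)
  have "?L * four_block_mat (1\<^sub>m n) A (0\<^sub>m m n) (1\<^sub>m m - B * A) = ?X"
    by (subst mult_four_block_mat[of _ n n _ m _ m _ _ n _ m])
      (use A B c in \<open>auto intro!: cong_four_block_mat eq_matI\<close>)
  then have "Determinant.det ?X = Determinant.det ?L *
      Determinant.det (four_block_mat (1\<^sub>m n) A (0\<^sub>m m n) (1\<^sub>m m - B * A))"
    using det_mult[OF L four_block_carrier_mat[OF c(1) c(4)], of A "0\<^sub>m m n"] by simp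
  also have "\<dots> = Determinant.det (1\<^sub>m m - B * A)"
    unfolding detL by (subst det_four_block_mat_lower_left_zero[of _ n _ m]) (use A c in auto)
  finally have 1: "Determinant.det ?X = Determinant.det (1\<^sub>m m - B * A)" .
  have "four_block_mat (1\<^sub>m n - A * B) A (0\<^sub>m m n) (1\<^sub>m m) * ?L = ?X"
    by (subst mult_four_block_mat[of _ n n _ m _ m _ _ n _ m])
      (use A B c in \<open>auto intro!: cong_four_block_mat eq_matI\<close>)
  then have "Determinant.det ?X =
      Determinant.det (four_block_mat (1\<^sub>m n - A * B) A (0\<^sub>m m n) (1\<^sub>m m)) * Determinant.det ?L"
    using det_mult[OF four_block_carrier_mat[OF c(3) c(2)] L, of A "0\<^sub>m m n"] by simp
  also have "\<dots> = Determinant.det (1\<^sub>m n - A * B)"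
    unfolding detL by (subst det_four_block_mat_lower_left_zero[of _ n _ m]) (use A c in auto)
  finally show ?thesis using 1 by simp
qed

lemma fdet_Sylvester:
  fixes A B :: "nat \<Rightarrow> nat \<Rightarrow> 'a::idom"
  shows "fdet n (\<lambda>i j. (if i = j then 1 else 0) - (\<Sum>p<m. A i p * B p j)) =
    fdet m (\<lambda>p q. (if p = q then 1 else 0) - (\<Sum>i<n. B p i * A i q))"
proof -
  have eq: "1\<^sub>m n - Matrix.mat n n (\<lambda>(i, j). F i j) = Matrix.mat n n (\<lambda>(i, j). (if i = j then 1 else 0) - F i j)"
    for n and F :: "nat \<Rightarrow> nat \<Rightarrow> 'a"
    by (auto intro!: eq_matI)
  show ?thesis
    using det_Sylvester[of "Matrix.mat n m (\<lambda>(i, j). A i j)" n m "Matrix.mat m n (\<lambda>(i, j). B i j)"]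
    by (simp add: mat_mult_fun eq)
qed

text \<open>Division of \<open>q\<close> by 1 - a X is multiplication by the geometric
  series.\<close>

lemma coeff_sum_powers:
  fixes p q :: "real poly"
  assumes "q = [:1, - a:] * p"
  shows "coeff p t = (\<Sum>r\<le>t. coeff q r * a ^ (t - r))"
proof (induction t)
  case 0
  show ?case by (simp add: assms)
next
  case (Suc t)
  have "coeff q (Suc t) = coeff p (Suc t) - a * coeff p t" by (simp add: assms)
  moreover have "(\<Sum>r\<le>Suc t. coeff q r * a ^ (Suc t - r)) =
      coeff q (Suc t) + a * (\<Sum>r\<le>t. coeff q r * a ^ (t - r))"
    by (simp add: sum_distrib_left Suc_diff_le mult_ac)
  ultimately show ?case using Suc.IH by simp
qed

text \<open>The product of \<open>xpoly\<close> and \<open>ypoly\<close> is z^k / K(z): each factor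
  1 + y_j / z of 1 / K has been multiplied by z.\<close>

definition ypoly :: "nat \<Rightarrow> (nat \<Rightarrow> real) \<Rightarrow> real poly" where
  "ypoly k y = (\<Prod>j=1..k. [:y j, 1:])"

definition xpoly :: "nat \<Rightarrow> (nat \<Rightarrow> real) \<Rightarrow> real poly" where
  "xpoly n x = (\<Prod>i=1..n. [:1, - x i:])"

lemma degree_ypoly: "degree (ypoly k y) = k"
  unfolding ypoly_def by (subst degree_prod_eq_sum_degree) auto

lemma coeff_ypoly_reverse:
  assumes "\<And>j. j \<in> {1..k} \<Longrightarrow> y j \<noteq> 0" "r \<le> k"
  shows "coeff (\<Prod>j=1..k. [:1, y j:]) r = coeff (ypoly k y) (k - r)"
proof -
  have "reflect_poly (ypoly k y) = (\<Prod>j=1..k. [:1, y j:])"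
    unfolding ypoly_def reflect_poly_prod
    by (rule prod.cong) (use assms(1) in \<open>auto simp: reflect_poly_def\<close>)
  then show ?thesis
    using coeff_reflect_poly[of "ypoly k y" r] assms(2) by (simp add: degree_ypoly)
qed

lemma poly_ypoly_eq: "poly (ypoly k y) z = (\<Prod>j=1..k. y j + z)"
  by (simp add: ypoly_def poly_prod add.commute)

lemma poly_eq_sum_coeff: "degree p \<le> k \<Longrightarrow> poly p z = (\<Sum>t\<le>k. coeff p t * z ^ t)"
  for p :: "real poly"
  unfolding poly_altdef by (rule sum.mono_neutral_left) (auto simp: coeff_eq_0)

text \<open>The value of the \<open>i\<close>-th residue weight: minus the residue of the reciprocal kernel polynomial at \<open>1 / x i\<close>, up to the factor \<open>1 / x i\<close>.\<close>

definition node_weight :: "nat \<Rightarrow> nat \<Rightarrow> (nat \<Rightarrow> real) \<Rightarrow> (nat \<Rightarrow> real) \<Rightarrow> nat \<Rightarrow> real" where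
  "node_weight n k x y i = 1 / (poly (ypoly k y) (1 / x i) * (\<Prod>j\<in>{1..n} - {i}. 1 - x j / x i))"

text \<open>The coefficients come from the expansion of 1 / K(w) at 0, the inner sum from the
  residues at the poles 1 / x_i. The row index \<open>p\<close> belongs to the w-integral, so
  \<open>p\<close> and \<open>p'\<close> correspond to l' - 1 and l - 1.\<close>

definition gap_kernel :: "nat \<Rightarrow> nat \<Rightarrow> (nat \<Rightarrow> real) \<Rightarrow> (nat \<Rightarrow> real) \<Rightarrow> nat \<Rightarrow> nat \<Rightarrow> real" where
  "gap_kernel n k x y p p' = (\<Sum>r\<le>p. coeff (xpoly n x * ypoly k y) r *
     (\<Sum>i=1..n. x i ^ (p - r) * (1 / x i) ^ p' * node_weight n k x y i))"

context
  fixes n k :: nat and x y :: "nat \<Rightarrow> real"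
  assumes x_pos: "\<And>i. i \<in> {1..n} \<Longrightarrow> x i > 0"
    and x_inj: "inj_on x {1..n}"
    and y_pos: "\<And>j. j \<in> {1..k} \<Longrightarrow> y j > 0"
begin

private lemma Y_pos: "i \<in> {1..n} \<Longrightarrow> poly (ypoly k y) (1 / x i) > 0"
  unfolding poly_ypoly_eq by (intro prod_pos) (use x_pos y_pos in \<open>auto intro!: add_pos_pos\<close>)

text \<open>Lagrange basis polynomials for the nodes 1 / x_i. Their coefficients are the columns of
  the inverse Vandermonde matrix.\<close>

private definition Lp :: "nat \<Rightarrow> real poly" where
  "Lp i = Polynomial.smult (1 / (\<Prod>j\<in>{1..n} - {i}. 1 - x j / x i)) (\<Prod>j\<in>{1..n} - {i}. [:1, - x j:])"

private lemma D_nz: "i \<in> {1..n} \<Longrightarrow> (\<Prod>j\<in>{1..n} - {i}. 1 - x j / x i) \<noteq> 0"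
proof
  assume i: "i \<in> {1..n}" and "(\<Prod>j\<in>{1..n} - {i}. 1 - x j / x i) = 0"
  then have "\<exists>j\<in>{1..n} - {i}. 1 - x j / x i = 0" by (subst (asm) prod_zero_iff) auto
  then obtain j where "j \<in> {1..n}" "j \<noteq> i" "1 - x j / x i = 0" by blast
  then have "x j = x i" using x_pos[OF i] by simp
  then show False using inj_onD[OF x_inj] i \<open>j \<in> {1..n}\<close> \<open>j \<noteq> i\<close> by blast
qed

private lemma poly_Lp: "i \<in> {1..n} \<Longrightarrow> i' \<in> {1..n} \<Longrightarrow> poly (Lp i) (1 / x i') = (if i' = i then 1 else 0)"
  using x_pos[of i'] D_nz[of i] by (auto simp: Lp_def poly_prod)

private lemma degree_Lp: "i \<in> {1..n} \<Longrightarrow> degree (Lp i) < n"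
proof -
  assume i: "i \<in> {1..n}"
  have "degree (\<Prod>j\<in>{1..n} - {i}. [:1, - x j:]) \<le> (\<Sum>j\<in>{1..n} - {i}. degree [:1, - x j:])"
    using degree_prod_sum_le[of "{1..n} - {i}" "\<lambda>j. [:1, - x j:]"] by (simp add: o_def)
  also have "\<dots> \<le> (\<Sum>j\<in>{1..n} - {i}. 1)" by (rule sum_mono) simp
  also have "\<dots> < n" using i by simp
  finally show ?thesis unfolding Lp_def by (meson degree_smult_le order.strict_trans1)
qed

private lemma Lp_sum: "i \<in> {1..n} \<Longrightarrow> i' \<in> {1..n} \<Longrightarrow>
   (\<Sum>q<n. (1 / x i') ^ q * coeff (Lp i) q) = (if i' = i then 1 else 0)"
proof -
  assume i: "i \<in> {1..n}" "i' \<in> {1..n}"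
  have "poly (Lp i) (1 / x i') = (\<Sum>t\<le>n - 1. coeff (Lp i) t * (1 / x i') ^ t)"
    by (rule poly_eq_sum_coeff) (use degree_Lp[OF i(1)] in auto)
  also have "{..n - 1} = {..<n}" using i by auto
  finally show ?thesis using poly_Lp[OF i] by (simp add: mult.commute)
qed

private abbreviation "z \<equiv> \<lambda>i. 1 / x (Suc i)"
private abbreviation "Y \<equiv> ypoly k y"
private abbreviation "W \<equiv> fdet n (\<lambda>i j. z i ^ j)"

private lemma W_nz: "W \<noteq> 0"
proof -
  have "W * fdet n (\<lambda>q i. coeff (Lp (Suc i)) q) = fdet n (\<lambda>i j. if i = j then 1 else 0)"
    unfolding fdet_mult by (rule fdet_cong) (simp add: Lp_sum)
  then show ?thesis by (auto simp: fdet_one)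
qed

private lemma vandermonde_reverse:
  "fdet n (\<lambda>i j. x (Suc i) ^ (n - 1 - j)) = (\<Prod>i<n. x (Suc i) ^ (n - 1)) * W"
  unfolding fdet_scale_rows[symmetric]
proof (rule fdet_cong)
  fix i j assume "i < n" "j < n"
  have x: "x (Suc i) > 0" using x_pos[of "Suc i"] \<open>i < n\<close> by simp
  have e: "x (Suc i) ^ (n - 1) = x (Suc i) ^ (n - 1 - j) * x (Suc i) ^ j"
    using \<open>j < n\<close> by (simp add: power_add[symmetric])
  have "x (Suc i) ^ j * z i ^ j = 1" using x by (simp add: power_mult_distrib[symmetric])
  then show "x (Suc i) ^ (n - 1 - j) = x (Suc i) ^ (n - 1) * z i ^ j" by (simp only: e mult.assoc mult_1_right)
qed

text \<open>Up to row factors, the matrix of the truncated sum is z_i^j minus the product of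
  \<open>Bm\<close> and \<open>Cm\<close> with inner dimension \<open>\<Delta>\<close>.
  \<open>Gm\<close> is \<open>Bm\<close> multiplied from the left by the inverse Vandermonde
  matrix.\<close>

private definition Bm :: "nat \<Rightarrow> nat \<Rightarrow> real" where "Bm i p = z i ^ p / poly Y (z i)"
private definition Cm :: "nat \<Rightarrow> nat \<Rightarrow> real" where "Cm p j = (if j \<le> p then coeff Y (p - j) else 0)"
private definition Gm :: "nat \<Rightarrow> nat \<Rightarrow> real" where "Gm q p = (\<Sum>i<n. coeff (Lp (Suc i)) q * Bm i p)"

private lemma W_Gm: "i < n \<Longrightarrow> (\<Sum>q<n. z i ^ q * Gm q p) = Bm i p"
proof -
  assume i: "i < n"
  have "(\<Sum>q<n. z i ^ q * Gm q p) = (\<Sum>i'<n. (\<Sum>q<n. z i ^ q * coeff (Lp (Suc i')) q) * Bm i' p)"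
    unfolding Gm_def sum_distrib_left sum_distrib_right by (subst sum.swap) (simp add: mult_ac)
  also have "\<dots> = (\<Sum>i'<n. (if i = i' then 1 else 0) * Bm i' p)"
    by (intro sum.cong refl) (use i in \<open>simp add: Lp_sum\<close>)
  also have "\<dots> = Bm i p" using i by (simp add: if_distrib[of "\<lambda>u. u * _"] cong: if_cong)
  finally show ?thesis .
qed

private lemma C_Gm: "(\<Sum>q<n. Cm p q * Gm q p') = gap_kernel n k x y p p'"
proof -
  have "(\<Sum>q<n. Cm p q * Gm q p') = (\<Sum>i<n. (\<Sum>q<n. Cm p q * coeff (Lp (Suc i)) q) * Bm i p')"
    unfolding Gm_def sum_distrib_left sum_distrib_right by (subst sum.swap) (simp add: mult_ac)
  also have "\<dots> = (\<Sum>i<n. \<Sum>r\<le>p. coeff (xpoly n x * Y) r * (x (Suc i) ^ (p - r) * z i ^ p' * node_weight n k x y (Suc i)))"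
  proof (rule sum.cong[OF refl])
    fix i assume "i \<in> {..<n}"
    then have i: "Suc i \<in> {1..n}" by simp
    let ?D = "\<Prod>j\<in>{1..n} - {Suc i}. 1 - x j / x (Suc i)"
    have "(\<Sum>q<n. Cm p q * coeff (Lp (Suc i)) q) = (\<Sum>q\<le>p. coeff (Lp (Suc i)) q * coeff Y (p - q))"
    proof (rule sum.mono_neutral_cong)
      show "coeff (Lp (Suc i)) q * coeff Y (p - q) = 0" if "q \<in> {..p} - {..<n}" for q
        using that degree_Lp[OF i] by (simp add: coeff_eq_0)
    qed (auto simp: Cm_def)
    also have "\<dots> = coeff (Lp (Suc i) * Y) p" by (simp add: coeff_mult)
    \<comment> \<open>\<open>Lp\<close> lacks one factor 1 - x_i z of \<open>xpoly\<close>.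
      Restoring it turns the product with \<open>Y\<close> into the full polynomial, at the price of
      a geometric sum in x_i.\<close>
    also have "\<dots> = (\<Sum>r\<le>p. coeff (Polynomial.smult (1 / ?D) (xpoly n x * Y)) r * x (Suc i) ^ (p - r))"
    proof (rule coeff_sum_powers)
      have "xpoly n x = [:1, - x (Suc i):] * (\<Prod>j\<in>{1..n} - {Suc i}. [:1, - x j:])"
        unfolding xpoly_def by (rule prod.remove) (use i in auto)
      then show "Polynomial.smult (1 / ?D) (xpoly n x * Y) = [:1, - x (Suc i):] * (Lp (Suc i) * Y)"
        by (simp only: Lp_def mult_smult_left mult_smult_right mult.assoc)
    qed
    finally have S: "(\<Sum>q<n. Cm p q * coeff (Lp (Suc i)) q) = (\<Sum>r\<le>p. coeff (xpoly n x * Y) r * x (Suc i) ^ (p - r)) / ?D"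
      by (simp add: sum_divide_distrib)
    then show "(\<Sum>q<n. Cm p q * coeff (Lp (Suc i)) q) * Bm i p' =
        (\<Sum>r\<le>p. coeff (xpoly n x * Y) r * (x (Suc i) ^ (p - r) * z i ^ p' * node_weight n k x y (Suc i)))"
      unfolding S Bm_def node_weight_def sum_divide_distrib sum_distrib_right
      by (intro sum.cong refl) (simp add: mult_ac)
  qed
  also have "\<dots> = (\<Sum>r\<le>p. coeff (xpoly n x * Y) r * (\<Sum>i<n. x (Suc i) ^ (p - r) * z i ^ p' * node_weight n k x y (Suc i)))"
    by (subst sum.swap) (simp add: sum_distrib_left)
  also have "\<dots> = gap_kernel n k x y p p'"
    unfolding gap_kernel_def
    by (intro sum.cong refl arg_cong2[where f = times] sum.reindex_bij_witness[of _ "\<lambda>i. i - 1" Suc]) auto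
  finally show ?thesis .
qed

text \<open>Without the cut-off, the entry in row \<open>i\<close> and column \<open>j\<close> would
  be z_i^j times a row factor. The cut-off removes only the terms with t + j <
  \<open>\<Delta>\<close>, a perturbation of rank at most \<open>\<Delta>\<close>; after division by
  the Vandermonde matrix, Sylvester's identity passes to size \<open>\<Delta>\<close>.\<close>

lemma truncated_sum_eq_gap_det:
  assumes \<Delta>: "\<Delta> \<le> k"
  shows "(\<Sum>\<nu>\<in>box_partitions n (k - \<Delta>). schur n x \<nu> * schur k y (conj_partition \<nu>)) =
    (\<Prod>i=1..n. \<Prod>j=1..k. 1 + x i * y j) *
    fdet \<Delta> (\<lambda>p p'. (if p = p' then 1 else 0) - gap_kernel n k x y p p')"
proof -
  let ?Z = "\<Sum>\<nu>\<in>box_partitions n (k - \<Delta>). schur n x \<nu> * schur k y (conj_partition \<nu>)"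
  have entry: "(\<Sum>r\<le>k. coeff (\<Prod>j=1..k. [:1, y j:]) r *
      (if n - 1 - j + r < n + (k - \<Delta>) then x (Suc i) ^ (n - 1 - j + r) else 0)) =
     x (Suc i) ^ (n - 1 + k) * poly Y (z i) * (z i ^ j - (\<Sum>p<\<Delta>. Bm i p * Cm p j))"
    if "i < n" "j < n" for i j
  proof -
    have x: "x (Suc i) > 0" "poly Y (z i) > 0" using that x_pos Y_pos[of "Suc i"] by auto
    have "(\<Sum>r\<le>k. coeff (\<Prod>j=1..k. [:1, y j:]) r *
      (if n - 1 - j + r < n + (k - \<Delta>) then x (Suc i) ^ (n - 1 - j + r) else 0)) =
      (\<Sum>t\<le>k. coeff Y t * (if \<Delta> \<le> t + j then x (Suc i) ^ (n - 1 + k) * z i ^ (t + j) else 0))"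
    \<comment> \<open>The substitution r = k - t passes to the reversed polynomial \<open>Y\<close>
      with argument 1 / x_i and turns the upper cut-off into the lower one
      \<open>\<Delta> \<le> t + j\<close>.\<close>
    proof (rule sum.reindex_bij_witness[of _ "\<lambda>t. k - t" "\<lambda>r. k - r"])
      fix r assume r: "r \<in> {..k}"
      have c: "coeff (\<Prod>j=1..k. [:1, y j:]) r = coeff Y (k - r)"
        by (rule coeff_ypoly_reverse) (use y_pos r in force)+
      have e: "n - 1 + k = (n - 1 - j + r) + (k - r + j)" using that r by auto
      have "x (Suc i) ^ (n - 1 + k) * z i ^ (k - r + j) = x (Suc i) ^ (n - 1 - j + r)"
        unfolding e power_add using x by (simp add: power_divide)
      moreover have "n - 1 - j + r < n + (k - \<Delta>) \<longleftrightarrow> \<Delta> \<le> k - r + j" using that r \<Delta> by auto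
      ultimately show "coeff Y (k - r) * (if \<Delta> \<le> k - r + j then x (Suc i) ^ (n - 1 + k) * z i ^ (k - r + j) else 0) =
        coeff (\<Prod>j=1..k. [:1, y j:]) r * (if n - 1 - j + r < n + (k - \<Delta>) then x (Suc i) ^ (n - 1 - j + r) else 0)"
        unfolding c by simp
    qed auto
    also have "\<dots> = x (Suc i) ^ (n - 1 + k) * ((\<Sum>t\<le>k. coeff Y t * z i ^ (t + j)) -
        (\<Sum>t\<le>k. if t + j < \<Delta> then coeff Y t * z i ^ (t + j) else 0))"
      unfolding sum_subtractf[symmetric] sum_distrib_left by (intro sum.cong refl) (auto simp: mult_ac)
    also have "(\<Sum>t\<le>k. coeff Y t * z i ^ (t + j)) = z i ^ j * poly Y (z i)"
      by (simp add: poly_eq_sum_coeff[of Y k] degree_ypoly sum_distrib_left power_add mult_ac)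
    also have "(\<Sum>t\<le>k. if t + j < \<Delta> then coeff Y t * z i ^ (t + j) else 0) =
        (\<Sum>p<\<Delta>. if j \<le> p then coeff Y (p - j) * z i ^ p else 0)"
      unfolding sum.inter_filter[OF finite_atMost, symmetric] sum.inter_filter[OF finite_lessThan, symmetric]
      by (rule sum.reindex_bij_witness[of _ "\<lambda>p. p - j" "\<lambda>t. t + j"]) (use \<Delta> in auto)
    also have "\<dots> = poly Y (z i) * (\<Sum>p<\<Delta>. Bm i p * Cm p j)"
      unfolding sum_distrib_left by (intro sum.cong refl) (use x in \<open>auto simp: Bm_def Cm_def\<close>)
    finally show ?thesis by (simp add: algebra_simps)
  qed
  \<comment> \<open>Of the row factor, x_i^(n - 1) converts the Vandermonde determinant in x_i into
    the one in 1 / x_i, and x_i^k Y(1 / x_i) is the product of the 1 + x_i y_j, the normalization of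
    the measure.\<close>
  have prod: "(\<Prod>i<n. x (Suc i) ^ (n - 1 + k) * poly Y (z i)) =
      (\<Prod>i<n. x (Suc i) ^ (n - 1)) * (\<Prod>i=1..n. \<Prod>j=1..k. 1 + x i * y j)"
  proof -
    have "(\<Prod>i=1..n. \<Prod>j=1..k. 1 + x i * y j) = (\<Prod>i<n. \<Prod>j=1..k. 1 + x (Suc i) * y j)"
      by (rule prod.reindex_bij_witness[of _ Suc "\<lambda>i. i - 1"]) auto
    also have "\<dots> = (\<Prod>i<n. x (Suc i) ^ k * poly Y (z i))"
    proof (rule prod.cong[OF refl])
      fix i assume "i \<in> {..<n}"
      then have "x (Suc i) > 0" using x_pos by simp
      then have "1 + x (Suc i) * y j = x (Suc i) * (y j + z i)" for j by (simp add: field_simps)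
      then show "(\<Prod>j=1..k. 1 + x (Suc i) * y j) = x (Suc i) ^ k * poly Y (z i)"
        by (simp add: poly_ypoly_eq prod.distrib)
    qed
    finally show ?thesis by (simp only: prod.distrib power_add mult_ac)
  qed
  have "?Z * fdet n (\<lambda>i j. x (Suc i) ^ (n - 1 - j)) =
      fdet n (\<lambda>i j. x (Suc i) ^ (n - 1 + k) * poly Y (z i) * (z i ^ j - (\<Sum>p<\<Delta>. Bm i p * Cm p j)))"
    unfolding truncated_dual_Cauchy[OF diff_le_self] by (rule fdet_cong) (rule entry)
  also have "\<dots> = (\<Prod>i<n. x (Suc i) ^ (n - 1 + k) * poly Y (z i)) * fdet n (\<lambda>i j. z i ^ j - (\<Sum>p<\<Delta>. Bm i p * Cm p j))"
    by (rule fdet_scale_rows)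
  also have "fdet n (\<lambda>i j. z i ^ j - (\<Sum>p<\<Delta>. Bm i p * Cm p j)) =
      W * fdet n (\<lambda>i j. (if i = j then 1 else 0) - (\<Sum>p<\<Delta>. Gm i p * Cm p j))"
    unfolding fdet_mult
  proof (rule fdet_cong)
    fix i j assume ij: "i < n" "j < n"
    have swap: "(\<Sum>p<\<Delta>. (\<Sum>q<n. z i ^ q * Gm q p) * Cm p j) = (\<Sum>q<n. z i ^ q * (\<Sum>p<\<Delta>. Gm q p * Cm p j))"
      unfolding sum_distrib_right sum_distrib_left by (subst sum.swap) (simp only: mult.assoc)
    have "(\<Sum>q<n. z i ^ q * ((if q = j then 1 else 0) - (\<Sum>p<\<Delta>. Gm q p * Cm p j))) =
        (\<Sum>q<n. if q = j then z i ^ q else 0) - (\<Sum>p<\<Delta>. (\<Sum>q<n. z i ^ q * Gm q p) * Cm p j)"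
      unfolding swap sum_subtractf[symmetric] by (rule sum.cong) (simp_all add: right_diff_distrib)
    then show "z i ^ j - (\<Sum>p<\<Delta>. Bm i p * Cm p j) =
        (\<Sum>q<n. z i ^ q * ((if q = j then 1 else 0) - (\<Sum>p<\<Delta>. Gm q p * Cm p j)))"
      using ij by (simp add: W_Gm)
  qed
  also have "fdet n (\<lambda>i j. (if i = j then 1 else 0) - (\<Sum>p<\<Delta>. Gm i p * Cm p j)) =
      fdet \<Delta> (\<lambda>p p'. (if p = p' then 1 else 0) - gap_kernel n k x y p p')"
    unfolding fdet_Sylvester C_Gm ..
  finally have calc: "?Z * ((\<Prod>i<n. x (Suc i) ^ (n - 1)) * W) = (\<Prod>i<n. x (Suc i) ^ (n - 1)) * W *
     ((\<Prod>i=1..n. \<Prod>j=1..k. 1 + x i * y j) * fdet \<Delta> (\<lambda>p p'. (if p = p' then 1 else 0) - gap_kernel n k x y p p'))"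
    unfolding prod vandermonde_reverse by (simp only: mult_ac)
  have "x (Suc i) \<noteq> 0" if "i < n" for i using x_pos[of "Suc i"] that by simp
  then have "(\<Prod>i<n. x (Suc i) ^ (n - 1)) \<noteq> 0" by (simp add: prod_zero_iff)
  then have nz: "(\<Prod>i<n. x (Suc i) ^ (n - 1)) * W \<noteq> 0" using W_nz by simp
  show ?thesis using calc unfolding mult.commute[of ?Z] by (simp only: mult_left_cancel[OF nz])
qed

end

section \<open>Contours and the vertical line\<close>

lemma integrable_inverse_1_plus_square: "integrable lborel (\<lambda>u::real. 1 / (1 + u\<^sup>2))"
proof -
  have "einterval (-\<infinity>) \<infinity> = (UNIV :: real set)" by (auto simp: einterval_def)
  then show ?thesis
    using conjunct1[OF conjI[OF Sinc_Integral.integrable_inverse_1_plus_square TrueI]]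
    by (simp add: set_integrable_def inverse_eq_divide)
qed

lemma integrable_quadratic_decay:
  fixes F :: "real \<Rightarrow> complex"
  assumes cont: "continuous_on UNIV F" and decay: "\<And>u. \<bar>u\<bar> \<ge> R \<Longrightarrow> norm (F u) \<le> B / u\<^sup>2" and R: "R \<ge> 1"
  shows "integrable lborel F"
proof -
  have "bounded (F ` cball 0 R)"
    by (intro compact_imp_bounded compact_continuous_image continuous_on_subset[OF cont]) auto
  then obtain C where C0: "C > 0" "\<forall>v\<in>F ` cball 0 R. norm v \<le> C"
    unfolding bounded_pos by auto
  then have C: "\<bar>u\<bar> \<le> R \<Longrightarrow> norm (F u) \<le> C" "C > 0" for u by auto
  define D where "D = C * (1 + R\<^sup>2) + 2 * \<bar>B\<bar>"
  have bnd: "norm (F u) \<le> D * (1 / (1 + u\<^sup>2))" for u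
  proof (cases "\<bar>u\<bar> \<le> R")
    case True
    then have "u\<^sup>2 \<le> R\<^sup>2" using R by (metis abs_le_square_iff abs_of_nonneg order_trans zero_le_one)
    have "norm (F u) * (1 + u\<^sup>2) \<le> C * (1 + R\<^sup>2)"
      by (rule mult_mono) (use C True \<open>u\<^sup>2 \<le> R\<^sup>2\<close> in \<open>auto simp: add_nonneg_nonneg\<close>)
    also have "\<dots> \<le> D" by (simp add: D_def)
    finally show ?thesis by (simp add: field_simps add_pos_nonneg)
  next
    case False
    then have u: "\<bar>u\<bar> \<ge> R" by simp
    then have u1: "1 \<le> u\<^sup>2" using R by (metis abs_ge_self abs_le_square_iff abs_one one_power2 order_trans)
    have "norm (F u) * (1 + u\<^sup>2) \<le> \<bar>B\<bar> / u\<^sup>2 * (2 * u\<^sup>2)"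
    proof (rule mult_mono)
      show "norm (F u) \<le> \<bar>B\<bar> / u\<^sup>2"
        using decay[OF u] by (rule order_trans) (simp add: divide_right_mono)
    qed (use u1 in auto)
    also have "\<dots> = 2 * \<bar>B\<bar>" using u1 by (cases "u = 0") auto
    also have "\<dots> \<le> D" using C(2) by (simp add: D_def)
    finally show ?thesis by (simp add: field_simps add_pos_nonneg)
  qed
  have "integrable lborel (\<lambda>u. D * (1 / (1 + u\<^sup>2)))"
    by (intro integrable_mult_right integrable_inverse_1_plus_square)
  then show ?thesis
  proof (rule Bochner_Integration.integrable_bound)
    show "F \<in> borel_measurable lborel" using borel_measurable_continuous_onI[OF cont] by simp
    show "AE u in lborel. norm (F u) \<le> norm (D * (1 / (1 + u\<^sup>2)))"
      by (intro AE_I2 order_trans[OF bnd]) (metis abs_ge_self real_norm_def)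
  qed
qed

lemma tendsto_integral_symmetric:
  fixes F :: "real \<Rightarrow> complex"
  assumes cont: "continuous_on UNIV F" and int: "integrable lborel F"
  shows "(\<lambda>T. integral {- real T..real T} F) \<longlonglongrightarrow> (LINT u|lborel. F u)"
proof -
  have eq: "integral {- real T..real T} F = (LINT u|lborel. indicator {- real T..real T} u *\<^sub>R F u)" for T
  proof -
    have "set_integrable lborel {- real T..real T} F"
      using int unfolding set_integrable_def by (intro integrable_mult_indicator) auto
    from set_borel_integral_eq_integral(2)[OF this] show ?thesis
      by (simp add: set_lebesgue_integral_def)
  qed
  show ?thesis unfolding eq
  proof (rule integral_dominated_convergence[where w = "\<lambda>u. norm (F u)"])
    show "F \<in> borel_measurable lborel" using int by simp
    show "AE u in lborel. (\<lambda>T. indicator {- real T..real T} u *\<^sub>R F u) \<longlonglongrightarrow> F u"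
    proof (rule AE_I2)
      fix u :: real
      obtain N :: nat where N: "\<bar>u\<bar> \<le> real N" using real_arch_simple by blast
      show "(\<lambda>T. indicator {- real T..real T} u *\<^sub>R F u) \<longlonglongrightarrow> F u"
        by (rule tendsto_eventually, rule eventually_sequentiallyI[of N]) (use N in \<open>auto simp: indicator_def\<close>)
    qed
  qed (use int in \<open>auto simp: indicator_def intro!: AE_I2\<close>)
qed

text \<open>
  Closing the segment \<open>[\<epsilon> - i T, \<epsilon> + i T]\<close> by the left half circle encloses the poles to the left of the
  line; closing it by the right half circle encloses the others.
\<close>

definition segment_path :: "real \<Rightarrow> real \<Rightarrow> real \<Rightarrow> complex" where
  "segment_path \<epsilon> T = linepath (Complex \<epsilon> (- T)) (Complex \<epsilon> T)"

definition right_arc :: "real \<Rightarrow> real \<Rightarrow> real \<Rightarrow> complex" where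
  "right_arc \<epsilon> T = part_circlepath (of_real \<epsilon>) T (- pi / 2) (pi / 2)"

definition left_arc :: "real \<Rightarrow> real \<Rightarrow> real \<Rightarrow> complex" where
  "left_arc \<epsilon> T = part_circlepath (of_real \<epsilon>) T (pi / 2) (3 * pi / 2)"

lemma arc_endpoints:
  "pathstart (segment_path \<epsilon> T) = Complex \<epsilon> (- T)" "pathfinish (segment_path \<epsilon> T) = Complex \<epsilon> T"
  "pathstart (right_arc \<epsilon> T) = Complex \<epsilon> (- T)" "pathfinish (right_arc \<epsilon> T) = Complex \<epsilon> T"
  "pathstart (left_arc \<epsilon> T) = Complex \<epsilon> T" "pathfinish (left_arc \<epsilon> T) = Complex \<epsilon> (- T)"
proof -
  have "cis (3 * pi / 2) = - \<i>"
    using cis_mult[of pi "pi / 2"] by (simp add: add_divide_distrib[symmetric])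
  then show "pathstart (segment_path \<epsilon> T) = Complex \<epsilon> (- T)" "pathfinish (segment_path \<epsilon> T) = Complex \<epsilon> T"
  "pathstart (right_arc \<epsilon> T) = Complex \<epsilon> (- T)" "pathfinish (right_arc \<epsilon> T) = Complex \<epsilon> T"
  "pathstart (left_arc \<epsilon> T) = Complex \<epsilon> T" "pathfinish (left_arc \<epsilon> T) = Complex \<epsilon> (- T)"
    unfolding segment_path_def right_arc_def left_arc_def pathstart_part_circlepath pathfinish_part_circlepath
      pathstart_linepath pathfinish_linepath cis_conv_exp[symmetric]
    by (simp_all add: complex_eq_iff)
qed

lemma valid_path_arcs:
  "valid_path (segment_path \<epsilon> T)" "valid_path (right_arc \<epsilon> T)" "valid_path (left_arc \<epsilon> T)"
  by (simp_all add: segment_path_def right_arc_def left_arc_def)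

lemma path_image_segment:
  assumes "T \<ge> 0"
  shows "path_image (segment_path \<epsilon> T) \<subseteq> {z. Re z = \<epsilon>} \<inter> cball (of_real \<epsilon>) T"
proof -
  have "closed_segment (Complex \<epsilon> (- T)) (Complex \<epsilon> T) \<subseteq> {z. Re z = \<epsilon>} \<inter> cball (of_real \<epsilon>) T"
  proof (rule closed_segment_subset)
    show "convex ({z. Re z = \<epsilon>} \<inter> cball (of_real \<epsilon>) T)"
      using convex_hyperplane[of "1 :: complex" \<epsilon>] by (intro convex_Int convex_cball) (simp add: complex_inner_1)
  qed (use assms in \<open>auto simp: dist_norm cmod_def\<close>)
  then show ?thesis by (simp add: segment_path_def)
qed

lemma path_image_right_arc:
  assumes "T \<ge> 0"
  shows "path_image (right_arc \<epsilon> T) \<subseteq> {z. Re z \<ge> \<epsilon>} \<inter> sphere (of_real \<epsilon>) T"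
proof -
  have "Re (of_real \<epsilon> + of_real T * exp (\<i> * of_real t)) \<ge> \<epsilon>" if "- pi / 2 \<le> t" "t \<le> pi / 2" for t
    using that assms by (simp add: exp_eq_polar cis.ctr cos_ge_zero)
  then show ?thesis
    using path_image_part_circlepath_subset[of "- pi / 2" "pi / 2" T "of_real \<epsilon>"] assms
    by (auto simp: right_arc_def path_image_part_circlepath)
qed

lemma path_image_left_arc:
  assumes "T \<ge> 0"
  shows "path_image (left_arc \<epsilon> T) \<subseteq> {z. Re z \<le> \<epsilon>} \<inter> sphere (of_real \<epsilon>) T"
proof -
  have "Re (of_real \<epsilon> + of_real T * exp (\<i> * of_real t)) \<le> \<epsilon>" if "pi / 2 \<le> t" "t \<le> 3 * pi / 2" for t
  proof -
    have "cos (t - pi) \<ge> 0" using that by (intro cos_ge_zero) auto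
    then have "cos t \<le> 0" by (simp add: cos_diff)
    then show ?thesis using assms by (simp add: exp_eq_polar cis.ctr mult_nonneg_nonpos)
  qed
  then show ?thesis
    using path_image_part_circlepath_subset[of "pi / 2" "3 * pi / 2" T "of_real \<epsilon>"] assms
    by (auto simp: left_arc_def path_image_part_circlepath)
qed

text \<open>The two arcs close up to a circle, whose winding number is constant on the open disc; at
  the centre each half circle contributes 1/2 by direct integration.\<close>

lemma winding_number_arcs:
  assumes "norm (p - of_real \<epsilon>) < T"
  shows "winding_number (right_arc \<epsilon> T) p + winding_number (left_arc \<epsilon> T) p = 1"
proof -
  let ?c = "complex_of_real \<epsilon>"
  have T: "T > 0" using assms norm_ge_zero le_less_trans by blast
  let ?g = "right_arc \<epsilon> T +++ left_arc \<epsilon> T"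
  have path: "path (right_arc \<epsilon> T)" "path (left_arc \<epsilon> T)" by (simp_all add: valid_path_arcs valid_path_imp_path)
  have img: "path_image (right_arc \<epsilon> T) \<subseteq> sphere ?c T" "path_image (left_arc \<epsilon> T) \<subseteq> sphere ?c T"
    using path_image_right_arc[of T \<epsilon>] path_image_left_arc[of T \<epsilon>] T by auto
  have join: "winding_number ?g q = winding_number (right_arc \<epsilon> T) q + winding_number (left_arc \<epsilon> T) q"
    if "q \<in> ball ?c T" for q
    by (rule winding_number_join) (use that img path in \<open>auto simp: arc_endpoints\<close>)
  have full: "contour_integral (part_circlepath ?c T a b) (\<lambda>w. 1 / (w - ?c)) = \<i> * of_real (b - a)" if "a < b" for a b
  proof -
    have "contour_integral (part_circlepath ?c T a b) (\<lambda>w. 1 / (w - ?c)) = integral {a..b} (\<lambda>t. \<i>)"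
      unfolding contour_integral_part_circlepath_eq[OF that] using T by (intro integral_cong) simp
    then show ?thesis using that by (simp add: scaleR_conv_of_real)
  qed
  have w: "winding_number \<gamma> ?c = 1 / (2 * pi * \<i>) * contour_integral \<gamma> (\<lambda>w. 1 / (w - ?c))"
    if "\<gamma> = right_arc \<epsilon> T \<or> \<gamma> = left_arc \<epsilon> T" for \<gamma>
    by (rule winding_number_valid_path) (use that valid_path_arcs img T in auto)
  have "contour_integral (right_arc \<epsilon> T) (\<lambda>w. 1 / (w - ?c)) = \<i> * pi"
    "contour_integral (left_arc \<epsilon> T) (\<lambda>w. 1 / (w - ?c)) = \<i> * pi"
    unfolding right_arc_def left_arc_def by (subst full; simp)+
  then have h: "winding_number (right_arc \<epsilon> T) ?c = 1 / 2" "winding_number (left_arc \<epsilon> T) ?c = 1 / 2"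
    using w by simp_all
  have "winding_number (right_arc \<epsilon> T) ?c + winding_number (left_arc \<epsilon> T) ?c = 1" unfolding h by simp
  then have "winding_number ?g ?c = 1" using join[of ?c] T by simp
  moreover have "winding_number ?g p = winding_number ?g ?c"
    by (rule winding_number_eq[where S = "ball ?c T"])
      (use path img T assms in \<open>auto simp: arc_endpoints path_image_join dist_norm norm_minus_commute\<close>)
  ultimately show ?thesis using join[of p] assms by (simp add: dist_norm norm_minus_commute)
qed

text \<open>A point on the far side of the line is separated from the half disc by a convex half
  plane, so its winding number is 0. In the sum of both loops the segment cancels and the circle
  remains, which leaves 1 for the other loop.\<close>

lemma half_loops:
  assumes p: "norm (p - of_real \<epsilon>) < T"
  shows "Re p > \<epsilon> \<Longrightarrow> winding_number (segment_path \<epsilon> T +++ left_arc \<epsilon> T) p = 0"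
    and "Re p < \<epsilon> \<Longrightarrow> winding_number (segment_path \<epsilon> T +++ left_arc \<epsilon> T) p = 1"
    and "Re p < \<epsilon> \<Longrightarrow> winding_number (right_arc \<epsilon> T +++ reversepath (segment_path \<epsilon> T)) p = 0"
    and "Re p > \<epsilon> \<Longrightarrow> winding_number (right_arc \<epsilon> T +++ reversepath (segment_path \<epsilon> T)) p = 1"
proof -
  let ?S = "segment_path \<epsilon> T" and ?R = "right_arc \<epsilon> T" and ?L = "left_arc \<epsilon> T"
  have T: "T > 0" using p norm_ge_zero le_less_trans by blast
  have path: "path ?S" "path ?R" "path ?L" by (simp_all add: valid_path_arcs valid_path_imp_path)
  have img: "path_image ?S \<subseteq> {z. Re z = \<epsilon>} \<inter> cball (of_real \<epsilon>) T"
    "path_image ?R \<subseteq> {z. Re z \<ge> \<epsilon>} \<inter> sphere (of_real \<epsilon>) T"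
    "path_image ?L \<subseteq> {z. Re z \<le> \<epsilon>} \<inter> sphere (of_real \<epsilon>) T"
    using path_image_segment path_image_right_arc path_image_left_arc T by auto
  have np: "p \<notin> path_image ?R" "p \<notin> path_image ?L"
    using img p by (auto simp: dist_norm norm_minus_commute)
  have l0: "winding_number (?S +++ ?L) p = 0" if "Re p > \<epsilon>"
  proof (rule winding_number_zero_outside[where s = "{z. Re z \<le> \<epsilon>}"])
    show "convex {z. Re z \<le> \<epsilon>}" by (rule convex_halfspace_Re_le)
  qed (use path img that in \<open>auto simp: arc_endpoints path_image_join\<close>)
  have r0: "winding_number (?R +++ reversepath ?S) p = 0" if "Re p < \<epsilon>"
  proof (rule winding_number_zero_outside[where s = "{z. Re z \<ge> \<epsilon>}"])
    show "convex {z. Re z \<ge> \<epsilon>}" by (rule convex_halfspace_Re_ge)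
  qed (use path img that in \<open>auto simp: arc_endpoints path_image_join\<close>)
  have sum: "winding_number (?S +++ ?L) p + winding_number (?R +++ reversepath ?S) p = 1" if "Re p \<noteq> \<epsilon>"
  proof -
    have nS: "p \<notin> path_image ?S" using img that by auto
    have "winding_number (?S +++ ?L) p = winding_number ?S p + winding_number ?L p"
      by (rule winding_number_join) (use path np nS in \<open>auto simp: arc_endpoints\<close>)
    moreover have "winding_number (?R +++ reversepath ?S) p = winding_number ?R p + winding_number (reversepath ?S) p"
      by (rule winding_number_join) (use path np nS in \<open>auto simp: arc_endpoints\<close>)
    moreover have "winding_number (reversepath ?S) p = - winding_number ?S p"
      by (rule winding_number_reversepath) (use path nS in auto)
    ultimately show ?thesis using winding_number_arcs[OF p] by (simp add: add.commute)
  qed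
  show "Re p > \<epsilon> \<Longrightarrow> winding_number (?S +++ ?L) p = 0" by (rule l0)
  show "Re p < \<epsilon> \<Longrightarrow> winding_number (?R +++ reversepath ?S) p = 0" by (rule r0)
  show "Re p < \<epsilon> \<Longrightarrow> winding_number (?S +++ ?L) p = 1" using sum r0 by auto
  show "Re p > \<epsilon> \<Longrightarrow> winding_number (?R +++ reversepath ?S) p = 1" using sum l0 by auto
qed

context
  fixes H :: "complex \<Rightarrow> complex" and pts :: "complex set" and \<epsilon> B R0 :: real
  assumes fin: "finite pts" and hol: "H holomorphic_on UNIV - pts"
    and off: "\<And>p. p \<in> pts \<Longrightarrow> Re p \<noteq> \<epsilon>"
    and decay: "\<And>z. norm z \<ge> R0 \<Longrightarrow> norm (H z) \<le> B / (norm z)\<^sup>2"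
begin

lemma line_continuous: "continuous_on UNIV (\<lambda>u. H (Complex \<epsilon> u))"
proof -
  have "continuous_on UNIV (\<lambda>u. Complex \<epsilon> u)"
    by (subst complex_eq) (intro continuous_intros)
  moreover have "continuous_on (range (Complex \<epsilon>)) H"
    by (rule continuous_on_subset[OF holomorphic_on_imp_continuous_on[OF hol]]) (auto dest: off)
  ultimately show ?thesis using continuous_on_compose2 by blast
qed

lemma line_integrable: "integrable lborel (\<lambda>u. H (Complex \<epsilon> u))"
proof (rule integrable_quadratic_decay[OF line_continuous, of "max R0 1" "\<bar>B\<bar>"])
  fix u :: real assume u: "max R0 1 \<le> \<bar>u\<bar>"
  have n: "\<bar>u\<bar> \<le> norm (Complex \<epsilon> u)" using abs_Im_le_cmod[of "Complex \<epsilon> u"] by simp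
  then have "norm (H (Complex \<epsilon> u)) \<le> B / (norm (Complex \<epsilon> u))\<^sup>2" using u by (intro decay) simp
  also have "\<dots> \<le> \<bar>B\<bar> / (norm (Complex \<epsilon> u))\<^sup>2" by (simp add: divide_right_mono)
  also have "\<dots> \<le> \<bar>B\<bar> / u\<^sup>2"
  proof (rule divide_left_mono)
    show "u\<^sup>2 \<le> (norm (Complex \<epsilon> u))\<^sup>2" using n by (simp add: abs_le_square_iff[symmetric])
    show "0 < (norm (Complex \<epsilon> u))\<^sup>2 * u\<^sup>2" using n u by (intro mult_pos_pos zero_less_power2[THEN iffD2]) auto
  qed simp
  finally show "norm (H (Complex \<epsilon> u)) \<le> \<bar>B\<bar> / u\<^sup>2" .
qed simp

text \<open>The arc has length \<open>pi * T\<close>, and all its points have modulus at least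
  \<open>T - \<bar>\<epsilon>\<bar>\<close>; against decay of order 2 the integral is of order 1 /
  T.\<close>

lemma arc_bound:
  assumes T: "T > 0" "T - \<bar>\<epsilon>\<bar> \<ge> max R0 1"
    and arc: "\<gamma> = right_arc \<epsilon> T \<or> \<gamma> = left_arc \<epsilon> T" and int: "H contour_integrable_on \<gamma>"
  shows "norm (contour_integral \<gamma> H) \<le> \<bar>B\<bar> * pi * T / (T - \<bar>\<epsilon>\<bar>)\<^sup>2"
proof -
  have b: "norm (H z) \<le> \<bar>B\<bar> / (T - \<bar>\<epsilon>\<bar>)\<^sup>2" if "z \<in> path_image \<gamma>" for z
  proof -
    have "norm (z - of_real \<epsilon>) = T"
      using that arc path_image_right_arc[of T \<epsilon>] path_image_left_arc[of T \<epsilon>] T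
      by (auto simp: dist_norm norm_minus_commute)
    then have n: "T - \<bar>\<epsilon>\<bar> \<le> norm z" using norm_triangle_ineq4[of z "of_real \<epsilon>"] by simp
    then have "norm (H z) \<le> B / (norm z)\<^sup>2" using T by (intro decay) simp
    also have "\<dots> \<le> \<bar>B\<bar> / (norm z)\<^sup>2" by (simp add: divide_right_mono)
    also have "\<dots> \<le> \<bar>B\<bar> / (T - \<bar>\<epsilon>\<bar>)\<^sup>2"
    proof (rule divide_left_mono)
      show "(T - \<bar>\<epsilon>\<bar>)\<^sup>2 \<le> (norm z)\<^sup>2" using n T by (intro power_mono) auto
      show "0 < (norm z)\<^sup>2 * (T - \<bar>\<epsilon>\<bar>)\<^sup>2" using n T by (intro mult_pos_pos zero_less_power) auto
    qed simp
    finally show ?thesis .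
  qed
  have "norm (contour_integral \<gamma> H) \<le> \<bar>B\<bar> / (T - \<bar>\<epsilon>\<bar>)\<^sup>2 * T * pi"
    using arc
  proof
    assume g: "\<gamma> = right_arc \<epsilon> T"
    show ?thesis
      using contour_integral_bound_part_circlepath[OF int[unfolded g right_arc_def] _ _ b[unfolded g right_arc_def]] T
      by (simp add: g right_arc_def)
  next
    assume g: "\<gamma> = left_arc \<epsilon> T"
    show ?thesis
      using contour_integral_bound_part_circlepath[OF int[unfolded g left_arc_def] _ _ b[unfolded g left_arc_def]] T
      by (simp add: g left_arc_def)
  qed
  then show ?thesis by (simp add: mult_ac)
qed

text \<open>For large T each residue sum differs from the integral over the segment only by the
  integral over an arc. The sign changes for the poles on the right, because their loop traverses
  the segment downwards.\<close>

lemma residues_line: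
  shows "2 * pi * \<i> * (\<Sum>p | p \<in> pts \<and> Re p < \<epsilon>. residue H p) = \<i> * (LINT u|lborel. H (Complex \<epsilon> u))"
    and "2 * pi * \<i> * (\<Sum>p | p \<in> pts \<and> Re p > \<epsilon>. residue H p) = - \<i> * (LINT u|lborel. H (Complex \<epsilon> u))"
proof -
  let ?resl = "2 * pi * \<i> * (\<Sum>p | p \<in> pts \<and> Re p < \<epsilon>. residue H p)"
  let ?resr = "2 * pi * \<i> * (\<Sum>p | p \<in> pts \<and> Re p > \<epsilon>. residue H p)"
  let ?I = "\<lambda>T. integral {- real T..real T} (\<lambda>u. H (Complex \<epsilon> u))"
  have "bounded ((\<lambda>p. p - of_real \<epsilon>) ` pts)" using fin by (intro finite_imp_bounded) auto
  then obtain M where M: "\<And>p. p \<in> pts \<Longrightarrow> norm (p - of_real \<epsilon>) \<le> M" unfolding bounded_iff by auto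
  obtain N :: nat where N: "real N > max M (\<bar>\<epsilon>\<bar> + max R0 1)" using reals_Archimedean2 by blast
  have key: "norm (?resl - \<i> * ?I T) \<le> \<bar>B\<bar> * pi * real T / (real T - \<bar>\<epsilon>\<bar>)\<^sup>2 \<and>
             norm (?resr - (- \<i> * ?I T)) \<le> \<bar>B\<bar> * pi * real T / (real T - \<bar>\<epsilon>\<bar>)\<^sup>2" if "T \<ge> N" for T
  proof -
    let ?S = "segment_path \<epsilon> T" and ?R = "right_arc \<epsilon> T" and ?L = "left_arc \<epsilon> T"
    have T: "real T > M" "real T > 0" "real T - \<bar>\<epsilon>\<bar> \<ge> max R0 1" using that N by auto
    have pT: "norm (p - of_real \<epsilon>) < T" if "p \<in> pts" for p using M[OF that] T by simp
    have sph: "p \<notin> sphere (of_real \<epsilon>) (real T)" if "p \<in> pts" for p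
      using pT[OF that] by (simp add: dist_norm norm_minus_commute)
    have "z \<notin> pts" if "z \<in> path_image ?S" for z
      using subsetD[OF path_image_segment[OF of_nat_0_le_iff] that] off[of z] by auto
    moreover have "z \<notin> pts" if "z \<in> path_image ?R" for z
      using subsetD[OF path_image_right_arc[OF of_nat_0_le_iff] that] sph[of z] by blast
    moreover have "z \<notin> pts" if "z \<in> path_image ?L" for z
      using subsetD[OF path_image_left_arc[OF of_nat_0_le_iff] that] sph[of z] by blast
    ultimately have img: "path_image ?S \<subseteq> - pts" "path_image ?R \<subseteq> - pts" "path_image ?L \<subseteq> - pts"
      by blast+
    have holc: "H holomorphic_on - pts" using hol by (simp add: Compl_eq_Diff_UNIV)
    have opn: "open (- pts)" using fin by (simp add: finite_imp_closed open_Compl)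
    have int: "H contour_integrable_on ?S" "H contour_integrable_on ?R" "H contour_integrable_on ?L"
      using contour_integrable_holomorphic_simple[OF holc opn] valid_path_arcs img by auto
    have seg: "contour_integral ?S H = \<i> * ?I T"
      unfolding segment_path_def by (rule contour_integral_linepath_same_Re) (use T in auto)
    have "contour_integral (?S +++ ?L) H = 2 * pi * \<i> * (\<Sum>p\<in>pts. winding_number (?S +++ ?L) p * residue H p)"
      by (rule Residue_theorem[OF open_UNIV _ fin hol])
        (use valid_path_arcs img in \<open>auto simp: arc_endpoints path_image_join intro: valid_path_join\<close>)
    also have "(\<Sum>p\<in>pts. winding_number (?S +++ ?L) p * residue H p) = (\<Sum>p\<in>pts. if Re p < \<epsilon> then residue H p else 0)"
    proof (rule sum.cong[OF refl])
      fix p assume "p \<in> pts"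
      then show "winding_number (?S +++ ?L) p * residue H p = (if Re p < \<epsilon> then residue H p else 0)"
        using half_loops(1,2)[OF pT] off[of p] by (cases "Re p < \<epsilon>") auto
    qed
    also have "\<dots> = (\<Sum>p | p \<in> pts \<and> Re p < \<epsilon>. residue H p)" by (rule sum.inter_filter[OF fin, symmetric])
    finally have l: "?resl = contour_integral ?S H + contour_integral ?L H"
      using int valid_path_arcs by simp
    have "contour_integral (?R +++ reversepath ?S) H = 2 * pi * \<i> * (\<Sum>p\<in>pts. winding_number (?R +++ reversepath ?S) p * residue H p)"
      by (rule Residue_theorem[OF open_UNIV _ fin hol])
        (use valid_path_arcs img in \<open>auto simp: arc_endpoints path_image_join intro: valid_path_join\<close>)
    also have "(\<Sum>p\<in>pts. winding_number (?R +++ reversepath ?S) p * residue H p) = (\<Sum>p\<in>pts. if Re p > \<epsilon> then residue H p else 0)"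
    proof (rule sum.cong[OF refl])
      fix p assume "p \<in> pts"
      then show "winding_number (?R +++ reversepath ?S) p * residue H p = (if Re p > \<epsilon> then residue H p else 0)"
        using half_loops(3,4)[OF pT] off[of p] by (cases "Re p > \<epsilon>") auto
    qed
    also have "\<dots> = (\<Sum>p | p \<in> pts \<and> Re p > \<epsilon>. residue H p)" by (rule sum.inter_filter[OF fin, symmetric])
    finally have r: "?resr = contour_integral ?R H - contour_integral ?S H"
      using int valid_path_arcs by (simp add: contour_integral_reversepath contour_integrable_reversepath)
    show ?thesis
      using arc_bound[OF T(2,3) _ int(2)] arc_bound[OF T(2,3) _ int(3)] l r seg by simp
  qed
  have lim0: "(\<lambda>T. \<bar>B\<bar> * pi * real T / (real T - \<bar>\<epsilon>\<bar>)\<^sup>2) \<longlonglongrightarrow> 0" by real_asymp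
  have I: "?I \<longlonglongrightarrow> (LINT u|lborel. H (Complex \<epsilon> u))"
    by (rule tendsto_integral_symmetric[OF line_continuous line_integrable])
  have ev: "eventually (\<lambda>T. T \<ge> N) sequentially" by (rule eventually_ge_at_top)
  have l0: "(\<lambda>T. ?resl - \<i> * ?I T) \<longlonglongrightarrow> 0"
    by (rule Lim_null_comparison[OF _ lim0]) (rule eventually_mono[OF ev], use key in blast)
  have l1: "(\<lambda>T. ?resl - \<i> * ?I T) \<longlonglongrightarrow> ?resl - \<i> * (LINT u|lborel. H (Complex \<epsilon> u))"
    by (intro tendsto_intros I)
  show "?resl = \<i> * (LINT u|lborel. H (Complex \<epsilon> u))"
    using LIMSEQ_unique[OF l1 l0] by (rule eq_iff_diff_eq_0[THEN iffD2])
  have r0: "(\<lambda>T. ?resr - (- \<i> * ?I T)) \<longlonglongrightarrow> 0"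
    by (rule Lim_null_comparison[OF _ lim0]) (rule eventually_mono[OF ev], use key in blast)
  have r1: "(\<lambda>T. ?resr - (- \<i> * ?I T)) \<longlonglongrightarrow> ?resr - (- \<i> * (LINT u|lborel. H (Complex \<epsilon> u)))"
    by (intro tendsto_intros I)
  show "?resr = - \<i> * (LINT u|lborel. H (Complex \<epsilon> u))"
    using LIMSEQ_unique[OF r1 r0] by (rule eq_iff_diff_eq_0[THEN iffD2])
qed

text \<open>The winding number \<open>\<omega>\<close> around the poles on the left is kept general:
  it is 1 for the given z-contour and -1 for the image of that contour under z -> -1/z.\<close>

lemma contour_integral_eq_line:
  assumes g: "valid_path \<gamma>" "pathfinish \<gamma> = pathstart \<gamma>" "path_image \<gamma> \<inter> pts = {}"
    and w: "\<And>p. p \<in> pts \<Longrightarrow> Re p < \<epsilon> \<Longrightarrow> winding_number \<gamma> p = \<omega>"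
      "\<And>p. p \<in> pts \<Longrightarrow> Re p > \<epsilon> \<Longrightarrow> winding_number \<gamma> p = 0"
  shows "contour_integral \<gamma> H = \<omega> * \<i> * (LINT u|lborel. H (Complex \<epsilon> u))"
proof -
  have "contour_integral \<gamma> H = 2 * pi * \<i> * (\<Sum>p\<in>pts. winding_number \<gamma> p * residue H p)"
    by (rule Residue_theorem[OF open_UNIV _ fin hol]) (use g in auto)
  also have "(\<Sum>p\<in>pts. winding_number \<gamma> p * residue H p) = (\<Sum>p\<in>pts. if Re p < \<epsilon> then \<omega> * residue H p else 0)"
  proof (rule sum.cong[OF refl])
    fix p assume "p \<in> pts"
    then show "winding_number \<gamma> p * residue H p = (if Re p < \<epsilon> then \<omega> * residue H p else 0)"
      using w[of p] off[of p] by (cases "Re p < \<epsilon>") auto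
  qed
  also have "\<dots> = \<omega> * (\<Sum>p | p \<in> pts \<and> Re p < \<epsilon>. residue H p)"
    by (simp add: sum.inter_filter[OF fin, symmetric] sum_distrib_left)
  finally show ?thesis using residues_line(1) by (simp add: mult_ac)
qed

end

section \<open>The correlation kernel as a sum of line integrals\<close>

definition kpoly :: "nat \<Rightarrow> nat \<Rightarrow> (nat \<Rightarrow> real) \<Rightarrow> (nat \<Rightarrow> real) \<Rightarrow> real poly" where
  "kpoly n k x y = xpoly n x * ypoly k y"

text \<open>This is z^k / K(z) in product form, a polynomial with the coefficients of
  \<open>kpoly\<close>.\<close>

definition kfun :: "nat \<Rightarrow> nat \<Rightarrow> (nat \<Rightarrow> real) \<Rightarrow> (nat \<Rightarrow> real) \<Rightarrow> complex \<Rightarrow> complex" where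
  "kfun n k x y z = (\<Prod>i=1..n. 1 - of_real (x i) * z) * (\<Prod>j=1..k. z + of_real (y j))"

definition line_moment ::
  "real \<Rightarrow> nat \<Rightarrow> nat \<Rightarrow> (nat \<Rightarrow> real) \<Rightarrow> (nat \<Rightarrow> real) \<Rightarrow> int \<Rightarrow> complex" where
  "line_moment \<epsilon> n k x y e =
     1 / (2 * pi) * (LINT u|lborel. Complex \<epsilon> u powi e / kfun n k x y (Complex \<epsilon> u))"

text \<open>Each term pairs a coefficient from the w-integral with the power of z that it leaves
  over. Near the corner only \<open>l'\<close> coefficients survive, so the number of terms does not
  grow with n.\<close>

definition line_kernel ::
  "real \<Rightarrow> nat \<Rightarrow> nat \<Rightarrow> (nat \<Rightarrow> real) \<Rightarrow> (nat \<Rightarrow> real) \<Rightarrow> nat \<Rightarrow> nat \<Rightarrow> complex" where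
  "line_kernel \<epsilon> n k x y l l' = (\<Sum>r<l'. of_real (coeff (kpoly n k x y) r) *
     line_moment \<epsilon> n k x y (int l - 1 + int r - int l'))"

lemma degree_kpoly: "degree (kpoly n k x y) \<le> n + k"
proof -
  have "degree (xpoly n x) \<le> (\<Sum>i\<in>{1..n}. degree [:1, - x i:])"
    unfolding xpoly_def using degree_prod_sum_le[of "{1..n}" "\<lambda>i. [:1, - x i:]"] by (simp add: o_def)
  also have "\<dots> \<le> (\<Sum>i\<in>{1..n}. 1)" by (rule sum_mono) simp
  finally have "degree (xpoly n x) \<le> n" by simp
  then show ?thesis
    unfolding kpoly_def using degree_mult_le[of "xpoly n x" "ypoly k y"] degree_ypoly[of k y] by simp
qed

lemma coeff_of_real_mult:
  assumes "\<And>r. coeff P r = of_real (coeff p r)" "\<And>r. coeff Q r = of_real (coeff q r)"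
  shows "coeff (P * Q :: complex poly) r = of_real (coeff (p * q) r)"
  by (simp add: coeff_mult assms)

lemma coeff_of_real_prod:
  assumes "\<And>i r. i \<in> I \<Longrightarrow> coeff (P i) r = of_real (coeff (p i) r)"
  shows "coeff (\<Prod>i\<in>I. P i :: complex poly) r = of_real (coeff (\<Prod>i\<in>I. p i) r)"
  using assms
proof (induction I arbitrary: r rule: infinite_finite_induct)
  case (insert i I)
  then show ?case
    unfolding prod.insert[OF insert.hyps] by (intro coeff_of_real_mult) auto
qed auto

lemma kfun_eq_sum: "kfun n k x y z = (\<Sum>r\<le>n + k. of_real (coeff (kpoly n k x y) r) * z ^ r)"
proof -
  define P where "P = (\<Prod>i=1..n. [:1, - complex_of_real (x i):]) * (\<Prod>j=1..k. [:complex_of_real (y j), 1:])"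
  have c: "coeff P r = of_real (coeff (kpoly n k x y) r)" for r
    unfolding P_def kpoly_def xpoly_def ypoly_def
    by (intro coeff_of_real_mult coeff_of_real_prod) (auto simp: coeff_pCons split: nat.splits)
  have "degree P \<le> n + k"
    by (rule degree_le) (use degree_kpoly[of n k x y] in \<open>auto simp: c coeff_eq_0\<close>)
  then have "poly P z = (\<Sum>r\<le>n + k. coeff P r * z ^ r)"
    unfolding poly_altdef by (intro sum.mono_neutral_left) (auto simp: coeff_eq_0)
  moreover have "kfun n k x y z = poly P z"
    by (simp add: P_def kfun_def poly_prod mult.commute add.commute)
  ultimately show ?thesis by (simp add: c)
qed

text \<open>The point 0 is included because of the negative powers of z. An index with
  \<open>x i = 0\<close> has a constant factor and no pole; such variables occur at the left corner,
  where the values of \<open>g\<close> take this place.\<close>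

definition kpoles :: "nat \<Rightarrow> nat \<Rightarrow> (nat \<Rightarrow> real) \<Rightarrow> (nat \<Rightarrow> real) \<Rightarrow> complex set" where
  "kpoles n k x y = insert 0 ((\<lambda>j. - of_real (y j)) ` {1..k} \<union> (\<lambda>i. 1 / of_real (x i)) ` {i\<in>{1..n}. x i \<noteq> 0})"

lemma finite_kpoles: "finite (kpoles n k x y)"
  by (simp add: kpoles_def)

lemma kfun_nonzero:
  assumes "z \<notin> kpoles n k x y"
  shows "kfun n k x y z \<noteq> 0"
proof -
  have "1 - of_real (x i) * z \<noteq> 0" if "i \<in> {1..n}" for i
  proof
    assume *: "1 - of_real (x i) * z = 0"
    then have "x i \<noteq> 0" by auto
    with * have "z = 1 / of_real (x i)" by (simp add: field_simps)
    then show False using assms that \<open>x i \<noteq> 0\<close> by (auto simp: kpoles_def)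
  qed
  moreover have "z + of_real (y j) \<noteq> 0" if "j \<in> {1..k}" for j
    using assms that by (auto simp: kpoles_def add_eq_0_iff2)
  ultimately show ?thesis by (simp add: kfun_def)
qed

lemma holomorphic_kernel:
  "(\<lambda>z. z powi e / kfun n k x y z) holomorphic_on UNIV - kpoles n k x y"
proof (rule holomorphic_on_divide)
  show "(\<lambda>z. z powi e) holomorphic_on UNIV - kpoles n k x y"
    by (intro holomorphic_intros) (auto simp: kpoles_def)
  show "kfun n k x y holomorphic_on UNIV - kpoles n k x y"
    unfolding kfun_def by (intro holomorphic_intros)
qed (use kfun_nonzero in auto)

text \<open>The line Re z = \<open>\<epsilon>\<close> has 0 and all - y_j on its left and all 1 /
  x_i on its right. Written as a product, the inequality also covers \<open>x i = 0\<close>.\<close>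

definition admissible :: "real \<Rightarrow> nat \<Rightarrow> nat \<Rightarrow> (nat \<Rightarrow> real) \<Rightarrow> (nat \<Rightarrow> real) \<Rightarrow> bool" where
  "admissible \<epsilon> n k x y \<longleftrightarrow>
     \<epsilon> > 0 \<and> (\<forall>i\<in>{1..n}. 0 \<le> x i \<and> \<epsilon> * x i < 1) \<and> (\<forall>j\<in>{1..k}. 0 \<le> y j)"

lemma admissible_x:
  assumes "admissible \<epsilon> n k x y" "i \<in> {1..n}"
  shows "0 \<le> x i" "x i > 0 \<Longrightarrow> \<epsilon> < 1 / x i"
  using assms by (auto simp: admissible_def field_simps)

text \<open>Far out, each factor 1 - x_i z has modulus at least 1 and each factor z + y_j modulus at
  least |z| / 2, so the integrand is of order |z|^(e - k), and \<open>e + 2 \<le> int k\<close>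
  makes this quadratic decay.\<close>

lemma kernel_decay:
  assumes adm: "admissible \<epsilon> n k x y" and k: "e + 2 \<le> int k"
  shows "\<exists>R. \<forall>z. R \<le> norm z \<longrightarrow> norm (z powi e / kfun n k x y z) \<le> 2 ^ k / (norm z)\<^sup>2"
proof (intro exI allI impI)
  have x: "x i \<ge> 0" if "i \<in> {1..n}" for i using adm that by (simp add: admissible_def)
  have y: "y j \<ge> 0" if "j \<in> {1..k}" for j using adm that by (simp add: admissible_def)
  fix z :: complex
  \<comment> \<open>For \<open>x i = 0\<close> the summand 2 / \<open>x i\<close> is 0 by
    convention; the factor 1 - x_i z is then 1 and needs no condition on z.\<close>
  define R where "R = 1 + (\<Sum>i=1..n. 2 / x i) + (\<Sum>j=1..k. 2 * y j)"
  assume "1 + (\<Sum>i=1..n. 2 / x i) + (\<Sum>j=1..k. 2 * y j) \<le> norm z"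
  then have R: "R \<le> norm z" by (simp add: R_def)
  have s0: "(\<Sum>i=1..n. 2 / x i) \<ge> 0" "(\<Sum>j=1..k. 2 * y j) \<ge> 0" using x y by (auto intro!: sum_nonneg)
  have Rx: "2 / x i \<le> R" if "i \<in> {1..n}" for i
  proof -
    have "2 / x i \<le> (\<Sum>i=1..n. 2 / x i)" by (rule member_le_sum) (use that x in auto)
    then show ?thesis using s0 by (simp add: R_def)
  qed
  have Ry: "2 * y j \<le> R" if "j \<in> {1..k}" for j
  proof -
    have "2 * y j \<le> (\<Sum>j=1..k. 2 * y j)" by (rule member_le_sum) (use that y in auto)
    then show ?thesis using s0 by (simp add: R_def)
  qed
  have z1: "1 \<le> norm z" using R s0 by (simp add: R_def)
  have "1 \<le> norm (1 - of_real (x i) * z)" if i: "i \<in> {1..n}" for i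
  proof (cases "x i = 0")
    case False
    then have xi: "x i > 0" using x[OF i] by simp
    have "2 / x i \<le> norm z" using Rx[OF i] R by simp
    then have "2 \<le> x i * norm z" using xi by (simp add: field_simps)
    moreover have "norm (of_real (x i) * z) = x i * norm z" using xi by (simp add: norm_mult)
    ultimately show ?thesis
      using norm_triangle_ineq2[of "of_real (x i) * z" 1] by (simp add: norm_minus_commute)
  qed simp
  then have "1 \<le> (\<Prod>i=1..n. norm (1 - of_real (x i) * z))" by (intro prod_ge_1) auto
  moreover have "(norm z / 2) ^ k \<le> (\<Prod>j=1..k. norm (z + of_real (y j)))"
  proof -
    have "norm z / 2 \<le> norm (z + of_real (y j))" if j: "j \<in> {1..k}" for j
      using norm_diff_ineq[of z "of_real (y j)"] Ry[OF j] R y[OF j] by simp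
    then have "(\<Prod>j=1..k. norm z / 2) \<le> (\<Prod>j=1..k. norm (z + of_real (y j)))" by (intro prod_mono) auto
    then show ?thesis by simp
  qed
  ultimately have "1 * (norm z / 2) ^ k \<le> norm (kfun n k x y z)"
    unfolding kfun_def norm_mult prod_norm[symmetric] by (intro mult_mono) auto
  then have P: "(norm z / 2) ^ k \<le> norm (kfun n k x y z)" by simp
  have "0 < (norm z / 2) ^ k" using z1 by (intro zero_less_power) linarith
  with P have Ppos: "0 < (norm z / 2) ^ k" "0 < norm (kfun n k x y z)" by linarith+
  have "norm (z powi e / kfun n k x y z) \<le> norm z powi e / (norm z / 2) ^ k"
    unfolding norm_divide norm_power_int using P Ppos z1 by (intro divide_left_mono mult_pos_pos) auto
  also have "\<dots> = 2 ^ k * norm z powi (e - int k)"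
  proof -
    have "norm z powi (e - int k) = norm z powi e / norm z ^ k" using z1 by (subst power_int_diff) auto
    then show ?thesis by (simp add: power_divide)
  qed
  also have "\<dots> \<le> 2 ^ k * norm z powi (-2)"
    by (intro mult_left_mono power_int_increasing) (use z1 k in auto)
  also have "\<dots> = 2 ^ k / (norm z)\<^sup>2" by (simp add: power_int_minus field_simps)
  finally show "norm (z powi e / kfun n k x y z) \<le> 2 ^ k / (norm z)\<^sup>2" .
qed

lemma kpoles_Re:
  assumes adm: "admissible \<epsilon> n k x y" and p: "p \<in> kpoles n k x y"
  shows "Re p < \<epsilon> \<and> (p = 0 \<or> (\<exists>j\<in>{1..k}. p = - of_real (y j))) \<or>
         Re p > \<epsilon> \<and> (\<exists>i\<in>{1..n}. x i > 0 \<and> p = 1 / of_real (x i))"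
proof -
  consider "p = 0" | j where "j \<in> {1..k}" "p = - of_real (y j)"
    | i where "i \<in> {1..n}" "x i \<noteq> 0" "p = 1 / of_real (x i)"
    using p by (auto simp: kpoles_def)
  then show ?thesis
  proof cases
    case 1 then show ?thesis using adm by (simp add: admissible_def)
  next
    case 2
    have "Re p < \<epsilon>" using 2 adm by (force simp: admissible_def)
    then show ?thesis using 2 by blast
  next
    case 3
    then have xi: "x i > 0" using admissible_x(1)[OF adm 3(1)] by simp
    then have "\<epsilon> < 1 / x i" by (rule admissible_x(2)[OF adm 3(1)])
    moreover have "Re p = 1 / x i" using 3 by (simp add: Re_divide_of_real)
    ultimately show ?thesis using 3 xi by auto
  qed
qed

lemma contour_integral_kernel:
  assumes adm: "admissible \<epsilon> n k x y" and k: "e + 2 \<le> int k"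
    and g: "valid_path \<gamma>" "pathfinish \<gamma> = pathstart \<gamma>" "path_image \<gamma> \<inter> kpoles n k x y = {}"
    and w: "winding_number \<gamma> 0 = \<omega>"
      "\<And>j. j \<in> {1..k} \<Longrightarrow> winding_number \<gamma> (- of_real (y j)) = \<omega>"
      "\<And>i. i \<in> {1..n} \<Longrightarrow> x i > 0 \<Longrightarrow> winding_number \<gamma> (1 / of_real (x i)) = 0"
  shows "contour_integral \<gamma> (\<lambda>z. z powi e / kfun n k x y z) = \<omega> * (2 * pi * \<i>) * line_moment \<epsilon> n k x y e"
proof -
  obtain R where R: "\<And>z. R \<le> norm z \<Longrightarrow> norm (z powi e / kfun n k x y z) \<le> 2 ^ k / (norm z)\<^sup>2"
    using kernel_decay[OF adm k] by blast
  note pRe = kpoles_Re[OF adm]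
  have "contour_integral \<gamma> (\<lambda>z. z powi e / kfun n k x y z) =
      \<omega> * \<i> * (LINT u|lborel. Complex \<epsilon> u powi e / kfun n k x y (Complex \<epsilon> u))"
  proof (rule contour_integral_eq_line[OF finite_kpoles holomorphic_kernel _ R g])
    show "Re p \<noteq> \<epsilon>" if "p \<in> kpoles n k x y" for p using pRe[OF that] by auto
    show "winding_number \<gamma> p = \<omega>" if "p \<in> kpoles n k x y" "Re p < \<epsilon>" for p
      using pRe[OF that(1)] that(2) w(1,2) by auto
    show "winding_number \<gamma> p = 0" if "p \<in> kpoles n k x y" "Re p > \<epsilon>" for p
      using pRe[OF that(1)] that(2) w(3) by auto
  qed
  then show ?thesis by (simp add: line_moment_def)
qed

text \<open>The line is closed to the right. Distinctness of the \<open>x i\<close> makes every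
  enclosed pole simple, and the factor 1 / x_i of the residue raises the exponent to e + 1.\<close>

lemma line_moment_eq_sum_nodes:
  assumes x: "\<And>i. i \<in> {1..n} \<Longrightarrow> x i > 0" and inj: "inj_on x {1..n}" and y: "\<And>j. j \<in> {1..k} \<Longrightarrow> y j > 0"
    and adm: "admissible \<epsilon> n k x y" and k: "e + 2 \<le> int k"
  shows "line_moment \<epsilon> n k x y e = (\<Sum>i=1..n. of_real ((1 / x i) powi (e + 1) * node_weight n k x y i))"
proof -
  let ?H = "\<lambda>z. z powi e / kfun n k x y z" and ?p = "kpoles n k x y"
  obtain R where R: "\<And>z. R \<le> norm z \<Longrightarrow> norm (?H z) \<le> 2 ^ k / (norm z)\<^sup>2"
    using kernel_decay[OF adm k] by blast
  note pRe = kpoles_Re[OF adm]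
  let ?L = "LINT u|lborel. ?H (Complex \<epsilon> u)" and ?r = "\<Sum>p | p \<in> ?p \<and> Re p > \<epsilon>. residue ?H p"
  have "2 * pi * \<i> * (\<Sum>p | p \<in> ?p \<and> Re p > \<epsilon>. residue ?H p) = - \<i> * (LINT u|lborel. ?H (Complex \<epsilon> u))"
    by (rule residues_line(2)[OF finite_kpoles holomorphic_kernel _ R]) (use pRe in blast)
  then have "\<i> * (2 * pi * ?r) = \<i> * (- ?L)" by (simp only: mult_ac mult_minus_left mult_minus_right)
  then have "2 * pi * ?r = - ?L" unfolding mult_left_cancel[OF complex_i_not_zero] .
  then have "?L = - (2 * pi * ?r)" by (metis minus_minus)
  then have "line_moment \<epsilon> n k x y e = - ?r" by (simp add: line_moment_def)
  also have "{p. p \<in> ?p \<and> Re p > \<epsilon>} = (\<lambda>i. 1 / of_real (x i)) ` {1..n}"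
  proof (intro equalityI subsetI)
    fix p assume "p \<in> {p. p \<in> ?p \<and> Re p > \<epsilon>}"
    then show "p \<in> (\<lambda>i. 1 / of_real (x i)) ` {1..n}" using pRe[of p] by auto
  next
    fix p assume "p \<in> (\<lambda>i. 1 / complex_of_real (x i)) ` {1..n}"
    then obtain i where i: "i \<in> {1..n}" "p = 1 / of_real (x i)" by blast
    then have "p \<in> ?p" using x[OF i(1)] by (auto simp: kpoles_def)
    moreover have "Re p > \<epsilon>" 
      unfolding i(2) using admissible_x(2)[OF adm i(1) x[OF i(1)]] by (simp add: Re_divide_of_real)
    ultimately show "p \<in> {p. p \<in> ?p \<and> Re p > \<epsilon>}" by simp
  qed
  also have "(\<Sum>p\<in>(\<lambda>i. 1 / of_real (x i)) ` {1..n}. residue ?H p) = (\<Sum>i=1..n. residue ?H (1 / of_real (x i)))"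
  proof -
    have "inj_on (\<lambda>i. 1 / complex_of_real (x i)) {1..n}"
    proof (rule inj_onI)
      fix i j assume ij: "i \<in> {1..n}" "j \<in> {1..n}" "1 / complex_of_real (x i) = 1 / of_real (x j)"
      then have "x i = x j" using x[OF ij(1)] x[OF ij(2)] by (simp add: divide_eq_eq)
      then show "i = j" using inj_onD[OF inj _ ij(1,2)] by blast
    qed
    from sum.reindex[OF this, of "residue ?H"] show ?thesis by (simp only: o_def)
  qed
  also have "\<dots> = (\<Sum>i=1..n. - of_real ((1 / x i) powi (e + 1) * node_weight n k x y i))"
  proof (rule sum.cong[OF refl])
    fix i assume i: "i \<in> {1..n}"
    let ?z = "1 / complex_of_real (x i)"
    have xi: "x i > 0" by (rule x[OF i])
    \<comment> \<open>Writing 1 - x_i z as - x_i (z - 1 / x_i) splits off the simple pole;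
      \<open>G\<close> is the remaining factor, holomorphic near that pole.\<close>
    define G where "G z = z powi e / (- of_real (x i) * (\<Prod>j\<in>{1..n} - {i}. 1 - of_real (x j) * z) *
      (\<Prod>j=1..k. z + of_real (y j)))" for z :: complex
    have H: "?H = (\<lambda>z. G z / (z - ?z))"
    proof
      fix z :: complex
      have "(\<Prod>i=1..n. 1 - of_real (x i) * z) = (1 - of_real (x i) * z) * (\<Prod>j\<in>{1..n} - {i}. 1 - of_real (x j) * z)"
        by (rule prod.remove) (use i in auto)
      moreover have "1 - of_real (x i) * z = - of_real (x i) * (z - ?z)" using xi by (simp add: field_simps)
      ultimately have "kfun n k x y z = (- of_real (x i) * (\<Prod>j\<in>{1..n} - {i}. 1 - of_real (x j) * z) *
          (\<Prod>j=1..k. z + of_real (y j))) * (z - ?z)"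
        unfolding kfun_def by (simp only: mult_ac)
      then show "?H z = G z / (z - ?z)" unfolding G_def by (simp only: divide_divide_eq_left)
    qed
    let ?S = "UNIV - (?p - {?z})"
    have opn: "open ?S" by (intro open_Diff finite_imp_closed) (auto simp: finite_kpoles)
    have D: "(\<Prod>j\<in>{1..n} - {i}. 1 - of_real (x j) * z) * (\<Prod>j=1..k. z + of_real (y j)) \<noteq> 0" if "z \<in> ?S" for z
    proof -
      have "1 - of_real (x j) * z \<noteq> 0" if j: "j \<in> {1..n} - {i}" for j
      proof
        assume "1 - of_real (x j) * z = 0"
        then have z: "z = 1 / of_real (x j)" using x[of j] j by (auto simp: field_simps)
        then have "z \<in> ?p" using x[of j] j by (auto simp: kpoles_def)
        then have "z = ?z" using \<open>z \<in> ?S\<close> by blast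
        then have "x j = x i" using z x[of j] xi j by (simp add: field_simps)
        then show False using inj_onD[OF inj, of j i] i j by auto
      qed
      moreover have "z + of_real (y j) \<noteq> 0" if j: "j \<in> {1..k}" for j
      proof
        assume "z + of_real (y j) = 0"
        then have z: "z = - of_real (y j)" by (simp add: add_eq_0_iff2)
        then have "z \<in> ?p" using j by (auto simp: kpoles_def)
        then have "z = ?z" using \<open>z \<in> ?S\<close> by blast
        then have "Re z > 0" using xi by (simp add: Re_divide_of_real)
        then show False using z y[OF j] by simp
      qed
      ultimately show ?thesis by simp
    qed
    have "G holomorphic_on ?S"
      unfolding G_def
    proof (intro holomorphic_intros)
      show "0 \<le> e \<or> (\<forall>z\<in>?S. z \<noteq> 0)" using xi by (auto simp: kpoles_def)
      show "- of_real (x i) * (\<Prod>j\<in>{1..n} - {i}. 1 - of_real (x j) * z) * (\<Prod>j=1..k. z + of_real (y j)) \<noteq> 0"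
        if "z \<in> ?S" for z using D[OF that] xi by simp
    qed
    then have "residue ?H ?z = G ?z" unfolding H using residue_simple[OF opn] by blast
    also have "G ?z = - of_real ((1 / x i) powi (e + 1) * node_weight n k x y i)"
    proof -
      have "of_real (poly (ypoly k y) (1 / x i)) = (\<Prod>j=1..k. ?z + complex_of_real (y j))"
        by (simp add: poly_ypoly_eq add.commute)
      moreover have "of_real (\<Prod>j\<in>{1..n} - {i}. 1 - x j / x i) = (\<Prod>j\<in>{1..n} - {i}. 1 - complex_of_real (x j) * ?z)"
        by simp
      moreover have "complex_of_real ((1 / x i) powi (e + 1)) = ?z powi e * ?z"
        using xi by (simp add: power_int_add)
      ultimately show ?thesis
        unfolding G_def node_weight_def using xi by (simp add: mult_ac)
    qed
    finally show "residue ?H ?z = - of_real ((1 / x i) powi (e + 1) * node_weight n k x y i)" .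
  qed
  finally show ?thesis by (simp add: sum_negf)
qed

text \<open>Term by term a sum of residues is replaced by a line integral, whose form makes sense
  for coinciding \<open>x i\<close> as well. The exponents p' + r - p - 1 are at most p' - 1, so
  \<open>p' < k\<close> gives the decay needed for closing the line.\<close>

theorem gap_kernel_eq_line_kernel:
  assumes x: "\<And>i. i \<in> {1..n} \<Longrightarrow> x i > 0" and inj: "inj_on x {1..n}" and y: "\<And>j. j \<in> {1..k} \<Longrightarrow> y j > 0"
    and adm: "admissible \<epsilon> n k x y" and k: "p' < k"
  shows "of_real (gap_kernel n k x y p p') = line_kernel \<epsilon> n k x y (Suc p') (Suc p)"
proof -
  have "line_moment \<epsilon> n k x y (int (Suc p') - 1 + int r - int (Suc p)) =
     (\<Sum>i=1..n. of_real (x i ^ (p - r) * (1 / x i) ^ p' * node_weight n k x y i))" if r: "r \<le> p" for r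
  proof -
    have "line_moment \<epsilon> n k x y (int (Suc p') - 1 + int r - int (Suc p)) =
        (\<Sum>i=1..n. of_real ((1 / x i) powi (int (Suc p') - 1 + int r - int (Suc p) + 1) * node_weight n k x y i))"
      by (rule line_moment_eq_sum_nodes) (use assms r in auto)
    also have "\<dots> = (\<Sum>i=1..n. of_real (x i ^ (p - r) * (1 / x i) ^ p' * node_weight n k x y i))"
    proof (rule sum.cong[OF refl])
      fix i assume "i \<in> {1..n}"
      then have xi: "x i > 0" by (rule x)
      have "int (Suc p') - 1 + int r - int (Suc p) + 1 = int p' - int (p - r)" using r by simp
      moreover have "(1 / x i) powi (int p' - int d) = x i ^ d * (1 / x i) ^ p'" for d
        using xi by (subst power_int_diff) (auto simp: power_divide)
      ultimately have "(1 / x i) powi (int (Suc p') - 1 + int r - int (Suc p) + 1) = x i ^ (p - r) * (1 / x i) ^ p'"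
        by (simp only:)
      then show "complex_of_real ((1 / x i) powi (int (Suc p') - 1 + int r - int (Suc p) + 1) * node_weight n k x y i) =
          of_real (x i ^ (p - r) * (1 / x i) ^ p' * node_weight n k x y i)" by (simp only:)
    qed
    finally show ?thesis .
  qed
  then have "line_kernel \<epsilon> n k x y (Suc p') (Suc p) = (\<Sum>r\<le>p. of_real (coeff (kpoly n k x y) r) *
     (\<Sum>i=1..n. of_real (x i ^ (p - r) * (1 / x i) ^ p' * node_weight n k x y i)))"
    unfolding line_kernel_def lessThan_Suc_atMost by (intro sum.cong refl) simp
  then show ?thesis by (simp add: gap_kernel_def kpoly_def)
qed

section \<open>The w-integral and the kernel at the right corner\<close>

lemma kernel_factor_eq:
  assumes "z \<noteq> 0"
  shows "kernel_factor n k x y z = z ^ k / kfun n k x y z"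
proof -
  have "1 / (1 + of_real (y j) / z) = z / (z + of_real (y j))" for j
  proof -
    have "1 + of_real (y j) / z = (z + of_real (y j)) / z" using assms by (simp add: field_simps)
    then show ?thesis by simp
  qed
  then have "kernel_factor n k x y z = (\<Prod>i=1..n. 1 / (1 - of_real (x i) * z)) * (\<Prod>j=1..k. z / (z + of_real (y j)))"
    by (simp only: kernel_factor_def)
  then show ?thesis by (simp add: kfun_def prod_dividef)
qed

lemma power_int_minus_Suc: "v \<noteq> 0 \<Longrightarrow> v powi (- int (Suc m)) = v powi (- int m) / (v :: complex)"
proof -
  assume v: "v \<noteq> 0"
  have "- int (Suc m) = - int m - 1" by simp
  then show ?thesis by (simp only:) (subst power_int_diff, use v in simp_all)
qed

lemma cancel_unit:
  fixes K :: complex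
  assumes "K \<noteq> 0"
  shows "1 / K * c * (w * K * L) = w * c * L"
  using assms by simp

lemma two_pi_i_nonzero: "complex_of_real (2 * pi) * \<i> \<noteq> 0"
  by simp

text \<open>Every power other than the one with exponent -1 has a primitive away from 0.\<close>

lemma has_contour_integral_powi:
  assumes g: "valid_path \<gamma>" "pathfinish \<gamma> = pathstart \<gamma>" and w0: "0 \<notin> path_image \<gamma>" "winding_number \<gamma> 0 = 1"
  shows "((\<lambda>w. w powi s) has_contour_integral (if s = - 1 then 2 * pi * \<i> else 0)) \<gamma>"
proof (cases "s = - 1")
  case True
  have "(\<lambda>w. 1 / (w - 0)) contour_integrable_on \<gamma>"
    by (rule contour_integrable_inversediff[OF g(1) w0(1)])
  moreover have "contour_integral \<gamma> (\<lambda>w. 1 / (w - 0)) = 2 * pi * \<i>"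
    using winding_number_valid_path[OF g(1) w0(1)] w0(2) by (simp add: field_simps)
  ultimately have "((\<lambda>w. 1 / (w - 0)) has_contour_integral 2 * pi * \<i>) \<gamma>"
    by (metis has_contour_integral_integral)
  then show ?thesis using True by (simp add: power_int_minus inverse_eq_divide)
next
  case False
  then have s: "of_int (s + 1) \<noteq> (0 :: complex)" by (simp add: add_eq_0_iff of_int_eq_0_iff del: of_int_add)
  have "((\<lambda>w. w powi s) has_contour_integral 0) \<gamma>"
  proof (rule Cauchy_theorem_primitive[where S = "- {0}" and f = "\<lambda>w. w powi (s + 1) / of_int (s + 1)"])
    fix w :: complex assume w: "w \<in> - {0}"
    have "((\<lambda>w. w powi (s + 1)) has_field_derivative of_int (s + 1) * w powi (s + 1 - 1) * 1) (at w within - {0})"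
      by (rule DERIV_power_int[OF DERIV_ident]) (use w in simp)
    from DERIV_cdivide[OF this, of "of_int (s + 1)"]
    show "((\<lambda>w. w powi (s + 1) / of_int (s + 1)) has_field_derivative w powi s) (at w within - {0})"
      using s by (simp del: of_int_add)
  qed (use g w0 in auto)
  then show ?thesis using False by simp
qed

text \<open>For s >= 0 the integrand is holomorphic in the disc |w| < |z|. For negative s the
  partial fraction w^(-m-1) / (z - w) = (w^(-m-1) + w^(-m) / (z - w)) / z lowers the order of the
  pole at 0 by one.\<close>

lemma has_contour_integral_monomial_cauchy:
  fixes s :: int
  assumes g: "valid_path \<gamma>" "pathfinish \<gamma> = pathstart \<gamma>" and w0: "0 \<notin> path_image \<gamma>" "winding_number \<gamma> 0 = 1"
    and z: "\<And>w. w \<in> path_image \<gamma> \<Longrightarrow> norm w < norm z"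
  shows "((\<lambda>w. w powi s / (z - w)) has_contour_integral (if s < 0 then 2 * pi * \<i> * z powi s else 0)) \<gamma>"
proof -
  have "pathstart \<gamma> \<in> path_image \<gamma>" by (rule pathstart_in_path_image)
  from z[OF this] have z0: "z \<noteq> 0" by auto
  have img: "path_image \<gamma> \<subseteq> ball 0 (norm z)" using z by auto
  have pos: "((\<lambda>w. w powi int m / (z - w)) has_contour_integral 0) \<gamma>" for m
  proof (rule Cauchy_theorem_convex_simple[OF _ convex_ball g(1) img g(2)])
    show "(\<lambda>w. w powi int m / (z - w)) holomorphic_on ball 0 (norm z)"
      by (intro holomorphic_intros) auto
  qed
  have mono: "((\<lambda>w. w powi (- int (Suc m))) has_contour_integral (if m = 0 then 2 * pi * \<i> else 0)) \<gamma>" for m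
    using has_contour_integral_powi[OF g w0, of "- int (Suc m)"] by simp
  have neg: "((\<lambda>w. w powi (- int m) / (z - w)) has_contour_integral (if m = 0 then 0 else 2 * pi * \<i> * z powi (- int m))) \<gamma>" for m
  proof (induction m)
    case 0
    show ?case using pos[of 0] by simp
  next
    case (Suc m)
    have "((\<lambda>w. (1 / z) * (w powi (- int (Suc m)) + w powi (- int m) / (z - w))) has_contour_integral
        (1 / z) * ((if m = 0 then 2 * pi * \<i> else 0) + (if m = 0 then 0 else 2 * pi * \<i> * z powi (- int m)))) \<gamma>"
      by (intro has_contour_integral_lmul has_contour_integral_add mono Suc.IH)
    also have "(1 / z) * ((if m = 0 then 2 * pi * \<i> else 0) + (if m = 0 then 0 else 2 * pi * \<i> * z powi (- int m))) =
        2 * pi * \<i> * z powi (- int (Suc m))"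
      unfolding power_int_minus_Suc[OF z0] by simp
    finally have "((\<lambda>w. (1 / z) * (w powi (- int (Suc m)) + w powi (- int m) / (z - w))) has_contour_integral
        2 * pi * \<i> * z powi (- int (Suc m))) \<gamma>" .
    then have "((\<lambda>w. w powi (- int (Suc m)) / (z - w)) has_contour_integral 2 * pi * \<i> * z powi (- int (Suc m))) \<gamma>"
    proof (rule has_contour_integral_eq)
      fix w assume w: "w \<in> path_image \<gamma>"
      then have "w \<noteq> 0" "z - w \<noteq> 0" using w0 z[OF w] by auto
      moreover from this have "w powi (- int m) = w * w powi (- int (Suc m))"
        unfolding power_int_minus_Suc[OF \<open>w \<noteq> 0\<close>] by simp
      ultimately show "(1 / z) * (w powi (- int (Suc m)) + w powi (- int m) / (z - w)) = w powi (- int (Suc m)) / (z - w)"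
        using z0 by (simp only:) (simp add: field_simps)
    qed
    then show ?case by simp
  qed
  show ?thesis
  proof (cases "s < 0")
    case True
    define m where "m = nat (- s)"
    have "s = - int m" "m \<noteq> 0" using True by (auto simp: m_def)
    then show ?thesis using neg[of m] by simp
  next
    case False
    define m where "m = nat s"
    have "s = int m" using False by (simp add: m_def)
    then show ?thesis using pos[of m] by simp
  qed
qed

text \<open>1 / K(w) is a Laurent polynomial, so the integral is a finite sum; terms with
  nonnegative exponent of w integrate to 0, which truncates it.\<close>

lemma contour_integral_laurent_cauchy:
  assumes g: "valid_path \<gamma>" "pathfinish \<gamma> = pathstart \<gamma>" and w0: "0 \<notin> path_image \<gamma>" "winding_number \<gamma> 0 = 1"
    and z: "\<And>w. w \<in> path_image \<gamma> \<Longrightarrow> norm w < norm z"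
  shows "contour_integral \<gamma> (\<lambda>w. c * (kfun n k x y w * w powi (- N) / (z - w))) =
    c * (2 * pi * \<i> * (\<Sum>r | r \<le> n + k \<and> int r < N. of_real (coeff (kpoly n k x y) r) * z powi (int r - N)))"
proof -
  have "((\<lambda>w. c * (\<Sum>r\<in>{..n + k}. of_real (coeff (kpoly n k x y) r) * (w powi (int r - N) / (z - w)))) has_contour_integral
     c * (\<Sum>r\<in>{..n + k}. of_real (coeff (kpoly n k x y) r) * (if int r - N < 0 then 2 * pi * \<i> * z powi (int r - N) else 0))) \<gamma>"
    by (intro has_contour_integral_lmul has_contour_integral_sum has_contour_integral_monomial_cauchy g w0 z) auto
  also have "(\<Sum>r\<in>{..n + k}. of_real (coeff (kpoly n k x y) r) * (if int r - N < 0 then 2 * pi * \<i> * z powi (int r - N) else 0)) =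
     (\<Sum>r\<in>{..n + k}. if int r < N then 2 * pi * \<i> * (of_real (coeff (kpoly n k x y) r) * z powi (int r - N)) else 0)"
    by (intro sum.cong refl) auto
  also have "\<dots> = 2 * pi * \<i> * (\<Sum>r | r \<le> n + k \<and> int r < N. of_real (coeff (kpoly n k x y) r) * z powi (int r - N))"
    by (simp add: sum.inter_filter[symmetric] sum_distrib_left)
  finally show ?thesis
  proof (rule contour_integral_unique[OF has_contour_integral_eq])
    fix w assume "w \<in> path_image \<gamma>"
    then have w: "w \<noteq> 0" using w0 by auto
    have "(\<Sum>r\<le>n + k. of_real (coeff (kpoly n k x y) r) * (w powi (int r - N) / (z - w))) =
        (\<Sum>r\<le>n + k. of_real (coeff (kpoly n k x y) r) * w ^ r) * w powi (- N) / (z - w)"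
      unfolding sum_distrib_right sum_divide_distrib
      by (intro sum.cong refl) (use w in \<open>simp add: power_int_diff power_int_minus field_simps\<close>)
    then show "c * (\<Sum>r\<le>n + k. of_real (coeff (kpoly n k x y) r) * (w powi (int r - N) / (z - w))) =
       c * (kfun n k x y w * w powi (- N) / (z - w))"
      by (simp add: kfun_eq_sum)
  qed
qed

lemma rearrange_kernel_integrand:
  fixes c z w :: complex
  shows "1 / (c * z) * (1 / (c * w)) * ((zk / Kz) / (wk / Kw)) * za * wa / d =
    1 / c * (1 / c) * ((zk * za / z) / Kz) * (Kw * (wa / (w * wk)) / d)"
  by (simp add: divide_inverse mult_ac)

lemma corr_kernel_eq_single:
  assumes con: "kernel_contours n k x y \<gamma>z \<gamma>w"
  shows "corr_kernel \<gamma>z \<gamma>w n k x y a a' = contour_integral \<gamma>z (\<lambda>z. 1 / (2 * pi * \<i>) *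
    (z powi (int k - a - 1) / kfun n k x y z *
    (\<Sum>r | r \<le> n + k \<and> int r < int k - a'. of_real (coeff (kpoly n k x y) r) * z powi (int r - (int k - a')))))"
  unfolding corr_kernel_def
proof (rule contour_integral_cong[OF refl])
  have gw: "valid_path \<gamma>w" "pathfinish \<gamma>w = pathstart \<gamma>w" "0 \<notin> path_image \<gamma>w" "winding_number \<gamma>w 0 = 1"
    and gz: "0 \<notin> path_image \<gamma>z" "\<And>z w. z \<in> path_image \<gamma>z \<Longrightarrow> w \<in> path_image \<gamma>w \<Longrightarrow> norm w < norm z"
    using con unfolding kernel_contours_def by blast+
  fix z assume z: "z \<in> path_image \<gamma>z"
  then have z0: "z \<noteq> 0" using gz(1) by blast
  define c where "c = 1 / (2 * pi * \<i>) * (1 / (2 * pi * \<i>)) * (z powi (int k - a - 1) / kfun n k x y z)"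
  have "contour_integral \<gamma>w (\<lambda>w. 1 / (2 * of_real pi * \<i> * z) * (1 / (2 * of_real pi * \<i> * w)) *
       (kernel_factor n k x y z / kernel_factor n k x y w) * z powi (- a) * w powi (a' + 1) / (z - w)) =
     contour_integral \<gamma>w (\<lambda>w. c * (kfun n k x y w * w powi (- (int k - a')) / (z - w)))"
  proof (rule contour_integral_cong[OF refl])
    fix w assume "w \<in> path_image \<gamma>w"
    then have w0: "w \<noteq> 0" using gw(3) by blast
    have ez: "z powi (int k - a - 1) = z ^ k * z powi (- a) / z"
    proof -
      have "z powi (int k - a - 1) = z powi (int k - a) / z powi 1" by (rule power_int_diff) (use z0 in simp)
      moreover have "z powi (int k + - a) = z powi int k * z powi (- a)" by (rule power_int_add) (use z0 in simp)
      ultimately show ?thesis by simp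
    qed
    have ew: "w powi (- (int k - a')) = w powi (a' + 1) / (w * w ^ k)"
      using w0 by (simp add: power_int_diff power_int_add field_simps)
    show "1 / (2 * of_real pi * \<i> * z) * (1 / (2 * of_real pi * \<i> * w)) *
       (kernel_factor n k x y z / kernel_factor n k x y w) * z powi (- a) * w powi (a' + 1) / (z - w) =
       c * (kfun n k x y w * w powi (- (int k - a')) / (z - w))"
      unfolding c_def kernel_factor_eq[OF z0] kernel_factor_eq[OF w0] ez ew of_real_mult of_real_numeral
      by (rule rearrange_kernel_integrand)
  qed
  also have "\<dots> = c * (2 * pi * \<i> * (\<Sum>r | r \<le> n + k \<and> int r < int k - a'.
      of_real (coeff (kpoly n k x y) r) * z powi (int r - (int k - a'))))"
    by (rule contour_integral_laurent_cauchy[OF gw]) (rule gz(2)[OF z])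
  also have "\<dots> = 1 / (2 * pi * \<i>) * (z powi (int k - a - 1) / kfun n k x y z *
    (\<Sum>r | r \<le> n + k \<and> int r < int k - a'. of_real (coeff (kpoly n k x y) r) * z powi (int r - (int k - a'))))"
    by (simp add: c_def)
  finally show "contour_integral \<gamma>w (\<lambda>w. 1 / (2 * of_real pi * \<i> * z) * (1 / (2 * of_real pi * \<i> * w)) *
       (kernel_factor n k x y z / kernel_factor n k x y w) * z powi (- a) * w powi (a' + 1) / (z - w)) = \<dots>" .
qed

lemma kernel_contour_integrable:
  assumes g: "valid_path \<gamma>" "path_image \<gamma> \<inter> kpoles n k x y = {}"
  shows "(\<lambda>z. z powi e / kfun n k x y z) contour_integrable_on \<gamma>"
  by (rule contour_integrable_holomorphic_simple[OF holomorphic_kernel _ g(1)])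
    (use g in \<open>auto intro!: open_Diff finite_imp_closed finite_kpoles\<close>)

lemma kernel_contours_z:
  assumes con: "kernel_contours n k x y \<gamma>z \<gamma>w"
  shows "valid_path \<gamma>z" "pathfinish \<gamma>z = pathstart \<gamma>z" "path_image \<gamma>z \<inter> kpoles n k x y = {}" "0 \<notin> path_image \<gamma>z"
    "winding_number \<gamma>z 0 = 1"
    "\<And>j. j \<in> {1..k} \<Longrightarrow> - of_real (y j) \<notin> path_image \<gamma>z \<and> winding_number \<gamma>z (- of_real (y j)) = 1"
    "\<And>i. i \<in> {1..n} \<Longrightarrow> 1 / of_real (x i) \<notin> path_image \<gamma>z \<and> winding_number \<gamma>z (1 / of_real (x i)) = 0"
proof -
  show v: "valid_path \<gamma>z" "pathfinish \<gamma>z = pathstart \<gamma>z" "0 \<notin> path_image \<gamma>z" "winding_number \<gamma>z 0 = 1"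
    using con unfolding kernel_contours_def by blast+
  show y: "- of_real (y j) \<notin> path_image \<gamma>z \<and> winding_number \<gamma>z (- of_real (y j)) = 1" if "j \<in> {1..k}" for j
    using con that unfolding kernel_contours_def by blast
  show x: "1 / of_real (x i) \<notin> path_image \<gamma>z \<and> winding_number \<gamma>z (1 / of_real (x i)) = 0" if "i \<in> {1..n}" for i
    using con that unfolding kernel_contours_def by blast
  show "path_image \<gamma>z \<inter> kpoles n k x y = {}" unfolding kpoles_def using v(3) x y by blast
qed

text \<open>At distance \<open>l'\<close> from the corner the truncation leaves exactly the
  coefficients with r < l'. The bound \<open>l \<le> k\<close> provides the decay for moving the
  z-contour to the line.\<close>

theorem corr_kernel_right:
  assumes con: "kernel_contours n k x y \<gamma>z \<gamma>w" and adm: "admissible \<epsilon> n k x y" and l: "l \<le> k" "l' \<le> n + k"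
  shows "corr_kernel \<gamma>z \<gamma>w n k x y (int k - int l) (int k - int l') = line_kernel \<epsilon> n k x y l l'"
proof -
  note cz = kernel_contours_z[OF con]
  let ?c = "\<lambda>r. complex_of_real (coeff (kpoly n k x y) r)"
  let ?e = "\<lambda>r. int l - 1 + int r - int l'"
  have set: "{r. r \<le> n + k \<and> int r < int k - (int k - int l')} = {..<l'}" using l(2) by auto
  have "corr_kernel \<gamma>z \<gamma>w n k x y (int k - int l) (int k - int l') =
     contour_integral \<gamma>z (\<lambda>z. \<Sum>r<l'. 1 / (2 * pi * \<i>) * ?c r * (z powi ?e r / kfun n k x y z))"
    unfolding corr_kernel_eq_single[OF con] set
  proof (rule contour_integral_cong[OF refl])
    fix z assume "z \<in> path_image \<gamma>z"
    then have z0: "z \<noteq> 0" using cz(4) by auto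
    have e: "z powi (int k - (int k - int l) - 1) * z powi (int r - (int k - (int k - int l'))) = z powi ?e r" for r
      using z0 by (simp add: power_int_add[symmetric] algebra_simps)
    show "1 / (2 * pi * \<i>) * (z powi (int k - (int k - int l) - 1) / kfun n k x y z *
        (\<Sum>r<l'. ?c r * z powi (int r - (int k - (int k - int l'))))) =
      (\<Sum>r<l'. 1 / (2 * pi * \<i>) * ?c r * (z powi ?e r / kfun n k x y z))"
      unfolding sum_distrib_left e[symmetric] by (intro sum.cong refl) simp
  qed
  also have "\<dots> = (\<Sum>r<l'. 1 / (2 * pi * \<i>) * ?c r * contour_integral \<gamma>z (\<lambda>z. z powi ?e r / kfun n k x y z))"
  proof -
    note int = kernel_contour_integrable[OF cz(1,3)]
    show ?thesis
      by (subst contour_integral_sum) (intro finite_lessThan contour_integrable_lmul int sum.cong refl contour_integral_lmul)+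
  qed
  also have "\<dots> = (\<Sum>r<l'. ?c r * line_moment \<epsilon> n k x y (?e r))"
  proof (rule sum.cong[OF refl])
    fix r assume "r \<in> {..<l'}"
    then have "?e r + 2 \<le> int k" using l by simp
    then have "contour_integral \<gamma>z (\<lambda>z. z powi ?e r / kfun n k x y z) = 1 * (2 * pi * \<i>) * line_moment \<epsilon> n k x y (?e r)"
      by (rule contour_integral_kernel[OF adm]) (use cz in auto)
    then show "1 / (2 * pi * \<i>) * ?c r * contour_integral \<gamma>z (\<lambda>z. z powi ?e r / kfun n k x y z) =
        ?c r * line_moment \<epsilon> n k x y (?e r)" by (simp only: cancel_unit[OF two_pi_i_nonzero, of _ 1, unfolded mult_1] mult_1)
  qed
  finally show ?thesis by (simp add: line_kernel_def)
qed

section \<open>The inversion z -> -1/z and the kernel at the left corner\<close>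

lemma minus_inverse_path:
  assumes g: "valid_path \<gamma>" "0 \<notin> path_image \<gamma>"
  shows "valid_path ((\<lambda>z. - 1 / z) \<circ> \<gamma>)"
    and "contour_integral ((\<lambda>z. - 1 / z) \<circ> \<gamma>) G = contour_integral \<gamma> (\<lambda>z. G (- 1 / z) / z\<^sup>2)"
proof -
  let ?h = "\<lambda>z::complex. - 1 / z"
  have hol: "?h holomorphic_on - {0}" by (intro holomorphic_intros) auto
  have img: "path_image \<gamma> \<subseteq> - {0}" using g by auto
  show "valid_path (?h \<circ> \<gamma>)"
    by (rule valid_path_compose_holomorphic[OF g(1) hol _ img]) auto
  have "contour_integral (?h \<circ> \<gamma>) G = contour_integral \<gamma> (\<lambda>w. deriv ?h w * G (?h w))"
  proof (rule contour_integral_comp_analyticW[OF _ g(1) img])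
    have "open (- {0::complex})" by auto
    then show "?h analytic_on - {0}" using hol analytic_on_open by blast
  qed
  also have "\<dots> = contour_integral \<gamma> (\<lambda>z. G (- 1 / z) / z\<^sup>2)"
  proof (rule contour_integral_cong[OF refl])
    fix z assume "z \<in> path_image \<gamma>"
    then have "z \<noteq> 0" using g by auto
    then have "(?h has_field_derivative 1 / z\<^sup>2) (at z)"
      by (auto intro!: derivative_eq_intros simp: power2_eq_square)
    then show "deriv ?h z * G (?h z) = G (- 1 / z) / z\<^sup>2" by (simp add: DERIV_imp_deriv)
  qed
  finally show "contour_integral (?h \<circ> \<gamma>) G = contour_integral \<gamma> (\<lambda>z. G (- 1 / z) / z\<^sup>2)" .
qed

text \<open>For p other than 0 the pulled back integrand 1 / ((- 1 / z - p) z^2) splits into 1 / (z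
  + 1 / p) - 1 / z; for p = 0 only the second term is present.\<close>

lemma winding_number_minus_inverse:
  assumes g: "valid_path \<gamma>" "0 \<notin> path_image \<gamma>" and q: "p \<noteq> 0 \<Longrightarrow> - 1 / p \<notin> path_image \<gamma>"
  shows "winding_number ((\<lambda>z. - 1 / z) \<circ> \<gamma>) p =
    (if p = 0 then 0 else winding_number \<gamma> (- 1 / p)) - winding_number \<gamma> 0"
proof -
  let ?h = "\<lambda>z::complex. - 1 / z"
  have np: "p \<notin> path_image (?h \<circ> \<gamma>)"
  proof
    assume "p \<in> path_image (?h \<circ> \<gamma>)"
    then obtain z where z: "z \<in> path_image \<gamma>" "p = - 1 / z" by (auto simp: path_image_compose)
    then have "z \<noteq> 0" using g by auto
    then have "p \<noteq> 0" "- 1 / p = z" using z by auto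
    then show False using q z by auto
  qed
  have "winding_number (?h \<circ> \<gamma>) p = 1 / (2 * pi * \<i>) * contour_integral \<gamma> (\<lambda>z. 1 / (- 1 / z - p) / z\<^sup>2)"
    unfolding winding_number_valid_path[OF minus_inverse_path(1)[OF g] np] minus_inverse_path(2)[OF g] ..
  also have "contour_integral \<gamma> (\<lambda>z. 1 / (- 1 / z - p) / z\<^sup>2) =
      contour_integral \<gamma> (\<lambda>z. (if p = 0 then 0 else 1 / (z - (- 1 / p))) - 1 / (z - 0))"
  proof (rule contour_integral_cong[OF refl])
    fix z assume z: "z \<in> path_image \<gamma>"
    then have z0: "z \<noteq> 0" using g by auto
    show "1 / (- 1 / z - p) / z\<^sup>2 = (if p = 0 then 0 else 1 / (z - (- 1 / p))) - 1 / (z - 0)"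
    proof (cases "p = 0")
      case True then show ?thesis using z0 by (simp add: power2_eq_square)
    next
      case False
      have "z \<noteq> - 1 / p" using q[OF False] z by auto
      then have "1 + p * z \<noteq> 0" using False by (auto simp: field_simps add_eq_0_iff)
      moreover define D where "D = 1 + p * z"
      ultimately have D: "D \<noteq> 0" "p * z - D = - 1" by simp_all
      have "- 1 / z - p = - D / z" "z - - 1 / p = D / p" using z0 False by (simp_all add: field_simps D_def)
      then have e: "- 1 / z - p = - D / z" "z - - 1 / p = D / p" .
      have "1 / (- 1 / z - p) / z\<^sup>2 = 1 / (- D / z) / z\<^sup>2" unfolding e ..
      moreover have "1 / (z - - 1 / p) - 1 / (z - 0) = (p * z - D) / (D * z)"
        unfolding e using D(1) z0 False by (simp add: field_simps)
      moreover have "1 / (- D / z) / z\<^sup>2 = - 1 / (D * z)" using D(1) z0 by (simp add: field_simps power2_eq_square)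
      ultimately show ?thesis using False D(2) by simp
    qed
  qed
  also have "\<dots> = (if p = 0 then 0 else contour_integral \<gamma> (\<lambda>z. 1 / (z - (- 1 / p)))) - contour_integral \<gamma> (\<lambda>z. 1 / (z - 0))"
    using contour_integrable_inversediff[OF g] contour_integrable_inversediff[OF g(1) q]
    by (cases "p = 0") (simp_all add: contour_integral_diff contour_integral_neg)
  also have "1 / (2 * pi * \<i>) * \<dots> = (if p = 0 then 0 else winding_number \<gamma> (- 1 / p)) - winding_number \<gamma> 0"
    using winding_number_valid_path[OF g] winding_number_valid_path[OF g(1) q]
    by (cases "p = 0") (simp_all add: right_diff_distrib)
  finally show ?thesis .
qed

text \<open>Under the inversion the factors of the two families exchange their shapes, up to one
  sign per \<open>x i\<close> and a common power of z.\<close>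

lemma kfun_minus_inverse:
  assumes "z \<noteq> 0"
  shows "kfun k n y x (- 1 / z) * z ^ (n + k) = (-1) ^ n * kfun n k x y z"
proof -
  have "1 - of_real (y j) * (- 1 / z) = (z + of_real (y j)) / z" for j using assms by (simp add: field_simps)
  moreover have "- 1 / z + of_real (x i) = (-1) * (1 - of_real (x i) * z) / z" for i using assms by (simp add: field_simps)
  ultimately have "kfun k n y x (- 1 / z) = (\<Prod>j=1..k. (z + of_real (y j)) / z) * (\<Prod>i=1..n. (-1) * (1 - of_real (x i) * z) / z)"
    unfolding kfun_def by (simp only:)
  also have "\<dots> = (\<Prod>j=1..k. z + of_real (y j)) / z ^ k * ((-1) ^ n * (\<Prod>i=1..n. 1 - of_real (x i) * z) / z ^ n)"
    by (simp only: prod_dividef prod.distrib prod_constant card_atLeastAtMost diff_Suc_1)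
  finally show ?thesis using assms by (simp add: kfun_def power_add)
qed

text \<open>Reversal turns 1 - x_i z into z - x_i and z + y_j into 1 + y_j z. Up to signs these are
  the factors of \<open>kpoly k n y x\<close> at - z. Nonzero \<open>x i\<close> keep the degree at
  n + k, so that reversal acts as r -> n + k - r.\<close>

lemma coeff_kpoly_reverse:
  assumes x: "\<And>i. i \<in> {1..n} \<Longrightarrow> x i \<noteq> 0" and r: "r \<le> n + k"
  shows "coeff (kpoly n k x y) (n + k - r) = (-1) ^ (n + r) * coeff (kpoly k n y x) r"
proof -
  have x0: "xpoly n x \<noteq> 0" "ypoly k y \<noteq> 0" by (auto simp: xpoly_def ypoly_def)
  have "degree (xpoly n x) = n"
    unfolding xpoly_def by (subst degree_prod_eq_sum_degree) (use x in auto)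
  then have deg: "degree (kpoly n k x y) = n + k"
    unfolding kpoly_def by (simp add: degree_mult_eq[OF x0] degree_ypoly)
  have "reflect_poly (kpoly n k x y) = (\<Prod>i=1..n. reflect_poly [:1, - x i:]) * (\<Prod>j=1..k. reflect_poly [:y j, 1:])"
    by (simp only: kpoly_def xpoly_def ypoly_def reflect_poly_mult reflect_poly_prod)
  also have "(\<Prod>i=1..n. reflect_poly [:1, - x i:]) = (\<Prod>i=1..n. [:- x i, 1:])"
    by (rule prod.cong) (use x in \<open>auto simp: reflect_poly_def\<close>)
  also have "(\<Prod>j=1..k. reflect_poly [:y j, 1:]) = (\<Prod>j=1..k. [:1, y j:])"
    by (rule prod.cong) (auto simp: reflect_poly_def)
  finally have refl: "reflect_poly (kpoly n k x y) = (\<Prod>i=1..n. [:- x i, 1:]) * (\<Prod>j=1..k. [:1, y j:])" .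
  have "pcompose (kpoly k n y x) [:0, -1:] = (\<Prod>j=1..k. [:1, y j:]) * (\<Prod>i=1..n. Polynomial.smult (-1) [:- x i, 1:])"
    by (simp add: kpoly_def xpoly_def ypoly_def pcompose_mult pcompose_prod pcompose_pCons)
  also have "\<dots> = Polynomial.smult ((-1) ^ n) (reflect_poly (kpoly n k x y))"
    unfolding refl prod_smult by (simp add: mult.commute)
  finally have "coeff (pcompose (kpoly k n y x) [:0, -1:]) r = (-1) ^ n * coeff (reflect_poly (kpoly n k x y)) r" by simp
  then have "(-1) ^ r * coeff (kpoly k n y x) r = (-1) ^ n * coeff (kpoly n k x y) (n + k - r)"
    using r by (simp add: coeff_pcompose_linear coeff_reflect_poly deg)
  then have "(-1) ^ n * ((-1) ^ r * coeff (kpoly k n y x) r) = (-1) ^ n * ((-1) ^ n * coeff (kpoly n k x y) (n + k - r))"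
    by (simp only:)
  then show ?thesis by (simp add: power_add mult.assoc[symmetric] power_mult_distrib[symmetric])
qed

text \<open>The image of the contour winds -1 times around 0 and the - x_i and 0 times around the 1
  / y_j: it is a contour of the problem with the variables exchanged, traversed backwards.\<close>

lemma contour_integral_kernel_dual:
  assumes con: "kernel_contours n k x y \<gamma>z \<gamma>w" and adm: "admissible \<epsilon> k n y x"
    and x: "\<And>i. i \<in> {1..n} \<Longrightarrow> x i > 0" and e': "e' + 2 \<le> int n"
  shows "contour_integral \<gamma>z (\<lambda>z. z powi (int (n + k) - 2 - e') / kfun n k x y z) =
    (-1) powi e' * (-1) ^ n * (- 1) * (2 * pi * \<i>) * line_moment \<epsilon> k n y x e'"
proof -
  note cz = kernel_contours_z[OF con]
  let ?h = "\<lambda>z::complex. - 1 / z"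
  let ?G = "\<lambda>v. v powi e' / kfun k n y x v"
  let ?s = "(-1) powi e' * (-1) ^ n :: complex"
  have y: "y j \<ge> 0" if "j \<in> {1..k}" for j using admissible_x(1)[OF adm that] .
  note wn = winding_number_minus_inverse[OF cz(1,4)]
  have wx: "- of_real (x i) \<notin> path_image (?h \<circ> \<gamma>z)" "winding_number (?h \<circ> \<gamma>z) (- of_real (x i)) = - 1"
    if i: "i \<in> {1..n}" for i
  proof -
    have e: "- 1 / (- complex_of_real (x i)) = 1 / of_real (x i)" using x[OF i] by simp
    show "winding_number (?h \<circ> \<gamma>z) (- of_real (x i)) = - 1"
      using wn[of "- of_real (x i)"] cz(5) cz(7)[OF i] x[OF i] unfolding e by simp
    show "- of_real (x i) \<notin> path_image (?h \<circ> \<gamma>z)"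
    proof
      assume "- of_real (x i) \<in> path_image (?h \<circ> \<gamma>z)"
      then obtain z where z: "z \<in> path_image \<gamma>z" "- of_real (x i) = - 1 / z" by (auto simp: path_image_compose)
      then have "z = 1 / of_real (x i)" using x[OF i] by (auto simp: field_simps)
      then show False using z cz(7)[OF i] by simp
    qed
  qed
  have wy: "1 / of_real (y j) \<notin> path_image (?h \<circ> \<gamma>z)" "winding_number (?h \<circ> \<gamma>z) (1 / of_real (y j)) = 0"
    if j: "j \<in> {1..k}" "y j > 0" for j
  proof -
    have e: "- 1 / (1 / complex_of_real (y j)) = - of_real (y j)" by simp
    show "winding_number (?h \<circ> \<gamma>z) (1 / of_real (y j)) = 0"
      using wn[of "1 / of_real (y j)"] cz(5) cz(6)[OF j(1)] j unfolding e by simp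
    show "1 / of_real (y j) \<notin> path_image (?h \<circ> \<gamma>z)"
    proof
      assume "1 / of_real (y j) \<in> path_image (?h \<circ> \<gamma>z)"
      then obtain z where z: "z \<in> path_image \<gamma>z" "1 / of_real (y j) = - 1 / z" by (auto simp: path_image_compose)
      moreover have "z \<noteq> 0" using z(1) cz(4) by auto
      ultimately have "z = - of_real (y j)" using j by (simp add: field_simps)
      then show False using z cz(6)[OF j(1)] by simp
    qed
  qed
  have "0 \<notin> path_image (?h \<circ> \<gamma>z)" using cz(4) by (auto simp: path_image_compose)
  then have disj: "path_image (?h \<circ> \<gamma>z) \<inter> kpoles k n y x = {}"
    using wx(1) wy(1) y by (force simp: kpoles_def less_le)
  have "contour_integral (?h \<circ> \<gamma>z) ?G = - 1 * (2 * pi * \<i>) * line_moment \<epsilon> k n y x e'"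
    by (rule contour_integral_kernel[OF adm e' minus_inverse_path(1)[OF cz(1,4)] _ disj])
      (use wn[of 0] cz(2,5) wx(2) wy(2) in \<open>auto simp: pathstart_compose pathfinish_compose\<close>)
  also have "contour_integral (?h \<circ> \<gamma>z) ?G = contour_integral \<gamma>z (\<lambda>z. ?s * (z powi (int (n + k) - 2 - e') / kfun n k x y z))"
    unfolding minus_inverse_path(2)[OF cz(1,4)]
  proof (rule contour_integral_cong[OF refl])
    fix z assume z: "z \<in> path_image \<gamma>z"
    then have z0: "z \<noteq> 0" using cz(4) by auto
    have K: "kfun k n y x (- 1 / z) = (-1) ^ n * kfun n k x y z / z ^ (n + k)"
      using kfun_minus_inverse[OF z0, of k n y x] z0 by (simp add: field_simps)
    have p: "(- 1 / z) powi e' = (-1) powi e' / z powi e'" by (rule power_int_divide_distrib)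
    have e: "z powi (int (n + k) - 2 - e') = z ^ (n + k) / z\<^sup>2 / z powi e'"
      using z0 by (simp add: power_int_diff power_int_add power_add)
    have "1 / (-1) ^ n = ((-1) ^ n :: complex)" by (cases "even n") auto
    then show "?G (- 1 / z) / z\<^sup>2 = ?s * (z powi (int (n + k) - 2 - e') / kfun n k x y z)"
      unfolding K p e by (cases "even n") (simp_all add: field_simps)
  qed
  also have "\<dots> = ?s * contour_integral \<gamma>z (\<lambda>z. z powi (int (n + k) - 2 - e') / kfun n k x y z)"
    by (rule contour_integral_lmul) (rule kernel_contour_integrable[OF cz(1,3)])
  finally have *: "?s * contour_integral \<gamma>z (\<lambda>z. z powi (int (n + k) - 2 - e') / kfun n k x y z) =
      - 1 * (2 * pi * \<i>) * line_moment \<epsilon> k n y x e'" .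
  have "?s * ?s = 1" by (cases "even n"; cases "even e'") (auto simp: power_int_minus_left)
  then have "contour_integral \<gamma>z (\<lambda>z. z powi (int (n + k) - 2 - e') / kfun n k x y z) =
     ?s * (?s * contour_integral \<gamma>z (\<lambda>z. z powi (int (n + k) - 2 - e') / kfun n k x y z))"
    by (simp only: mult.assoc[symmetric] mult_1)
  then show ?thesis unfolding * by (simp only: mult.assoc)
qed

lemma minus_one_power_int_sign:
  "(-1) ^ (n + r) * ((-1) powi e * (-1) ^ n * (- 1)) = ((-1) powi (e + 1 - int r) :: complex)"
  by (subst power_int_diff, simp, subst power_int_add, simp)
    (cases "even n"; cases "even r"; simp add: power_add)

text \<open>This is the kernel of the holes. Near the left corner the truncation keeps all
  coefficients except the top \<open>l'\<close>. The full sum is the polynomial itself and cancels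
  against the denominator, leaving a bare power of z whose integral is the Kronecker delta. The top
  coefficients are, by reversal, the lowest ones of the exchanged problem.\<close>

theorem corr_kernel_left:
  assumes con: "kernel_contours n k x y \<gamma>z \<gamma>w" and adm: "admissible \<epsilon> k n y x"
    and x: "\<And>i. i \<in> {1..n} \<Longrightarrow> x i > 0" and l: "l \<le> n" "l' \<le> n + k"
  shows "(if l = l' then 1 else 0) - corr_kernel \<gamma>z \<gamma>w n k x y (- int n + int l - 1) (- int n + int l' - 1) =
    (-1) powi (int l - int l') * line_kernel \<epsilon> k n y x l l'"
proof -
  note cz = kernel_contours_z[OF con]
  let ?c = "\<lambda>r. complex_of_real (coeff (kpoly n k x y) r)"
  let ?N = "int k - (- int n + int l' - 1)"
  let ?e = "\<lambda>r. int (n + k) - 2 - (int l - 1 + int r - int l')"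
  have inv: "int k - (- int n + int l - 1) - 1 = int (n + k) - int l" by simp
  have "corr_kernel \<gamma>z \<gamma>w n k x y (- int n + int l - 1) (- int n + int l' - 1) =
     contour_integral \<gamma>z (\<lambda>z. 1 / (2 * pi * \<i>) * z powi (int l' - int l - 1) -
       (\<Sum>r<l'. 1 / (2 * pi * \<i>) * ?c (n + k - r) * (z powi ?e r / kfun n k x y z)))"
    unfolding corr_kernel_eq_single[OF con]
  proof (rule contour_integral_cong[OF refl])
    fix z assume z: "z \<in> path_image \<gamma>z"
    then have z0: "z \<noteq> 0" using cz(4) by auto
    have K0: "kfun n k x y z \<noteq> 0" using z cz(3) by (intro kfun_nonzero) auto
    \<comment> \<open>The truncation point \<open>?N\<close> equals n + k + 1 - l', so the excluded
      indices are the numbers n + k - r with r < l'.\<close>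
    have set: "{r. r \<le> n + k \<and> int r < ?N} = {..n + k} - (\<lambda>r. n + k - r) ` {..<l'}"
    proof (intro equalityI subsetI)
      fix r assume "r \<in> {r. r \<le> n + k \<and> int r < ?N}"
      then show "r \<in> {..n + k} - (\<lambda>r. n + k - r) ` {..<l'}" by auto
    next
      fix r assume r: "r \<in> {..n + k} - (\<lambda>r. n + k - r) ` {..<l'}"
      have "\<not> n + k - r < l'"
      proof
        assume "n + k - r < l'"
        then have "n + k - (n + k - r) \<in> (\<lambda>r. n + k - r) ` {..<l'}" by blast
        then show False using r by simp
      qed
      then show "r \<in> {r. r \<le> n + k \<and> int r < ?N}" using r by auto
    qed
    have "(\<Sum>r | r \<le> n + k \<and> int r < ?N. ?c r * z powi (int r - ?N)) =
        (\<Sum>r\<le>n + k. ?c r * z powi (int r - ?N)) - (\<Sum>r\<in>(\<lambda>r. n + k - r) ` {..<l'}. ?c r * z powi (int r - ?N))"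
      unfolding set by (rule sum_diff) (use l in auto)
    also have "(\<Sum>r\<in>(\<lambda>r. n + k - r) ` {..<l'}. ?c r * z powi (int r - ?N)) = (\<Sum>r<l'. ?c (n + k - r) * z powi (int (n + k - r) - ?N))"
      by (rule sum.reindex_cong[where l = "\<lambda>r. n + k - r"]) (use l in \<open>auto simp: inj_on_def\<close>)
    also have "(\<Sum>r\<le>n + k. ?c r * z powi (int r - ?N)) = kfun n k x y z * z powi (- ?N)"
      unfolding kfun_eq_sum sum_distrib_right
    proof (intro sum.cong refl)
      fix r
      have "z powi (int r - N) = z ^ r * z powi (- N)" for N
        using power_int_add[of z "int r" "- N"] z0 by simp
      then show "?c r * z powi (int r - ?N) = ?c r * z ^ r * z powi (- ?N)" by (simp only: mult.assoc)
    qed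
    finally have S: "(\<Sum>r | r \<le> n + k \<and> int r < ?N. ?c r * z powi (int r - ?N)) =
      kfun n k x y z * z powi (- ?N) - (\<Sum>r<l'. ?c (n + k - r) * z powi (int (n + k - r) - ?N))" .
    have e1: "z powi (int (n + k) - int l) * z powi (- ?N) = z powi (int l' - int l - 1)"
    proof -
      have "int l' - int l - 1 = (int (n + k) - int l) + - ?N" by simp
      then show ?thesis by (simp only:) (rule power_int_add[symmetric], use z0 in simp)
    qed
    have e2: "z powi (int (n + k) - int l) * z powi (int (n + k - r) - ?N) = z powi ?e r" if "r < l'" for r
    proof -
      have "?e r = (int (n + k) - int l) + (int (n + k - r) - ?N)" using that l by (simp add: of_nat_diff)
      then show ?thesis by (simp only:) (rule power_int_add[symmetric], use z0 in simp)
    qed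
    have "z powi (int (n + k) - int l) / kfun n k x y z *
        (kfun n k x y z * z powi (- ?N) - (\<Sum>r<l'. ?c (n + k - r) * z powi (int (n + k - r) - ?N))) =
      z powi (int (n + k) - int l) * z powi (- ?N) -
        (\<Sum>r<l'. ?c (n + k - r) * (z powi (int (n + k) - int l) * z powi (int (n + k - r) - ?N) / kfun n k x y z))"
      using K0 by (simp add: right_diff_distrib sum_distrib_left mult_ac)
    also have "\<dots> = z powi (int l' - int l - 1) - (\<Sum>r<l'. ?c (n + k - r) * (z powi ?e r / kfun n k x y z))"
      unfolding e1 by (intro arg_cong2[where f = "(-)"] sum.cong refl) (simp only: e2 lessThan_iff)
    finally show "1 / (2 * pi * \<i>) * (z powi (int k - (- int n + int l - 1) - 1) / kfun n k x y z *
        (\<Sum>r | r \<le> n + k \<and> int r < ?N. ?c r * z powi (int r - ?N))) =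
      1 / (2 * pi * \<i>) * z powi (int l' - int l - 1) - (\<Sum>r<l'. 1 / (2 * pi * \<i>) * ?c (n + k - r) * (z powi ?e r / kfun n k x y z))"
      unfolding S inv by (simp add: right_diff_distrib sum_distrib_left mult.assoc)
  qed
  also have "\<dots> = contour_integral \<gamma>z (\<lambda>z. 1 / (2 * pi * \<i>) * z powi (int l' - int l - 1)) -
      contour_integral \<gamma>z (\<lambda>z. \<Sum>r<l'. 1 / (2 * pi * \<i>) * ?c (n + k - r) * (z powi ?e r / kfun n k x y z))"
    by (intro contour_integral_diff contour_integrable_lmul contour_integrable_sum finite_lessThan
        kernel_contour_integrable[OF cz(1,3)] has_contour_integral_integrable[OF has_contour_integral_powi[OF cz(1,2,4,5)]])
  also have "contour_integral \<gamma>z (\<lambda>z. \<Sum>r<l'. 1 / (2 * pi * \<i>) * ?c (n + k - r) * (z powi ?e r / kfun n k x y z)) =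
      (\<Sum>r<l'. 1 / (2 * pi * \<i>) * ?c (n + k - r) * contour_integral \<gamma>z (\<lambda>z. z powi ?e r / kfun n k x y z))"
  proof -
    note int = kernel_contour_integrable[OF cz(1,3)]
    show ?thesis
      by (subst contour_integral_sum) (intro finite_lessThan contour_integrable_lmul int sum.cong refl contour_integral_lmul)+
  qed
  also have "\<dots> = (-1) powi (int l - int l') * line_kernel \<epsilon> k n y x l l'"
    unfolding line_kernel_def sum_distrib_left
  proof (rule sum.cong[OF refl])
    fix r assume "r \<in> {..<l'}"
    then have r: "r < l'" by simp
    let ?e' = "int l - 1 + int r - int l'"
    have I: "contour_integral \<gamma>z (\<lambda>z. z powi ?e r / kfun n k x y z) =
      (-1) powi ?e' * (-1) ^ n * (- 1) * (2 * pi * \<i>) * line_moment \<epsilon> k n y x ?e'"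
      by (rule contour_integral_kernel_dual[OF con adm x]) (use r l in auto)
    have x0: "x i \<noteq> 0" if "i \<in> {1..n}" for i using x[OF that] by simp
    have C: "?c (n + k - r) = (-1) ^ (n + r) * of_real (coeff (kpoly k n y x) r)"
      using coeff_kpoly_reverse[of n x r k y, OF x0] r l by simp
    have "int l - int l' = ?e' + 1 - int r" by simp
    then have sgn: "(-1) ^ (n + r) * ((-1) powi ?e' * (-1) ^ n * (- 1)) = ((-1) powi (int l - int l') :: complex)"
      by (simp only: minus_one_power_int_sign)
    show "1 / (2 * pi * \<i>) * ?c (n + k - r) * contour_integral \<gamma>z (\<lambda>z. z powi ?e r / kfun n k x y z) =
       (-1) powi (int l - int l') * (of_real (coeff (kpoly k n y x) r) * line_moment \<epsilon> k n y x ?e')"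
      unfolding I C cancel_unit[OF two_pi_i_nonzero] sgn[symmetric] by (simp only: mult_ac)
  qed
  also have "contour_integral \<gamma>z (\<lambda>z. 1 / (2 * pi * \<i>) * z powi (int l' - int l - 1)) = (if l = l' then 1 else 0)"
    using contour_integral_unique[OF has_contour_integral_lmul[OF has_contour_integral_powi[OF cz(1,2,4,5), of "int l' - int l - 1"], of "1 / (2 * pi * \<i>)"]]
    by auto
  finally show ?thesis by simp
qed

section \<open>Scaling limit of a product of linear factors\<close>

lemma Ln_approx_quadratic:
  fixes z :: complex
  assumes "norm z \<le> 1 / 2"
  shows "norm (ln (1 + z) - z + z\<^sup>2 / 2) \<le> 2 * norm z ^ 3"
proof -
  let ?f = "\<lambda>n. - ((-z)^n) / of_nat n"
  have "?f sums ln (1 + z)" using assms by (intro Ln_series') simp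
  from sums_split_initial_segment[OF this, of 3]
  have s: "(\<lambda>n. ?f (n + 3)) sums (ln (1 + z) - z + z\<^sup>2 / 2)"
    by (simp add: eval_nat_numeral algebra_simps)
  have g: "(\<lambda>n. norm z ^ 3 * norm z ^ n) sums (norm z ^ 3 * (1 / (1 - norm z)))"
    using assms by (intro sums_mult geometric_sums) simp
  have "norm (ln (1 + z) - z + z\<^sup>2 / 2) \<le> norm z ^ 3 * (1 / (1 - norm z))"
  proof (rule norm_sums_le[OF s g])
    fix n
    have "norm (?f (n + 3)) = norm z ^ (n + 3) / real (n + 3)" by (simp add: norm_divide norm_power del: of_nat_add)
    also have "\<dots> \<le> norm z ^ (n + 3) / 1" by (rule divide_left_mono) auto
    finally show "norm (?f (n + 3)) \<le> norm z ^ 3 * norm z ^ n" by (simp add: power_add mult.commute)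
  qed
  also have "1 / (1 - norm z) \<le> 2" using assms by (simp add: field_simps)
  then have "norm z ^ 3 * (1 / (1 - norm z)) \<le> norm z ^ 3 * 2" by (intro mult_left_mono) auto
  finally show ?thesis by simp
qed

text \<open>Concavity of the logarithm: its chord gives ln (1 + a_i) >= (a_i / B) ln (1 + B), and
  the a_i / B sum to at least \<open>D\<close>. In this way polynomial growth of any degree is
  collected from many factors that are individually close to 1.\<close>

lemma prod_ge_power_of_sum:
  fixes a :: "'a \<Rightarrow> real"
  assumes fin: "finite I" and a: "\<And>i. i \<in> I \<Longrightarrow> 0 \<le> a i \<and> a i \<le> B" and S: "real D * B \<le> sum a I" and B: "B \<ge> 0"
  shows "(1 + B) ^ D \<le> (\<Prod>i\<in>I. 1 + a i)"
proof (cases "B = 0")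
  case True
  then have "a i = 0" if "i \<in> I" for i using a[OF that] by simp
  then show ?thesis using True by simp
next
  case False
  then have B: "B > 0" using B by simp
  have l: "a i / B * ln (1 + B) \<le> ln (1 + a i)" if i: "i \<in> I" for i
  proof -
    let ?t = "a i / B"
    have t: "0 \<le> ?t" "?t \<le> 1" using a[OF i] B by auto
    have "(1 - ?t) * ln 1 + ?t * ln (1 + B) \<le> ln ((1 - ?t) *\<^sub>R 1 + ?t *\<^sub>R (1 + B))"
      by (rule concave_onD[OF ln_concave]) (use t B in auto)
    moreover have "(1 - t) *\<^sub>R 1 + t *\<^sub>R (1 + B) = 1 + t * B" for t by (simp add: algebra_simps)
    moreover have "1 + ?t * B = 1 + a i" using B by simp
    ultimately show ?thesis by (simp only: ln_one mult_zero_right add_0)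
  qed
  have pos: "1 + a i > 0" if "i \<in> I" for i using a[OF that] by simp
  have "real D * ln (1 + B) \<le> (sum a I / B) * ln (1 + B)"
    using S B by (intro mult_right_mono) (auto simp: field_simps)
  also have "\<dots> = (\<Sum>i\<in>I. a i / B * ln (1 + B))" by (simp add: sum_divide_distrib sum_distrib_right)
  also have "\<dots> \<le> (\<Sum>i\<in>I. ln (1 + a i))" by (intro sum_mono l)
  also have "\<dots> = ln (\<Prod>i\<in>I. 1 + a i)" using fin pos by (subst ln_prod) force+
  finally have "ln ((1 + B) ^ D) \<le> ln (\<Prod>i\<in>I. 1 + a i)" using B by (simp add: ln_realpow)
  moreover have "(\<Prod>i\<in>I. 1 + a i) > 0" using a by (intro prod_pos) (auto intro: add_pos_nonneg)
  ultimately show ?thesis using B by (subst (asm) ln_le_cancel_iff) auto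
qed

text \<open>Newton's identities, from the logarithmic derivative of the product as a formal power
  series: a factor 1 - c X contributes - c / (1 - c X), whose coefficients are the powers of c up to
  sign.\<close>

lemma newton_coeff_recursion:
  fixes b :: "nat \<Rightarrow> real"
  shows "real (Suc r) * coeff (\<Prod>i=1..N. [:1, - b i:]) (Suc r) =
    - (\<Sum>j\<le>r. (\<Sum>i=1..N. b i ^ Suc j) * coeff (\<Prod>i=1..N. [:1, - b i:]) (r - j))"
proof -
  define T where "T c = Abs_fps (\<lambda>j. c ^ Suc j :: real)" for c
  define F where "F N = fps_of_poly (\<Prod>i=1..N. [:1, - b i:])" for N
  define S where "S N = Abs_fps (\<lambda>j. \<Sum>i=1..N. b i ^ Suc j)" for N
  have T: "(1 - fps_const c * fps_X) * T c = fps_const c" for c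
  proof (rule fps_ext)
    fix j show "fps_nth ((1 - fps_const c * fps_X) * T c) j = fps_nth (fps_const c) j"
      by (cases j) (simp_all add: T_def left_diff_distrib mult.assoc)
  qed
  have "fps_deriv (F N) = - (S N * F N)" for N
  proof (induction N)
    case 0
    have "S 0 = 0" by (rule fps_ext) (simp add: S_def)
    then show ?case by (simp add: F_def)
  next
    case (Suc N)
    let ?L = "1 - fps_const (b (Suc N)) * fps_X :: real fps"
    have "fps_of_poly [:1, - b (Suc N):] = ?L" by (simp add: fps_of_poly_linear')
    then have F: "F (Suc N) = ?L * F N"
      by (simp add: F_def prod.nat_ivl_Suc' fps_of_poly_mult)
    have S: "S (Suc N) = S N + T (b (Suc N))"
      by (rule fps_ext) (simp add: S_def T_def)
    have "fps_deriv (F (Suc N)) = - (fps_const (b (Suc N)) * F N) + ?L * fps_deriv (F N)"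
      unfolding F by (simp add: algebra_simps)
    also have "\<dots> = - ((?L * T (b (Suc N))) * F N) - ?L * (S N * F N)" unfolding T Suc.IH by simp
    also have "\<dots> = - (S (Suc N) * F (Suc N))" unfolding F S by (simp add: algebra_simps)
    finally show ?case .
  qed
  from arg_cong[OF this[of N], of "\<lambda>f. fps_nth f r"]
  have "of_nat (Suc r) * fps_nth (F N) (Suc r) = - (\<Sum>j=0..r. fps_nth (S N) j * fps_nth (F N) (r - j))"
    by (simp add: fps_mult_nth)
  then show ?thesis by (simp add: F_def S_def atMost_atLeast0)
qed

text \<open>The numbers He_r(s) / r! are the coefficients of exp(s z - z^2 / 2), and this is the
  recursion given by its logarithmic derivative s - z. The case distinction avoids the truncated
  index r - 1 at r = 0.\<close>

lemma hermite_He_Suc_fact: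
  "real (Suc r) * (hermite_He (Suc r) s / fact (Suc r)) =
    s * (hermite_He r s / fact r) - (if r = 0 then 0 else hermite_He (r - 1) s / fact (r - 1))"
proof (cases r)
  case (Suc q)
  have "real (Suc r) * (hermite_He (Suc r) s / fact (Suc r)) = hermite_He (Suc r) s / fact r"
    by (simp del: hermite_He.simps of_nat_Suc)
  also have "\<dots> = s * (hermite_He r s / fact r) - real r * hermite_He q s / fact r"
    unfolding Suc by (simp add: diff_divide_distrib)
  also have "real r * hermite_He q s / fact r = hermite_He q s / fact q"
    unfolding Suc by (simp del: of_nat_Suc)
  finally show ?thesis using Suc by simp
qed simp

text \<open>A triangular array whose rescaled power sums of order 1 and 2 converge. For bounded
  entries all higher power sums then vanish in the limit, so these two determine the limit of the
  product of the factors 1 - b z. The sign of \<open>s\<close> is chosen such that this limit is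
  exp(s z - z^2 / 2).\<close>

locale scaling =
  fixes N :: "nat \<Rightarrow> nat" and b :: "nat \<Rightarrow> nat \<Rightarrow> real" and \<eta> :: "nat \<Rightarrow> real" and M s :: real
  assumes bound: "\<And>n i. i \<in> {1..N n} \<Longrightarrow> \<bar>b n i\<bar> \<le> M"
    and eta_nonneg: "\<And>n. \<eta> n \<ge> 0"
    and eta: "\<eta> \<longlonglongrightarrow> 0"
    and first: "(\<lambda>n. \<eta> n * (\<Sum>i=1..N n. b n i)) \<longlonglongrightarrow> - s"
    and second: "(\<lambda>n. (\<eta> n)\<^sup>2 * (\<Sum>i=1..N n. (b n i)\<^sup>2)) \<longlonglongrightarrow> 1"
begin

definition Q :: "nat \<Rightarrow> complex \<Rightarrow> complex" where
  "Q n z = (\<Prod>i=1..N n. 1 - of_real (b n i) * z)"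

lemma M_nonneg: "M \<ge> 0"
proof (rule ccontr)
  assume "\<not> M \<ge> 0"
  then have "N n = 0" for n using bound[of 1 n] by (cases "N n") auto
  then have "(\<lambda>n. 0) \<longlonglongrightarrow> (1::real)" using second by simp
  then show False by (simp add: LIMSEQ_const_iff)
qed

lemma eventually_small: "\<delta> > 0 \<Longrightarrow> eventually (\<lambda>n. \<forall>i\<in>{1..N n}. \<bar>b n i * \<eta> n\<bar> \<le> \<delta>) sequentially"
proof -
  assume \<delta>: "\<delta> > 0"
  have "(\<lambda>n. M * \<eta> n) \<longlonglongrightarrow> M * 0" by (intro tendsto_intros eta)
  then have "eventually (\<lambda>n. M * \<eta> n < \<delta>) sequentially" using \<delta> by (simp add: order_tendstoD(2))
  then show ?thesis
  proof eventually_elim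
    case (elim n)
    show ?case
    proof
      fix i assume "i \<in> {1..N n}"
      then have "\<bar>b n i * \<eta> n\<bar> \<le> M * \<eta> n"
        unfolding abs_mult using bound eta_nonneg[of n] by (simp add: mult_right_mono)
      then show "\<bar>b n i * \<eta> n\<bar> \<le> \<delta>" using elim by simp
    qed
  qed
qed

text \<open>The logarithm of each factor is expanded to second order. The cubic remainders together
  are at most a constant times \<open>\<eta> n\<close> times the second power sum, hence
  negligible.\<close>

lemma Q_tendsto: "(\<lambda>n. Q n (of_real (\<eta> n) * \<zeta>)) \<longlonglongrightarrow> exp (of_real s * \<zeta> - \<zeta>\<^sup>2 / 2)"
proof -
  define w where "w n i = - (of_real (b n i) * (of_real (\<eta> n) * \<zeta>))" for n i
  define E where "E n = (\<Sum>i=1..N n. ln (1 + w n i) - w n i + (w n i)\<^sup>2 / 2)" for n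
  \<comment> \<open>With this threshold every argument has modulus at most 1/2, as the expansion of
    the logarithm requires; the added 1 covers \<open>\<zeta> = 0\<close>.\<close>
  let ?\<delta> = "1 / (2 * (norm \<zeta> + 1))"
  have ev: "eventually (\<lambda>n. \<forall>i\<in>{1..N n}. norm (w n i) \<le> 1 / 2) sequentially"
    using eventually_small[of ?\<delta>]
  proof (rule eventually_mono)
    show "?\<delta> > 0" using norm_ge_zero[of \<zeta>] by (simp add: add_nonneg_pos)
    fix n assume *: "\<forall>i\<in>{1..N n}. \<bar>b n i * \<eta> n\<bar> \<le> ?\<delta>"
    show "\<forall>i\<in>{1..N n}. norm (w n i) \<le> 1 / 2"
    proof
      fix i assume "i \<in> {1..N n}"
      then have "\<bar>b n i * \<eta> n\<bar> * norm \<zeta> \<le> ?\<delta> * (norm \<zeta> + 1)" using * by (intro mult_mono) auto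
      also have "\<dots> = 1 / 2" using norm_ge_zero[of \<zeta>] by (simp add: field_simps add_nonneg_eq_0_iff)
      finally show "norm (w n i) \<le> 1 / 2" by (simp add: w_def norm_mult abs_mult mult.assoc)
    qed
  qed
  have Ebound: "eventually (\<lambda>n. norm (E n) \<le> 2 * (M * norm \<zeta> ^ 3) * (\<eta> n * ((\<eta> n)\<^sup>2 * (\<Sum>i=1..N n. (b n i)\<^sup>2)))) sequentially"
    using ev
  proof eventually_elim
    case (elim n)
    have "norm (E n) \<le> (\<Sum>i=1..N n. 2 * norm (w n i) ^ 3)"
      unfolding E_def by (rule sum_norm_le) (use elim in \<open>auto intro: Ln_approx_quadratic\<close>)
    also have "\<dots> \<le> (\<Sum>i=1..N n. 2 * (M * norm \<zeta> ^ 3) * (\<eta> n * ((\<eta> n)\<^sup>2 * (b n i)\<^sup>2)))"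
    proof (rule sum_mono)
      fix i assume i: "i \<in> {1..N n}"
      have "norm (w n i) ^ 3 = \<bar>b n i\<bar> * ((b n i)\<^sup>2 * ((\<eta> n)^3 * norm \<zeta> ^ 3))"
        unfolding w_def norm_minus_cancel norm_mult norm_of_real using eta_nonneg[of n]
        by (simp add: power3_eq_cube power2_eq_square abs_mult_self mult_ac flip: abs_mult)
      also have "\<dots> \<le> M * ((b n i)\<^sup>2 * ((\<eta> n)^3 * norm \<zeta> ^ 3))"
        using bound[OF i] eta_nonneg[of n] by (intro mult_right_mono) auto
      finally show "2 * norm (w n i) ^ 3 \<le> 2 * (M * norm \<zeta> ^ 3) * (\<eta> n * ((\<eta> n)\<^sup>2 * (b n i)\<^sup>2))"
        by (simp add: power3_eq_cube power2_eq_square mult_ac)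
    qed
    finally show ?case by (simp add: sum_distrib_left)
  qed
  have "(\<lambda>n. 2 * (M * norm \<zeta> ^ 3) * (\<eta> n * ((\<eta> n)\<^sup>2 * (\<Sum>i=1..N n. (b n i)\<^sup>2)))) \<longlonglongrightarrow> 2 * (M * norm \<zeta> ^ 3) * (0 * 1)"
    by (intro tendsto_mult tendsto_const eta second)
  then have E0: "E \<longlonglongrightarrow> 0" using Lim_null_comparison[OF Ebound] by simp
  have "(\<lambda>n. of_real (- (\<eta> n * (\<Sum>i=1..N n. b n i))) * \<zeta> - of_real ((\<eta> n)\<^sup>2 * (\<Sum>i=1..N n. (b n i)\<^sup>2)) * (\<zeta>\<^sup>2 / 2) + E n)
    \<longlonglongrightarrow> of_real (- (- s)) * \<zeta> - of_real 1 * (\<zeta>\<^sup>2 / 2) + 0"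
    by (intro tendsto_intros first second E0)
  then have lim: "(\<lambda>n. exp (of_real (- (\<eta> n * (\<Sum>i=1..N n. b n i))) * \<zeta> - of_real ((\<eta> n)\<^sup>2 * (\<Sum>i=1..N n. (b n i)\<^sup>2)) * (\<zeta>\<^sup>2 / 2) + E n))
    \<longlonglongrightarrow> exp (of_real s * \<zeta> - \<zeta>\<^sup>2 / 2)"
    by (intro tendsto_exp) simp
  show ?thesis
  proof (rule Lim_transform_eventually[OF lim])
    show "eventually (\<lambda>n. exp (of_real (- (\<eta> n * (\<Sum>i=1..N n. b n i))) * \<zeta> - of_real ((\<eta> n)\<^sup>2 * (\<Sum>i=1..N n. (b n i)\<^sup>2)) * (\<zeta>\<^sup>2 / 2) + E n)
      = Q n (of_real (\<eta> n) * \<zeta>)) sequentially"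
      using ev
    proof eventually_elim
      case (elim n)
      have nz: "1 + w n i \<noteq> 0" if "i \<in> {1..N n}" for i
      proof
        assume "1 + w n i = 0"
        then have "norm (w n i) = 1" by (metis add_eq_0_iff norm_minus_cancel norm_one)
        then show False using bspec[OF elim that] by simp
      qed
      have "of_real (- (\<eta> n * (\<Sum>i=1..N n. b n i))) * \<zeta> - of_real ((\<eta> n)\<^sup>2 * (\<Sum>i=1..N n. (b n i)\<^sup>2)) * (\<zeta>\<^sup>2 / 2) =
          (\<Sum>i=1..N n. w n i - (w n i)\<^sup>2 / 2)"
        unfolding sum_subtractf
        by (simp add: w_def sum_distrib_left sum_distrib_right sum_divide_distrib sum_negf power_mult_distrib mult_ac)
      then have "of_real (- (\<eta> n * (\<Sum>i=1..N n. b n i))) * \<zeta> - of_real ((\<eta> n)\<^sup>2 * (\<Sum>i=1..N n. (b n i)\<^sup>2)) * (\<zeta>\<^sup>2 / 2) + E n =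
          (\<Sum>i=1..N n. ln (1 + w n i))"
        unfolding E_def by (simp add: sum.distrib[symmetric])
      then have "exp (of_real (- (\<eta> n * (\<Sum>i=1..N n. b n i))) * \<zeta> - of_real ((\<eta> n)\<^sup>2 * (\<Sum>i=1..N n. (b n i)\<^sup>2)) * (\<zeta>\<^sup>2 / 2) + E n) =
          (\<Prod>i=1..N n. exp (ln (1 + w n i)))" by (simp only: exp_sum[OF finite_atLeastAtMost])
      also have "\<dots> = (\<Prod>i=1..N n. 1 - of_real (b n i) * (of_real (\<eta> n) * \<zeta>))"
      proof (rule prod.cong[OF refl])
        fix i assume "i \<in> {1..N n}"
        then show "exp (ln (1 + w n i)) = 1 - of_real (b n i) * (of_real (\<eta> n) * \<zeta>)"
          by (simp only: exp_Ln[OF nz]) (simp add: w_def)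
      qed
      finally show ?case by (simp add: Q_def)
    qed
  qed
qed

lemma power_sums_tendsto:
  "(\<lambda>n. \<eta> n ^ Suc j * (\<Sum>i=1..N n. b n i ^ Suc j)) \<longlonglongrightarrow> (if j = 0 then - s else if j = 1 then 1 else 0)"
proof -
  consider "j = 0" | "j = 1" | m where "j = Suc (Suc m)" by (metis One_nat_def not0_implies_Suc)
  then show ?thesis
  proof cases
    case 1 then show ?thesis using first by simp
  next
    case 2 then show ?thesis using second by (simp add: power2_eq_square eval_nat_numeral)
  next
    case (3 m)
    \<comment> \<open>For exponent at least 3, all but two of the factors b in each summand are
      bounded by \<open>M\<close>, and their share of the powers of \<open>\<eta>\<close> tends to
      0.\<close>
    have "norm (\<eta> n ^ Suc j * (\<Sum>i=1..N n. b n i ^ Suc j)) \<le> (M * \<eta> n) ^ Suc m * ((\<eta> n)\<^sup>2 * (\<Sum>i=1..N n. (b n i)\<^sup>2))" for n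
    proof -
      have "norm (\<Sum>i=1..N n. b n i ^ Suc j) \<le> (\<Sum>i=1..N n. M ^ Suc m * (b n i)\<^sup>2)"
      proof (rule sum_norm_le)
        fix i assume i: "i \<in> {1..N n}"
        have "Suc j = Suc m + 2" using 3 by simp
        then have "norm (b n i ^ Suc j) = \<bar>b n i\<bar> ^ Suc m * (b n i)\<^sup>2"
          by (simp only: power_add) (simp add: abs_mult power_abs)
        also have "\<dots> \<le> M ^ Suc m * (b n i)\<^sup>2" using bound[OF i] by (intro mult_right_mono power_mono) auto
        finally show "norm (b n i ^ Suc j) \<le> M ^ Suc m * (b n i)\<^sup>2" .
      qed
      then have "norm (\<eta> n ^ Suc j * (\<Sum>i=1..N n. b n i ^ Suc j)) \<le> \<eta> n ^ Suc j * (\<Sum>i=1..N n. M ^ Suc m * (b n i)\<^sup>2)"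
        unfolding norm_mult using eta_nonneg[of n] by (intro mult_mono) (auto simp: norm_power)
      also have "\<eta> n ^ Suc j * (\<Sum>i=1..N n. M ^ Suc m * (b n i)\<^sup>2) =
          \<eta> n ^ Suc m * (\<eta> n)\<^sup>2 * (\<Sum>i=1..N n. M ^ Suc m * (b n i)\<^sup>2)"
        using 3 by (simp add: power2_eq_square)
      also have "\<dots> = (M * \<eta> n) ^ Suc m * ((\<eta> n)\<^sup>2 * (\<Sum>i=1..N n. (b n i)\<^sup>2))"
        by (simp only: sum_distrib_left[symmetric] power_mult_distrib mult_ac)
      finally show ?thesis .
    qed
    then have b: "eventually (\<lambda>n. norm (\<eta> n ^ Suc j * (\<Sum>i=1..N n. b n i ^ Suc j)) \<le>
      (M * \<eta> n) ^ Suc m * ((\<eta> n)\<^sup>2 * (\<Sum>i=1..N n. (b n i)\<^sup>2))) sequentially" by simp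
    have "(\<lambda>n. (M * \<eta> n) ^ Suc m * ((\<eta> n)\<^sup>2 * (\<Sum>i=1..N n. (b n i)\<^sup>2))) \<longlonglongrightarrow> (M * 0) ^ Suc m * 1"
      by (intro tendsto_intros eta second)
    then show ?thesis using Lim_null_comparison[OF b] 3 by simp
  qed
qed

text \<open>Newton's identities pass to the limit term by term. Of the power sums only orders 1 and
  2 survive, and what remains is the recursion for He_r(s) / r!.\<close>

lemma coeff_tendsto:
  "(\<lambda>n. coeff (\<Prod>i=1..N n. [:1, - b n i:]) r * \<eta> n ^ r) \<longlonglongrightarrow> hermite_He r s / fact r"
proof (induction r rule: less_induct)
  case (less r)
  let ?q = "\<lambda>n r. coeff (\<Prod>i=1..N n. [:1, - b n i:]) r"
  show ?case
  proof (cases r)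
    case 0
    have "?q n 0 = 1" for n by (simp add: coeff_0_prod_list poly_0_coeff_0[symmetric] poly_prod)
    then show ?thesis using 0 by simp
  next
    case (Suc q)
    let ?L = "\<lambda>j. if j = 0 then - s else if j = 1 then 1 else (0::real)"
    have eq: "real (Suc q) * (?q n (Suc q) * \<eta> n ^ Suc q) =
       - (\<Sum>j\<le>q. (\<eta> n ^ Suc j * (\<Sum>i=1..N n. b n i ^ Suc j)) * (?q n (q - j) * \<eta> n ^ (q - j)))" for n
    proof -
      have "real (Suc q) * (?q n (Suc q) * \<eta> n ^ Suc q) = (real (Suc q) * ?q n (Suc q)) * \<eta> n ^ Suc q" by (simp only: mult.assoc)
      also have "\<dots> = - (\<Sum>j\<le>q. (\<Sum>i=1..N n. b n i ^ Suc j) * ?q n (q - j) * \<eta> n ^ Suc q)"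
      proof -
        have "(- (\<Sum>j\<le>q. c j)) * e = - (\<Sum>j\<le>q. c j * e)" for c :: "nat \<Rightarrow> real" and e by (simp add: sum_distrib_right)
        then show ?thesis unfolding newton_coeff_recursion .
      qed
      also have "(\<Sum>j\<le>q. (\<Sum>i=1..N n. b n i ^ Suc j) * ?q n (q - j) * \<eta> n ^ Suc q) =
         (\<Sum>j\<le>q. (\<eta> n ^ Suc j * (\<Sum>i=1..N n. b n i ^ Suc j)) * (?q n (q - j) * \<eta> n ^ (q - j)))"
      proof (rule sum.cong[OF refl])
        fix j assume "j \<in> {..q}"
        then have "\<eta> n ^ Suc q = \<eta> n ^ Suc j * \<eta> n ^ (q - j)" by (simp add: power_add[symmetric] flip: power_Suc)
        then show "(\<Sum>i=1..N n. b n i ^ Suc j) * ?q n (q - j) * \<eta> n ^ Suc q =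
          (\<eta> n ^ Suc j * (\<Sum>i=1..N n. b n i ^ Suc j)) * (?q n (q - j) * \<eta> n ^ (q - j))" by (simp only: mult_ac)
      qed
      finally show ?thesis .
    qed
    have "(\<lambda>n. real (Suc q) * (?q n (Suc q) * \<eta> n ^ Suc q)) \<longlonglongrightarrow> - (\<Sum>j\<le>q. ?L j * (hermite_He (q - j) s / fact (q - j)))"
      unfolding eq by (intro tendsto_minus tendsto_sum tendsto_mult power_sums_tendsto less.IH) (use Suc in auto)
    also have "(\<Sum>j\<le>q. ?L j * (hermite_He (q - j) s / fact (q - j))) =
       - (s * (hermite_He q s / fact q)) + (if q = 0 then 0 else hermite_He (q - 1) s / fact (q - 1))"
    proof (cases q)
      case (Suc p)
      have "(\<Sum>j\<le>Suc p. ?L j * (hermite_He (Suc p - j) s / fact (Suc p - j))) =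
          - s * (hermite_He (Suc p) s / fact (Suc p)) + (\<Sum>j\<le>p. (if j = 0 then 1 else 0) * (hermite_He (p - j) s / fact (p - j)))"
        unfolding sum.atMost_Suc_shift by (intro arg_cong2[where f = "(+)"] sum.cong refl) auto
      also have "(\<Sum>j\<le>p. (if j = 0 then 1 else 0) * (hermite_He (p - j) s / fact (p - j))) =
          (\<Sum>j\<le>p. if j = 0 then hermite_He (p - j) s / fact (p - j) else 0)" by (rule sum.cong) auto
      also have "\<dots> = hermite_He p s / fact p" by (subst sum.delta) auto
      finally show ?thesis using Suc by simp
    qed simp
    also have "- \<dots> = real (Suc q) * (hermite_He (Suc q) s / fact (Suc q))"
      unfolding hermite_He_Suc_fact by simp
    finally have "(\<lambda>n. real (Suc q) * (?q n (Suc q) * \<eta> n ^ Suc q) / real (Suc q)) \<longlonglongrightarrow>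
        real (Suc q) * (hermite_He (Suc q) s / fact (Suc q)) / real (Suc q)"
      by (intro tendsto_divide tendsto_const) auto
    then show ?thesis unfolding Suc by (simp del: of_nat_Suc hermite_He.simps fact_Suc power_Suc)
  qed
qed

end

lemma norm_Complex_one: "norm (Complex 1 u) = sqrt (1 + u\<^sup>2)"
  by (simp add: complex_norm)

lemma Complex_one_nonzero: "Complex 1 u \<noteq> 0"
  by (simp add: complex_eq_iff)

lemma continuous_Complex_one: "continuous_on A (\<lambda>u. Complex 1 u)"
  by (subst complex_eq) (intro continuous_intros)

lemma norm_Complex_one_powi_le: "norm (Complex 1 u powi e) \<le> sqrt (1 + u\<^sup>2) ^ nat \<bar>e\<bar>"
proof -
  have "1 \<le> sqrt (1 + u\<^sup>2)" by simp
  then have "sqrt (1 + u\<^sup>2) powi e \<le> sqrt (1 + u\<^sup>2) powi \<bar>e\<bar>" by (intro power_int_increasing) auto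
  also have "\<dots> = sqrt (1 + u\<^sup>2) ^ nat \<bar>e\<bar>" by (simp add: power_int_def)
  finally show ?thesis by (simp add: norm_power_int norm_Complex_one)
qed

context scaling
begin

text \<open>With t = b \<open>\<eta>\<close> and |t| <= 1, the squared modulus of 1 - t (1 + iu) is
  (1 - t)^2 + t^2 u^2, which is at least (1 - t)^2 (1 + t^2 u^2 / 4). The first factors multiply to
  |Q(\<open>\<eta>\<close>)|^2, which stays away from 0; the second ones grow like a power of 1 +
  u^2.\<close>

lemma integrand_bound:
  "\<exists>C. eventually (\<lambda>n. \<forall>u. norm (Complex 1 u powi e / Q n (of_real (\<eta> n) * Complex 1 u)) \<le> C / (1 + u\<^sup>2)) sequentially"
proof -
  define m where "m = nat \<bar>e\<bar>"
  \<comment> \<open>The squared modulus of the power of 1 + iu is at most (1 + u^2)^m; two further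
    powers in the denominator leave the square of an integrable majorant.\<close>
  define D where "D = m + 2"
  \<comment> \<open>Half of exp(s - 1/2), the limit of |Q(\<open>\<eta>\<close>)|.\<close>
  define c where "c = exp (s - 1 / 2) / 2"
  have c: "c > 0" by (simp add: c_def)
  define C where "C = sqrt ((8 * real D) ^ D) / c"
  have D1: "real D \<ge> 1" by (simp add: D_def)
  have "(\<lambda>n. norm (Q n (of_real (\<eta> n) * 1))) \<longlonglongrightarrow> norm (exp (of_real s * 1 - 1\<^sup>2 / 2 :: complex))"
    by (intro tendsto_norm Q_tendsto)
  moreover have "norm (exp (of_real s * 1 - 1\<^sup>2 / 2 :: complex)) > c" by (simp add: c_def)
  ultimately have ev1: "eventually (\<lambda>n. norm (Q n (of_real (\<eta> n))) > c) sequentially"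
    using order_tendstoD(1) by fastforce
  have ev2: "eventually (\<lambda>n. (\<eta> n)\<^sup>2 * (\<Sum>i=1..N n. (b n i)\<^sup>2) > 1 / 2) sequentially"
    by (rule order_tendstoD(1)[OF second]) simp
  have ev3: "eventually (\<lambda>n. \<forall>i\<in>{1..N n}. \<bar>b n i * \<eta> n\<bar> \<le> 1 / (2 * real D)) sequentially"
    by (rule eventually_small) (use D1 in simp)
  have "eventually (\<lambda>n. \<forall>u. norm (Complex 1 u powi e / Q n (of_real (\<eta> n) * Complex 1 u)) \<le> C / (1 + u\<^sup>2)) sequentially"
    using ev1 ev2 ev3
  proof eventually_elim
    case (elim n)
    show ?case
    proof
      fix u :: real
      define t where "t i = b n i * \<eta> n" for i
      \<comment> \<open>Since |t_i| <= 1 / (2 D) and |t_i| <= 1, each a_i is at most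
        \<open>B\<close>; since the second power sum exceeds 1/2, the a_i sum to at least u^2 / 8 =
        D B.\<close>
      define B where "B = u\<^sup>2 / (8 * real D)"
      define a where "a i = (t i)\<^sup>2 * u\<^sup>2 / 4" for i
      have t: "\<bar>t i\<bar> \<le> 1 / (2 * real D)" "\<bar>t i\<bar> \<le> 1" if "i \<in> {1..N n}" for i
      proof -
        show "\<bar>t i\<bar> \<le> 1 / (2 * real D)" using elim(3) that by (simp add: t_def)
        also have "\<dots> \<le> 1" using D1 by simp
        finally show "\<bar>t i\<bar> \<le> 1" .
      qed
      have factor: "(1 - t i)\<^sup>2 * (1 + a i) \<le> (norm (1 - of_real (b n i) * (of_real (\<eta> n) * Complex 1 u)))\<^sup>2"
        if i: "i \<in> {1..N n}" for i
      proof -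
        have "1 - of_real (b n i) * (of_real (\<eta> n) * Complex 1 u) = Complex (1 - t i) (- (t i * u))"
          by (simp add: complex_eq_iff t_def)
        then have "(norm (1 - of_real (b n i) * (of_real (\<eta> n) * Complex 1 u)))\<^sup>2 = (1 - t i)\<^sup>2 + (t i)\<^sup>2 * u\<^sup>2"
          by (simp add: cmod_power2 power_mult_distrib)
        moreover have "(1 - t i)\<^sup>2 \<le> 4"
        proof -
          have "\<bar>1 - t i\<bar> \<le> 2" using t(2)[OF i] by linarith
          then have "(1 - t i)\<^sup>2 \<le> 2\<^sup>2" by (metis abs_le_square_iff abs_numeral)
          then show ?thesis by simp
        qed
        then have "(1 - t i)\<^sup>2 * ((t i)\<^sup>2 * u\<^sup>2) \<le> 4 * ((t i)\<^sup>2 * u\<^sup>2)" by (intro mult_right_mono) auto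
        ultimately show ?thesis by (simp add: a_def algebra_simps)
      qed
      have "(1 + B) ^ D \<le> (\<Prod>i=1..N n. 1 + a i)"
      proof (rule prod_ge_power_of_sum)
        fix i assume i: "i \<in> {1..N n}"
        have "(t i)\<^sup>2 \<le> (1 / (2 * real D)) * 1"
          unfolding power2_eq_square using t[OF i] by (subst abs_mult_self_eq[symmetric]) (intro mult_mono, auto)
        then have "(t i)\<^sup>2 * u\<^sup>2 / 4 \<le> (1 / (2 * real D)) * u\<^sup>2 / 4" by (intro divide_right_mono mult_right_mono) auto
        then show "0 \<le> a i \<and> a i \<le> B" by (simp add: a_def B_def)
      next
        have "real D * B = (1 / 2) * (u\<^sup>2 / 4)" using D1 by (simp add: B_def)
        also have "\<dots> \<le> ((\<eta> n)\<^sup>2 * (\<Sum>i=1..N n. (b n i)\<^sup>2)) * (u\<^sup>2 / 4)"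
          using elim(2) by (intro mult_right_mono) auto
        also have "\<dots> = sum a {1..N n}"
          by (simp add: a_def t_def sum_distrib_left sum_distrib_right sum_divide_distrib power_mult_distrib mult_ac)
        finally show "real D * B \<le> sum a {1..N n}" .
      qed (auto simp: B_def)
      moreover have "((1 + u\<^sup>2) / (8 * real D)) ^ D \<le> (1 + B) ^ D"
        by (intro power_mono) (use D1 in \<open>auto simp: B_def field_simps\<close>)
      ultimately have P: "((1 + u\<^sup>2) / (8 * real D)) ^ D \<le> (\<Prod>i=1..N n. 1 + a i)" by linarith
      have Qr: "Q n (of_real (\<eta> n)) = of_real (\<Prod>i=1..N n. 1 - t i)" by (simp add: Q_def t_def)
      have "c\<^sup>2 * ((1 + u\<^sup>2) / (8 * real D)) ^ D \<le> (norm (Q n (of_real (\<eta> n))))\<^sup>2 * (\<Prod>i=1..N n. 1 + a i)"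
        using P elim(1) c by (intro mult_mono power_mono) auto
      also have "\<dots> = (\<Prod>i=1..N n. (1 - t i)\<^sup>2 * (1 + a i))"
        unfolding Qr norm_of_real power2_abs prod.distrib prod_power_distrib ..
      also have "\<dots> \<le> (\<Prod>i=1..N n. (norm (1 - of_real (b n i) * (of_real (\<eta> n) * Complex 1 u)))\<^sup>2)"
        by (intro prod_mono conjI factor) (auto simp: a_def)
      also have "\<dots> = (norm (Q n (of_real (\<eta> n) * Complex 1 u)))\<^sup>2"
        by (simp add: Q_def prod_norm[symmetric] prod_power_distrib)
      finally have low: "c\<^sup>2 * ((1 + u\<^sup>2) / (8 * real D)) ^ D \<le> (norm (Q n (of_real (\<eta> n) * Complex 1 u)))\<^sup>2" .
      have w: "1 + u\<^sup>2 > 0" by (simp add: add_pos_nonneg)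
      have pos: "c\<^sup>2 * ((1 + u\<^sup>2) / (8 * real D)) ^ D > 0" using c D1 w by (intro mult_pos_pos zero_less_power divide_pos_pos) auto
      have "(norm (Complex 1 u powi e))\<^sup>2 \<le> (sqrt (1 + u\<^sup>2) ^ m)\<^sup>2"
        unfolding m_def by (intro power_mono norm_Complex_one_powi_le) simp
      also have "\<dots> = (1 + u\<^sup>2) ^ m" using w by (simp add: power_mult[symmetric] mult.commute[of m] power_mult)
      finally have up: "(norm (Complex 1 u powi e))\<^sup>2 \<le> (1 + u\<^sup>2) ^ m" .
      have "(norm (Complex 1 u powi e / Q n (of_real (\<eta> n) * Complex 1 u)))\<^sup>2 \<le>
          (1 + u\<^sup>2) ^ m / (c\<^sup>2 * ((1 + u\<^sup>2) / (8 * real D)) ^ D)"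
        unfolding norm_divide power_divide[of "norm (Complex 1 u powi e)"]
        by (rule frac_le) (use up low pos w in \<open>simp_all only: zero_le_power less_imp_le\<close>)
      also have "\<dots> = (C / (1 + u\<^sup>2))\<^sup>2"
      proof -
        have "(1 + u\<^sup>2) ^ D = (1 + u\<^sup>2) ^ m * (1 + u\<^sup>2)\<^sup>2" by (simp only: D_def power_add)
        moreover have "C\<^sup>2 = (8 * real D) ^ D / c\<^sup>2" by (simp add: C_def power_divide)
        ultimately show ?thesis using w D1 c by (simp add: power_divide field_simps)
      qed
      finally show "norm (Complex 1 u powi e / Q n (of_real (\<eta> n) * Complex 1 u)) \<le> C / (1 + u\<^sup>2)"
        by (rule power2_le_imp_le) (use c w in \<open>auto simp: C_def\<close>)
    qed
  qed
  then show ?thesis by blast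
qed

lemma moment_tendsto:
  "(\<lambda>n. LINT u|lborel. Complex 1 u powi e / Q n (of_real (\<eta> n) * Complex 1 u)) \<longlonglongrightarrow>
   (LINT u|lborel. Complex 1 u powi e * exp ((Complex 1 u)\<^sup>2 / 2 - of_real s * Complex 1 u))"
proof -
  obtain C where "eventually (\<lambda>n. \<forall>u. norm (Complex 1 u powi e / Q n (of_real (\<eta> n) * Complex 1 u)) \<le> C / (1 + u\<^sup>2)) sequentially"
    using integrand_bound by blast
  then obtain n0 where C: "\<And>n u. n \<ge> n0 \<Longrightarrow> norm (Complex 1 u powi e / Q n (of_real (\<eta> n) * Complex 1 u)) \<le> C / (1 + u\<^sup>2)"
    unfolding eventually_sequentially by blast
  have powi: "continuous_on UNIV (\<lambda>u. Complex 1 u powi e)"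
    by (intro continuous_intros continuous_Complex_one) (auto simp: Complex_one_nonzero)
  have meas: "(\<lambda>u. Complex 1 u powi e / Q n (of_real (\<eta> n) * Complex 1 u)) \<in> borel_measurable lborel" for n
  proof -
    have "continuous_on UNIV (\<lambda>u. Q n (of_real (\<eta> n) * Complex 1 u))"
      unfolding Q_def by (intro continuous_intros continuous_Complex_one)
    then show ?thesis using powi by (intro borel_measurable_divide) (auto intro: borel_measurable_continuous_onI)
  qed
  \<comment> \<open>The majorant holds only from \<open>n0\<close> on, so dominated convergence is
    applied to the shifted sequence.\<close>
  have "(\<lambda>n. LINT u|lborel. Complex 1 u powi e / Q (n + n0) (of_real (\<eta> (n + n0)) * Complex 1 u)) \<longlonglongrightarrow>
   (LINT u|lborel. Complex 1 u powi e * exp ((Complex 1 u)\<^sup>2 / 2 - of_real s * Complex 1 u))"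
  proof (rule integral_dominated_convergence[where w = "\<lambda>u. C * (1 / (1 + u\<^sup>2))"])
    show "(\<lambda>u. Complex 1 u powi e * exp ((Complex 1 u)\<^sup>2 / 2 - of_real s * Complex 1 u)) \<in> borel_measurable lborel"
    proof -
      have "continuous_on UNIV (\<lambda>u. Complex 1 u powi e * exp ((Complex 1 u)\<^sup>2 / 2 - of_real s * Complex 1 u))"
        by (intro continuous_intros continuous_Complex_one powi) auto
      then show ?thesis by (auto intro: borel_measurable_continuous_onI)
    qed
    show "integrable lborel (\<lambda>u. C * (1 / (1 + u\<^sup>2)))"
      by (intro integrable_mult_right integrable_inverse_1_plus_square)
    show "AE u in lborel. (\<lambda>n. Complex 1 u powi e / Q (n + n0) (of_real (\<eta> (n + n0)) * Complex 1 u)) \<longlonglongrightarrow>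
        Complex 1 u powi e * exp ((Complex 1 u)\<^sup>2 / 2 - of_real s * Complex 1 u)"
    proof (rule AE_I2)
      fix u
      have "(\<lambda>n. Complex 1 u powi e / Q n (of_real (\<eta> n) * Complex 1 u)) \<longlonglongrightarrow>
          Complex 1 u powi e / exp (of_real s * Complex 1 u - (Complex 1 u)\<^sup>2 / 2)"
        by (intro tendsto_intros Q_tendsto) simp
      also have "Complex 1 u powi e / exp (of_real s * Complex 1 u - (Complex 1 u)\<^sup>2 / 2) =
          Complex 1 u powi e * exp ((Complex 1 u)\<^sup>2 / 2 - of_real s * Complex 1 u)"
        by (simp only: divide_inverse exp_minus[symmetric] minus_diff_eq)
      finally show "(\<lambda>n. Complex 1 u powi e / Q (n + n0) (of_real (\<eta> (n + n0)) * Complex 1 u)) \<longlonglongrightarrow>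
        Complex 1 u powi e * exp ((Complex 1 u)\<^sup>2 / 2 - of_real s * Complex 1 u)"
        by (rule LIMSEQ_ignore_initial_segment)
    qed
    show "AE u in lborel. norm (Complex 1 u powi e / Q (n + n0) (of_real (\<eta> (n + n0)) * Complex 1 u)) \<le> C * (1 / (1 + u\<^sup>2))" for n
      using C[of "n + n0"] by simp
  qed (rule meas)
  then show ?thesis by (rule LIMSEQ_offset)
qed

end

section \<open>The joint array of the x_i and - 1 / y_j, and the substitution z = \<eta> (1 +
  iu)\<close>

definition joint :: "nat \<Rightarrow> (nat \<Rightarrow> real) \<Rightarrow> (nat \<Rightarrow> real) \<Rightarrow> nat \<Rightarrow> real" where
  "joint n x y i = (if i \<le> n then x i else - (1 / y (i - n)))"

lemma prod_joint:
  fixes F :: "real \<Rightarrow> 'a::comm_monoid_mult"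
  shows "(\<Prod>i=1..n + k. F (joint n x y i)) = (\<Prod>i=1..n. F (x i)) * (\<Prod>j=1..k. F (- (1 / y j)))"
proof -
  have "{1..n + k} = {1..n} \<union> {n + 1..n + k}" by auto
  then have "(\<Prod>i=1..n + k. F (joint n x y i)) = (\<Prod>i=1..n. F (joint n x y i)) * (\<Prod>i=n+1..n + k. F (joint n x y i))"
    by (simp add: prod.union_disjoint)
  also have "(\<Prod>i=1..n. F (joint n x y i)) = (\<Prod>i=1..n. F (x i))" by (rule prod.cong) (auto simp: joint_def)
  also have "(\<Prod>i=n+1..n + k. F (joint n x y i)) = (\<Prod>j=1..k. F (- (1 / y j)))"
    by (rule prod.reindex_bij_witness[of _ "\<lambda>j. j + n" "\<lambda>i. i - n"]) (auto simp: joint_def)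
  finally show ?thesis .
qed

lemma sum_joint:
  fixes F :: "real \<Rightarrow> real"
  shows "(\<Sum>i=1..n + k. F (joint n x y i)) = (\<Sum>i=1..n. F (x i)) + (\<Sum>j=1..k. F (- (1 / y j)))"
proof -
  have "{1..n + k} = {1..n} \<union> {n + 1..n + k}" by auto
  then have "(\<Sum>i=1..n + k. F (joint n x y i)) = (\<Sum>i=1..n. F (joint n x y i)) + (\<Sum>i=n+1..n + k. F (joint n x y i))"
    by (simp add: sum.union_disjoint)
  also have "(\<Sum>i=1..n. F (joint n x y i)) = (\<Sum>i=1..n. F (x i))" by (rule sum.cong) (auto simp: joint_def)
  also have "(\<Sum>i=n+1..n + k. F (joint n x y i)) = (\<Sum>j=1..k. F (- (1 / y j)))"
    by (rule sum.reindex_bij_witness[of _ "\<lambda>j. j + n" "\<lambda>i. i - n"]) (auto simp: joint_def)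
  finally show ?thesis .
qed

text \<open>Writing z + y_j as y_j (1 + z / y_j) costs the product of the \<open>y j\<close>; it
  appears in the coefficients and in the denominator of the moments and cancels. The powers of
  \<open>\<eta>\<close> are distributed so that the coefficient with index r carries
  \<open>\<eta> ^ r\<close>.\<close>

lemma line_kernel_rescaled:
  assumes y: "\<And>j. j \<in> {1..k} \<Longrightarrow> y j > 0" and \<eta>: "\<eta> > 0"
  shows "line_kernel \<eta> n k x y l l' = of_real (\<eta> powi (int l - int l')) *
    (\<Sum>r<l'. of_real (coeff (\<Prod>i=1..n + k. [:1, - joint n x y i:]) r * \<eta> ^ r) *
      (1 / (2 * pi) * (LINT u|lborel. Complex 1 u powi (int l - 1 + int r - int l') /
         (\<Prod>i=1..n + k. 1 - of_real (joint n x y i) * (of_real \<eta> * Complex 1 u)))))"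
proof -
  define Y where "Y = (\<Prod>j=1..k. y j)"
  have Y: "Y > 0" unfolding Y_def by (rule prod_pos) (rule y)
  let ?R = "\<lambda>z. \<Prod>i=1..n + k. 1 - of_real (joint n x y i) * z :: complex"
  have kf: "kfun n k x y z = of_real Y * ?R z" for z
  proof -
    have "(\<Prod>j=1..k. z + of_real (y j)) = (\<Prod>j=1..k. of_real (y j) * (1 - of_real (- (1 / y j)) * z))"
      by (rule prod.cong[OF refl]) (use y in \<open>force simp: field_simps\<close>)
    also have "\<dots> = of_real Y * (\<Prod>j=1..k. 1 - of_real (- (1 / y j)) * z)" by (simp only: prod.distrib Y_def of_real_prod)
    finally show ?thesis
      unfolding kfun_def prod_joint[of "\<lambda>b. 1 - of_real b * z"] by (simp only: mult_ac)
  qed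
  have kp: "coeff (kpoly n k x y) r = Y * coeff (\<Prod>i=1..n + k. [:1, - joint n x y i:]) r" for r
  proof -
    have "ypoly k y = (\<Prod>j=1..k. Polynomial.smult (y j) [:1, - (- (1 / y j)):])"
      unfolding ypoly_def by (rule prod.cong[OF refl]) (use y in force)
    then have "kpoly n k x y = Polynomial.smult Y (\<Prod>i=1..n + k. [:1, - joint n x y i:])"
      unfolding kpoly_def xpoly_def prod_joint[of "\<lambda>b. [:1, - b:]"] prod_smult Y_def
      by (simp only: mult_smult_right)
    then show ?thesis by simp
  qed
  have lm: "line_moment \<eta> n k x y e = of_real (\<eta> powi (e + 1) / Y) *
      (1 / (2 * pi) * (LINT u|lborel. Complex 1 u powi e / ?R (of_real \<eta> * Complex 1 u)))" for e
  proof -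
    have "(LINT u|lborel. Complex \<eta> u powi e / kfun n k x y (Complex \<eta> u)) =
        \<bar>\<eta>\<bar> *\<^sub>R (LINT u|lborel. Complex \<eta> (0 + \<eta> * u) powi e / kfun n k x y (Complex \<eta> (0 + \<eta> * u)))"
      by (rule lborel_integral_real_affine) (use \<eta> in simp)
    also have "(\<lambda>u. Complex \<eta> (0 + \<eta> * u) powi e / kfun n k x y (Complex \<eta> (0 + \<eta> * u))) =
        (\<lambda>u. of_real (\<eta> powi e / Y) * (Complex 1 u powi e / ?R (of_real \<eta> * Complex 1 u)))"
    proof
      fix u
      have c: "Complex \<eta> (0 + \<eta> * u) = of_real \<eta> * Complex 1 u" by (simp add: complex_eq_iff)
      show "Complex \<eta> (0 + \<eta> * u) powi e / kfun n k x y (Complex \<eta> (0 + \<eta> * u)) =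
        of_real (\<eta> powi e / Y) * (Complex 1 u powi e / ?R (of_real \<eta> * Complex 1 u))"
        unfolding c kf power_int_mult_distrib by (simp add: of_real_power_int)
    qed
    finally have I: "(LINT u|lborel. Complex \<eta> u powi e / kfun n k x y (Complex \<eta> u)) =
        \<bar>\<eta>\<bar> *\<^sub>R (of_real (\<eta> powi e / Y) * (LINT u|lborel. Complex 1 u powi e / ?R (of_real \<eta> * Complex 1 u)))"
      by (simp only: integral_mult_right_zero)
    show ?thesis
      unfolding line_moment_def I using \<eta> by (simp add: scaleR_conv_of_real power_int_add mult_ac)
  qed
  show ?thesis
    unfolding line_kernel_def sum_distrib_left
  proof (rule sum.cong[OF refl])
    fix r
    have "int l - 1 + int r - int l' + 1 = (int l - int l') + int r" by simp
    then have p: "\<eta> powi (int l - 1 + int r - int l' + 1) = \<eta> powi (int l - int l') * \<eta> ^ r"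
      using \<eta> by (simp only:) (simp add: power_int_add)
    show "of_real (coeff (kpoly n k x y) r) * line_moment \<eta> n k x y (int l - 1 + int r - int l') =
      of_real (\<eta> powi (int l - int l')) * (of_real (coeff (\<Prod>i=1..n + k. [:1, - joint n x y i:]) r * \<eta> ^ r) *
      (1 / (2 * pi) * (LINT u|lborel. Complex 1 u powi (int l - 1 + int r - int l') / ?R (of_real \<eta> * Complex 1 u))))"
      unfolding kp lm p using Y by simp
  qed
qed

text \<open>With z = 1 + iu this is 1 / (2 \<pi> i) times the integral of z^e exp(z^2 / 2 - s z)
  over the line Re z = 1. The abscissa 1 keeps negative powers away from 0 and yields decay exp(- s)
  in s.\<close>

definition gauss_moment :: "int \<Rightarrow> real \<Rightarrow> complex" where
  "gauss_moment e s = 1 / (2 * pi) *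
     (LINT u|lborel. Complex 1 u powi e * exp ((Complex 1 u)\<^sup>2 / 2 - of_real s * Complex 1 u))"

theorem line_kernel_tendsto:
  assumes sc: "scaling (\<lambda>n. p n + k n) (\<lambda>n. joint (p n) (x n) (y n)) \<eta> M s"
    and pos: "eventually (\<lambda>n. \<eta> n > 0 \<and> (\<forall>j\<in>{1..k n}. y n j > 0)) sequentially"
  shows "(\<lambda>n. of_real (\<eta> n powi (int l' - int l)) * line_kernel (\<eta> n) (p n) (k n) (x n) (y n) l l') \<longlonglongrightarrow>
    (\<Sum>r<l'. of_real (hermite_He r s / fact r) * gauss_moment (int l - 1 + int r - int l') s)"
proof -
  interpret scaling "\<lambda>n. p n + k n" "\<lambda>n. joint (p n) (x n) (y n)" \<eta> M s by (rule sc)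
  let ?e = "\<lambda>r. int l - 1 + int r - int l'"
  have lim: "(\<lambda>n. \<Sum>r<l'. of_real (coeff (\<Prod>i=1..p n + k n. [:1, - joint (p n) (x n) (y n) i:]) r * \<eta> n ^ r) *
      (1 / (2 * pi) * (LINT u|lborel. Complex 1 u powi ?e r / Q n (of_real (\<eta> n) * Complex 1 u)))) \<longlonglongrightarrow>
    (\<Sum>r<l'. of_real (hermite_He r s / fact r) * gauss_moment (?e r) s)"
    unfolding gauss_moment_def by (intro tendsto_intros coeff_tendsto moment_tendsto)
  show ?thesis
  proof (rule Lim_transform_eventually[OF lim])
    show "eventually (\<lambda>n. (\<Sum>r<l'. of_real (coeff (\<Prod>i=1..p n + k n. [:1, - joint (p n) (x n) (y n) i:]) r * \<eta> n ^ r) *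
      (1 / (2 * pi) * (LINT u|lborel. Complex 1 u powi ?e r / Q n (of_real (\<eta> n) * Complex 1 u)))) =
      of_real (\<eta> n powi (int l' - int l)) * line_kernel (\<eta> n) (p n) (k n) (x n) (y n) l l') sequentially"
      using pos
    proof eventually_elim
      case (elim n)
      then have \<eta>: "\<eta> n > 0" and y: "\<And>j. j \<in> {1..k n} \<Longrightarrow> y n j > 0" by auto
      have "\<eta> n powi (int l' - int l) * \<eta> n powi (int l - int l') = 1"
        using \<eta> power_int_add[of "\<eta> n" "int l' - int l" "int l - int l'"] by simp
      then have "complex_of_real (\<eta> n powi (int l' - int l)) * of_real (\<eta> n powi (int l - int l')) = 1"
        by (metis of_real_1 of_real_mult)
      then have c: "complex_of_real (\<eta> n powi (int l' - int l)) * (of_real (\<eta> n powi (int l - int l')) * S) = S" for S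
        by (simp only: mult.assoc[symmetric] mult_1)
      show ?case
        by (subst line_kernel_rescaled) (use y \<eta> in \<open>simp_all only: c Q_def\<close>)
    qed
  qed
qed

section \<open>Gaussian moments and the discrete Hermite kernel\<close>

lemma power_le_fact_exp: "0 \<le> v \<Longrightarrow> v ^ m \<le> fact m * exp (v :: real)"
proof -
  assume v: "0 \<le> v"
  have "(\<Sum>n\<in>{m}. v ^ n /\<^sub>R fact n) \<le> exp v"
    unfolding exp_def by (rule sum_le_suminf[OF summable_exp_generic]) (use v in auto)
  then show ?thesis by (simp add: field_simps)
qed

text \<open>From (v - 2)^2 >= 0 follows 4 v <= 5 + u^2, so the Gaussian absorbs exp(2 v) at the cost
  of \<open>exp 3\<close>. One factor exp(v) is the one in the statement, the other one dominates
  the power v^(m + 2).\<close>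

lemma gauss_decay:
  fixes u :: real
  defines "v \<equiv> sqrt (1 + u\<^sup>2)"
  shows "v ^ m * exp v * exp ((1 - u\<^sup>2) / 2) \<le> exp 3 * fact (m + 2) * (1 / (1 + u\<^sup>2))"
proof -
  have v: "v \<ge> 0" "v\<^sup>2 = 1 + u\<^sup>2" "v\<^sup>2 > 0" by (auto simp: v_def add_pos_nonneg)
  have "(v - 2)\<^sup>2 = v\<^sup>2 - 4 * v + 4" by (simp add: power2_eq_square algebra_simps)
  then have "4 * v \<le> 5 + u\<^sup>2" using zero_le_power2[of "v - 2"] v(2) by simp
  moreover have "4 * a \<le> 5 + w \<Longrightarrow> a + (1 - w) / 2 \<le> 3 - a" for a w :: real by (simp add: field_simps)
  ultimately have "v + (1 - u\<^sup>2) / 2 \<le> 3 - v" by blast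
  then have "exp v * exp ((1 - u\<^sup>2) / 2) \<le> exp (3 - v)" by (simp add: exp_add[symmetric])
  then have "v ^ (m + 2) * (exp v * exp ((1 - u\<^sup>2) / 2)) \<le> (fact (m + 2) * exp v) * exp (3 - v)"
    using v by (intro mult_mono power_le_fact_exp) auto
  also have "\<dots> = exp 3 * fact (m + 2)" by (simp add: exp_add[symmetric] mult.assoc)
  finally have "v ^ m * exp v * exp ((1 - u\<^sup>2) / 2) * v\<^sup>2 \<le> exp 3 * fact (m + 2)"
    by (simp only: power_add mult_ac)
  then show ?thesis using v by (simp add: pos_le_divide_eq)
qed

definition gauss_integrand :: "int \<Rightarrow> real \<Rightarrow> real \<Rightarrow> complex" where
  "gauss_integrand e s u = Complex 1 u powi e * exp ((Complex 1 u)\<^sup>2 / 2 - of_real s * Complex 1 u)"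

lemma norm_gauss_exp: "norm (exp ((Complex 1 u)\<^sup>2 / 2 - of_real s * Complex 1 u)) = exp ((1 - u\<^sup>2) / 2) * exp (- s)"
  by (simp add: norm_exp_eq_Re exp_add[symmetric] complex_eq_iff power2_eq_square flip: exp_diff)

text \<open>The factors exp(v) and v^q, where v = |1 + iu|, leave room for the Taylor remainder of
  exp(- h z) when the integral is differentiated in s.\<close>

lemma gauss_integrand_bound:
  "norm (gauss_integrand e s u) * exp (sqrt (1 + u\<^sup>2)) * sqrt (1 + u\<^sup>2) ^ q \<le>
     exp (- s) * (exp 3 * fact (nat \<bar>e\<bar> + q + 2) * (1 / (1 + u\<^sup>2)))"
proof -
  let ?v = "sqrt (1 + u\<^sup>2)"
  have "norm (gauss_integrand e s u) * exp ?v * ?v ^ q =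
      norm (Complex 1 u powi e) * (?v ^ q * exp ?v * (exp ((1 - u\<^sup>2) / 2) * exp (- s)))"
    unfolding gauss_integrand_def norm_mult norm_gauss_exp by (simp only: mult_ac)
  also have "\<dots> \<le> ?v ^ nat \<bar>e\<bar> * (?v ^ q * exp ?v * (exp ((1 - u\<^sup>2) / 2) * exp (- s)))"
    by (intro mult_right_mono norm_Complex_one_powi_le) simp
  also have "\<dots> = exp (- s) * (?v ^ (nat \<bar>e\<bar> + q) * exp ?v * exp ((1 - u\<^sup>2) / 2))"
    by (simp only: power_add mult_ac)
  also have "\<dots> \<le> exp (- s) * (exp 3 * fact (nat \<bar>e\<bar> + q + 2) * (1 / (1 + u\<^sup>2)))"
    by (intro mult_left_mono gauss_decay) simp
  finally show ?thesis .
qed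

lemma gauss_integrand_bound0:
  "norm (gauss_integrand e s u) \<le> exp (- s) * (exp 3 * fact (nat \<bar>e\<bar> + 2) * (1 / (1 + u\<^sup>2)))"
proof -
  have "norm (gauss_integrand e s u) * 1 \<le> norm (gauss_integrand e s u) * exp (sqrt (1 + u\<^sup>2))"
    by (intro mult_left_mono) auto
  then show ?thesis using gauss_integrand_bound[of e s u 0] by simp
qed

lemma gauss_integrand_measurable: "gauss_integrand e s \<in> borel_measurable lborel"
proof -
  have "continuous_on UNIV (gauss_integrand e s)"
    unfolding gauss_integrand_def
    by (intro continuous_intros continuous_Complex_one) (auto simp: Complex_one_nonzero)
  then show ?thesis by (auto intro: borel_measurable_continuous_onI)
qed

lemma integrable_quadratic_majorant: "integrable lborel (\<lambda>u::real. c * (d * (1 / (1 + u\<^sup>2))))"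
  by (intro integrable_mult_right integrable_inverse_1_plus_square)

lemma gauss_integrand_integrable: "integrable lborel (gauss_integrand e s)"
  by (rule Bochner_Integration.integrable_bound[OF integrable_quadratic_majorant gauss_integrand_measurable])
    (rule AE_I2, unfold real_norm_def, rule order_trans[OF gauss_integrand_bound0 abs_ge_self])

lemma norm_integral_le:
  fixes f :: "'a \<Rightarrow> complex"
  assumes "integrable M f" "integrable M g" "\<And>u. norm (f u) \<le> g u"
  shows "norm (integral\<^sup>L M f) \<le> integral\<^sup>L M g"
  by (rule order_trans[OF Bochner_Integration.integral_norm_bound Bochner_Integration.integral_mono])
    (use assms in auto)

lemma gauss_moment_decay: "\<exists>C. \<forall>s. norm (gauss_moment e s) \<le> C * exp (- s)"
proof -
  let ?K = "exp 3 * fact (nat \<bar>e\<bar> + 2) :: real"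
  let ?L = "LINT u|lborel. ?K * (1 / (1 + u\<^sup>2))"
  have "norm (gauss_moment e s) \<le> (1 / (2 * pi) * ?L) * exp (- s)" for s
  proof -
    have "norm (LINT u|lborel. gauss_integrand e s u) \<le> (LINT u|lborel. exp (- s) * (?K * (1 / (1 + u\<^sup>2))))"
      by (intro norm_integral_le gauss_integrand_integrable integrable_quadratic_majorant gauss_integrand_bound0)
    also have "\<dots> = exp (- s) * ?L" by (rule integral_mult_right_zero)
    finally have "1 / (2 * pi) * norm (LINT u|lborel. gauss_integrand e s u) \<le> 1 / (2 * pi) * (exp (- s) * ?L)"
      by (intro mult_left_mono) auto
    then show ?thesis
      by (simp add: gauss_moment_def gauss_integrand_def norm_mult norm_divide mult_ac)
  qed
  then show ?thesis by blast
qed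

lemma norm_exp_minus_linear: "norm (exp w - 1 - w) \<le> (norm w)\<^sup>2 * exp (norm w)" for w :: complex
proof -
  have "(\<lambda>n. w ^ n /\<^sub>R fact n) sums exp w" by (rule exp_converges)
  from sums_split_initial_segment[OF this, of 2]
  have s: "(\<lambda>n. w ^ (n + 2) /\<^sub>R fact (n + 2)) sums (exp w - 1 - w)"
    by (simp add: numeral_2_eq_2 diff_diff_eq)
  have g: "(\<lambda>n. (norm w)\<^sup>2 * (norm w ^ n /\<^sub>R fact n)) sums ((norm w)\<^sup>2 * exp (norm w))"
    by (intro sums_mult exp_converges)
  show ?thesis
  proof (rule norm_sums_le[OF s g])
    fix n
    have "norm (w ^ (n + 2) /\<^sub>R fact (n + 2)) = norm w ^ (n + 2) / fact (n + 2)"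
      by (simp add: norm_power divide_inverse mult.commute del: fact_Suc power_Suc add_2_eq_Suc')
    also have "\<dots> \<le> norm w ^ (n + 2) / fact n"
      by (rule divide_left_mono) (auto intro: fact_mono simp del: fact_Suc)
    also have "\<dots> = (norm w)\<^sup>2 * (norm w ^ n /\<^sub>R fact n)"
      by (simp only: power_add real_scaleR_def divide_inverse mult_ac)
    finally show "norm (w ^ (n + 2) /\<^sub>R fact (n + 2)) \<le> (norm w)\<^sup>2 * (norm w ^ n /\<^sub>R fact n)" .
  qed
qed

text \<open>Differentiating exp(- s z) brings down - z and raises the exponent by one. For |h| <= 1
  the second-order remainder is at most h^2 times an integrable function that does not depend on
  h.\<close>

lemma gauss_moment_deriv: "(gauss_moment e has_vector_derivative - gauss_moment (e + 1) s) (at s)"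
proof -
  let ?G = "gauss_integrand e s"
  let ?K = "exp 3 * fact (nat \<bar>e\<bar> + 2 + 2) :: real"
  define C where "C = 1 / (2 * pi) * (LINT u|lborel. exp (- s) * (?K * (1 / (1 + u\<^sup>2))))"
  have step: "norm (gauss_moment e (s + h) - gauss_moment e s - h *\<^sub>R (- gauss_moment (e + 1) s)) \<le> h\<^sup>2 * C" if h: "\<bar>h\<bar> \<le> 1" for h
  proof -
    let ?F = "\<lambda>u. gauss_integrand e (s + h) u - ?G u + h *\<^sub>R gauss_integrand (e + 1) s u"
    have int: "integrable lborel ?F"
      by (intro Bochner_Integration.integrable_add Bochner_Integration.integrable_diff integrable_scaleR_right gauss_integrand_integrable)
    have F: "?F u = ?G u * (exp (- (of_real h * Complex 1 u)) - 1 - (- (of_real h * Complex 1 u)))" for u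
    proof -
      have "gauss_integrand e (s + h) u = ?G u * exp (- (of_real h * Complex 1 u))"
        unfolding gauss_integrand_def mult.assoc exp_add[symmetric] by (simp add: algebra_simps)
      moreover have "gauss_integrand (e + 1) s u = ?G u * Complex 1 u"
        unfolding gauss_integrand_def by (simp add: power_int_add_1 Complex_one_nonzero)
      ultimately show ?thesis by (simp add: algebra_simps scaleR_conv_of_real)
    qed
    have "norm (?F u) \<le> h\<^sup>2 * (exp (- s) * (?K * (1 / (1 + u\<^sup>2))))" for u
    proof -
      let ?v = "sqrt (1 + u\<^sup>2)"
      have nw: "norm (- (of_real h * Complex 1 u)) = \<bar>h\<bar> * ?v" by (simp add: norm_mult norm_Complex_one)
      have "norm (?F u) \<le> norm (?G u) * ((\<bar>h\<bar> * ?v)\<^sup>2 * exp (\<bar>h\<bar> * ?v))"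
        unfolding F norm_mult using norm_exp_minus_linear[of "- (of_real h * Complex 1 u)"] unfolding nw
        by (intro mult_left_mono) auto
      also have "\<dots> \<le> norm (?G u) * ((\<bar>h\<bar> * ?v)\<^sup>2 * exp ?v)"
        using h mult_right_mono[of "\<bar>h\<bar>" 1 ?v] by (intro mult_left_mono) auto
      also have "\<dots> = h\<^sup>2 * (norm (?G u) * exp ?v * ?v ^ 2)"
        unfolding power_mult_distrib power2_abs by (simp only: mult_ac)
      also have "\<dots> \<le> h\<^sup>2 * (exp (- s) * (?K * (1 / (1 + u\<^sup>2))))"
        by (intro mult_left_mono gauss_integrand_bound) simp
      finally show ?thesis .
    qed
    then have "norm (LINT u|lborel. ?F u) \<le> (LINT u|lborel. h\<^sup>2 * (exp (- s) * (?K * (1 / (1 + u\<^sup>2)))))"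
      by (intro norm_integral_le int integrable_mult_right integrable_inverse_1_plus_square)
    also have "\<dots> = h\<^sup>2 * (LINT u|lborel. exp (- s) * (?K * (1 / (1 + u\<^sup>2))))" by (rule integral_mult_right_zero)
    finally have "1 / (2 * pi) * norm (LINT u|lborel. ?F u) \<le> h\<^sup>2 * C"
      unfolding C_def by (simp add: divide_right_mono)
    moreover have eqI: "(LINT u|lborel. ?F u) = (LINT u|lborel. gauss_integrand e (s + h) u) - (LINT u|lborel. ?G u) +
        h *\<^sub>R (LINT u|lborel. gauss_integrand (e + 1) s u)"
      by (simp add: gauss_integrand_integrable)
    have "gauss_moment e (s + h) - gauss_moment e s - h *\<^sub>R (- gauss_moment (e + 1) s) = 1 / (2 * pi) * (LINT u|lborel. ?F u)"
      unfolding gauss_moment_def gauss_integrand_def[symmetric] eqI by (simp add: algebra_simps scaleR_conv_of_real)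
    ultimately show ?thesis by (simp add: norm_mult norm_divide)
  qed
  show ?thesis
    unfolding has_vector_derivative_def has_derivative_at
  proof (intro conjI bounded_linear_scaleR_left)
    have ev: "eventually (\<lambda>h::real. norm (norm (gauss_moment e (s + h) - gauss_moment e s - h *\<^sub>R (- gauss_moment (e + 1) s)) / norm h) \<le> \<bar>h\<bar> * C) (at 0)"
      unfolding eventually_at
    proof (intro exI[of _ 1] conjI ballI impI)
      fix h :: real assume "h \<noteq> 0 \<and> dist h 0 < 1"
      then have h: "h \<noteq> 0" "\<bar>h\<bar> \<le> 1" by (auto simp: dist_real_def)
      have "norm (gauss_moment e (s + h) - gauss_moment e s - h *\<^sub>R (- gauss_moment (e + 1) s)) / \<bar>h\<bar> \<le> h\<^sup>2 * C / \<bar>h\<bar>"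
        by (intro divide_right_mono step h) simp
      also have "h\<^sup>2 * C / \<bar>h\<bar> = \<bar>h\<bar> * C" using h power2_abs[of h] by (simp add: power2_eq_square field_simps del: power2_abs abs_mult_self_eq)
      finally show "norm (norm (gauss_moment e (s + h) - gauss_moment e s - h *\<^sub>R (- gauss_moment (e + 1) s)) / norm h) \<le> \<bar>h\<bar> * C"
        by simp
    qed simp
    have "((\<lambda>h::real. \<bar>h\<bar> * C) \<longlongrightarrow> \<bar>0\<bar> * C) (at 0)" by (intro tendsto_intros)
    then show "((\<lambda>h. norm (gauss_moment e (s + h) - gauss_moment e s - h *\<^sub>R (- gauss_moment (e + 1) s)) / norm h) \<longlongrightarrow> 0) (at 0)"
      using Lim_null_comparison[OF ev] by simp
  qed
qed

text \<open>Separated into real and imaginary parts, the integral is the characteristic function of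
  the standard normal law at 1 - s, and exp(1/2 - s) exp(- (1 - s)^2 / 2) = exp(- s^2 / 2).\<close>

lemma gauss_moment_0: "gauss_moment 0 s = of_real (exp (- s\<^sup>2 / 2) / sqrt (2 * pi))"
proof -
  have "(CLINT u|std_normal_distribution. iexp ((1 - s) * u)) = of_real (exp (- (1 - s)\<^sup>2 / 2))"
    using fun_cong[OF char_std_normal_distribution, of "1 - s"] by (simp add: char_def)
  moreover have "(CLINT u|std_normal_distribution. iexp ((1 - s) * u)) =
      (LINT u|lborel. std_normal_density u *\<^sub>R iexp ((1 - s) * u))"
    by (subst integral_density) auto
  ultimately have *: "(LINT u|lborel. std_normal_density u *\<^sub>R iexp ((1 - s) * u)) = of_real (exp (- (1 - s)\<^sup>2 / 2))"
    by simp
  have g: "gauss_integrand 0 s u = of_real (sqrt (2 * pi) * exp (1 / 2 - s)) * (std_normal_density u *\<^sub>R iexp ((1 - s) * u))" for u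
  proof -
    have "(Complex 1 u)\<^sup>2 / 2 - of_real s * Complex 1 u = of_real (1 / 2 - s) + of_real (- u\<^sup>2 / 2) + \<i> * of_real ((1 - s) * u)"
      by (simp add: complex_eq_iff power2_eq_square field_simps)
    then have "gauss_integrand 0 s u = of_real (exp (1 / 2 - s)) * of_real (exp (- u\<^sup>2 / 2)) * iexp ((1 - s) * u)"
      unfolding gauss_integrand_def by (simp only: exp_add exp_of_real power_int_0_right mult_1)
    also have "of_real (exp (- u\<^sup>2 / 2)) = complex_of_real (sqrt (2 * pi) * std_normal_density u)"
      by (simp add: std_normal_density_def)
    finally show ?thesis by (simp add: scaleR_conv_of_real mult_ac)
  qed
  have "gauss_moment 0 s = complex_of_real (1 / (2 * pi)) *
      (complex_of_real (sqrt (2 * pi) * exp (1 / 2 - s)) * complex_of_real (exp (- (1 - s)\<^sup>2 / 2)))"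
    unfolding gauss_moment_def gauss_integrand_def[symmetric] g integral_mult_right_zero * ..
  also have "\<dots> = complex_of_real (sqrt (2 * pi) / (2 * pi) * (exp (1 / 2 - s) * exp (- (1 - s)\<^sup>2 / 2)))" by simp
  also have "exp (1 / 2 - s) * exp (- (1 - s)\<^sup>2 / 2) = exp (- s\<^sup>2 / 2)"
    by (simp add: exp_add[symmetric] power2_eq_square field_simps)
  also have "sqrt (2 * pi) / (2 * pi) * exp (- s\<^sup>2 / 2) = exp (- s\<^sup>2 / 2) / sqrt (2 * pi)"
    using real_div_sqrt[of "2 * pi"] by (simp add: field_simps)
  finally show ?thesis .
qed

lemma hermite_He_rec: "hermite_He (Suc r) t = t * hermite_He r t - real r * hermite_He (r - 1) t"
  by (cases r) simp_all

lemma DERIV_hermite_He: "(hermite_He r has_real_derivative real r * hermite_He (r - 1) t) (at t)"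
proof (induction r arbitrary: t rule: less_induct)
  case (less r)
  show ?case
  proof (cases r)
    case 0
    have "hermite_He 0 = (\<lambda>_. 1)" by (rule ext) simp
    then show ?thesis using 0 by simp
  next
    case (Suc q)
    have eq: "hermite_He r = (\<lambda>t. t * hermite_He q t - real q * hermite_He (q - 1) t)"
      unfolding Suc by (rule ext) (rule hermite_He_rec)
    have d1: "(hermite_He q has_real_derivative real q * hermite_He (q - 1) t) (at t)" by (rule less.IH) (simp add: Suc)
    have d2: "(hermite_He (q - 1) has_real_derivative real (q - 1) * hermite_He (q - 1 - 1) t) (at t)" by (rule less.IH) (simp add: Suc)
    have "(hermite_He r has_real_derivative (1 * hermite_He q t + t * (real q * hermite_He (q - 1) t)) -
        real q * (real (q - 1) * hermite_He (q - 1 - 1) t)) (at t)"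
      unfolding eq
      by (intro DERIV_diff DERIV_cmult d2) (rule DERIV_cong[OF DERIV_mult[OF DERIV_ident d1]], simp)
    moreover have "(1 * hermite_He q t + t * (real q * hermite_He (q - 1) t)) - real q * (real (q - 1) * hermite_He (q - 1 - 1) t) =
        real r * hermite_He (r - 1) t"
    proof (cases q)
      case (Suc p)
      have "hermite_He q t = t * hermite_He (q - 1) t - real (q - 1) * hermite_He (q - 1 - 1) t"
        using hermite_He_rec[of p t] Suc by simp
      then have "t * (real q * hermite_He (q - 1) t) - real q * (real (q - 1) * hermite_He (q - 1 - 1) t) = real q * hermite_He q t"
        by (simp only:) (simp add: algebra_simps)
      then show ?thesis using \<open>r = Suc q\<close> by (simp add: algebra_simps)
    qed (simp add: Suc)
    ultimately show ?thesis by simp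
  qed
qed

text \<open>Rodrigues' formula: - d/ds raises the exponent of the moment and also takes He_m times
  the Gaussian to He_(m+1) times the Gaussian.\<close>

lemma gauss_moment_nat:
  "gauss_moment (int m) s = of_real (hermite_He m s * (exp (- s\<^sup>2 / 2) / sqrt (2 * pi)))"
proof (induction m arbitrary: s)
  case 0
  show ?case using gauss_moment_0 by simp
next
  case (Suc m)
  have "((\<lambda>t. hermite_He m t * (exp (- t\<^sup>2 / 2) / sqrt (2 * pi))) has_real_derivative
      real m * hermite_He (m - 1) s * (exp (- s\<^sup>2 / 2) / sqrt (2 * pi)) + hermite_He m s * (- s * exp (- s\<^sup>2 / 2) / sqrt (2 * pi))) (at s)"
  proof -
    have e: "((\<lambda>t. exp (- t\<^sup>2 / 2) / sqrt (2 * pi)) has_real_derivative - s * exp (- s\<^sup>2 / 2) / sqrt (2 * pi)) (at s)"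
      by (rule DERIV_cdivide) (auto intro!: derivative_eq_intros)
    show ?thesis by (rule DERIV_cong[OF DERIV_mult[OF DERIV_hermite_He e]]) (simp only: mult_ac add.commute)
  qed
  then have "((\<lambda>t. hermite_He m t * (exp (- t\<^sup>2 / 2) / sqrt (2 * pi))) has_real_derivative
      - (hermite_He (Suc m) s * (exp (- s\<^sup>2 / 2) / sqrt (2 * pi)))) (at s)"
    by (rule DERIV_cong) (simp add: hermite_He_rec algebra_simps diff_divide_distrib del: hermite_He.simps)
  then have "((\<lambda>t. complex_of_real (hermite_He m t * (exp (- t\<^sup>2 / 2) / sqrt (2 * pi)))) has_vector_derivative
      of_real (- (hermite_He (Suc m) s * (exp (- s\<^sup>2 / 2) / sqrt (2 * pi))))) (at s)"
    by (intro has_vector_derivative_of_real) (simp add: has_real_derivative_iff_has_vector_derivative)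
  moreover have "(gauss_moment (int m) has_vector_derivative - gauss_moment (int m + 1) s) (at s)"
    by (rule gauss_moment_deriv)
  moreover have "gauss_moment (int m) = (\<lambda>t. of_real (hermite_He m t * (exp (- t\<^sup>2 / 2) / sqrt (2 * pi))))"
    by (rule ext) (rule Suc.IH)
  ultimately have "- gauss_moment (int m + 1) s = of_real (- (hermite_He (Suc m) s * (exp (- s\<^sup>2 / 2) / sqrt (2 * pi))))"
    using vector_derivative_unique_at by metis
  then show ?case by (simp add: algebra_simps del: hermite_He.simps)
qed

lemma hermite_He_poly: "\<exists>p. \<forall>t. hermite_He r t = poly p t"
proof (induction r rule: less_induct)
  case (less r)
  show ?case
  proof (cases r)
    case 0 then show ?thesis by (intro exI[of _ 1]) simp
  next
    case (Suc q)
    obtain p1 p2 where "\<forall>t. hermite_He q t = poly p1 t" "\<forall>t. hermite_He (q - 1) t = poly p2 t"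
      using less.IH[of q] less.IH[of "q - 1"] Suc by (meson diff_less_Suc lessI)
    then have "\<forall>t. hermite_He r t = poly ([:0, 1:] * p1 - Polynomial.smult (real q) p2) t"
      unfolding Suc hermite_He_rec by simp
    then show ?thesis by blast
  qed
qed

lemma poly_exp_minus_tendsto_0: "((\<lambda>t. poly p t * exp (- t)) \<longlongrightarrow> (0::real)) at_top"
proof -
  have "((\<lambda>t. \<Sum>i\<le>degree p. coeff p i * (t ^ i / exp t)) \<longlongrightarrow> (\<Sum>i\<le>degree p. coeff p i * 0)) at_top"
    by (intro tendsto_intros tendsto_power_div_exp_0)
  moreover have "(\<Sum>i\<le>degree p. coeff p i * (t ^ i / exp t)) = poly p t * exp (- t)" for t
    unfolding poly_altdef sum_distrib_right exp_minus by (intro sum.cong refl) (simp add: divide_inverse)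
  ultimately show ?thesis by simp
qed

lemma integrable_hermite_weight:
  "integrable lborel (\<lambda>t. exp (- t\<^sup>2 / 2) * hermite_He q t * hermite_He r t)"
proof -
  obtain p1 p2 where p: "\<forall>t. hermite_He q t = poly p1 t" "\<forall>t. hermite_He r t = poly p2 t"
    using hermite_He_poly by meson
  have "integrable lborel (\<lambda>t. \<Sum>i\<le>degree (p1 * p2). (sqrt (2 * pi) * coeff (p1 * p2) i) * (std_normal_density t * t ^ i))"
    by (intro Bochner_Integration.integrable_sum integrable_mult_right integrable_std_normal_moment)
  also have "(\<lambda>t. \<Sum>i\<le>degree (p1 * p2). (sqrt (2 * pi) * coeff (p1 * p2) i) * (std_normal_density t * t ^ i)) =
     (\<lambda>t. exp (- t\<^sup>2 / 2) * hermite_He q t * hermite_He r t)"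
  proof
    fix t
    have "(\<Sum>i\<le>degree (p1 * p2). (sqrt (2 * pi) * coeff (p1 * p2) i) * (std_normal_density t * t ^ i)) =
      sqrt (2 * pi) * std_normal_density t * poly (p1 * p2) t"
      unfolding poly_altdef[of "p1 * p2"] sum_distrib_left by (simp only: mult_ac)
    then show "(\<Sum>i\<le>degree (p1 * p2). (sqrt (2 * pi) * coeff (p1 * p2) i) * (std_normal_density t * t ^ i)) =
      exp (- t\<^sup>2 / 2) * hermite_He q t * hermite_He r t"
      using p by (simp add: std_normal_density_def)
  qed
  finally show ?thesis .
qed

lemma integral_tail_limit:
  fixes g :: "real \<Rightarrow> real"
  assumes g: "integrable lborel g"
  shows "(\<lambda>n. integral {s..s + real n} g) \<longlonglongrightarrow> integral {s..} g"
proof -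
  have eq: "integral A g = (LINT t|lborel. indicator A t * g t)" if "A \<in> sets lborel" for A
  proof -
    have "set_integrable lborel A g"
      using that unfolding set_integrable_def by (rule integrable_mult_indicator[OF _ g])
    from set_borel_integral_eq_integral(2)[OF this] show ?thesis by (simp add: set_lebesgue_integral_def)
  qed
  have "(\<lambda>n. LINT t|lborel. indicator {s..s + real n} t * g t) \<longlonglongrightarrow> (LINT t|lborel. indicator {s..} t * g t)"
  proof (rule integral_dominated_convergence[where w = "\<lambda>t. norm (g t)"])
    show "AE t in lborel. (\<lambda>n. indicator {s..s + real n} t * g t) \<longlonglongrightarrow> indicator {s..} t * g t"
    proof (rule AE_I2)
      fix t :: real
      obtain N :: nat where N: "t - s \<le> real N" using real_arch_simple by blast
      show "(\<lambda>n. indicator {s..s + real n} t * g t) \<longlonglongrightarrow> indicator {s..} t * g t"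
        by (rule tendsto_eventually, rule eventually_sequentiallyI[of N]) (use N in \<open>auto simp: indicator_def\<close>)
    qed
    have [measurable]: "g \<in> borel_measurable borel" using g by simp
    show "(\<lambda>t. indicator {s..} t * g t) \<in> borel_measurable lborel" by measurable
    show "(\<lambda>t. indicator {s..s + real n} t * g t) \<in> borel_measurable lborel" for n by measurable
    show "integrable lborel (\<lambda>t. norm (g t))" by (rule integrable_norm[OF g])
    show "AE t in lborel. norm (indicator {s..s + real n} t * g t) \<le> norm (g t)" for n
      by (rule AE_I2) (simp add: indicator_def)
  qed
  then show ?thesis by (simp add: eq)
qed

text \<open>As functions of s both sides tend to 0 at infinity and have the same derivative. Since
  He_r' = r He_(r-1) and - d/ds raises the exponent of each moment, the derivative of the sum
  telescopes, and only He_(l-1) He_(l'-1) times the Gaussian is left.\<close>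

theorem hermite_moment_sum:
  assumes l: "l \<ge> 1" "l' \<ge> 1"
  shows "(\<Sum>r<l'. of_real (hermite_He r s / fact r) * gauss_moment (int l - 1 + int r - int l') s) =
    of_real (sqrt (fact (l - 1) / fact (l' - 1)) * hermite_kernel s l l')"
proof -
  define \<Phi> where "\<Phi> s = (\<Sum>r<l'. of_real (hermite_He r s / fact r) * gauss_moment (int l - 1 + int r - int l') s)" for s
  \<comment> \<open>1 / (l' - 1)! belongs to the last coefficient and 1 / sqrt (2 \<pi>) to the
    moment. This is the normalization of \<open>hermite_kernel\<close> times the square root of (l -
    1)! / (l' - 1)!.\<close>
  define c where "c = 1 / (sqrt (2 * pi) * fact (l' - 1))"
  define g where "g t = c * (exp (- t\<^sup>2 / 2) * hermite_He (l - 1) t * hermite_He (l' - 1) t)" for t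
  have deriv: "(\<Phi> has_vector_derivative - of_real (g t)) (at t)" for t
  proof -
    let ?h = "\<lambda>r. complex_of_real (hermite_He r t / fact r)"
    let ?J = "\<lambda>r. gauss_moment (int l - 1 + int r - int l') t"
    \<comment> \<open>The boundary value \<open>D 0 = 0\<close> stands for the missing derivative of
      the constant He_0 and makes the telescoping uniform in r.\<close>
    define D where "D r = (if r = 0 then 0 else ?h (r - 1) * ?J r)" for r
    have "((\<lambda>s. of_real (hermite_He r s / fact r) * gauss_moment (int l - 1 + int r - int l') s) has_vector_derivative
        ?h r * - gauss_moment (int l - 1 + int r - int l' + 1) t + of_real (real r * hermite_He (r - 1) t / fact r) * ?J r) (at t)" for r
    proof (rule has_vector_derivative_mult)
      have "((\<lambda>s. hermite_He r s / fact r) has_real_derivative real r * hermite_He (r - 1) t / fact r) (at t)"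
        by (rule DERIV_cdivide) (rule DERIV_hermite_He)
      then show "((\<lambda>s. complex_of_real (hermite_He r s / fact r)) has_vector_derivative of_real (real r * hermite_He (r - 1) t / fact r)) (at t)"
        by (intro has_vector_derivative_of_real) (simp add: has_real_derivative_iff_has_vector_derivative)
    qed (rule gauss_moment_deriv)
    moreover have "?h r * - gauss_moment (int l - 1 + int r - int l' + 1) t + of_real (real r * hermite_He (r - 1) t / fact r) * ?J r =
        D r - D (Suc r)" for r
    proof -
      have "real r * hermite_He (r - 1) t / fact r = (if r = 0 then 0 else hermite_He (r - 1) t / fact (r - 1))"
        by (cases r) (simp_all del: of_nat_Suc hermite_He.simps)
      moreover have "int l - 1 + int r - int l' + 1 = int l - 1 + int (Suc r) - int l'" by simp
      ultimately show ?thesis unfolding D_def by (simp only:) (simp del: of_nat_Suc hermite_He.simps)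
    qed
    ultimately have "(\<Phi> has_vector_derivative (\<Sum>r<l'. D r - D (Suc r))) (at t)"
      unfolding \<Phi>_def by (intro has_vector_derivative_sum) simp
    also have "(\<Sum>r<l'. D r - D (Suc r)) = D 0 - D l'" by (rule sum_lessThan_telescope')
    also have "D 0 - D l' = - of_real (g t)"
    proof -
      have "int l - 1 + int l' - int l' = int (l - 1)" using l by simp
      then have "D l' = of_real (hermite_He (l' - 1) t / fact (l' - 1)) * gauss_moment (int (l - 1)) t"
        using l by (simp add: D_def)
      then show ?thesis unfolding gauss_moment_nat by (simp add: D_def g_def c_def mult_ac)
    qed
    finally show ?thesis .
  qed
  \<comment> \<open>The decay exp(- s) of the moments, valid for negative exponents as well, beats
    the polynomial growth of the He_r and fixes the constant of integration.\<close>
  have lim0: "(\<lambda>n. \<Phi> (s + real n)) \<longlonglongrightarrow> 0"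
  proof -
    have "((\<lambda>t. of_real (hermite_He r t / fact r) * gauss_moment e t) \<longlongrightarrow> 0) at_top" for r e
    proof -
      obtain C where C: "\<And>t. norm (gauss_moment e t) \<le> C * exp (- t)" using gauss_moment_decay by blast
      obtain p where p: "\<forall>t. hermite_He r t = poly p t" using hermite_He_poly by blast
      have ev: "eventually (\<lambda>t. norm (of_real (hermite_He r t / fact r) * gauss_moment e t) \<le> C / fact r * \<bar>poly p t * exp (- t)\<bar>) at_top"
      proof (intro always_eventually allI)
        fix t
        have "norm (of_real (hermite_He r t / fact r) * gauss_moment e t) \<le> \<bar>poly p t\<bar> / fact r * (C * exp (- t))"
          unfolding norm_mult norm_of_real using p by (intro mult_mono C) auto
        then show "norm (of_real (hermite_He r t / fact r) * gauss_moment e t) \<le> C / fact r * \<bar>poly p t * exp (- t)\<bar>"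
          by (simp add: abs_mult mult_ac)
      qed
      have "((\<lambda>t. C / fact r * \<bar>poly p t * exp (- t)\<bar>) \<longlongrightarrow> C / fact r * \<bar>0\<bar>) at_top"
        by (intro tendsto_intros poly_exp_minus_tendsto_0)
      then show ?thesis using Lim_null_comparison[OF ev] by simp
    qed
    then have "(\<Phi> \<longlongrightarrow> (\<Sum>r<l'. 0)) at_top" unfolding \<Phi>_def by (intro tendsto_sum)
    moreover have "filterlim (\<lambda>n. s + real n) at_top sequentially"
      by (rule filterlim_tendsto_add_at_top[OF tendsto_const filterlim_real_sequentially])
    ultimately have "(\<lambda>n. \<Phi> (s + real n)) \<longlonglongrightarrow> (\<Sum>r<l'. 0)" by (rule filterlim_compose)
    then show ?thesis by simp
  qed
  have "integrable lborel g" unfolding g_def by (intro integrable_mult_right integrable_hermite_weight)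
  then have lim: "(\<lambda>n. complex_of_real (integral {s..s + real n} g)) \<longlonglongrightarrow> of_real (integral {s..} g)"
    by (intro tendsto_of_real integral_tail_limit)
  have "complex_of_real (integral {s..s + real n} g) = \<Phi> s - \<Phi> (s + real n)" for n
  proof -
    have "((\<lambda>t. - complex_of_real (g t)) has_integral \<Phi> (s + real n) - \<Phi> s) {s..s + real n}"
      by (rule fundamental_theorem_of_calculus) (simp, rule has_vector_derivative_at_within[OF deriv])
    from has_integral_neg[OF this] have "((\<lambda>t. complex_of_real (g t)) has_integral \<Phi> s - \<Phi> (s + real n)) {s..s + real n}" by simp
    moreover have "((\<lambda>t. complex_of_real (g t)) has_integral of_real (integral {s..s + real n} g)) {s..s + real n}"
    proof -
      have "set_integrable lborel {s..s + real n} g"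
        using \<open>integrable lborel g\<close> unfolding set_integrable_def by (intro integrable_mult_indicator[OF _ \<open>integrable lborel g\<close>]) simp
      then have "g integrable_on {s..s + real n}" by (rule set_borel_integral_eq_integral(1))
      then show ?thesis by (intro has_integral_of_real integrable_integral)
    qed
    ultimately show ?thesis by (rule has_integral_unique[symmetric])
  qed
  then have "(\<lambda>n. \<Phi> s - \<Phi> (s + real n)) \<longlonglongrightarrow> of_real (integral {s..} g)" using lim by simp
  moreover have "(\<lambda>n. \<Phi> s - \<Phi> (s + real n)) \<longlonglongrightarrow> \<Phi> s - 0" by (intro tendsto_intros lim0)
  ultimately have "of_real (integral {s..} g) = \<Phi> s - 0" by (rule LIMSEQ_unique)
  then have "\<Phi> s = of_real (integral {s..} g)" by simp
  also have "integral {s..} g = c * integral {s..} (\<lambda>t. exp (- t\<^sup>2 / 2) * hermite_He (l - 1) t * hermite_He (l' - 1) t)"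
    unfolding g_def by (rule integral_mult_right)
  also have "\<dots> = sqrt (fact (l - 1) / fact (l' - 1)) * hermite_kernel s l l'"
  proof -
    have "sqrt (fact (l - 1) / fact (l' - 1)) * (1 / sqrt (2 * pi * fact (l - 1) * fact (l' - 1))) = c"
    proof -
      have *: "a / b * (1 / (p * a * b)) = 1 / (p * (b * b))" if "a > 0" for a b p :: real
        using that by simp
      have "sqrt (fact (l' - 1)) * sqrt (fact (l' - 1)) = (fact (l' - 1) :: real)" by simp
      then show ?thesis unfolding c_def real_sqrt_divide real_sqrt_mult using * by simp
    qed
    then show ?thesis unfolding hermite_kernel_def by (simp only: mult.assoc[symmetric])
  qed
  finally show ?thesis by (simp only: \<Phi>_def)
qed

section \<open>Riemann sums of piecewise smooth functions\<close>

text \<open>The form of piecewise smoothness used for integrals and Riemann sums. With the same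
  pieces it passes to squares and, above a positive bound, to reciprocals. The pieces may
  overlap.\<close>

definition pw_lipschitz :: "real set set \<Rightarrow> real \<Rightarrow> (real \<Rightarrow> real) \<Rightarrow> bool" where
  "pw_lipschitz \<I> L f \<longleftrightarrow> finite \<I> \<and> \<Union>\<I> = {0..1} \<and> L \<ge> 0 \<and>
     (\<forall>I\<in>\<I>. is_interval I \<and> I \<noteq> {} \<and> (\<forall>s\<in>I. \<forall>t\<in>I. \<bar>f s - f t\<bar> \<le> L * \<bar>s - t\<bar>))"

lemma C1_lipschitz:
  fixes h :: "real \<Rightarrow> real"
  assumes "h C1_differentiable_on UNIV"
  shows "\<exists>L\<ge>0. \<forall>s\<in>{0..1}. \<forall>t\<in>{0..1}. \<bar>h s - h t\<bar> \<le> L * \<bar>s - t\<bar>"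
proof -
  obtain D where D: "\<And>x. (h has_vector_derivative D x) (at x)" and cont: "continuous_on UNIV D"
    using assms unfolding C1_differentiable_on_def by auto
  have "compact (D ` {0..1})" by (intro compact_continuous_image continuous_on_subset[OF cont]) auto
  then obtain L where L: "L > 0" "\<forall>v\<in>D ` {0..1}. norm v \<le> L" using compact_imp_bounded bounded_pos by metis
  have "\<bar>h t - h s\<bar> \<le> L * \<bar>t - s\<bar>" if st: "s \<in> {0..1}" "t \<in> {0..1}" for s t
  proof -
    have "norm (h t - h s) \<le> L * norm (t - s)"
    proof (rule differentiable_bound[where S = "{0..1}" and f' = "\<lambda>x u. u * D x"])
      fix x :: real assume x: "x \<in> {0..1}"
      show "(h has_derivative (\<lambda>u. u * D x)) (at x within {0..1})"
        using D[of x] unfolding has_vector_derivative_def by (auto intro: has_derivative_at_withinI)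
      show "onorm (\<lambda>u. u * D x) \<le> L"
      proof (rule onorm_le)
        have "\<bar>D x\<bar> \<le> L" using L(2) x by auto
        then show "norm (u * D x) \<le> L * norm u" for u
          using mult_right_mono[of "\<bar>D x\<bar>" L "\<bar>u\<bar>"] by (simp add: abs_mult mult.commute)
      qed
    qed (use st in auto)
    then show ?thesis by simp
  qed
  then show ?thesis using L(1) by (intro exI[of _ L]) auto
qed

lemma piecewise_C1_pw_lipschitz:
  assumes "piecewise_C1 f"
  shows "\<exists>\<I> L. pw_lipschitz \<I> L f"
proof -
  obtain \<I> where fin: "finite \<I>" and cov: "\<Union>\<I> = {0..1}"
    and I: "\<And>I. I \<in> \<I> \<Longrightarrow> is_interval I \<and> interior I \<noteq> {} \<and> (\<exists>h. h C1_differentiable_on UNIV \<and> (\<forall>t\<in>I. f t = h t))"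
    using assms unfolding piecewise_C1_def by blast
  have "\<exists>L\<ge>0. \<forall>s\<in>I. \<forall>t\<in>I. \<bar>f s - f t\<bar> \<le> L * \<bar>s - t\<bar>" if J: "I \<in> \<I>" for I
  proof -
    obtain h where h: "h C1_differentiable_on UNIV" "\<And>t. t \<in> I \<Longrightarrow> f t = h t" using I[OF J] by blast
    have "I \<subseteq> {0..1}" using J cov by blast
    then show ?thesis using C1_lipschitz[OF h(1)] h(2) by (metis subset_iff)
  qed
  then obtain L where L: "\<And>I. I \<in> \<I> \<Longrightarrow> L I \<ge> 0 \<and> (\<forall>s\<in>I. \<forall>t\<in>I. \<bar>f s - f t\<bar> \<le> L I * \<bar>s - t\<bar>)" by metis
  have "pw_lipschitz \<I> (sum L \<I>) f"
    unfolding pw_lipschitz_def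
  proof (intro conjI ballI)
    show "sum L \<I> \<ge> 0" using L by (intro sum_nonneg) auto
    fix J assume J: "J \<in> \<I>"
    show "is_interval J" using I[OF J] by blast
    show "J \<noteq> {}" using I[OF J] by auto
    have "L J \<le> sum L \<I>" by (rule member_le_sum) (use J L fin in auto)
    fix s t assume "s \<in> J" "t \<in> J"
    then have "\<bar>f s - f t\<bar> \<le> L J * \<bar>s - t\<bar>" using L[OF J] by blast
    also have "\<dots> \<le> sum L \<I> * \<bar>s - t\<bar>" using \<open>L J \<le> sum L \<I>\<close> by (rule mult_right_mono) simp
    finally show "\<bar>f s - f t\<bar> \<le> sum L \<I> * \<bar>s - t\<bar>" .
  qed (rule fin cov)+
  then show ?thesis by blast
qed

lemma pw_lipschitz_bounded:
  assumes "pw_lipschitz \<I> L f"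
  shows "\<exists>M>0. \<forall>t\<in>{0..1}. \<bar>f t\<bar> \<le> M"
proof -
  have p: "finite \<I>" "\<Union>\<I> = {0..1}" "L \<ge> 0" using assms by (auto simp: pw_lipschitz_def)
  define c where "c I = (SOME t. t \<in> I)" for I :: "real set"
  have c: "c I \<in> I" if "I \<in> \<I>" for I
    unfolding c_def using assms that by (intro some_in_eq[THEN iffD2]) (auto simp: pw_lipschitz_def)
  have "\<bar>f t\<bar> \<le> (\<Sum>I\<in>\<I>. \<bar>f (c I)\<bar>) + L + 1" if "t \<in> {0..1}" for t
  proof -
    obtain I where I: "I \<in> \<I>" "t \<in> I" using \<open>t \<in> {0..1}\<close> p(2) by blast
    have "c I \<in> {0..1}" using c[OF I(1)] I(1) p(2) by blast
    then have "\<bar>t - c I\<bar> \<le> 1" using that by auto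
    then have "L * \<bar>t - c I\<bar> \<le> L" using p(3) mult_left_mono[of "\<bar>t - c I\<bar>" 1 L] by simp
    moreover have "\<bar>f t - f (c I)\<bar> \<le> L * \<bar>t - c I\<bar>" using assms I c[OF I(1)] by (auto simp: pw_lipschitz_def)
    moreover have "\<bar>f (c I)\<bar> \<le> (\<Sum>I\<in>\<I>. \<bar>f (c I)\<bar>)" by (rule member_le_sum) (use I p in auto)
    ultimately show ?thesis by linarith
  qed
  moreover have "(\<Sum>I\<in>\<I>. \<bar>f (c I)\<bar>) + L + 1 > 0" using p(3) by (simp add: sum_nonneg add_nonneg_pos)
  ultimately show ?thesis by blast
qed

lemma pw_lipschitz_compose:
  assumes f: "pw_lipschitz \<I> L f" and K: "K \<ge> 0"
    and \<phi>: "\<And>s t. s \<in> {0..1} \<Longrightarrow> t \<in> {0..1} \<Longrightarrow> \<bar>\<phi> (f s) - \<phi> (f t)\<bar> \<le> K * \<bar>f s - f t\<bar>"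
  shows "pw_lipschitz \<I> (K * L) (\<lambda>t. \<phi> (f t))"
  unfolding pw_lipschitz_def
proof (intro conjI ballI)
  show "finite \<I>" "\<Union>\<I> = {0..1}" using f by (auto simp: pw_lipschitz_def)
  show "K * L \<ge> 0" using K f by (simp add: pw_lipschitz_def)
  fix I assume I: "I \<in> \<I>"
  show "is_interval I" "I \<noteq> {}" using f I by (auto simp: pw_lipschitz_def)
  fix s t assume st: "s \<in> I" "t \<in> I"
  have "I \<subseteq> {0..1}" using f I by (auto simp: pw_lipschitz_def)
  then have "\<bar>\<phi> (f s) - \<phi> (f t)\<bar> \<le> K * \<bar>f s - f t\<bar>" using st by (intro \<phi>) auto
  also have "\<dots> \<le> K * (L * \<bar>s - t\<bar>)" using f I st K by (intro mult_left_mono) (auto simp: pw_lipschitz_def)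
  finally show "\<bar>\<phi> (f s) - \<phi> (f t)\<bar> \<le> K * L * \<bar>s - t\<bar>" by (simp add: mult.assoc)
qed

lemma pw_lipschitz_power2:
  assumes "pw_lipschitz \<I> L f"
  shows "\<exists>L'. pw_lipschitz \<I> L' (\<lambda>t. (f t)\<^sup>2)"
proof -
  obtain M where M: "M > 0" "\<forall>t\<in>{0..1}. \<bar>f t\<bar> \<le> M" using pw_lipschitz_bounded[OF assms] by blast
  have "pw_lipschitz \<I> ((2 * M) * L) (\<lambda>t. (f t)\<^sup>2)"
  proof (rule pw_lipschitz_compose[OF assms])
    fix s t :: real assume "s \<in> {0..1}" "t \<in> {0..1}"
    then have "\<bar>f s\<bar> \<le> M" "\<bar>f t\<bar> \<le> M" using M by auto
    then have "\<bar>f s + f t\<bar> \<le> 2 * M" by linarith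
    then have "\<bar>f s + f t\<bar> * \<bar>f s - f t\<bar> \<le> 2 * M * \<bar>f s - f t\<bar>" by (rule mult_right_mono) simp
    moreover have "(f s)\<^sup>2 - (f t)\<^sup>2 = (f s + f t) * (f s - f t)" by (simp add: power2_eq_square algebra_simps)
    ultimately show "\<bar>(f s)\<^sup>2 - (f t)\<^sup>2\<bar> \<le> 2 * M * \<bar>f s - f t\<bar>" by (simp add: abs_mult)
  qed (use M in simp)
  then show ?thesis by blast
qed

lemma pw_lipschitz_inverse:
  assumes f: "pw_lipschitz \<I> L f" and \<delta>: "\<delta> > 0" "\<And>t. t \<in> {0..1} \<Longrightarrow> f t \<ge> \<delta>"
  shows "\<exists>L'. pw_lipschitz \<I> L' (\<lambda>t. 1 / f t)"
proof -
  have "pw_lipschitz \<I> ((1 / \<delta>\<^sup>2) * L) (\<lambda>t. 1 / f t)"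
  proof (rule pw_lipschitz_compose[OF f])
    fix s t :: real assume "s \<in> {0..1}" "t \<in> {0..1}"
    then have st: "f s \<ge> \<delta>" "f t \<ge> \<delta>" using \<delta> by auto
    then have p: "f s > 0" "f t > 0" using \<delta>(1) by linarith+
    have "\<delta>\<^sup>2 \<le> f s * f t" unfolding power2_eq_square using st \<delta>(1) by (intro mult_mono) auto
    then have "1 / (f s * f t) \<le> 1 / \<delta>\<^sup>2" using \<delta>(1) by (intro divide_left_mono) (auto simp: p)
    then have "1 / (f s * f t) * \<bar>f s - f t\<bar> \<le> 1 / \<delta>\<^sup>2 * \<bar>f s - f t\<bar>" by (rule mult_right_mono) simp
    moreover have "1 / f s - 1 / f t = (f t - f s) / (f s * f t)" using p by (simp add: field_simps)
    then have "\<bar>1 / f s - 1 / f t\<bar> = 1 / (f s * f t) * \<bar>f s - f t\<bar>" using p by (simp add: abs_divide abs_mult abs_minus_commute)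
    ultimately show "\<bar>1 / f s - 1 / f t\<bar> \<le> 1 / \<delta>\<^sup>2 * \<bar>f s - f t\<bar>" by simp
  qed simp
  then show ?thesis by blast
qed

context
  fixes \<I> :: "real set set" and L :: real and f :: "real \<Rightarrow> real"
  assumes pw: "pw_lipschitz \<I> L f"
begin

private definition E :: "real set" where "E = Inf ` \<I> \<union> Sup ` \<I>"

private lemma finite_E: "finite E" using pw by (simp add: E_def pw_lipschitz_def)

private lemma piece:
  assumes "I \<in> \<I>"
  shows "is_interval I" "I \<noteq> {}" "I \<subseteq> {0..1}" "bdd_below I" "bdd_above I"
    "s \<in> I \<Longrightarrow> t \<in> I \<Longrightarrow> \<bar>f s - f t\<bar> \<le> L * \<bar>s - t\<bar>"
proof -
  show sub: "I \<subseteq> {0..1}" using pw assms unfolding pw_lipschitz_def by blast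
  show "bdd_below I" "bdd_above I" using sub by (meson bdd_below_Icc bdd_below_mono bdd_above_Icc bdd_above_mono)+
  show "is_interval I" "I \<noteq> {}" using pw assms unfolding pw_lipschitz_def by blast+
  show "s \<in> I \<Longrightarrow> t \<in> I \<Longrightarrow> \<bar>f s - f t\<bar> \<le> L * \<bar>s - t\<bar>" using pw assms unfolding pw_lipschitz_def by blast
qed

text \<open>The piece that contains \<open>a\<close> has both its end points outside the closed
  interval, so it extends strictly beyond it on either side. The points \<open>p\<close> and
  \<open>q\<close> give the neighbourhood needed for continuity.\<close>

private lemma piece_contains:
  assumes ab: "0 \<le> a" "a \<le> b" "b \<le> 1" and E: "{a..b} \<inter> E = {}"
  shows "\<exists>I\<in>\<I>. {a..b} \<subseteq> I \<and> (\<exists>p\<in>I. \<exists>q\<in>I. p < a \<and> b < q)"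
proof -
  have "a \<in> \<Union>\<I>" using pw ab unfolding pw_lipschitz_def by auto
  then obtain I where I: "I \<in> \<I>" "a \<in> I" by blast
  note P = piece[OF I(1)]
  have "Inf I \<le> a" "a \<le> Sup I" using P I by (auto intro: cInf_lower cSup_upper)
  moreover have "Inf I \<in> E" "Sup I \<in> E" using I by (auto simp: E_def)
  ultimately have "Inf I < a" "b < Sup I"
    using E ab by (smt (verit) atLeastAtMost_iff disjoint_iff)+
  then obtain p q where pq: "p \<in> I" "p < a" "q \<in> I" "b < q"
    using cInf_lessD[OF P(2)] less_cSupD[OF P(2)] by blast
  have "{a..b} \<subseteq> I"
  proof
    fix x assume "x \<in> {a..b}"
    then show "x \<in> I" using P(1) pq mem_is_interval_1_I[of I p q x] by auto
  qed
  then show ?thesis using I pq by blast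
qed

lemma pw_lipschitz_integrable: "f integrable_on {0..1}"
proof -
  let ?S = "{0..1} - E"
  obtain M where M: "M > 0" "\<forall>t\<in>{0..1}. \<bar>f t\<bar> \<le> M" using pw_lipschitz_bounded[OF pw] by blast
  have S: "?S \<in> sets borel" using finite_E by (intro sets.Diff) (auto intro: finite_imp_closed borel_closed)
  have "isCont f t" if t: "t \<in> ?S" for t
  proof -
    obtain I p q where I: "I \<in> \<I>" "p \<in> I" "q \<in> I" "p < t" "t < q"
      using piece_contains[of t t] t by auto
    have sub: "x \<in> I" if "x \<in> {p<..<q}" for x
      using piece(1)[OF I(1)] I that mem_is_interval_1_I[of I p q x] by auto
    have "(f \<longlongrightarrow> f t) (at t)"
    proof (rule Lim_transform_bound[where g = "\<lambda>x. L * \<bar>x - t\<bar>", THEN Lim_null[THEN iffD2]])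
      show "eventually (\<lambda>x. norm (f x - f t) \<le> norm (L * \<bar>x - t\<bar>)) (at t)"
        unfolding eventually_at_topological
      proof (intro exI[of _ "{p<..<q}"] conjI ballI impI)
        fix x assume "x \<in> {p<..<q}"
        then have "\<bar>f x - f t\<bar> \<le> L * \<bar>x - t\<bar>" using sub I by (intro piece(6)[OF I(1)]) auto
        then show "norm (f x - f t) \<le> norm (L * \<bar>x - t\<bar>)" by simp
      qed (use I in auto)
      have "((\<lambda>x. L * \<bar>x - t\<bar>) \<longlongrightarrow> L * \<bar>t - t\<bar>) (at t)" by (intro tendsto_intros)
      then show "((\<lambda>x. L * \<bar>x - t\<bar>) \<longlongrightarrow> 0) (at t)" by simp
    qed
    then show ?thesis by (simp add: isCont_def)
  qed
  then have "continuous_on ?S f" by (simp add: continuous_at_imp_continuous_on)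
  then have "set_borel_measurable lborel ?S f"
    using borel_measurable_continuous_on_indicator[OF S, of f] by (simp add: set_borel_measurable_def del: real_scaleR_def)
  then have meas: "(\<lambda>t. indicator ?S t *\<^sub>R f t) \<in> borel_measurable lborel" by (simp only: set_borel_measurable_def)
  have "integrable lborel (\<lambda>t. indicator {0..1::real} t *\<^sub>R M)"
    by (intro integrable_scaleR_left integrable_real_indicator) auto
  then have "integrable lborel (\<lambda>t. indicator ?S t *\<^sub>R f t)"
  proof (rule Bochner_Integration.integrable_bound[OF _ meas])
    show "AE t in lborel. norm (indicator ?S t *\<^sub>R f t) \<le> norm (indicator {0..1} t *\<^sub>R M)"
      using M by (intro AE_I2) (auto simp: indicator_def)
  qed
  then have "set_integrable lborel ?S f" by (simp only: set_integrable_def)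
  then have "f integrable_on ?S" by (rule set_borel_integral_eq_integral(1))
  then show ?thesis
  proof (rule integrable_spike_set)
    show "negligible {x \<in> ?S - {0..1}. f x \<noteq> 0}" by (rule negligible_subset[of "{}"]) auto
    show "negligible {x \<in> {0..1} - ?S. f x \<noteq> 0}"
      by (rule negligible_subset[OF negligible_finite[OF finite_E]]) blast
  qed
qed

text \<open>After multiplication by n, a cell without break points has error at most L / n, and the
  n cells together give L. Each break point spoils at most two closed cells, each at a cost of 2
  M.\<close>

lemma riemann_sum_bounded_error:
  "\<exists>C. \<forall>n. \<bar>(\<Sum>i<n. f (real i / real n)) - real n * integral {0..1} f\<bar> \<le> C"
proof -
  obtain M where M: "M > 0" "\<forall>t\<in>{0..1}. \<bar>f t\<bar> \<le> M" using pw_lipschitz_bounded[OF pw] by blast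
  have L: "L \<ge> 0" using pw by (simp add: pw_lipschitz_def)
  have "\<bar>(\<Sum>i<n. f (real i / real n)) - real n * integral {0..1} f\<bar> \<le> L + 2 * M * real (2 * card E)" for n
  proof (cases "n = 0")
    case True
    then show ?thesis using L M(1) by simp
  next
    case False
    then have n: "real n > 0" by simp
    define a where "a i = real i / real n" for i
    have a01: "0 \<le> a i" "a i \<le> 1" if "i \<le> n" for i using that n by (auto simp: a_def divide_simps)
    have aS: "a (Suc i) - a i = 1 / real n" "a i \<le> a (Suc i)" for i
      using n by (auto simp: a_def diff_divide_distrib[symmetric] divide_right_mono)
    have int: "f integrable_on {a i..a j}" if "i \<le> n" "j \<le> n" for i j
      by (rule integrable_on_subinterval[OF pw_lipschitz_integrable]) (use a01[OF that(1)] a01[OF that(2)] in auto)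
    define bad where "bad = {i. i < n \<and> {a i..a (Suc i)} \<inter> E \<noteq> {}}"
    have sum_int: "integral {0..a m} f = (\<Sum>i<m. integral {a i..a (Suc i)} f)" if "m \<le> n" for m
      using that
    proof (induction m)
      case 0 then show ?case by (simp add: a_def)
    next
      case (Suc m)
      have a0: "a 0 = 0" by (simp add: a_def)
      have "integral {0..a m} f + integral {a m..a (Suc m)} f = integral {0..a (Suc m)} f"
        by (rule Henstock_Kurzweil_Integration.integral_combine)
          (use a01[of m] aS(2)[of m] int[of 0 "Suc m"] Suc.prems in \<open>auto simp: a0\<close>)
      then show ?case using Suc by simp
    qed
    have an: "a n = 1" using n by (simp add: a_def)
    have cell: "\<bar>f (a i) - real n * integral {a i..a (Suc i)} f\<bar> \<le> L / real n + (if i \<in> bad then 2 * M else 0)" if i: "i < n" for i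
    proof -
      let ?c = "L / real n + (if i \<in> bad then 2 * M else 0)"
      have ii: "i \<le> n" "Suc i \<le> n" using i by auto
      have osc: "\<bar>f (a i) - f t\<bar> \<le> ?c" if t: "t \<in> {a i..a (Suc i)}" for t
      proof (cases "i \<in> bad")
        case True
        have "\<bar>f (a i)\<bar> \<le> M" "\<bar>f t\<bar> \<le> M" using M(2) a01[OF ii(1)] a01[OF ii(2)] t by auto
        then have "\<bar>f (a i) - f t\<bar> \<le> 2 * M" by linarith
        moreover have "L / real n \<ge> 0" using L n by simp
        ultimately show ?thesis using True by simp
      next
        case False
        then have "{a i..a (Suc i)} \<inter> E = {}" using i by (simp add: bad_def)
        then obtain I where I: "I \<in> \<I>" "{a i..a (Suc i)} \<subseteq> I"
          using piece_contains[of "a i" "a (Suc i)"] a01[OF ii(1)] a01[OF ii(2)] aS(2)[of i] by blast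
        then have "\<bar>f (a i) - f t\<bar> \<le> L * \<bar>a i - t\<bar>" using t aS(2)[of i] by (intro piece(6)[OF I(1)]) auto
        also have "\<dots> \<le> L * (1 / real n)" using t aS[of i] L by (intro mult_left_mono) auto
        finally show ?thesis using False by simp
      qed
      have "\<bar>f (a i) * (a (Suc i) - a i) - integral {a i..a (Suc i)} f\<bar> \<le> ?c * (a (Suc i) - a i)"
      proof -
        have "integral {a i..a (Suc i)} (\<lambda>t. f (a i) - f t) = f (a i) * (a (Suc i) - a i) - integral {a i..a (Suc i)} f"
          using int[OF ii] aS(2)[of i] by (subst Henstock_Kurzweil_Integration.integral_diff) (auto simp: mult.commute)
        moreover have "norm (integral {a i..a (Suc i)} (\<lambda>t. f (a i) - f t)) \<le> integral {a i..a (Suc i)} (\<lambda>t. ?c)"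
          by (rule integral_norm_bound_integral) (use int[OF ii] osc in \<open>auto intro!: integrable_diff\<close>)
        moreover have "integral {a i..a (Suc i)} (\<lambda>t. d) = d * (a (Suc i) - a i)" for d :: real
          using aS(2)[of i] by (simp add: mult.commute)
        ultimately show ?thesis unfolding real_norm_def by metis
      qed
      then have "real n * \<bar>f (a i) * (1 / real n) - integral {a i..a (Suc i)} f\<bar> \<le> real n * (?c * (1 / real n))"
        unfolding aS(1) using n by (intro mult_left_mono) auto
      moreover have "real n * \<bar>f (a i) * (1 / real n) - integral {a i..a (Suc i)} f\<bar> = \<bar>f (a i) - real n * integral {a i..a (Suc i)} f\<bar>"
      proof -
        have "real n * \<bar>z\<bar> = \<bar>real n * z\<bar>" for z using n by (simp add: abs_mult)
        then show ?thesis using n by (simp add: right_diff_distrib)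
      qed
      ultimately show ?thesis using n by simp
    qed
    have "finite bad" by (simp add: bad_def)
    have "card bad \<le> card ((\<lambda>(e, d). nat \<lfloor>real n * e\<rfloor> - d) ` (E \<times> {0, 1::nat}))"
    proof (rule card_mono)
      \<comment> \<open>A point \<open>e\<close> can lie only in the closed cell with index floor(n
        e) or, at a grid point, in the preceding one.\<close>
      show "bad \<subseteq> (\<lambda>(e, d). nat \<lfloor>real n * e\<rfloor> - d) ` (E \<times> {0, 1::nat})"
      proof
        fix i assume "i \<in> bad"
        then obtain e where e: "e \<in> E" "a i \<le> e" "e \<le> a (Suc i)" by (auto simp: bad_def)
        then have "real i \<le> real n * e" "real n * e \<le> real i + 1" using n by (auto simp: a_def field_simps)
        then have "\<lfloor>real n * e\<rfloor> = int i \<or> \<lfloor>real n * e\<rfloor> = int i + 1" by linarith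
        then have "i = nat \<lfloor>real n * e\<rfloor> - 0 \<or> i = nat \<lfloor>real n * e\<rfloor> - 1" by auto
        then show "i \<in> (\<lambda>(e, d). nat \<lfloor>real n * e\<rfloor> - d) ` (E \<times> {0, 1::nat})" using e(1) by force
      qed
    qed (use finite_E in auto)
    also have "\<dots> \<le> card (E \<times> {0, 1::nat})" using finite_E by (intro card_image_le) auto
    finally have cb: "card bad \<le> 2 * card E" by (simp add: card_cartesian_product)
    have "(\<Sum>i<n. f (real i / real n)) - real n * integral {0..1} f = (\<Sum>i<n. f (a i) - real n * integral {a i..a (Suc i)} f)"
      using sum_int[of n] an by (simp add: a_def sum_subtractf sum_distrib_left)
    then have "\<bar>(\<Sum>i<n. f (real i / real n)) - real n * integral {0..1} f\<bar> \<le> (\<Sum>i<n. \<bar>f (a i) - real n * integral {a i..a (Suc i)} f\<bar>)"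
      by simp
    also have "\<dots> \<le> (\<Sum>i<n. L / real n + (if i \<in> bad then 2 * M else 0))" by (intro sum_mono cell) simp
    also have "\<dots> = L + 2 * M * real (card bad)"
    proof -
      have "(\<Sum>i<n. if i \<in> bad then 2 * M else 0) = (\<Sum>i\<in>bad. 2 * M)"
        by (rule sum.mono_neutral_cong_right) (auto simp: bad_def)
      then show ?thesis using n by (simp add: sum.distrib mult.commute)
    qed
    also have "\<dots> \<le> L + 2 * M * real (2 * card E)" using cb M(1) by (intro add_left_mono mult_left_mono) auto
    finally show ?thesis .
  qed
  then show ?thesis by blast
qed

text \<open>The variables are sampled at i = 1, ..., n, whereas the sums of the critical condition
  start at 0; for n > 0 they differ by f(1) - f(0).\<close>

lemma riemann_sum_bounded_error':
  "\<exists>C. \<forall>n. \<bar>(\<Sum>i=1..n. f (real i / real n)) - real n * integral {0..1} f\<bar> \<le> C"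
proof -
  obtain C where C: "\<And>n. \<bar>(\<Sum>i<n. f (real i / real n)) - real n * integral {0..1} f\<bar> \<le> C"
    using riemann_sum_bounded_error by blast
  have "\<bar>(\<Sum>i=1..n. f (real i / real n)) - real n * integral {0..1} f\<bar> \<le> C + \<bar>f 1\<bar> + \<bar>f 0\<bar>" for n
  proof (cases n)
    case 0
    then show ?thesis using C[of 0] by simp
  next
    case (Suc m)
    have "(\<Sum>i=1..n. f (real i / real n)) = (\<Sum>i<Suc n. f (real i / real n)) - f 0"
    proof -
      have "(\<Sum>i<Suc n. f (real i / real n)) = f (real 0 / real n) + (\<Sum>i<n. f (real (Suc i) / real n))"
        by (rule sum.lessThan_Suc_shift)
      also have "(\<Sum>i<n. f (real (Suc i) / real n)) = (\<Sum>i=1..n. f (real i / real n))"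
        by (rule sum.reindex_bij_witness[of _ "\<lambda>i. i - 1" Suc]) auto
      finally show ?thesis by simp
    qed
    also have "(\<Sum>i<Suc n. f (real i / real n)) = (\<Sum>i<n. f (real i / real n)) + f 1" using Suc by simp
    finally show ?thesis using C[of n] by linarith
  qed
  then show ?thesis by blast
qed

end

text \<open>On a piece, \<open>g\<close> is the restriction of a function h that is Lipschitz on
  [0, 1]. If h vanished at a point t0 of the closure, then g <= L |t - t0| on the piece, and the
  integral of 1 / g^2 over a one-sided neighbourhood of t0 would diverge.\<close>

lemma finite_norm2_inverse_lower_bound:
  assumes C1: "piecewise_C1 g" and nonneg: "\<And>t. t \<in> {0..1} \<Longrightarrow> g t \<ge> 0" and fin: "finite_norm2_inverse g"
  shows "\<exists>\<delta>>0. \<forall>t\<in>{0..1}. g t \<ge> \<delta>"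
proof -
  obtain \<I> where finI: "finite \<I>" and cov: "\<Union>\<I> = {0..1}"
    and I: "\<And>I. I \<in> \<I> \<Longrightarrow> is_interval I \<and> interior I \<noteq> {} \<and> (\<exists>h. h C1_differentiable_on UNIV \<and> (\<forall>t\<in>I. g t = h t))"
    using C1 unfolding piecewise_C1_def by blast
  have "\<exists>\<delta>>0. \<forall>t\<in>J. g t \<ge> \<delta>" if J: "J \<in> \<I>" for J
  proof -
    obtain h where h: "h C1_differentiable_on UNIV" "\<And>t. t \<in> J \<Longrightarrow> g t = h t" using I[OF J] by blast
    have J01: "J \<subseteq> {0..1}" using J cov by blast
    have cl01: "closure J \<subseteq> {0..1}" using J01 closed_atLeastAtMost by (rule closure_minimal)
    have cont: "continuous_on A h" for A
      using h(1) C1_differentiable_imp_continuous_on continuous_on_subset by blast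
    have ne: "J \<noteq> {}" using I[OF J] by auto
    have "compact (closure J)" using cl01 by (meson bounded_closed_interval bounded_subset compact_closure closure_subset order_trans)
    \<comment> \<open>The minimum is taken over the closure, since a half-open piece may attain it
      only at the missing end point.\<close>
    then obtain t0 where t0: "t0 \<in> closure J" "\<And>t. t \<in> closure J \<Longrightarrow> h t0 \<le> h t"
      using continuous_attains_inf[OF _ _ cont, of "closure J"] ne by auto
    have h_nonneg: "h t \<ge> 0" if "t \<in> closure J" for t
    proof (rule continuous_ge_on_closure[OF cont that])
      fix s assume "s \<in> J" then show "0 \<le> h s" using h(2) nonneg[of s] J01 by auto
    qed
    have "h t0 > 0"
    proof (rule ccontr)
      assume "\<not> h t0 > 0"
      then have ht0: "h t0 = 0" using h_nonneg[OF t0(1)] by simp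
      obtain L0 where L0: "L0 \<ge> 0" "\<forall>s\<in>{0..1}. \<forall>t\<in>{0..1}. \<bar>h s - h t\<bar> \<le> L0 * \<bar>s - t\<bar>" using C1_lipschitz[OF h(1)] by blast
      define L where "L = L0 + 1"
      have L: "L > 0" using L0 by (simp add: L_def)
      have gL: "g t \<le> L * \<bar>t - t0\<bar>" if t: "t \<in> J" for t
      proof -
        have "\<bar>h t - h t0\<bar> \<le> L0 * \<bar>t - t0\<bar>" using L0(2) t J01 t0(1) cl01 by blast
        also have "\<dots> \<le> L * \<bar>t - t0\<bar>" by (simp add: L_def mult_right_mono)
        finally show ?thesis using h(2)[OF t] ht0 by simp
      qed
      obtain p q where pq: "p < q" "{p..q} \<subseteq> J"
      proof -
        obtain x where "x \<in> interior J" using I[OF J] by blast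
        then obtain r where r: "r > 0" "cball x r \<subseteq> J" unfolding mem_interior_cball by blast
        have "{x..x + r} \<subseteq> J" using r by (auto simp: cball_def dist_real_def)
        then show ?thesis using that[of x "x + r"] r by simp
      qed
      have conv: "x \<in> J" if "a \<in> J" "b \<in> J" "a \<le> x" "x \<le> b" for a b x
        using I[OF J] that mem_is_interval_1_I by blast
      \<comment> \<open>\<open>t0\<close> may be an end point of the piece, and then only one side
        of it is available; its position relative to the nondegenerate interval
        \<open>{p..q}\<close> tells which.\<close>
      have "\<exists>\<eta>0>0. (\<forall>x. t0 < x \<and> x < t0 + \<eta>0 \<longrightarrow> x \<in> J) \<or> (\<forall>x. t0 - \<eta>0 < x \<and> x < t0 \<longrightarrow> x \<in> J)"
      proof (cases "t0 < q")
        case True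
        have "x \<in> J" if x: "t0 < x" "x < t0 + (q - t0)" for x
        proof -
          obtain y where "y \<in> J" "dist y t0 < x - t0" using t0(1) x(1) closure_approachable[of t0 J] by (metis diff_gt_0_iff_gt)
          then have "y \<le> x" by (simp add: dist_real_def)
          moreover have "q \<in> J" using pq by auto
          ultimately show ?thesis using conv[OF \<open>y \<in> J\<close> \<open>q \<in> J\<close>] x by simp
        qed
        then show ?thesis using True by (intro exI[of _ "q - t0"]) auto
      next
        case False
        have "x \<in> J" if x: "t0 - (t0 - p) < x" "x < t0" for x
        proof -
          obtain y where "y \<in> J" "dist y t0 < t0 - x" using t0(1) x(2) closure_approachable[of t0 J] by (metis diff_gt_0_iff_gt)
          then have "x \<le> y" by (simp add: dist_real_def)
          moreover have "p \<in> J" using pq by auto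
          ultimately show ?thesis using conv[OF \<open>p \<in> J\<close> \<open>y \<in> J\<close>] x by simp
        qed
        then show ?thesis using False pq(1) by (intro exI[of _ "t0 - p"]) auto
      qed
      then obtain \<eta>0 where \<eta>0: "\<eta>0 > 0" "(\<forall>x. t0 < x \<and> x < t0 + \<eta>0 \<longrightarrow> x \<in> J) \<or> (\<forall>x. t0 - \<eta>0 < x \<and> x < t0 \<longrightarrow> x \<in> J)" by blast
      define N where "N = (\<integral>\<^sup>+ t\<in>{0..1}. (inverse (ennreal (g t)))\<^sup>2 \<partial>lborel)"
      have Nfin: "N < \<infinity>" using fin by (simp add: finite_norm2_inverse_def N_def)
      \<comment> \<open>On an interval of length \<open>\<eta>\<close> next to \<open>t0\<close> the
        integrand is at least 1 / (L \<eta>)^2.\<close>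
      have key: "ennreal (1 / (L\<^sup>2 * \<eta>)) \<le> N" if \<eta>: "0 < \<eta>" "\<eta> \<le> \<eta>0" for \<eta>
      proof -
        obtain A where A: "A \<subseteq> J" "A \<in> sets lborel" "emeasure lborel A = ennreal \<eta>" "\<And>t. t \<in> A \<Longrightarrow> \<bar>t - t0\<bar> \<le> \<eta>"
        proof (cases "\<forall>x. t0 < x \<and> x < t0 + \<eta>0 \<longrightarrow> x \<in> J")
          case True
          show ?thesis by (rule that[of "{t0<..<t0 + \<eta>}"]) (use True \<eta> in auto)
        next
          case False
          then have "\<forall>x. t0 - \<eta>0 < x \<and> x < t0 \<longrightarrow> x \<in> J" using \<eta>0 by blast
          then show ?thesis by (intro that[of "{t0 - \<eta><..<t0}"]) (use \<eta> in auto)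
        qed
        have "ennreal (1 / (L\<^sup>2 * \<eta>)) = (\<integral>\<^sup>+ t. ennreal (1 / (L * \<eta>)\<^sup>2) * indicator A t \<partial>lborel)"
          using A L \<eta> by (subst nn_integral_cmult_indicator) (auto simp: ennreal_mult[symmetric] power2_eq_square)
        also have "\<dots> \<le> N"
          unfolding N_def
        proof (rule nn_integral_mono)
          fix t :: real
          show "ennreal (1 / (L * \<eta>)\<^sup>2) * indicator A t \<le> (inverse (ennreal (g t)))\<^sup>2 * indicator {0..1} t"
          proof (cases "t \<in> A")
            case True
            then have tJ: "t \<in> J" using A(1) by blast
            have "g t \<le> L * \<bar>t - t0\<bar>" by (rule gL[OF tJ])
            also have "\<dots> \<le> L * \<eta>" using A(4)[OF True] L by (intro mult_left_mono) auto
            finally have le: "g t \<le> L * \<eta>" .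
            have "inverse (ennreal (L * \<eta>)) \<le> inverse (ennreal (g t))"
            proof (cases "g t = 0")
              case False
              then have g0: "0 < g t" using nonneg[of t] tJ J01 by (auto simp: less_le)
              then have "inverse (L * \<eta>) \<le> inverse (g t)" using le by (intro le_imp_inverse_le)
              then show ?thesis using g0 L \<eta> by (simp add: inverse_ennreal ennreal_leI)
            qed simp
            then have "(inverse (ennreal (L * \<eta>)))\<^sup>2 \<le> (inverse (ennreal (g t)))\<^sup>2" by (rule power_mono) simp
            moreover have "(inverse (ennreal (L * \<eta>)))\<^sup>2 = ennreal (1 / (L * \<eta>)\<^sup>2)"
              using L \<eta> by (simp add: inverse_ennreal ennreal_power power_one_over inverse_eq_divide)
            ultimately show ?thesis using True tJ J01 by auto
          qed simp
        qed
        finally show ?thesis .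
      qed
      obtain m where m: "N = ennreal m" "m \<ge> 0" using Nfin by (cases N) auto
      \<comment> \<open>This choice gives m L^2 \<eta> <= m / (m + 1) < 1, whereas the lower bound
        on the integral demands m L^2 \<eta> >= 1.\<close>
      define \<eta> where "\<eta> = min \<eta>0 (1 / (L\<^sup>2 * (m + 1)))"
      have \<eta>: "0 < \<eta>" "\<eta> \<le> \<eta>0" using \<eta>0(1) L m(2) by (auto simp: \<eta>_def)
      have "1 / (L\<^sup>2 * \<eta>) \<le> m" using key[OF \<eta>] m by simp
      then have "1 \<le> m * (L\<^sup>2 * \<eta>)" using L \<eta> by (simp add: field_simps)
      also have "\<dots> \<le> m * (L\<^sup>2 * (1 / (L\<^sup>2 * (m + 1))))" using m(2) by (intro mult_left_mono) (auto simp: \<eta>_def)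
      also have "\<dots> = m / (m + 1)" using L by simp
      also have "\<dots> < 1" using m(2) by simp
      finally show False by simp
    qed
    then show ?thesis using t0 h(2) closure_subset by (metis subsetD)
  qed
  then obtain d where d: "\<And>J. J \<in> \<I> \<Longrightarrow> d J > 0 \<and> (\<forall>t\<in>J. g t \<ge> d J)" by metis
  have neI: "\<I> \<noteq> {}" using cov by auto
  show ?thesis
  proof (intro exI[of _ "Min (d ` \<I>)"] conjI ballI)
    show "0 < Min (d ` \<I>)" using d finI neI by (subst Min_gr_iff) auto
    fix t :: real assume "t \<in> {0..1}"
    then obtain J where J: "J \<in> \<I>" "t \<in> J" using cov by blast
    have "Min (d ` \<I>) \<le> d J" using finI J by (intro Min_le) auto
    then show "Min (d ` \<I>) \<le> g t" using d[OF J(1)] J(2) by force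
  qed
qed

section \<open>The support interval\<close>

lemma complex_lipschitz_integrable:
  fixes \<phi> :: "real \<Rightarrow> complex"
  assumes a: "pw_lipschitz \<I> L a" and K: "K \<ge> 0"
    and \<phi>: "\<And>s t. s \<in> {0..1} \<Longrightarrow> t \<in> {0..1} \<Longrightarrow> norm (\<phi> (a s) - \<phi> (a t)) \<le> K * \<bar>a s - a t\<bar>"
  shows "(\<lambda>s. \<phi> (a s)) integrable_on {0..1}"
proof -
  have "(\<lambda>s. Re (\<phi> (a s))) integrable_on {0..1}"
  proof (rule pw_lipschitz_integrable[OF pw_lipschitz_compose[OF a K, of "\<lambda>v. Re (\<phi> v)"]])
    show "\<bar>Re (\<phi> (a s)) - Re (\<phi> (a t))\<bar> \<le> K * \<bar>a s - a t\<bar>" if "s \<in> {0..1}" "t \<in> {0..1}" for s t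
      using abs_Re_le_cmod[of "\<phi> (a s) - \<phi> (a t)"] \<phi>[OF that] by simp
  qed
  then have re: "((\<lambda>s. complex_of_real (Re (\<phi> (a s)))) has_integral of_real (integral {0..1} (\<lambda>s. Re (\<phi> (a s))))) {0..1}"
    by (intro has_integral_of_real integrable_integral)
  have "(\<lambda>s. Im (\<phi> (a s))) integrable_on {0..1}"
  proof (rule pw_lipschitz_integrable[OF pw_lipschitz_compose[OF a K, of "\<lambda>v. Im (\<phi> v)"]])
    show "\<bar>Im (\<phi> (a s)) - Im (\<phi> (a t))\<bar> \<le> K * \<bar>a s - a t\<bar>" if "s \<in> {0..1}" "t \<in> {0..1}" for s t
      using abs_Im_le_cmod[of "\<phi> (a s) - \<phi> (a t)"] \<phi>[OF that] by simp
  qed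
  then have im: "((\<lambda>s. complex_of_real (Im (\<phi> (a s)))) has_integral of_real (integral {0..1} (\<lambda>s. Im (\<phi> (a s))))) {0..1}"
    by (intro has_integral_of_real integrable_integral)
  have "(\<lambda>s. complex_of_real (Re (\<phi> (a s))) + \<i> * complex_of_real (Im (\<phi> (a s)))) integrable_on {0..1}"
    by (rule has_integral_integrable[OF has_integral_add[OF re has_integral_mult_right[OF im]]])
  then show ?thesis by (simp only: complex_eq[symmetric])
qed

lemma norm_resolvent_denominator:
  fixes v M :: real and z :: complex
  assumes "\<bar>v\<bar> \<le> M" "M * norm z \<le> 1 / 2"
  shows "1 / 2 \<le> norm (1 - of_real v * z)" "1 - of_real v * z \<noteq> 0"
proof -
  have "norm (of_real v * z) \<le> M * norm z" using assms(1) by (simp add: norm_mult mult_right_mono)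
  then have "norm (of_real v * z) \<le> 1 / 2" using assms(2) by simp
  then show *: "1 / 2 \<le> norm (1 - of_real v * z)" using norm_triangle_ineq2[of 1 "of_real v * z"] by simp
  then show "1 - of_real v * z \<noteq> 0" by auto
qed

text \<open>The integrated remainder in v z / (1 - v z) = v z + z^2 v^2 / (1 - v z). At z = 0 it is
  the squared norm of the profile.\<close>

definition resolvent_remainder :: "(real \<Rightarrow> real) \<Rightarrow> complex \<Rightarrow> complex" where
  "resolvent_remainder a z = integral {0..1} (\<lambda>s. (of_real (a s))\<^sup>2 / (1 - of_real (a s) * z))"

context
  fixes \<I> :: "real set set" and L M :: real and a :: "real \<Rightarrow> real"
  assumes a: "pw_lipschitz \<I> L a" and M: "M > 0" and aM: "\<forall>t\<in>{0..1}. \<bar>a t\<bar> \<le> M"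
begin

lemma resolvent_remainder_integrable:
  assumes z: "M * norm z \<le> 1 / 2"
  shows "(\<lambda>s. (complex_of_real (a s))\<^sup>2 / (1 - of_real (a s) * z)) integrable_on {0..1}"
proof (rule complex_lipschitz_integrable[OF a, of "4 * (2 * M + M * (1 / 2))" "\<lambda>v. (of_real v)\<^sup>2 / (1 - of_real v * z)"])
  show "0 \<le> 4 * (2 * M + M * (1 / 2))" using M by simp
  fix s t :: real assume "s \<in> {0..1}" "t \<in> {0..1}"
  then have st: "\<bar>a s\<bar> \<le> M" "\<bar>a t\<bar> \<le> M" using aM by auto
  let ?v = "complex_of_real (a s)" and ?w = "complex_of_real (a t)"
  note dv = norm_resolvent_denominator[OF st(1) z] and dw = norm_resolvent_denominator[OF st(2) z]
  have "?v\<^sup>2 / (1 - ?v * z) - ?w\<^sup>2 / (1 - ?w * z) =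
      (?v - ?w) * (?v + ?w - ?v * ?w * z) / ((1 - ?v * z) * (1 - ?w * z))"
    using dv(2) dw(2) by (simp add: diff_frac_eq power2_eq_square) (simp add: algebra_simps)
  also have "norm \<dots> = \<bar>a s - a t\<bar> * norm (?v + ?w - ?v * ?w * z) / (norm (1 - ?v * z) * norm (1 - ?w * z))"
    unfolding norm_mult norm_divide by (simp flip: of_real_diff)
  also have "\<dots> \<le> \<bar>a s - a t\<bar> * (2 * M + M * (1 / 2)) / (1 / 2 * (1 / 2))"
  proof (rule frac_le)
    have "norm (?v * ?w * z) = \<bar>a s\<bar> * (\<bar>a t\<bar> * norm z)" by (simp add: norm_mult)
    also have "\<dots> \<le> M * (M * norm z)" using st by (intro mult_mono mult_right_mono) auto
    also have "\<dots> \<le> M * (1 / 2)" using z M by (intro mult_left_mono) auto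
    finally have "norm (?v * ?w * z) \<le> M * (1 / 2)" .
    moreover have "norm (?v + ?w) \<le> \<bar>a s\<bar> + \<bar>a t\<bar>" by (rule norm_triangle_le) simp
    ultimately have "norm (?v + ?w - ?v * ?w * z) \<le> 2 * M + M * (1 / 2)"
      using norm_triangle_ineq4[of "?v + ?w" "?v * ?w * z"] st by linarith
    then show "\<bar>a s - a t\<bar> * norm (?v + ?w - ?v * ?w * z) \<le> \<bar>a s - a t\<bar> * (2 * M + M * (1 / 2))"
      by (intro mult_left_mono) auto
    show "1 / 2 * (1 / 2) \<le> norm (1 - ?v * z) * norm (1 - ?w * z)"
      by (rule mult_mono[OF dv(1) dw(1)]) auto
  qed (use M in auto)
  finally show "norm (?v\<^sup>2 / (1 - ?v * z) - ?w\<^sup>2 / (1 - ?w * z)) \<le> 4 * (2 * M + M * (1 / 2)) * \<bar>a s - a t\<bar>"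
    by (simp add: algebra_simps)
qed

lemma resolvent_has_integral:
  assumes z: "M * norm z \<le> 1 / 2"
  shows "((\<lambda>s. of_real (a s) * z / (1 - of_real (a s) * z)) has_integral
    z * of_real (integral {0..1} a) + z\<^sup>2 * resolvent_remainder a z) {0..1}"
proof -
  have "((\<lambda>s. z * of_real (a s) + z\<^sup>2 * ((of_real (a s))\<^sup>2 / (1 - of_real (a s) * z))) has_integral
    z * of_real (integral {0..1} a) + z\<^sup>2 * resolvent_remainder a z) {0..1}"
    unfolding resolvent_remainder_def
    by (intro has_integral_add has_integral_mult_right has_integral_of_real integrable_integral
        pw_lipschitz_integrable[OF a] resolvent_remainder_integrable z)
  then show ?thesis
  proof (rule has_integral_eq[rotated])
    fix s :: real assume "s \<in> {0..1}"
    note d = norm_resolvent_denominator(2)[OF bspec[OF aM this] z]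
    have "w + w\<^sup>2 / (1 - w) = w / (1 - w)" if "1 - w \<noteq> 0" for w :: complex
      using that by (simp add: field_simps power2_eq_square)
    from this[OF d] show "z * of_real (a s) + z\<^sup>2 * ((of_real (a s))\<^sup>2 / (1 - of_real (a s) * z)) =
        of_real (a s) * z / (1 - of_real (a s) * z)"
      by (simp add: power_mult_distrib mult_ac)
  qed
qed

text \<open>Both denominators have modulus at least 1/2. The estimate supplies the continuity for
  the intermediate value argument and keeps the remainder close to its value at 0.\<close>

lemma resolvent_remainder_lipschitz:
  assumes z: "M * norm z \<le> 1 / 2" and w: "M * norm w \<le> 1 / 2"
  shows "norm (resolvent_remainder a z - resolvent_remainder a w) \<le> 4 * M ^ 3 * norm (z - w)"
proof -
  let ?F = "\<lambda>z s. (complex_of_real (a s))\<^sup>2 / (1 - of_real (a s) * z)"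
  have "norm (integral {0..1} (\<lambda>s. ?F z s - ?F w s)) \<le> integral {0..1} (\<lambda>s::real. 4 * M ^ 3 * norm (z - w))"
  proof (rule integral_norm_bound_integral)
    show "(\<lambda>s. ?F z s - ?F w s) integrable_on {0..1}"
      by (intro integrable_diff resolvent_remainder_integrable z w)
    fix s :: real assume "s \<in> {0..1}"
    note s = bspec[OF aM this]
    let ?v = "complex_of_real (a s)"
    note dz = norm_resolvent_denominator[OF s z] and dw = norm_resolvent_denominator[OF s w]
    have "?F z s - ?F w s = ?v ^ 3 * (z - w) / ((1 - ?v * z) * (1 - ?v * w))"
      using dz(2) dw(2) by (simp add: diff_frac_eq power2_eq_square power3_eq_cube) (simp add: algebra_simps)
    also have "norm \<dots> = \<bar>a s\<bar> ^ 3 * norm (z - w) / (norm (1 - ?v * z) * norm (1 - ?v * w))"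
      by (simp add: norm_mult norm_divide norm_power)
    also have "\<dots> \<le> M ^ 3 * norm (z - w) / (1 / 2 * (1 / 2))"
    proof (rule frac_le)
      show "\<bar>a s\<bar> ^ 3 * norm (z - w) \<le> M ^ 3 * norm (z - w)"
        using s by (intro mult_right_mono power_mono) auto
      show "1 / 2 * (1 / 2) \<le> norm (1 - ?v * z) * norm (1 - ?v * w)"
        by (rule mult_mono[OF dz(1) dw(1)]) auto
    qed (use M in auto)
    finally show "norm (?F z s - ?F w s) \<le> 4 * M ^ 3 * norm (z - w)" by simp
  qed (rule integrable_const_ivl)
  moreover have "integral {0..1} (\<lambda>s. ?F z s - ?F w s) = resolvent_remainder a z - resolvent_remainder a w"
    unfolding resolvent_remainder_def
    by (rule Henstock_Kurzweil_Integration.integral_diff) (intro resolvent_remainder_integrable z w)+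
  ultimately show ?thesis by simp
qed

lemma resolvent_remainder_0: "resolvent_remainder a 0 = of_real (integral {0..1} (\<lambda>t. (a t)\<^sup>2))"
proof -
  obtain L' where "pw_lipschitz \<I> L' (\<lambda>t. (a t)\<^sup>2)" using pw_lipschitz_power2[OF a] by blast
  from has_integral_of_real[OF integrable_integral[OF pw_lipschitz_integrable[OF this]]]
  have "((\<lambda>t. complex_of_real ((a t)\<^sup>2)) has_integral of_real (integral {0..1} (\<lambda>t. (a t)\<^sup>2))) {0..1}" .
  from integral_unique[OF this] show ?thesis unfolding resolvent_remainder_def by simp
qed

end

text \<open>On the segment \<open>z = \<eta> (t + \<i>)\<close>, \<open>\<bar>t\<bar> \<le> 1\<close>, the imaginary part of \<open>z\<^sup>2 Q z\<close> changes sign.\<close>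

lemma real_value_near_0:
  fixes Q :: "complex \<Rightarrow> complex"
  assumes Q: "\<And>z w. norm z \<le> \<rho> \<Longrightarrow> norm w \<le> \<rho> \<Longrightarrow> norm (Q z - Q w) \<le> K * norm (z - w)"
    and \<rho>: "\<rho> > 0" and Q0: "Q 0 = of_real m" and m: "m > 0" and \<epsilon>: "\<epsilon> > 0"
  shows "\<exists>z u. z \<notin> \<real> \<and> norm z \<le> \<rho> \<and> z\<^sup>2 * Q z = of_real u \<and> - \<epsilon> < u \<and> u < 0"
proof -
  have "0 \<le> K * \<rho>" using order_trans[OF norm_ge_zero Q[of "of_real \<rho>" 0]] \<rho> by simp
  then have K: "K \<ge> 0" using \<rho> by (simp add: zero_le_mult_iff)
  have "eventually (\<lambda>\<eta>. 2 * \<eta> < \<rho> \<and> K * (2 * \<eta>) < m / 4 \<and> (2 * \<eta>)\<^sup>2 * (2 * m) < \<epsilon>) (at_right (0::real))"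
  proof (intro eventually_conj)
    have "((\<lambda>\<eta>::real. 2 * \<eta>) \<longlongrightarrow> 2 * 0) (at_right 0)" by (intro tendsto_intros)
    then show "eventually (\<lambda>\<eta>. 2 * \<eta> < \<rho>) (at_right (0::real))" by (rule order_tendstoD) (use \<rho> in simp)
    have "((\<lambda>\<eta>::real. K * (2 * \<eta>)) \<longlongrightarrow> K * (2 * 0)) (at_right 0)" by (intro tendsto_intros)
    then show "eventually (\<lambda>\<eta>. K * (2 * \<eta>) < m / 4) (at_right (0::real))" by (rule order_tendstoD) (use m in simp)
    have "((\<lambda>\<eta>::real. (2 * \<eta>)\<^sup>2 * (2 * m)) \<longlongrightarrow> (2 * 0)\<^sup>2 * (2 * m)) (at_right 0)" by (intro tendsto_intros)
    then show "eventually (\<lambda>\<eta>. (2 * \<eta>)\<^sup>2 * (2 * m) < \<epsilon>) (at_right (0::real))" by (rule order_tendstoD) (use \<epsilon> in simp)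
  qed
  from eventually_happens'[OF _ eventually_conj[OF eventually_at_right_less this]]
  obtain \<eta> :: real where \<eta>: "\<eta> > 0" "2 * \<eta> < \<rho>" "K * (2 * \<eta>) < m / 4" "(2 * \<eta>)\<^sup>2 * (2 * m) < \<epsilon>" by auto
  define z where "z t = Complex (\<eta> * t) \<eta>" for t
  have nz: "norm (z t) \<le> 2 * \<eta>" if "t \<in> {-1..1}" for t
  proof -
    have "norm (z t) \<le> \<bar>\<eta> * t\<bar> + \<bar>\<eta>\<bar>" using cmod_le[of "z t"] by (simp add: z_def)
    also have "\<dots> \<le> \<eta> * 1 + \<eta>" unfolding abs_mult using \<eta>(1) that by (intro add_mono mult_mono) auto
    finally show ?thesis by simp
  qed
  have near: "norm (Q (z t) - of_real m) \<le> m / 4" if "t \<in> {-1..1}" for t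
  proof -
    have "norm (Q (z t) - Q 0) \<le> K * norm (z t - 0)" using nz[OF that] \<eta> \<rho> by (intro Q) auto
    also have "\<dots> \<le> K * (2 * \<eta>)" using nz[OF that] K by (intro mult_left_mono) auto
    finally show ?thesis using \<eta>(3) Q0 by simp
  qed
  have ReQ: "Re (Q (z t)) > 0" if "t \<in> {-1..1}" for t
    using near[OF that] abs_Re_le_cmod[of "Q (z t) - of_real m"] m by simp
  \<comment> \<open>Up to the factor \<open>\<eta>\<close> squared this is the imaginary part of z^2
    Q(z). At t = -1 and t = 1 the term with Im Q vanishes, and the sign is that of t.\<close>
  define h where "h t = (t\<^sup>2 - 1) * Im (Q (z t)) + 2 * t * Re (Q (z t))" for t
  have expand: "(z t)\<^sup>2 * Q (z t) = of_real (\<eta>\<^sup>2) * Complex ((t\<^sup>2 - 1) * Re (Q (z t)) - 2 * t * Im (Q (z t))) (h t)" for t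
    by (simp add: complex_eq_iff z_def h_def power2_eq_square) (simp add: algebra_simps)
  have "continuous_on {-1..1} (\<lambda>t. Q (z t))"
  proof (rule continuous_on_compose2[where t = "cball 0 \<rho>" and g = Q and f = z])
    have "lipschitz_on K (cball 0 \<rho>) Q"
      by (rule lipschitz_onI) (use Q K in \<open>auto simp: dist_norm\<close>)
    then show "continuous_on (cball 0 \<rho>) Q" by (rule lipschitz_on_continuous_on)
    have "z = (\<lambda>t. of_real (\<eta> * t) + \<i> * of_real \<eta>)" by (auto simp: z_def complex_eq_iff)
    then show "continuous_on {-1..1} z" by (simp only:) (intro continuous_intros)
    show "z ` {-1..1} \<subseteq> cball 0 \<rho>" using nz \<eta>(2) by fastforce
  qed
  then have "continuous_on {-1..1} h" unfolding h_def by (intro continuous_intros)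
  moreover have "h (-1) \<le> 0" "0 \<le> h 1" using ReQ[of "-1"] ReQ[of 1] by (auto simp: h_def)
  ultimately obtain t where t: "-1 \<le> t" "t \<le> 1" "h t = 0" using IVT'[of h "-1" 0 1] by auto
  have tI: "t \<in> {-1..1}" using t by simp
  let ?R = "Re (Q (z t))" and ?I = "Im (Q (z t))"
  define v where "v = (t\<^sup>2 - 1) * ?R - 2 * t * ?I"
  have "t \<noteq> 1" "t \<noteq> -1" using t(3) ReQ[of 1] ReQ[of "-1"] by (auto simp: h_def)
  then have t2: "t\<^sup>2 < 1" using t by (simp add: abs_square_less_1 abs_if)
  have tR: "2 * t * ?R = (1 - t\<^sup>2) * ?I" using t(3) by (simp add: h_def algebra_simps)
  \<comment> \<open>Multiplied by Re Q and reduced with h(t) = 0, the real part turns into (t^2 - 1)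
    |Q|^2, which is negative because |t| < 1.\<close>
  have "v * ?R = (t\<^sup>2 - 1) * ?R\<^sup>2 - (2 * t * ?R) * ?I" by (simp add: v_def power2_eq_square algebra_simps)
  then have "v * ?R = (t\<^sup>2 - 1) * (?R\<^sup>2 + ?I\<^sup>2)" unfolding tR by (simp add: power2_eq_square algebra_simps)
  moreover have "?R\<^sup>2 + ?I\<^sup>2 > 0" using ReQ[OF tI] by (simp add: add_pos_nonneg)
  ultimately have "v * ?R < 0" using t2 by (simp add: mult_neg_pos)
  then have v0: "v < 0" using ReQ[OF tI] by (simp add: mult_less_0_iff)
  have val: "(z t)\<^sup>2 * Q (z t) = of_real (\<eta>\<^sup>2 * v)"
    unfolding expand t(3) v_def by (simp add: complex_eq_iff)
  have "norm ((z t)\<^sup>2 * Q (z t)) \<le> (2 * \<eta>)\<^sup>2 * (2 * m)"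
    unfolding norm_mult norm_power
  proof (intro mult_mono power_mono nz tI)
    show "norm (Q (z t)) \<le> 2 * m"
      using near[OF tI] norm_triangle_ineq2[of "Q (z t)" "of_real m"] m by simp
  qed auto
  then have "\<bar>\<eta>\<^sup>2 * v\<bar> < \<epsilon>" unfolding val norm_of_real using \<eta>(4) by simp
  moreover have "\<eta>\<^sup>2 * v < 0" using v0 \<eta>(1) by (simp add: mult_pos_neg)
  ultimately have "- \<epsilon> < \<eta>\<^sup>2 * v" "\<eta>\<^sup>2 * v < 0" by auto
  moreover have "z t \<notin> \<real>" using \<eta>(1) by (simp add: complex_is_Real_iff z_def)
  moreover have "norm (z t) \<le> \<rho>" using nz[OF tI] \<eta>(2) by simp
  ultimately show ?thesis using val by blast
qed

text \<open>The common core of both corners: the critical condition removes the term linear in z,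
  and the squared norms make the quadratic coefficient positive, so that arbitrarily small negative
  values occur at nonreal z near 0.\<close>

lemma resolvent_pair_real_value:
  assumes a: "pw_lipschitz \<I> L a" and b: "pw_lipschitz \<J> L' b"
    and M: "M > 0" and aM: "\<forall>t\<in>{0..1}. \<bar>a t\<bar> \<le> M" and bM: "\<forall>t\<in>{0..1}. \<bar>b t\<bar> \<le> M"
    and first: "\<alpha> * integral {0..1} a + \<beta> * integral {0..1} b = 0"
    and second: "\<alpha> * integral {0..1} (\<lambda>t. (a t)\<^sup>2) + \<beta> * integral {0..1} (\<lambda>t. (b t)\<^sup>2) > 0"
    and \<epsilon>: "\<epsilon> > 0"
  shows "\<exists>z u A B. z \<notin> \<real> \<and> M * norm z \<le> 1 / 2 \<and> - \<epsilon> < u \<and> u < 0 \<and>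
    ((\<lambda>s. of_real (a s) * z / (1 - of_real (a s) * z)) has_integral A) {0..1} \<and>
    ((\<lambda>s. of_real (b s) * z / (1 - of_real (b s) * z)) has_integral B) {0..1} \<and>
    of_real \<alpha> * A + of_real \<beta> * B = complex_of_real u"
proof -
  define Q where "Q z = of_real \<alpha> * resolvent_remainder a z + of_real \<beta> * resolvent_remainder b z" for z
  have small: "M * norm z \<le> 1 / 2 \<longleftrightarrow> norm z \<le> 1 / (2 * M)" for z :: complex using M by (simp add: field_simps)
  have lip: "norm (Q z - Q w) \<le> ((\<bar>\<alpha>\<bar> + \<bar>\<beta>\<bar>) * (4 * M ^ 3)) * norm (z - w)"
    if "norm z \<le> 1 / (2 * M)" "norm w \<le> 1 / (2 * M)" for z w
  proof -
    note zw = that[folded small]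
    have "Q z - Q w = of_real \<alpha> * (resolvent_remainder a z - resolvent_remainder a w) +
        of_real \<beta> * (resolvent_remainder b z - resolvent_remainder b w)"
      by (simp add: Q_def algebra_simps)
    also have "norm \<dots> \<le> norm (of_real \<alpha> * (resolvent_remainder a z - resolvent_remainder a w)) +
        norm (of_real \<beta> * (resolvent_remainder b z - resolvent_remainder b w))" by (rule norm_triangle_ineq)
    also have "\<dots> \<le> \<bar>\<alpha>\<bar> * (4 * M ^ 3 * norm (z - w)) + \<bar>\<beta>\<bar> * (4 * M ^ 3 * norm (z - w))"
      unfolding norm_mult norm_of_real
      by (intro add_mono mult_left_mono resolvent_remainder_lipschitz[OF a M aM zw] resolvent_remainder_lipschitz[OF b M bM zw]) auto
    finally show ?thesis by (simp add: algebra_simps)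
  qed
  have Q0: "Q 0 = of_real (\<alpha> * integral {0..1} (\<lambda>t. (a t)\<^sup>2) + \<beta> * integral {0..1} (\<lambda>t. (b t)\<^sup>2))"
    unfolding Q_def resolvent_remainder_0[OF a M aM] resolvent_remainder_0[OF b M bM] by simp
  have "0 < 1 / (2 * M)" using M by simp
  from real_value_near_0[of "1 / (2 * M)" Q, OF lip this Q0 second \<epsilon>]
  obtain z u where z: "z \<notin> \<real>" "norm z \<le> 1 / (2 * M)" "z\<^sup>2 * Q z = of_real u" "- \<epsilon> < u" "u < 0"
    by blast
  note zM = z(2)[folded small]
  have "of_real \<alpha> * (z * of_real (integral {0..1} a) + z\<^sup>2 * resolvent_remainder a z) +
      of_real \<beta> * (z * of_real (integral {0..1} b) + z\<^sup>2 * resolvent_remainder b z) =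
      z * of_real (\<alpha> * integral {0..1} a + \<beta> * integral {0..1} b) + z\<^sup>2 * Q z"
    by (simp add: Q_def algebra_simps)
  also have "\<dots> = of_real u" using first z(3) by simp
  finally show ?thesis
    using z(1,4,5) zM resolvent_has_integral[OF a M aM zM] resolvent_has_integral[OF b M bM zM] by blast
qed

lemma action_equation_cnj:
  assumes "action_equation f g c t z"
  shows "action_equation f g c t (cnj z)"
proof -
  let ?A = "integral {0..1} (\<lambda>s. complex_of_real (f s) * z / (1 - complex_of_real (f s) * z))"
  let ?B = "integral {0..1} (\<lambda>s. complex_of_real (g s) / (z + complex_of_real (g s)))"
  have "cnj (?A + complex_of_real c * ?B - complex_of_real t) = 0"
    using assms unfolding action_equation_def by simp
  moreover have "cnj ?A = integral {0..1} (\<lambda>s. complex_of_real (f s) * cnj z / (1 - complex_of_real (f s) * cnj z))"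
    unfolding integral_cnj by simp
  moreover have "cnj ?B = integral {0..1} (\<lambda>s. complex_of_real (g s) / (cnj z + complex_of_real (g s)))"
    unfolding integral_cnj by simp
  ultimately show ?thesis by (simp add: action_equation_def)
qed

lemma resolvent_reciprocal:
  fixes v z :: complex
  assumes "v \<noteq> 0" "z + v \<noteq> 0"
  shows "1 + (- (1 / v)) * z / (1 - (- (1 / v)) * z) = v / (z + v)"
proof -
  have "1 - (- (1 / v)) * z = (z + v) / v" using assms(1) by (simp add: add_divide_distrib add.commute)
  then have "(- (1 / v)) * z / (1 - (- (1 / v)) * z) = - (z / (z + v))" using assms by simp
  also have "1 + - (z / (z + v)) = (z + v) / (z + v) - z / (z + v)" using assms(2) by simp
  also have "\<dots> = v / (z + v)" unfolding diff_divide_distrib[symmetric] by simp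
  finally show ?thesis .
qed

lemma resolvent_inversion:
  fixes v w :: complex
  assumes "w \<noteq> 0" "w + v \<noteq> 0"
  shows "v * (- 1 / w) / (1 - v * (- 1 / w)) = - (v / (w + v))"
proof -
  have "1 - v * (- 1 / w) = (w + v) / w" using assms(1) by (simp add: add_divide_distrib)
  then show ?thesis using assms by simp
qed

lemma reciprocal_inversion:
  fixes v w :: complex
  assumes "w \<noteq> 0"
  shows "v / (- 1 / w + v) = - (v * w / (1 - v * w))"
proof -
  have "- 1 / w + v = - ((1 - v * w) / w)" using assms by (simp add: diff_divide_distrib)
  then show ?thesis by simp
qed

lemma nonreal_add_of_real: "z \<notin> \<real> \<Longrightarrow> z + complex_of_real r \<noteq> 0"
  by (metis Reals_minus_iff Reals_of_real add.inverse_inverse eq_neg_iff_add_eq_0)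

text \<open>The integrand g / (z + g) is 1 plus the resolvent of - 1 / g, so near z = 0 the action
  equation reads t = c + u with small u. Nonreal solutions exist for arbitrarily small negative real
  u, and their conjugates complete the pair.\<close>

theorem t_plus_eq:
  assumes f: "pw_lipschitz \<I> L f" and b: "pw_lipschitz \<J> L' (\<lambda>t. 1 / g t)"
    and g: "\<And>t. t \<in> {0..1} \<Longrightarrow> g t > 0" and c: "c > 0"
    and first: "integral {0..1} f = c * integral {0..1} (\<lambda>t. 1 / g t)"
    and second: "sqnorm2 f + c * sqnorm2 (\<lambda>t. 1 / g t) > 0"
  shows "t_plus f g c = c"
proof -
  have b': "pw_lipschitz \<J> L' (\<lambda>t. - (1 / g t))"
    using pw_lipschitz_compose[OF b, of 1 uminus] by simp
  obtain M1 where M1: "M1 > 0" "\<forall>t\<in>{0..1}. \<bar>f t\<bar> \<le> M1" using pw_lipschitz_bounded[OF f] by blast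
  obtain M2 where M2: "M2 > 0" "\<forall>t\<in>{0..1}. \<bar>- (1 / g t)\<bar> \<le> M2" using pw_lipschitz_bounded[OF b'] by blast
  have mem: "\<exists>t\<in>limit_support f g c. c - \<epsilon> < t" if \<epsilon>: "\<epsilon> > 0" for \<epsilon>
  proof -
    \<comment> \<open>The minimum with \<open>c\<close> keeps c + u positive, hence inside
      [-1, c].\<close>
    have "\<exists>z u A B. z \<notin> \<real> \<and> max M1 M2 * norm z \<le> 1 / 2 \<and> - (min \<epsilon> c) < u \<and> u < 0 \<and>
      ((\<lambda>s. of_real (f s) * z / (1 - of_real (f s) * z)) has_integral A) {0..1} \<and>
      ((\<lambda>s. of_real (- (1 / g s)) * z / (1 - of_real (- (1 / g s)) * z)) has_integral B) {0..1} \<and>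
      of_real 1 * A + of_real c * B = complex_of_real u"
    proof (rule resolvent_pair_real_value[OF f b'])
      show "\<forall>t\<in>{0..1}. \<bar>f t\<bar> \<le> max M1 M2" using M1(2) by (auto intro: max.coboundedI1)
      show "\<forall>t\<in>{0..1}. \<bar>- (1 / g t)\<bar> \<le> max M1 M2" using M2(2) by (auto intro: max.coboundedI2)
    qed (use M1(1) first second c \<epsilon> in \<open>auto simp: sqnorm2_def\<close>)
    then obtain z u A B where z: "z \<notin> \<real>" "max M1 M2 * norm z \<le> 1 / 2" "- (min \<epsilon> c) < u" "u < 0"
      and A: "((\<lambda>s. of_real (f s) * z / (1 - of_real (f s) * z)) has_integral A) {0..1}"
      and B: "((\<lambda>s. of_real (- (1 / g s)) * z / (1 - of_real (- (1 / g s)) * z)) has_integral B) {0..1}"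
      and AB: "of_real 1 * A + of_real c * B = complex_of_real u" by blast
    have "((\<lambda>s::real. 1 :: complex) has_integral 1) {0..1}" using has_integral_const_real[of "1::complex" 0 1] by simp
    from has_integral_add[OF this B]
    have "((\<lambda>s. complex_of_real (g s) / (z + complex_of_real (g s))) has_integral 1 + B) {0..1}"
    proof (rule has_integral_eq[rotated])
      fix s :: real assume s: "s \<in> {0..1}"
      show "1 + complex_of_real (- (1 / g s)) * z / (1 - of_real (- (1 / g s)) * z) =
          complex_of_real (g s) / (z + complex_of_real (g s))"
        using resolvent_reciprocal[OF _ nonreal_add_of_real[OF z(1)], of "g s"] g[OF s] by simp
    qed
    then have "action_equation f g c (c + u) z"
      unfolding action_equation_def integral_unique[OF A] by (subst integral_unique, assumption) (use AB in \<open>simp add: algebra_simps\<close>)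
    then have "c + u \<in> limit_support f g c"
      unfolding limit_support_def using z c action_equation_cnj by auto
    then show ?thesis using z(3) by (intro bexI[of _ "c + u"]) auto
  qed
  show ?thesis
    unfolding t_plus_def
  proof (rule cSup_eq_non_empty)
    show "limit_support f g c \<noteq> {}" using mem[of 1] by auto
    show "x \<le> c" if "x \<in> limit_support f g c" for x using that by (simp add: limit_support_def)
    show "c \<le> y" if "\<And>x. x \<in> limit_support f g c \<Longrightarrow> x \<le> y" for y
      using mem[of "c - y"] that by (rule_tac ccontr) force
  qed
qed

text \<open>Under \<open>z = -1 / w\<close> the action equation near infinity becomes the one near 0 with the profiles exchanged.\<close>

theorem t_minus_eq:
  assumes g: "pw_lipschitz \<I> L g" and b: "pw_lipschitz \<J> L' (\<lambda>t. 1 / f t)"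
    and f: "\<And>t. t \<in> {0..1} \<Longrightarrow> f t > 0" and c: "c > 0"
    and first: "integral {0..1} (\<lambda>t. 1 / f t) = c * integral {0..1} g"
    and second: "sqnorm2 (\<lambda>t. 1 / f t) + c * sqnorm2 g > 0"
  shows "t_minus f g c = -1"
proof -
  have b': "pw_lipschitz \<J> L' (\<lambda>t. - (1 / f t))"
    using pw_lipschitz_compose[OF b, of 1 uminus] by simp
  obtain M1 where M1: "M1 > 0" "\<forall>t\<in>{0..1}. \<bar>g t\<bar> \<le> M1" using pw_lipschitz_bounded[OF g] by blast
  obtain M2 where M2: "M2 > 0" "\<forall>t\<in>{0..1}. \<bar>- (1 / f t)\<bar> \<le> M2" using pw_lipschitz_bounded[OF b'] by blast
  have mem: "\<exists>t\<in>limit_support f g c. t < -1 + \<epsilon>" if \<epsilon>: "\<epsilon> > 0" for \<epsilon>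
  proof -
    \<comment> \<open>Here t = - 1 - u; the minimum with 1 keeps it negative, hence inside
      [-1, c].\<close>
    have "\<exists>z u A B. z \<notin> \<real> \<and> max M1 M2 * norm z \<le> 1 / 2 \<and> - (min \<epsilon> 1) < u \<and> u < 0 \<and>
      ((\<lambda>s. of_real (- (1 / f s)) * z / (1 - of_real (- (1 / f s)) * z)) has_integral A) {0..1} \<and>
      ((\<lambda>s. of_real (g s) * z / (1 - of_real (g s) * z)) has_integral B) {0..1} \<and>
      of_real 1 * A + of_real c * B = complex_of_real u"
    proof (rule resolvent_pair_real_value[OF b' g])
      show "\<forall>t\<in>{0..1}. \<bar>g t\<bar> \<le> max M1 M2" using M1(2) by (auto intro: max.coboundedI1)
      show "\<forall>t\<in>{0..1}. \<bar>- (1 / f t)\<bar> \<le> max M1 M2" using M2(2) by (auto intro: max.coboundedI2)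
    qed (use M1(1) first second c \<epsilon> in \<open>auto simp: sqnorm2_def\<close>)
    then obtain w u A B where w: "w \<notin> \<real>" "max M1 M2 * norm w \<le> 1 / 2" "- (min \<epsilon> 1) < u" "u < 0"
      and A: "((\<lambda>s. of_real (- (1 / f s)) * w / (1 - of_real (- (1 / f s)) * w)) has_integral A) {0..1}"
      and B: "((\<lambda>s. of_real (g s) * w / (1 - of_real (g s) * w)) has_integral B) {0..1}"
      and AB: "of_real 1 * A + of_real c * B = complex_of_real u" by blast
    have w0: "w \<noteq> 0" using w(1) by auto
    define z where "z = - 1 / w"
    have zR: "z \<notin> \<real>"
    proof
      assume "z \<in> \<real>"
      then have "- 1 / z \<in> \<real>" by simp
      then show False using w(1) w0 by (simp add: z_def)
    qed
    have "((\<lambda>s::real. 1 :: complex) has_integral 1) {0..1}" using has_integral_const_real[of "1::complex" 0 1] by simp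
    from has_integral_neg[OF has_integral_add[OF this A]]
    have A': "((\<lambda>s. complex_of_real (f s) * z / (1 - complex_of_real (f s) * z)) has_integral - (1 + A)) {0..1}"
    proof (rule has_integral_eq[rotated])
      fix s :: real assume s: "s \<in> {0..1}"
      show "- (1 + complex_of_real (- (1 / f s)) * w / (1 - of_real (- (1 / f s)) * w)) =
          complex_of_real (f s) * z / (1 - complex_of_real (f s) * z)"
        using resolvent_reciprocal[OF _ nonreal_add_of_real[OF w(1)], of "f s"] f[OF s]
          resolvent_inversion[OF w0 nonreal_add_of_real[OF w(1)], of "f s"]
        unfolding z_def by simp
    qed
    have B': "((\<lambda>s. complex_of_real (g s) / (z + complex_of_real (g s))) has_integral - B) {0..1}"
    proof (rule has_integral_eq[rotated, OF has_integral_neg[OF B]])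
      fix s :: real assume "s \<in> {0..1}"
      show "- (complex_of_real (g s) * w / (1 - of_real (g s) * w)) = complex_of_real (g s) / (z + complex_of_real (g s))"
        unfolding z_def by (rule reciprocal_inversion[OF w0, symmetric])
    qed
    have "action_equation f g c (- 1 - u) z"
      unfolding action_equation_def integral_unique[OF A'] integral_unique[OF B'] using AB by (simp add: algebra_simps)
    then have "- 1 - u \<in> limit_support f g c"
      unfolding limit_support_def using zR w(3,4) c action_equation_cnj by auto
    then show ?thesis using w(3) by (intro bexI[of _ "- 1 - u"]) auto
  qed
  show ?thesis
    unfolding t_minus_def
  proof (rule cInf_eq_non_empty)
    show "limit_support f g c \<noteq> {}" using mem[of 1] by auto
    show "-1 \<le> x" if "x \<in> limit_support f g c" for x using that by (simp add: limit_support_def)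
    show "y \<le> -1" if "\<And>x. x \<in> limit_support f g c \<Longrightarrow> y \<le> x" for y
      using mem[of "y + 1"] that by (rule_tac ccontr) force
  qed
qed

section \<open>Gap probabilities\<close>

definition rect_sum :: "nat \<Rightarrow> nat \<Rightarrow> nat \<Rightarrow> (nat \<Rightarrow> real) \<Rightarrow> (nat \<Rightarrow> real) \<Rightarrow> real" where
  "rect_sum n k m x y = (\<Sum>\<nu>\<in>box_partitions n m. schur n x \<nu> * schur k y (conj_partition \<nu>))"

lemma schur_tendsto:
  assumes "\<And>i. ((\<lambda>\<theta>. X \<theta> i) \<longlongrightarrow> x i) F"
  shows "((\<lambda>\<theta>. schur n (X \<theta>) \<mu>) \<longlongrightarrow> schur n x \<mu>) F"
  unfolding schur_def by (intro tendsto_intros assms)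

lemma rect_sum_tendsto:
  assumes "\<And>i. ((\<lambda>\<theta>. X \<theta> i) \<longlongrightarrow> x i) F" "\<And>i. ((\<lambda>\<theta>. Y \<theta> i) \<longlongrightarrow> y i) F"
  shows "((\<lambda>\<theta>. rect_sum n k m (X \<theta>) (Y \<theta>)) \<longlongrightarrow> rect_sum n k m x y) F"
  unfolding rect_sum_def by (intro tendsto_intros schur_tendsto assms)

lemma perturbation_tendsto: "((\<lambda>\<theta>. x i + \<theta> * real i) \<longlongrightarrow> x i) (at_right 0)"
proof -
  have "((\<lambda>\<theta>. x i + \<theta> * real i) \<longlongrightarrow> x i + 0 * real i) (at_right 0)" by (intro tendsto_intros)
  then show ?thesis by simp
qed

text \<open>Equal entries are separated by every positive \<open>\<theta>\<close> because their
  indices differ; different entries remain different for small \<open>\<theta>\<close>.\<close>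

lemma eventually_perturbation_generic:
  assumes x: "\<forall>i\<in>{1..n}. x i \<ge> 0"
  shows "eventually (\<lambda>\<theta>. inj_on (\<lambda>i. x i + \<theta> * real i) {1..n} \<and> (\<forall>i\<in>{1..n}. x i + \<theta> * real i > 0)) (at_right 0)"
proof (rule eventually_conj)
  have sep: "eventually (\<lambda>\<theta>. i \<noteq> j \<longrightarrow> x i + \<theta> * real i \<noteq> x j + \<theta> * real j) (at_right 0)" for i j
  proof (cases "x i = x j")
    case True
    show ?thesis using eventually_at_right_less[of "0::real"] by eventually_elim (simp add: True)
  next
    case False
    have "((\<lambda>\<theta>. (x i + \<theta> * real i) - (x j + \<theta> * real j)) \<longlongrightarrow> x i - x j) (at_right 0)"
      by (intro tendsto_diff perturbation_tendsto)
    then have "eventually (\<lambda>\<theta>. (x i + \<theta> * real i) - (x j + \<theta> * real j) \<noteq> 0) (at_right 0)"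
      by (rule tendsto_imp_eventually_ne) (use False in simp)
    then show ?thesis by eventually_elim simp
  qed
  have "eventually (\<lambda>\<theta>. \<forall>i\<in>{1..n}. \<forall>j\<in>{1..n}. i \<noteq> j \<longrightarrow> x i + \<theta> * real i \<noteq> x j + \<theta> * real j) (at_right 0)"
    by (intro eventually_ball_finite ballI sep finite_atLeastAtMost)
  then show "eventually (\<lambda>\<theta>. inj_on (\<lambda>i. x i + \<theta> * real i) {1..n}) (at_right 0)"
    by eventually_elim (meson inj_onI)
  show "eventually (\<lambda>\<theta>. \<forall>i\<in>{1..n}. x i + \<theta> * real i > 0) (at_right 0)"
    using eventually_at_right_less[of "0::real"]
    by eventually_elim (use x in \<open>auto intro!: add_nonneg_pos mult_pos_pos\<close>)
qed

text \<open>The dual Cauchy identity is the case \<open>\<Delta> = 0\<close> with its empty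
  determinant, first for distinct positive variables and then by continuity.\<close>

lemma rect_sum_total:
  assumes x: "\<forall>i\<in>{1..n}. x i \<ge> 0" and y: "\<forall>j\<in>{1..k}. y j \<ge> 0"
  shows "rect_sum n k k x y = (\<Prod>i=1..n. \<Prod>j=1..k. 1 + x i * y j)"
proof (rule tendsto_unique)
  let ?X = "\<lambda>\<theta> i. x i + \<theta> * real i" and ?Y = "\<lambda>\<theta> i. y i + \<theta> * real i"
  show "at_right (0::real) \<noteq> bot" by simp
  show "((\<lambda>\<theta>. rect_sum n k k (?X \<theta>) (?Y \<theta>)) \<longlongrightarrow> rect_sum n k k x y) (at_right 0)"
    by (intro rect_sum_tendsto perturbation_tendsto)
  show "((\<lambda>\<theta>. rect_sum n k k (?X \<theta>) (?Y \<theta>)) \<longlongrightarrow> (\<Prod>i=1..n. \<Prod>j=1..k. 1 + x i * y j)) (at_right 0)"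
  proof (rule Lim_transform_eventually)
    show "((\<lambda>\<theta>. \<Prod>i=1..n. \<Prod>j=1..k. 1 + ?X \<theta> i * ?Y \<theta> j) \<longlongrightarrow> (\<Prod>i=1..n. \<Prod>j=1..k. 1 + x i * y j)) (at_right 0)"
      by (intro tendsto_prod tendsto_add tendsto_const tendsto_mult perturbation_tendsto)
    show "eventually (\<lambda>\<theta>. (\<Prod>i=1..n. \<Prod>j=1..k. 1 + ?X \<theta> i * ?Y \<theta> j) = rect_sum n k k (?X \<theta>) (?Y \<theta>)) (at_right 0)"
      using eventually_perturbation_generic[of n x, OF x] eventually_perturbation_generic[of k y, OF y]
    proof eventually_elim
      case (elim \<theta>)
      have "rect_sum n k (k - 0) (?X \<theta>) (?Y \<theta>) = (\<Prod>i=1..n. \<Prod>j=1..k. 1 + ?X \<theta> i * ?Y \<theta> j) *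
          fdet 0 (\<lambda>p p'. (if p = p' then 1 else 0) - gap_kernel n k (?X \<theta>) (?Y \<theta>) p p')"
        unfolding rect_sum_def by (rule truncated_sum_eq_gap_det) (use elim in auto)
      then show ?case by (simp add: fdet_col)
    qed
  qed
qed

text \<open>The weights are nonnegative and sum to 1 by the dual Cauchy identity, which is what lets
  \<open>embed_pmf\<close> return them as probabilities.\<close>

lemma prob_skew_howe:
  assumes x: "\<forall>i\<in>{1..n}. x i \<ge> 0" and y: "\<forall>j\<in>{1..k}. y j \<ge> 0"
  shows "measure_pmf.prob (skew_howe_pmf n k x y) A =
    (\<Sum>\<mu>\<in>A \<inter> box_partitions n k. schur n x \<mu> * schur k y (conj_partition \<mu>)) / (\<Prod>i=1..n. \<Prod>j=1..k. 1 + x i * y j)"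
proof -
  let ?P = "\<Prod>i=1..n. \<Prod>j=1..k. 1 + x i * y j" and ?B = "box_partitions n k"
  let ?w = "\<lambda>\<mu>. schur n x \<mu> * schur k y (conj_partition \<mu>) / ?P"
  let ?f = "\<lambda>\<mu>. if \<mu> \<in> ?B then ?w \<mu> else 0"
  have P: "?P > 0" by (intro prod_pos ballI add_pos_nonneg mult_nonneg_nonneg bspec[OF x] bspec[OF y]) auto
  have w: "?w \<mu> \<ge> 0" for \<mu>
    by (intro divide_nonneg_pos mult_nonneg_nonneg schur_nonneg bspec[OF x] bspec[OF y] order_less_imp_le[OF P] P) auto
  have "(\<integral>\<^sup>+\<mu>. ennreal (?f \<mu>) \<partial>count_space UNIV) = (\<Sum>\<mu>\<in>?B. ennreal (?f \<mu>))"
    by (rule nn_integral_count_space'[OF finite_box_partitions]) auto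
  also have "\<dots> = (\<Sum>\<mu>\<in>?B. ennreal (?w \<mu>))" by (rule sum.cong) auto
  also have "\<dots> = ennreal (\<Sum>\<mu>\<in>?B. ?w \<mu>)" by (rule sum_ennreal) (rule w)
  also have "(\<Sum>\<mu>\<in>?B. ?w \<mu>) = rect_sum n k k x y / ?P" by (simp add: rect_sum_def sum_divide_distrib)
  also have "\<dots> = 1" unfolding rect_sum_total[OF x y] by (rule divide_self) (rule less_imp_neq[OF P, symmetric])
  finally have "(\<integral>\<^sup>+\<mu>. ennreal (?f \<mu>) \<partial>count_space UNIV) = 1" by simp
  then have pmf: "pmf (skew_howe_pmf n k x y) \<mu> = ?f \<mu>" for \<mu>
    unfolding skew_howe_pmf_def by (intro pmf_embed_pmf) (use w in auto)
  have "measure_pmf.prob (skew_howe_pmf n k x y) A = measure_pmf.prob (skew_howe_pmf n k x y) (A \<inter> ?B)"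
    by (rule measure_prob_cong_0) (auto simp: pmf)
  also have "\<dots> = (\<Sum>\<mu>\<in>A \<inter> ?B. ?f \<mu>)"
    by (subst measure_measure_pmf_finite) (auto simp: pmf finite_box_partitions)
  also have "\<dots> = (\<Sum>\<mu>\<in>A \<inter> ?B. ?w \<mu>)" by (rule sum.cong) auto
  finally show ?thesis by (simp add: sum_divide_distrib)
qed

lemma prob_first_row:
  assumes x: "\<forall>i\<in>{1..n}. x i \<ge> 0" and y: "\<forall>j\<in>{1..k}. y j \<ge> 0" and \<Delta>: "\<Delta> \<le> k"
  shows "measure_pmf.prob (skew_howe_pmf n k x y) {\<mu>. int (\<mu> 0) - int k \<le> - int \<Delta>} =
    rect_sum n k (k - \<Delta>) x y / (\<Prod>i=1..n. \<Prod>j=1..k. 1 + x i * y j)"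
proof -
  have "{\<mu>. int (\<mu> 0) - int k \<le> - int \<Delta>} \<inter> box_partitions n k = box_partitions n (k - \<Delta>)"
    using \<Delta> unfolding box_partitions_width[OF diff_le_self] by auto
  then show ?thesis by (simp only: prob_skew_howe[OF x y] rect_sum_def)
qed

text \<open>Conjugation maps the box to the transposed one and exchanges the two Schur factors; the
  first column becomes a first row with the variables exchanged.\<close>

lemma prob_first_column:
  assumes x: "\<forall>i\<in>{1..n}. x i \<ge> 0" and y: "\<forall>j\<in>{1..k}. y j \<ge> 0" and \<Delta>: "\<Delta> \<le> n"
  shows "measure_pmf.prob (skew_howe_pmf n k x y) {\<mu>. int (conj_partition \<mu> 0) - int n \<le> - int \<Delta>} =
    rect_sum k n (n - \<Delta>) y x / (\<Prod>j=1..k. \<Prod>i=1..n. 1 + y j * x i)"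
proof -
  let ?A = "{\<mu>. int (conj_partition \<mu> 0) - int n \<le> - int \<Delta>} \<inter> box_partitions n k"
  have "(\<Sum>\<mu>\<in>?A. schur n x \<mu> * schur k y (conj_partition \<mu>)) = rect_sum k n (n - \<Delta>) y x"
    unfolding rect_sum_def
  proof (rule sum.reindex_bij_witness[of _ conj_partition conj_partition])
    fix \<mu> assume \<mu>: "\<mu> \<in> ?A"
    then have box: "\<mu> \<in> box_partitions n k" by blast
    show cc: "conj_partition (conj_partition \<mu>) = \<mu>" by (rule conj_conj_partition[OF box])
    show "conj_partition \<mu> \<in> box_partitions k (n - \<Delta>)"
      unfolding box_partitions_width[OF diff_le_self] using \<mu> conj_partition_box[OF box] \<Delta> by auto
    show "schur k y (conj_partition \<mu>) * schur n x (conj_partition (conj_partition \<mu>)) =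
        schur n x \<mu> * schur k y (conj_partition \<mu>)" unfolding cc by simp
  next
    fix \<nu> assume "\<nu> \<in> box_partitions k (n - \<Delta>)"
    then have \<nu>: "\<nu> \<in> box_partitions k n" "\<nu> 0 \<le> n - \<Delta>" unfolding box_partitions_width[OF diff_le_self] by auto
    show "conj_partition (conj_partition \<nu>) = \<nu>" by (rule conj_conj_partition[OF \<nu>(1)])
    then show "conj_partition \<nu> \<in> ?A" using \<nu> conj_partition_box[OF \<nu>(1)] \<Delta> by auto
  qed
  moreover have "(\<Prod>i=1..n. \<Prod>j=1..k. 1 + x i * y j) = (\<Prod>j=1..k. \<Prod>i=1..n. 1 + y j * x i)"
    by (subst prod.swap) (simp add: mult.commute)
  ultimately show ?thesis by (simp only: prob_skew_howe[OF x y])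
qed

text \<open>N entries change by at most 1 / (N + 1) each, so the two power sums change by at most 1
  and 2 M + 1, and the factors \<open>\<eta> n\<close> make this vanish.\<close>

lemma scaling_perturb:
  assumes sc: "scaling N b \<eta> M s"
    and b': "\<And>n i. i \<in> {1..N n} \<Longrightarrow> \<bar>b' n i - b n i\<bar> \<le> 1 / real (N n + 1)"
  shows "scaling N b' \<eta> (M + 1) s"
proof -
  interpret scaling N b \<eta> M s by (rule sc)
  have le1: "real (N n) * (1 / real (N n + 1)) \<le> 1" for n by (simp add: divide_simps)
  have b'M: "\<bar>b' n i\<bar> \<le> M + 1" if "i \<in> {1..N n}" for n i
  proof -
    have "1 / real (N n + 1) \<le> 1" by (simp add: divide_simps)
    then show ?thesis using b'[OF that] bound[OF that] by linarith
  qed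
  have small: "(\<lambda>n. \<eta> n * D n) \<longlonglongrightarrow> 0" if D: "\<And>n. \<bar>D n\<bar> \<le> C" for D :: "nat \<Rightarrow> real" and C
  proof (rule Lim_null_comparison)
    show "eventually (\<lambda>n. norm (\<eta> n * D n) \<le> \<eta> n * C) sequentially"
      by (intro always_eventually allI) (simp add: abs_mult eta_nonneg mult_left_mono D)
    show "(\<lambda>n. \<eta> n * C) \<longlonglongrightarrow> 0" by (rule tendsto_mult_left_zero[OF eta])
  qed
  show ?thesis
  proof
    show "\<bar>b' n i\<bar> \<le> M + 1" if "i \<in> {1..N n}" for n i by (rule b'M[OF that])
    show "\<eta> n \<ge> 0" for n by (rule eta_nonneg)
    show "\<eta> \<longlonglongrightarrow> 0" by (rule eta)
    have "\<bar>(\<Sum>i=1..N n. b' n i) - (\<Sum>i=1..N n. b n i)\<bar> \<le> 1" for n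
    proof -
      have "\<bar>\<Sum>i=1..N n. b' n i - b n i\<bar> \<le> (\<Sum>i=1..N n. 1 / real (N n + 1))"
        by (rule order_trans[OF sum_abs sum_mono]) (rule b')
      also have "\<dots> = real (N n) * (1 / real (N n + 1))" by simp
      finally show ?thesis using le1[of n] unfolding sum_subtractf by (rule order_trans)
    qed
    then have "(\<lambda>n. \<eta> n * ((\<Sum>i=1..N n. b' n i) - (\<Sum>i=1..N n. b n i))) \<longlonglongrightarrow> 0" by (rule small)
    from tendsto_add[OF first this]
    show "(\<lambda>n. \<eta> n * (\<Sum>i=1..N n. b' n i)) \<longlonglongrightarrow> - s" by (simp add: algebra_simps)
    have "\<bar>\<eta> n * ((\<Sum>i=1..N n. (b' n i)\<^sup>2) - (\<Sum>i=1..N n. (b n i)\<^sup>2))\<bar> \<le> \<eta> n * (2 * M + 1)" for n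
    proof -
      have "\<bar>(b' n i)\<^sup>2 - (b n i)\<^sup>2\<bar> \<le> 1 / real (N n + 1) * (2 * M + 1)" if i: "i \<in> {1..N n}" for i
      proof -
        have "(b' n i)\<^sup>2 - (b n i)\<^sup>2 = (b' n i - b n i) * (b' n i + b n i)" by (simp add: power2_eq_square algebra_simps)
        moreover have "\<bar>b' n i + b n i\<bar> \<le> 2 * M + 1" using b'M[OF i] bound[OF i] by linarith
        ultimately show ?thesis unfolding abs_mult using b'[OF i] by (simp only: abs_mult) (rule mult_mono, auto)
      qed
      then have "\<bar>\<Sum>i=1..N n. (b' n i)\<^sup>2 - (b n i)\<^sup>2\<bar> \<le> (\<Sum>i=1..N n. 1 / real (N n + 1) * (2 * M + 1))"
        by (intro order_trans[OF sum_abs sum_mono]) auto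
      also have "\<dots> = (real (N n) * (1 / real (N n + 1))) * (2 * M + 1)" by simp
      also have "\<dots> \<le> 1 * (2 * M + 1)" using M_nonneg by (intro mult_right_mono le1) simp
      finally show ?thesis by (simp add: sum_subtractf abs_mult eta_nonneg mult_left_mono)
    qed
    then have "(\<lambda>n. \<eta> n * (\<eta> n * ((\<Sum>i=1..N n. (b' n i)\<^sup>2) - (\<Sum>i=1..N n. (b n i)\<^sup>2)))) \<longlonglongrightarrow> 0"
    proof -
      assume *: "\<And>n. \<bar>\<eta> n * ((\<Sum>i=1..N n. (b' n i)\<^sup>2) - (\<Sum>i=1..N n. (b n i)\<^sup>2))\<bar> \<le> \<eta> n * (2 * M + 1)"
      obtain H where H: "\<And>n. norm (\<eta> n) \<le> H" using Bseq_def convergent_imp_Bseq[OF convergentI[OF eta]] by metis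
      have "\<eta> n * (2 * M + 1) \<le> H * (2 * M + 1)" for n
        using H[of n] M_nonneg by (intro mult_right_mono) auto
      from small[OF order_trans[OF * this]] show ?thesis .
    qed
    from tendsto_add[OF second this]
    show "(\<lambda>n. (\<eta> n)\<^sup>2 * (\<Sum>i=1..N n. (b' n i)\<^sup>2)) \<longlonglongrightarrow> 1" by (simp add: algebra_simps power2_eq_square)
  qed
qed

lemma fdet_conjugate:
  fixes A :: "nat \<Rightarrow> nat \<Rightarrow> 'a::field"
  assumes "\<And>i. i < n \<Longrightarrow> d i \<noteq> 0"
  shows "fdet n (\<lambda>i j. d i * A i j / d j) = fdet n A"
proof -
  have "fdet n (\<lambda>i j. d i * A i j / d j) = fdet n (\<lambda>i j. d i * (inverse (d j) * A i j))"
    by (rule fdet_cong) (simp add: divide_inverse mult_ac)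
  also have "\<dots> = (\<Prod>i<n. d i) * ((\<Prod>j<n. inverse (d j)) * fdet n A)"
    unfolding fdet_scale_rows fdet_scale_cols ..
  also have "\<dots> = (\<Prod>i<n. d i * inverse (d i)) * fdet n A" by (simp add: prod.distrib)
  also have "(\<Prod>i<n. d i * inverse (d i)) = 1" by (rule prod.neutral) (use assms in auto)
  finally show ?thesis by simp
qed

lemma fdet_tendsto:
  fixes A :: "'b \<Rightarrow> nat \<Rightarrow> nat \<Rightarrow> real"
  assumes "\<And>i j. i < n \<Longrightarrow> j < n \<Longrightarrow> ((\<lambda>t. A t i j) \<longlongrightarrow> B i j) F"
  shows "((\<lambda>t. fdet n (A t)) \<longlongrightarrow> fdet n B) F"
  unfolding fdet_col
proof (intro tendsto_sum tendsto_mult tendsto_const tendsto_prod)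
  fix p j assume "p \<in> {p. p permutes {0..<n}}" "j \<in> {..<n}"
  then show "((\<lambda>t. A t (p j) j) \<longlongrightarrow> B (p j) j) F"
    using permutes_in_image[of p "{0..<n}" j] by (intro assms) auto
qed

text \<open>For each n the \<open>x\<close> are replaced by distinct values so close that the array
  keeps its limits and the probability changes by less than 1 / (n + 1). The gap kernel of the new
  values is a line kernel, whose limit depends on the array only through the power sums.\<close>

theorem gap_probability_tendsto:
  assumes sc: "scaling (\<lambda>n. p n + q n) (\<lambda>n. joint (p n) (x n) (y n)) \<eta> M s"
    and \<eta>: "eventually (\<lambda>n. \<eta> n > 0) sequentially"
    and x: "\<And>n i. i \<in> {1..p n} \<Longrightarrow> x n i \<ge> 0" and y: "\<And>n j. j \<in> {1..q n} \<Longrightarrow> y n j > 0"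
    and q: "filterlim q at_top sequentially"
  shows "(\<lambda>n. rect_sum (p n) (q n) (q n - \<Delta>) (x n) (y n) / (\<Prod>i=1..p n. \<Prod>j=1..q n. 1 + x n i * y n j))
    \<longlonglongrightarrow> hermite_gap_det s \<Delta>"
proof -
  define R where "R n x' = rect_sum (p n) (q n) (q n - \<Delta>) x' (y n) / (\<Prod>i=1..p n. \<Prod>j=1..q n. 1 + x' i * y n j)" for n x'
  have "\<exists>x'. inj_on x' {1..p n} \<and> (\<forall>i\<in>{1..p n}. x' i > 0 \<and> \<bar>x' i - x n i\<bar> \<le> 1 / real (p n + q n + 1)) \<and>
      \<bar>R n x' - R n (x n)\<bar> < 1 / real (Suc n)" for n
  proof -
    let ?X = "\<lambda>\<theta> i. x n i + \<theta> * real i"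
    have "(\<Prod>i=1..p n. \<Prod>j=1..q n. 1 + x n i * y n j) > 0"
      by (intro prod_pos ballI add_pos_nonneg mult_nonneg_nonneg x order_less_imp_le[OF y]) auto
    then have "((\<lambda>\<theta>. R n (?X \<theta>)) \<longlongrightarrow> R n (x n)) (at_right 0)"
      unfolding R_def
      by (intro tendsto_divide rect_sum_tendsto tendsto_prod tendsto_add tendsto_mult tendsto_const perturbation_tendsto) (rule less_imp_neq[symmetric])
    then have R: "eventually (\<lambda>\<theta>. dist (R n (?X \<theta>)) (R n (x n)) < 1 / real (Suc n)) (at_right 0)"
      by (rule tendstoD) simp
    have "eventually (\<lambda>\<theta>. \<forall>i\<in>{1..p n}. dist (?X \<theta> i) (x n i) < 1 / real (p n + q n + 1)) (at_right 0)"
      by (intro eventually_ball_finite ballI tendstoD[OF perturbation_tendsto] finite_atLeastAtMost) simp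
    from eventually_happens'[OF _ eventually_conj[OF this eventually_conj[OF R eventually_perturbation_generic[of "p n" "x n", OF ballI[OF x]]]]]
    obtain \<theta> where \<theta>: "\<forall>i\<in>{1..p n}. dist (?X \<theta> i) (x n i) < 1 / real (p n + q n + 1)"
      "dist (R n (?X \<theta>)) (R n (x n)) < 1 / real (Suc n)" "inj_on (?X \<theta>) {1..p n}" "\<forall>i\<in>{1..p n}. ?X \<theta> i > 0"
      by auto
    show ?thesis
    proof (intro exI[of _ "?X \<theta>"] conjI ballI \<theta>(3))
      show "\<bar>R n (?X \<theta>) - R n (x n)\<bar> < 1 / real (Suc n)" using \<theta>(2) by (simp only: dist_real_def)
      fix i assume i: "i \<in> {1..p n}"
      show "?X \<theta> i > 0" using \<theta>(4) i by blast
      show "\<bar>?X \<theta> i - x n i\<bar> \<le> 1 / real (p n + q n + 1)"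
        using \<theta>(1) i unfolding dist_real_def by (meson less_imp_le)
    qed
  qed
  then obtain x' where inj: "\<And>n. inj_on (x' n) {1..p n}"
    and x'0: "\<And>n i. i \<in> {1..p n} \<Longrightarrow> x' n i > 0"
    and x'x: "\<And>n i. i \<in> {1..p n} \<Longrightarrow> \<bar>x' n i - x n i\<bar> \<le> 1 / real (p n + q n + 1)"
    and RR: "\<And>n. \<bar>R n (x' n) - R n (x n)\<bar> < 1 / real (Suc n)" by metis
  have sc': "scaling (\<lambda>n. p n + q n) (\<lambda>n. joint (p n) (x' n) (y n)) \<eta> (M + 1) s"
    by (rule scaling_perturb[OF sc]) (use x'x in \<open>auto simp: joint_def\<close>)
  interpret S: scaling "\<lambda>n. p n + q n" "\<lambda>n. joint (p n) (x' n) (y n)" \<eta> "M + 1" s by (rule sc')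
  have x'M: "x' n i \<le> M + 1" if "i \<in> {1..p n}" for n i
    using S.bound[of i n] that by (auto simp: joint_def)
  have "(\<lambda>n. \<eta> n * (M + 1)) \<longlonglongrightarrow> 0" by (rule tendsto_mult_left_zero[OF S.eta])
  then have "eventually (\<lambda>n. \<eta> n * (M + 1) < 1) sequentially" by (rule order_tendstoD) simp
  moreover have "eventually (\<lambda>n. Suc \<Delta> \<le> q n) sequentially" using q by (simp add: filterlim_at_top)
  ultimately have ev: "eventually (\<lambda>n. \<eta> n > 0 \<and> admissible (\<eta> n) (p n) (q n) (x' n) (y n) \<and> \<Delta> \<le> q n) sequentially"
    using \<eta>
  proof eventually_elim
    case (elim n)
    have "\<eta> n * x' n i < 1" if "i \<in> {1..p n}" for i
      using mult_left_mono[OF x'M[OF that], of "\<eta> n"] elim by linarith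
    then show ?case using elim x'0 y unfolding admissible_def by (auto intro: less_imp_le)
  qed
  \<comment> \<open>Conjugation by powers of \<open>\<eta> n\<close> leaves the determinant
    unchanged and makes every entry converge.\<close>
  define A where "A n i j = \<eta> n powi (int i - int j) * gap_kernel (p n) (q n) (x' n) (y n) i j" for n i j
  have A: "(\<lambda>n. A n i j) \<longlonglongrightarrow> sqrt (fact j / fact i) * hermite_kernel s (Suc j) (Suc i)" if ij: "i < \<Delta>" "j < \<Delta>" for i j
  proof -
    have pos: "eventually (\<lambda>n. \<eta> n > 0 \<and> (\<forall>j\<in>{1..q n}. y n j > 0)) sequentially"
      using \<eta> by eventually_elim (use y in auto)
    have "(\<Sum>r<Suc i. of_real (hermite_He r s / fact r) * gauss_moment (int (Suc j) - 1 + int r - int (Suc i)) s) =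
        of_real (sqrt (fact (Suc j - 1) / fact (Suc i - 1)) * hermite_kernel s (Suc j) (Suc i))"
      by (rule hermite_moment_sum) auto
    with line_kernel_tendsto[OF sc' pos, of "Suc i" "Suc j"]
    have lim: "(\<lambda>n. of_real (\<eta> n powi (int (Suc i) - int (Suc j))) * line_kernel (\<eta> n) (p n) (q n) (x' n) (y n) (Suc j) (Suc i))
        \<longlonglongrightarrow> of_real (sqrt (fact (Suc j - 1) / fact (Suc i - 1)) * hermite_kernel s (Suc j) (Suc i))"
      by (simp only:)
    have "(\<lambda>n. complex_of_real (A n i j)) \<longlonglongrightarrow> of_real (sqrt (fact (Suc j - 1) / fact (Suc i - 1)) * hermite_kernel s (Suc j) (Suc i))"
    proof (rule Lim_transform_eventually[OF lim])
      show "eventually (\<lambda>n. of_real (\<eta> n powi (int (Suc i) - int (Suc j))) * line_kernel (\<eta> n) (p n) (q n) (x' n) (y n) (Suc j) (Suc i) =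
          complex_of_real (A n i j)) sequentially"
        using ev
      proof eventually_elim
        case (elim n)
        have "of_real (gap_kernel (p n) (q n) (x' n) (y n) i j) = line_kernel (\<eta> n) (p n) (q n) (x' n) (y n) (Suc j) (Suc i)"
          by (rule gap_kernel_eq_line_kernel) (use x'0 inj y elim ij in auto)
        then show ?case by (simp add: A_def)
      qed
    qed
    then show ?thesis by (simp only: tendsto_of_real_iff diff_Suc_1)
  qed
  have "(\<lambda>n. fdet \<Delta> (\<lambda>i j. (if i = j then 1 else 0) - A n i j)) \<longlonglongrightarrow>
      fdet \<Delta> (\<lambda>i j. (if i = j then 1 else 0) - sqrt (fact j / fact i) * hermite_kernel s (Suc j) (Suc i))"
    by (intro fdet_tendsto tendsto_diff tendsto_const A)
  \<comment> \<open>The factorials form a diagonal conjugation. The arguments of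
    \<open>hermite_kernel\<close> stand in reverse order since the row index of
    \<open>gap_kernel\<close> belongs to l'; a transposition restores it.\<close>
  also have "fdet \<Delta> (\<lambda>i j. (if i = j then 1 else 0) - sqrt (fact j / fact i) * hermite_kernel s (Suc j) (Suc i)) =
      fdet \<Delta> (\<lambda>i j. inverse (sqrt (fact i)) * ((if i = j then 1 else 0) - hermite_kernel s (Suc j) (Suc i)) / inverse (sqrt (fact j)))"
    by (rule fdet_cong) (simp add: real_sqrt_divide field_simps)
  also have "\<dots> = fdet \<Delta> (\<lambda>i j. (if i = j then 1 else 0) - hermite_kernel s (Suc j) (Suc i))"
    by (rule fdet_conjugate) simp
  also have "\<dots> = fdet \<Delta> (\<lambda>i j. (if j = i then 1 else 0) - hermite_kernel s (Suc i) (Suc j))"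
    by (rule fdet_transpose[symmetric])
  also have "\<dots> = hermite_gap_det s \<Delta>"
    unfolding hermite_gap_det_def by (rule fdet_cong) auto
  finally have lim: "(\<lambda>n. fdet \<Delta> (\<lambda>i j. (if i = j then 1 else 0) - A n i j)) \<longlonglongrightarrow> hermite_gap_det s \<Delta>" .
  have "(\<lambda>n. R n (x' n)) \<longlonglongrightarrow> hermite_gap_det s \<Delta>"
  proof (rule Lim_transform_eventually[OF lim])
    show "eventually (\<lambda>n. fdet \<Delta> (\<lambda>i j. (if i = j then 1 else 0) - A n i j) = R n (x' n)) sequentially"
      using ev
    proof eventually_elim
      case (elim n)
      let ?G = "gap_kernel (p n) (q n) (x' n) (y n)"
      have e0: "\<eta> n \<noteq> 0" using elim by simp
      have pos: "(\<Prod>i=1..p n. \<Prod>j=1..q n. 1 + x' n i * y n j) > 0"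
        by (intro prod_pos ballI add_pos_nonneg mult_nonneg_nonneg order_less_imp_le[OF x'0] order_less_imp_le[OF y]) auto
      have eq: "rect_sum (p n) (q n) (q n - \<Delta>) (x' n) (y n) = (\<Prod>i=1..p n. \<Prod>j=1..q n. 1 + x' n i * y n j) *
          fdet \<Delta> (\<lambda>i j. (if i = j then 1 else 0) - ?G i j)"
        unfolding rect_sum_def by (rule truncated_sum_eq_gap_det) (use x'0 inj y elim in auto)
      have "R n (x' n) = fdet \<Delta> (\<lambda>i j. (if i = j then 1 else 0) - ?G i j)"
        unfolding R_def eq by (rule nonzero_mult_div_cancel_left) (rule less_imp_neq[OF pos, symmetric])
      also have "\<dots> = fdet \<Delta> (\<lambda>i j. \<eta> n ^ i * ((if i = j then 1 else 0) - ?G i j) / \<eta> n ^ j)"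
        by (rule fdet_conjugate[symmetric]) (use e0 in simp)
      also have "\<dots> = fdet \<Delta> (\<lambda>i j. (if i = j then 1 else 0) - A n i j)"
      proof (rule fdet_cong)
        fix i j
        show "\<eta> n ^ i * ((if i = j then 1 else 0) - ?G i j) / \<eta> n ^ j = (if i = j then 1 else 0) - A n i j"
          using e0 by (simp add: A_def power_int_diff right_diff_distrib diff_divide_distrib)
      qed
      finally show ?case ..
    qed
  qed
  moreover have "(\<lambda>n. R n (x' n) - R n (x n)) \<longlonglongrightarrow> 0"
  proof (rule Lim_null_comparison)
    show "eventually (\<lambda>n. norm (R n (x' n) - R n (x n)) \<le> 1 / real (Suc n)) sequentially"
      using RR by (intro always_eventually allI) (simp add: less_imp_le)
    show "(\<lambda>n. 1 / real (Suc n)) \<longlonglongrightarrow> 0" by (rule LIMSEQ_Suc[OF lim_1_over_n])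
  qed
  ultimately have "(\<lambda>n. R n (x' n) - (R n (x' n) - R n (x n))) \<longlonglongrightarrow> hermite_gap_det s \<Delta> - 0"
    by (intro tendsto_diff)
  then show ?thesis by (simp add: R_def)
qed

section \<open>The critical regime\<close>

lemma tendsto_0_times_bounded:
  fixes \<eta> D :: "nat \<Rightarrow> real"
  assumes \<eta>: "\<eta> \<longlonglongrightarrow> 0" and D: "\<And>n. \<bar>D n\<bar> \<le> C"
  shows "(\<lambda>n. \<eta> n * D n) \<longlonglongrightarrow> 0"
proof (rule Lim_null_comparison)
  show "eventually (\<lambda>n. norm (\<eta> n * D n) \<le> \<bar>\<eta> n\<bar> * C) sequentially"
    by (intro always_eventually allI) (simp add: abs_mult mult_left_mono D)
  show "(\<lambda>n. \<bar>\<eta> n\<bar> * C) \<longlonglongrightarrow> 0" by (rule tendsto_mult_left_zero[OF tendsto_rabs_zero[OF \<eta>]])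
qed

lemma const_over_sqrt_tendsto_0: "(\<lambda>n. \<tau> / sqrt (real n)) \<longlonglongrightarrow> 0"
proof (rule tendsto_divide_0[OF tendsto_const])
  have "filterlim (\<lambda>n. sqrt (real n)) at_top sequentially"
    by (rule filterlim_compose[OF sqrt_at_top filterlim_real_sequentially])
  then show "filterlim (\<lambda>n. sqrt (real n)) at_infinity sequentially" by (rule filterlim_at_top_imp_at_infinity)
qed

text \<open>The Riemann sums have errors O(1), which the factor 1 / sqrt n removes, so only the
  integrals have to satisfy the limits. \<open>F\<close> and \<open>H\<close> are \<open>f\<close>
  and \<open>g\<close> at the right corner, \<open>g\<close> and \<open>f\<close> at the left
  one.\<close>

lemma corner_scaling:
  assumes F: "pw_lipschitz \<I> L F" and H: "pw_lipschitz \<J> L' (\<lambda>t. 1 / H t)" and \<tau>: "\<tau> \<ge> 0"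
    and c1: "(\<lambda>n. \<tau> / sqrt (real n) * (real (p n) * integral {0..1} F - real (q n) * integral {0..1} (\<lambda>t. 1 / H t))) \<longlonglongrightarrow> - s"
    and c2: "(\<lambda>n. (\<tau> / sqrt (real n))\<^sup>2 * (real (p n) * sqnorm2 F + real (q n) * sqnorm2 (\<lambda>t. 1 / H t))) \<longlonglongrightarrow> 1"
  shows "\<exists>M. scaling (\<lambda>n. p n + q n) (\<lambda>n. joint (p n) (\<lambda>i. F (real i / real (p n))) (\<lambda>j. H (real j / real (q n))))
    (\<lambda>n. \<tau> / sqrt (real n)) M s"
proof -
  let ?b = "\<lambda>n. joint (p n) (\<lambda>i. F (real i / real (p n))) (\<lambda>j. H (real j / real (q n)))"
  let ?G = "\<lambda>t. 1 / H t"
  obtain M1 where M1: "\<forall>t\<in>{0..1}. \<bar>F t\<bar> \<le> M1" using pw_lipschitz_bounded[OF F] by blast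
  obtain M2 where M2: "\<forall>t\<in>{0..1}. \<bar>1 / H t\<bar> \<le> M2" using pw_lipschitz_bounded[OF H] by blast
  obtain LF where F2: "pw_lipschitz \<I> LF (\<lambda>t. (F t)\<^sup>2)" using pw_lipschitz_power2[OF F] by blast
  obtain LH where H2: "pw_lipschitz \<J> LH (\<lambda>t. (1 / H t)\<^sup>2)" using pw_lipschitz_power2[OF H] by blast
  obtain A where A: "\<And>n. \<bar>(\<Sum>i=1..n. F (real i / real n)) - real n * integral {0..1} F\<bar> \<le> A"
    using riemann_sum_bounded_error'[OF F] by blast
  obtain B where B: "\<And>n. \<bar>(\<Sum>i=1..n. 1 / H (real i / real n)) - real n * integral {0..1} ?G\<bar> \<le> B"
    using riemann_sum_bounded_error'[OF H] by blast
  obtain A2 where A2: "\<And>n. \<bar>(\<Sum>i=1..n. (F (real i / real n))\<^sup>2) - real n * sqnorm2 F\<bar> \<le> A2"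
    unfolding sqnorm2_def using riemann_sum_bounded_error'[OF F2] by blast
  obtain B2 where B2: "\<And>n. \<bar>(\<Sum>i=1..n. (1 / H (real i / real n))\<^sup>2) - real n * sqnorm2 ?G\<bar> \<le> B2"
    unfolding sqnorm2_def using riemann_sum_bounded_error'[OF H2] by blast
  note eta = const_over_sqrt_tendsto_0[of \<tau>]
  show ?thesis
  proof (intro exI[of _ "max M1 M2"] scaling.intro eta)
    fix n i assume i: "i \<in> {1..p n + q n}"
    show "\<bar>?b n i\<bar> \<le> max M1 M2"
    proof (cases "i \<le> p n")
      case True
      then have "real i / real (p n) \<in> {0..1}" by (auto simp: divide_le_eq_1)
      then show ?thesis using True M1 by (auto simp: joint_def intro: max.coboundedI1)
    next
      case False
      then have "real (i - p n) / real (q n) \<in> {0..1}" using i by (auto simp: divide_le_eq_1)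
      from bspec[OF M2 this] show ?thesis using False by (simp add: joint_def max.coboundedI2)
    qed
  next
    show "0 \<le> \<tau> / sqrt (real n)" for n using \<tau> by simp
    let ?D = "\<lambda>n. ((\<Sum>i=1..p n. F (real i / real (p n))) - real (p n) * integral {0..1} F) -
        ((\<Sum>i=1..q n. 1 / H (real i / real (q n))) - real (q n) * integral {0..1} ?G)"
    have "\<bar>?D n\<bar> \<le> A + B" for n using A[of "p n"] B[of "q n"] by linarith
    then have D0: "(\<lambda>n. \<tau> / sqrt (real n) * ?D n) \<longlonglongrightarrow> 0" by (rule tendsto_0_times_bounded[OF eta])
    have eq: "(real (p n) * integral {0..1} F - real (q n) * integral {0..1} ?G) + ?D n = (\<Sum>i=1..p n + q n. ?b n i)" for n
      unfolding sum_joint[of "\<lambda>b. b"] sum_negf by linarith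
    show "(\<lambda>n. \<tau> / sqrt (real n) * (\<Sum>i=1..p n + q n. ?b n i)) \<longlonglongrightarrow> - s"
      using tendsto_add[OF c1 D0] unfolding distrib_left[symmetric] eq by simp
    let ?D2 = "\<lambda>n. ((\<Sum>i=1..p n. (F (real i / real (p n)))\<^sup>2) - real (p n) * sqnorm2 F) +
        ((\<Sum>i=1..q n. (1 / H (real i / real (q n)))\<^sup>2) - real (q n) * sqnorm2 ?G)"
    have "\<bar>?D2 n\<bar> \<le> A2 + B2" for n using A2[of "p n"] B2[of "q n"] by linarith
    moreover have "(\<lambda>n. (\<tau> / sqrt (real n))\<^sup>2) \<longlonglongrightarrow> 0" using tendsto_power[OF eta, of 2] by simp
    ultimately have "(\<lambda>n. (\<tau> / sqrt (real n))\<^sup>2 * ?D2 n) \<longlonglongrightarrow> 0" by (intro tendsto_0_times_bounded)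
    from tendsto_add[OF c2 this]
    show "(\<lambda>n. (\<tau> / sqrt (real n))\<^sup>2 * (\<Sum>i=1..p n + q n. (?b n i)\<^sup>2)) \<longlonglongrightarrow> 1"
      unfolding sum_joint[of "\<lambda>b. b\<^sup>2"] distrib_left[symmetric] power2_minus by (simp add: algebra_simps)
  qed
qed

lemma reciprocal_integral_pos:
  assumes g: "pw_lipschitz \<I> L g" and \<delta>: "\<delta> > 0" "\<forall>t\<in>{0..1}. g t \<ge> \<delta>"
  shows "integral {0..1} (\<lambda>t. 1 / g t) > 0" "sqnorm2 (\<lambda>t. 1 / g t) > 0"
proof -
  obtain L1 where r: "pw_lipschitz \<I> L1 (\<lambda>t. 1 / g t)"
    using pw_lipschitz_inverse[OF g \<delta>(1) bspec[OF \<delta>(2)]] by blast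
  obtain L2 where r2: "pw_lipschitz \<I> L2 (\<lambda>t. (1 / g t)\<^sup>2)" using pw_lipschitz_power2[OF r] by blast
  obtain M where M: "M > 0" "\<forall>t\<in>{0..1}. \<bar>g t\<bar> \<le> M" using pw_lipschitz_bounded[OF g] by blast
  have le: "1 / M \<le> 1 / g t" if "t \<in> {0..1}" for t
    using M(2) \<delta> that by (intro divide_left_mono) (force simp: less_le_trans)+
  have pos: "integral {0..1} h > 0" if h: "h integrable_on {0..1}" "\<And>t. t \<in> {0..1} \<Longrightarrow> d \<le> h t" "d > 0"
    for h :: "real \<Rightarrow> real" and d
  proof -
    have "integral {0..1} (\<lambda>t::real. d) \<le> integral {0..1} h"
      by (rule integral_le[OF integrable_const_ivl h(1)]) (rule h(2))
    then show ?thesis using h(3) by simp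
  qed
  show "integral {0..1} (\<lambda>t. 1 / g t) > 0"
    by (rule pos[OF pw_lipschitz_integrable[OF r] le]) (use M(1) in auto)
  show "sqnorm2 (\<lambda>t. 1 / g t) > 0"
    unfolding sqnorm2_def
  proof (rule pos[OF pw_lipschitz_integrable[OF r2]])
    show "(1 / M)\<^sup>2 \<le> (1 / g t)\<^sup>2" if "t \<in> {0..1}" for t using le[OF that] M(1) by (intro power_mono) auto
  qed (use M(1) in auto)
qed

lemma sqnorm2_nonneg:
  assumes "pw_lipschitz \<I> L f"
  shows "sqnorm2 f \<ge> 0"
proof -
  obtain L2 where "pw_lipschitz \<I> L2 (\<lambda>t. (f t)\<^sup>2)" using pw_lipschitz_power2[OF assms] by blast
  then show ?thesis unfolding sqnorm2_def by (intro integral_nonneg pw_lipschitz_integrable) auto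
qed

lemma eventually_sqrt_pos: "eventually (\<lambda>n. 0 < sqrt (real n)) sequentially"
  using eventually_gt_at_top[of 0] by eventually_elim simp

lemma smallo_sqrt_iff:
  fixes D :: "nat \<Rightarrow> real"
  shows "D \<in> o(\<lambda>n. sqrt (real n)) \<longleftrightarrow> (\<lambda>n. D n / sqrt (real n)) \<longlonglongrightarrow> 0"
proof
  show "(\<lambda>n. D n / sqrt (real n)) \<longlonglongrightarrow> 0 \<Longrightarrow> D \<in> o(\<lambda>n. sqrt (real n))"
    by (rule smalloI_tendsto) (use eventually_sqrt_pos in \<open>auto elim: eventually_mono\<close>)
qed (rule smalloD_tendsto)

lemma regime_iff: "regime c \<tau> s k \<longleftrightarrow> (\<lambda>n. (real (k n) - c * real n) / sqrt (real n)) \<longlonglongrightarrow> s / \<tau>"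
proof -
  have ev: "eventually (\<lambda>n. (real (k n) - (c * real n + s / \<tau> * sqrt (real n))) / sqrt (real n) =
      (real (k n) - c * real n) / sqrt (real n) - s / \<tau>) sequentially"
    using eventually_sqrt_pos by eventually_elim (simp add: diff_divide_distrib add_divide_distrib)
  have "regime c \<tau> s k \<longleftrightarrow> (\<lambda>n. (real (k n) - c * real n) / sqrt (real n) - s / \<tau>) \<longlonglongrightarrow> 0"
    unfolding regime_def smallo_sqrt_iff by (rule tendsto_cong[OF ev])
  then show ?thesis by (simp only: Lim_null[of _ "s / \<tau>"])
qed

lemma regime_ratio:
  assumes "regime c \<tau> s k"
  shows "(\<lambda>n. real (k n) / real n) \<longlonglongrightarrow> c"
proof -
  have "(\<lambda>n. c + (real (k n) - c * real n) / sqrt (real n) * (1 / sqrt (real n))) \<longlonglongrightarrow> c + s / \<tau> * 0"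
    by (intro tendsto_intros const_over_sqrt_tendsto_0 assms[unfolded regime_iff])
  then have lim: "(\<lambda>n. c + (real (k n) - c * real n) / sqrt (real n) * (1 / sqrt (real n))) \<longlonglongrightarrow> c" by simp
  show ?thesis
  proof (rule Lim_transform_eventually[OF lim])
    show "eventually (\<lambda>n. c + (real (k n) - c * real n) / sqrt (real n) * (1 / sqrt (real n)) = real (k n) / real n) sequentially"
      using eventually_gt_at_top[of 0] by eventually_elim (simp add: diff_divide_distrib)
  qed
qed

lemma ratio_at_top:
  assumes "(\<lambda>n. real (k n) / real n) \<longlonglongrightarrow> c" "c > 0"
  shows "filterlim k at_top sequentially"
proof -
  have "filterlim (\<lambda>n. real (k n) / real n * real n) at_top sequentially"
    by (rule filterlim_tendsto_pos_mult_at_top[OF assms filterlim_real_sequentially])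
  moreover have "eventually (\<lambda>n. real (k n) / real n * real n = real (k n)) sequentially"
    using eventually_gt_at_top[of 0] by eventually_elim simp
  ultimately have "filterlim (\<lambda>n. real (k n)) at_top sequentially" by (simp cong: filterlim_cong)
  then show ?thesis using filterlim_sequentially_iff_filterlim_real by blast
qed

text \<open>Up to O(1) the sums are the integrals times n and k, so the condition on the sums
  prescribes the limit of a difference of integrals divided by sqrt n. Dividing once more by sqrt n
  forces the integrals to balance; the difference is then a multiple of k - c n, with a nonzero
  factor, and its limit gives the regime of k.\<close>

lemma critical_condition_iff:
  assumes f: "pw_lipschitz \<I> L f" and r: "pw_lipschitz \<J> L' (\<lambda>t. 1 / g t)"
    and G: "integral {0..1} (\<lambda>t. 1 / g t) > 0"
  shows "(integral {0..1} f = c * integral {0..1} (\<lambda>t. 1 / g t) \<and> regime c \<tau> st k) \<longleftrightarrow>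
    ((\<lambda>n. real (k n) / real n) \<longlonglongrightarrow> c \<and>
     (\<lambda>n. (\<Sum>i<n. f (real i / real n)) - ((\<Sum>j<k n. 1 / g (real j / real (k n))) -
        st * integral {0..1} (\<lambda>t. 1 / g t) / \<tau> * sqrt (real n))) \<in> o(\<lambda>n. sqrt (real n)))"
proof -
  define G where "G = integral {0..1} (\<lambda>t. 1 / g t)"
  define X where "X n = (real n * integral {0..1} f - real (k n) * G) / sqrt (real n)" for n
  let ?D = "\<lambda>n. (\<Sum>i<n. f (real i / real n)) - ((\<Sum>j<k n. 1 / g (real j / real (k n))) - st * G / \<tau> * sqrt (real n))"
  obtain A where A: "\<And>n. \<bar>(\<Sum>i<n. f (real i / real n)) - real n * integral {0..1} f\<bar> \<le> A"
    using riemann_sum_bounded_error[OF f] by blast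
  obtain B where B: "\<And>n. \<bar>(\<Sum>i<n. 1 / g (real i / real n)) - real n * G\<bar> \<le> B"
    unfolding G_def using riemann_sum_bounded_error[OF r] by blast
  define e where "e n = ((\<Sum>i<n. f (real i / real n)) - real n * integral {0..1} f) -
      ((\<Sum>j<k n. 1 / g (real j / real (k n))) - real (k n) * G)" for n
  have "\<bar>e n\<bar> \<le> A + B" for n unfolding e_def using A[of n] B[of "k n"] by linarith
  then have e0: "(\<lambda>n. 1 / sqrt (real n) * e n) \<longlonglongrightarrow> 0"
    by (rule tendsto_0_times_bounded[OF const_over_sqrt_tendsto_0])
  have ev: "eventually (\<lambda>n. ?D n / sqrt (real n) = X n + st * G / \<tau> + 1 / sqrt (real n) * e n) sequentially"
    using eventually_sqrt_pos
  proof eventually_elim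
    case (elim n)
    have D: "?D n = (real n * integral {0..1} f - real (k n) * G) + st * G / \<tau> * sqrt (real n) + e n"
      by (simp add: e_def)
    show ?case unfolding D X_def add_divide_distrib using elim by simp
  qed
  have DX: "?D \<in> o(\<lambda>n. sqrt (real n)) \<longleftrightarrow> X \<longlonglongrightarrow> - (st * G / \<tau>)"
  proof -
    have "?D \<in> o(\<lambda>n. sqrt (real n)) \<longleftrightarrow> (\<lambda>n. X n + st * G / \<tau> + 1 / sqrt (real n) * e n) \<longlonglongrightarrow> 0"
      unfolding smallo_sqrt_iff by (rule tendsto_cong[OF ev])
    also have "\<dots> \<longleftrightarrow> X \<longlonglongrightarrow> - (st * G / \<tau>)"
    proof
      assume "(\<lambda>n. X n + st * G / \<tau> + 1 / sqrt (real n) * e n) \<longlonglongrightarrow> 0"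
      from tendsto_diff[OF tendsto_diff[OF this e0] tendsto_const[of "st * G / \<tau>"]]
      show "X \<longlonglongrightarrow> - (st * G / \<tau>)" by simp
    next
      assume "X \<longlonglongrightarrow> - (st * G / \<tau>)"
      from tendsto_add[OF tendsto_add[OF this tendsto_const[of "st * G / \<tau>"]] e0]
      show "(\<lambda>n. X n + st * G / \<tau> + 1 / sqrt (real n) * e n) \<longlonglongrightarrow> 0" by simp
    qed
    finally show ?thesis .
  qed
  have X_crit: "X n = - G * ((real (k n) - c * real n) / sqrt (real n))" if "integral {0..1} f = c * G" for n
  proof -
    have "real n * integral {0..1} f - real (k n) * G = - G * (real (k n) - c * real n)"
      unfolding that by (simp add: algebra_simps)
    then show ?thesis by (simp only: X_def times_divide_eq_right)
  qed
  have "(integral {0..1} f = c * G \<and> regime c \<tau> st k) \<longleftrightarrow>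
      ((\<lambda>n. real (k n) / real n) \<longlonglongrightarrow> c \<and> ?D \<in> o(\<lambda>n. sqrt (real n)))"
    unfolding DX
  proof (intro iffI conjI; elim conjE)
    assume fG: "integral {0..1} f = c * G" and reg: "regime c \<tau> st k"
    show "(\<lambda>n. real (k n) / real n) \<longlonglongrightarrow> c" by (rule regime_ratio[OF reg])
    from tendsto_mult_left[OF reg[unfolded regime_iff], of "- G"] show "X \<longlonglongrightarrow> - (st * G / \<tau>)"
      unfolding X_crit[OF fG] by (simp add: mult.commute)
  next
    assume kc: "(\<lambda>n. real (k n) / real n) \<longlonglongrightarrow> c" and X: "X \<longlonglongrightarrow> - (st * G / \<tau>)"
    have "(\<lambda>n. X n * (1 / sqrt (real n))) \<longlonglongrightarrow> - (st * G / \<tau>) * 0"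
      by (intro tendsto_mult X const_over_sqrt_tendsto_0)
    moreover have "(\<lambda>n. X n * (1 / sqrt (real n))) \<longlonglongrightarrow> integral {0..1} f - c * G"
    proof (rule Lim_transform_eventually)
      show "(\<lambda>n. integral {0..1} f - real (k n) / real n * G) \<longlonglongrightarrow> integral {0..1} f - c * G"
        by (intro tendsto_intros kc)
      show "eventually (\<lambda>n. integral {0..1} f - real (k n) / real n * G = X n * (1 / sqrt (real n))) sequentially"
        using eventually_gt_at_top[of 0] by eventually_elim (simp add: X_def diff_divide_distrib)
    qed
    ultimately have "- (st * G / \<tau>) * 0 = integral {0..1} f - c * G" by (rule LIMSEQ_unique)
    then show fG: "integral {0..1} f = c * G" by simp
    have G0: "G \<noteq> 0" using G by (simp add: G_def)
    have "- (1 / G) * (- G * z) = z" "- (1 / G) * - (st * G / \<tau>) = st / \<tau>" for z using G0 by simp_all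
    then show "regime c \<tau> st k"
      using tendsto_mult_left[OF X, of "- (1 / G)"] unfolding regime_iff X_crit[OF fG] by (simp only:)
  qed
  then show ?thesis by (simp only: G_def)
qed

section \<open>Limits at the corners\<close>

text \<open>The x-variables stay bounded while the abscissa \<open>\<eta> n\<close> tends to 0, so
  the line eventually lies to the left of all poles 1 / x_i.\<close>

lemma scaling_admissible:
  assumes sc: "scaling (\<lambda>n. p n + q n) (\<lambda>n. joint (p n) (x n) (y n)) \<eta> M s"
    and \<eta>: "eventually (\<lambda>n. \<eta> n > 0) sequentially"
    and x: "\<And>n i. i \<in> {1..p n} \<Longrightarrow> x n i \<ge> 0" and y: "\<And>n j. j \<in> {1..q n} \<Longrightarrow> y n j \<ge> 0"
  shows "eventually (\<lambda>n. admissible (\<eta> n) (p n) (q n) (x n) (y n)) sequentially"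
proof -
  interpret scaling "\<lambda>n. p n + q n" "\<lambda>n. joint (p n) (x n) (y n)" \<eta> M s by (rule sc)
  have xM: "x n i \<le> M" if "i \<in> {1..p n}" for n i
    using bound[of i n] that by (auto simp: joint_def)
  have "(\<lambda>n. \<eta> n * M) \<longlonglongrightarrow> 0" by (rule tendsto_mult_left_zero[OF eta])
  then have "eventually (\<lambda>n. \<eta> n * M < 1) sequentially" by (rule order_tendstoD) simp
  then show ?thesis
    using \<eta>
  proof eventually_elim
    case (elim n)
    have "\<eta> n * x n i < 1" if "i \<in> {1..p n}" for i
      using mult_left_mono[OF xM[OF that], of "\<eta> n"] elim by linarith
    then show ?case using elim x y unfolding admissible_def by blast
  qed
qed

lemma powi_sqrt_rescale:
  assumes "\<tau> > 0" "n > 0"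
  shows "\<tau> powi (int l - int l') * (\<tau> / sqrt (real n)) powi (int l' - int l) = real n powr ((real l - real l') / 2)"
proof -
  let ?e = "int l - int l'"
  have t: "\<tau> powi ?e \<noteq> 0" using assms by simp
  have "(\<tau> / sqrt (real n)) powi (int l' - int l) = inverse (\<tau> powi ?e / sqrt (real n) powi ?e)"
    using power_int_minus[of "\<tau> / sqrt (real n)" ?e] by (simp add: power_int_divide_distrib)
  then have "\<tau> powi ?e * (\<tau> / sqrt (real n)) powi (int l' - int l) = sqrt (real n) powi ?e" using t by simp
  also have "\<dots> = sqrt (real n) powr real_of_int ?e" by (rule powr_real_of_int'[symmetric]) (use assms in auto)
  also have "\<dots> = real n powr (1 / 2 * real_of_int ?e)" using assms by (simp add: powr_half_sqrt[symmetric] powr_powr)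
  finally show ?thesis by simp
qed

lemma rescaled_line_kernel_tendsto:
  assumes sc: "scaling (\<lambda>n. p n + q n) (\<lambda>n. joint (p n) (x n) (y n)) (\<lambda>n. \<tau> / sqrt (real n)) M s"
    and \<tau>: "\<tau> > 0" and y: "\<And>n j. j \<in> {1..q n} \<Longrightarrow> y n j > 0" and l: "l \<ge> 1" "l' \<ge> 1"
  shows "(\<lambda>n. complex_of_real (real n powr ((real l - real l') / 2)) *
      line_kernel (\<tau> / sqrt (real n)) (p n) (q n) (x n) (y n) l l') \<longlonglongrightarrow>
    complex_of_real (\<tau> powi (int l - int l') * sqrt (fact (l - 1) / fact (l' - 1)) * hermite_kernel s l l')"
proof -
  let ?e = "int l - int l'"
  have pos: "eventually (\<lambda>n. \<tau> / sqrt (real n) > 0 \<and> (\<forall>j\<in>{1..q n}. y n j > 0)) sequentially"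
    using eventually_sqrt_pos by eventually_elim (use \<tau> y in auto)
  from tendsto_mult_left[OF line_kernel_tendsto[OF sc pos, of l' l, unfolded hermite_moment_sum[OF l]], of "of_real (\<tau> powi ?e)"]
  have lim: "(\<lambda>n. complex_of_real (\<tau> powi ?e) * (of_real ((\<tau> / sqrt (real n)) powi (int l' - int l)) *
      line_kernel (\<tau> / sqrt (real n)) (p n) (q n) (x n) (y n) l l')) \<longlonglongrightarrow>
    complex_of_real (\<tau> powi ?e * sqrt (fact (l - 1) / fact (l' - 1)) * hermite_kernel s l l')"
    by (simp only: of_real_mult mult.assoc)
  show ?thesis
  proof (rule Lim_transform_eventually[OF lim])
    show "eventually (\<lambda>n. complex_of_real (\<tau> powi ?e) * (of_real ((\<tau> / sqrt (real n)) powi (int l' - int l)) *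
        line_kernel (\<tau> / sqrt (real n)) (p n) (q n) (x n) (y n) l l') =
      complex_of_real (real n powr ((real l - real l') / 2)) *
        line_kernel (\<tau> / sqrt (real n)) (p n) (q n) (x n) (y n) l l') sequentially"
      using eventually_gt_at_top[of 0]
      by eventually_elim (simp only: powi_sqrt_rescale[OF \<tau>, symmetric] of_real_mult mult.assoc)
  qed
qed

lemma eventually_const_over_sqrt_pos: "\<tau> > 0 \<Longrightarrow> eventually (\<lambda>n. \<tau> / sqrt (real n) > 0) sequentially"
  by (rule eventually_mono[OF eventually_sqrt_pos]) simp

lemma right_corner_kernel:
  assumes sc: "scaling (\<lambda>n. n + k n) (\<lambda>n. joint n (x n) (y n)) (\<lambda>n. \<tau> / sqrt (real n)) M s" and \<tau>: "\<tau> > 0"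
    and x: "\<And>n i. i \<in> {1..n} \<Longrightarrow> x n i \<ge> 0" and y: "\<And>n j. j \<in> {1..k n} \<Longrightarrow> y n j > 0"
    and k: "filterlim k at_top sequentially"
    and con: "\<And>n. kernel_contours n (k n) (x n) (y n) (\<gamma>z n) (\<gamma>w n)" and l: "l \<ge> 1" "l' \<ge> 1"
  shows "(\<lambda>n. complex_of_real (real n powr ((real l - real l') / 2)) *
      corr_kernel (\<gamma>z n) (\<gamma>w n) n (k n) (x n) (y n) (int (k n) - int l) (int (k n) - int l')) \<longlonglongrightarrow>
    complex_of_real (\<tau> powi (int l - int l') * sqrt (fact (l - 1) / fact (l' - 1)) * hermite_kernel s l l')"
proof (rule Lim_transform_eventually[OF rescaled_line_kernel_tendsto[OF sc \<tau> y l]])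
  have "eventually (\<lambda>n. admissible (\<tau> / sqrt (real n)) n (k n) (x n) (y n)) sequentially"
    by (rule scaling_admissible[OF sc eventually_const_over_sqrt_pos[OF \<tau>] x less_imp_le[OF y]])
  moreover have "eventually (\<lambda>n. max l l' \<le> k n) sequentially" using k by (simp only: filterlim_at_top)
  ultimately show "eventually (\<lambda>n. complex_of_real (real n powr ((real l - real l') / 2)) *
        line_kernel (\<tau> / sqrt (real n)) n (k n) (x n) (y n) l l' =
      complex_of_real (real n powr ((real l - real l') / 2)) *
      corr_kernel (\<gamma>z n) (\<gamma>w n) n (k n) (x n) (y n) (int (k n) - int l) (int (k n) - int l')) sequentially"
  proof eventually_elim
    case (elim n)
    have "corr_kernel (\<gamma>z n) (\<gamma>w n) n (k n) (x n) (y n) (int (k n) - int l) (int (k n) - int l') =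
        line_kernel (\<tau> / sqrt (real n)) n (k n) (x n) (y n) l l'"
      by (rule corr_kernel_right[OF con elim(1)]) (use elim(2) in auto)
    then show ?case by (simp only:)
  qed
qed

text \<open>The sign (-1)^(l - l') produced by the inversion is absorbed into the power of -
  \<open>\<tau>\<close>.\<close>

lemma left_corner_kernel:
  assumes sc: "scaling (\<lambda>n. k n + n) (\<lambda>n. joint (k n) (y n) (x n)) (\<lambda>n. \<tau> / sqrt (real n)) M s" and \<tau>: "\<tau> > 0"
    and x: "\<And>n i. i \<in> {1..n} \<Longrightarrow> x n i > 0" and y: "\<And>n j. j \<in> {1..k n} \<Longrightarrow> y n j \<ge> 0"
    and con: "\<And>n. kernel_contours n (k n) (x n) (y n) (\<gamma>z n) (\<gamma>w n)" and l: "l \<ge> 1" "l' \<ge> 1"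
  shows "(\<lambda>n. complex_of_real (real n powr ((real l - real l') / 2)) * ((if l = l' then 1 else 0) -
      corr_kernel (\<gamma>z n) (\<gamma>w n) n (k n) (x n) (y n) (- int n + int l - 1) (- int n + int l' - 1))) \<longlonglongrightarrow>
    complex_of_real ((- \<tau>) powi (int l - int l') * sqrt (fact (l - 1) / fact (l' - 1)) * hermite_kernel s l l')"
proof -
  let ?e = "int l - int l'"
  have sgn: "(- \<tau>) powi ?e = (-1) powi ?e * \<tau> powi ?e"
    using power_int_mult_distrib[of "-1" \<tau> ?e] by simp
  from tendsto_mult_left[OF rescaled_line_kernel_tendsto[OF sc \<tau> x l], of "(-1) powi ?e"]
  have lim: "(\<lambda>n. (-1) powi ?e * (complex_of_real (real n powr ((real l - real l') / 2)) *
        line_kernel (\<tau> / sqrt (real n)) (k n) n (y n) (x n) l l')) \<longlonglongrightarrow>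
      complex_of_real ((- \<tau>) powi ?e * sqrt (fact (l - 1) / fact (l' - 1)) * hermite_kernel s l l')"
    unfolding sgn by (simp add: of_real_power_int mult.assoc)
  show ?thesis
  proof (rule Lim_transform_eventually[OF lim])
    have "eventually (\<lambda>n. admissible (\<tau> / sqrt (real n)) (k n) n (y n) (x n)) sequentially"
      by (rule scaling_admissible[OF sc eventually_const_over_sqrt_pos[OF \<tau>] y less_imp_le[OF x]])
    moreover have "eventually (\<lambda>n. max l l' \<le> n) sequentially" by (rule eventually_ge_at_top)
    ultimately show "eventually (\<lambda>n. (-1) powi ?e * (complex_of_real (real n powr ((real l - real l') / 2)) *
        line_kernel (\<tau> / sqrt (real n)) (k n) n (y n) (x n) l l') =
      complex_of_real (real n powr ((real l - real l') / 2)) * ((if l = l' then 1 else 0) -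
        corr_kernel (\<gamma>z n) (\<gamma>w n) n (k n) (x n) (y n) (- int n + int l - 1) (- int n + int l' - 1))) sequentially"
    proof eventually_elim
      case (elim n)
      have "(if l = l' then 1 else 0) - corr_kernel (\<gamma>z n) (\<gamma>w n) n (k n) (x n) (y n) (- int n + int l - 1) (- int n + int l' - 1) =
          (-1) powi ?e * line_kernel (\<tau> / sqrt (real n)) (k n) n (y n) (x n) l l'"
        by (rule corr_kernel_left[OF con elim(1) x]) (use elim(2) in auto)
      then show ?case by (simp only: mult_ac)
    qed
  qed
qed

lemma right_corner_probability:
  assumes sc: "scaling (\<lambda>n. n + k n) (\<lambda>n. joint n (x n) (y n)) (\<lambda>n. \<tau> / sqrt (real n)) M s" and \<tau>: "\<tau> > 0"
    and x: "\<And>n i. i \<in> {1..n} \<Longrightarrow> x n i \<ge> 0" and y: "\<And>n j. j \<in> {1..k n} \<Longrightarrow> y n j > 0"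
    and k: "filterlim k at_top sequentially"
  shows "(\<lambda>n. measure_pmf.prob (skew_howe_pmf n (k n) (x n) (y n)) {\<mu>. int (\<mu> 0) - int (k n) \<le> - int \<Delta>})
    \<longlonglongrightarrow> hermite_gap_det s \<Delta>"
proof (rule Lim_transform_eventually[OF gap_probability_tendsto[OF sc eventually_const_over_sqrt_pos[OF \<tau>] x y k]])
  have "eventually (\<lambda>n. \<Delta> \<le> k n) sequentially" using k by (simp only: filterlim_at_top)
  then show "eventually (\<lambda>n. rect_sum n (k n) (k n - \<Delta>) (x n) (y n) / (\<Prod>i=1..n. \<Prod>j=1..k n. 1 + x n i * y n j) =
      measure_pmf.prob (skew_howe_pmf n (k n) (x n) (y n)) {\<mu>. int (\<mu> 0) - int (k n) \<le> - int \<Delta>}) sequentially"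
  proof eventually_elim
    case (elim n)
    show ?case by (rule prob_first_row[symmetric]) (use x y elim in \<open>auto intro: less_imp_le\<close>)
  qed
qed

lemma left_corner_probability:
  assumes sc: "scaling (\<lambda>n. k n + n) (\<lambda>n. joint (k n) (y n) (x n)) (\<lambda>n. \<tau> / sqrt (real n)) M s" and \<tau>: "\<tau> > 0"
    and x: "\<And>n i. i \<in> {1..n} \<Longrightarrow> x n i > 0" and y: "\<And>n j. j \<in> {1..k n} \<Longrightarrow> y n j \<ge> 0"
  shows "(\<lambda>n. measure_pmf.prob (skew_howe_pmf n (k n) (x n) (y n)) {\<mu>. int (conj_partition \<mu> 0) - int n \<le> - int \<Delta>})
    \<longlonglongrightarrow> hermite_gap_det s \<Delta>"
proof (rule Lim_transform_eventually[OF gap_probability_tendsto[OF sc eventually_const_over_sqrt_pos[OF \<tau>] y x filterlim_ident]])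
  have "eventually (\<lambda>n. \<Delta> \<le> n) sequentially" by (rule eventually_ge_at_top)
  then show "eventually (\<lambda>n. rect_sum (k n) n (n - \<Delta>) (y n) (x n) / (\<Prod>i=1..k n. \<Prod>j=1..n. 1 + y n i * x n j) =
      measure_pmf.prob (skew_howe_pmf n (k n) (x n) (y n)) {\<mu>. int (conj_partition \<mu> 0) - int n \<le> - int \<Delta>}) sequentially"
  proof eventually_elim
    case (elim n)
    show ?case by (rule prob_first_column[symmetric]) (use x y elim in \<open>auto intro: less_imp_le\<close>)
  qed
qed

lemma scaled_norm_tendsto:
  assumes kc: "(\<lambda>n. real (k n) / real n) \<longlonglongrightarrow> c" and S: "A + c * B > 0" and \<tau>: "\<tau> = 1 / sqrt (A + c * B)"
  shows "(\<lambda>n. (\<tau> / sqrt (real n))\<^sup>2 * (real n * A + real (k n) * B)) \<longlonglongrightarrow> 1"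
proof (rule Lim_transform_eventually)
  have "(\<lambda>n. \<tau>\<^sup>2 * (A + real (k n) / real n * B)) \<longlonglongrightarrow> \<tau>\<^sup>2 * (A + c * B)" by (intro tendsto_intros kc)
  also have "\<tau>\<^sup>2 * (A + c * B) = 1" using S by (simp add: \<tau> power_divide)
  finally show "(\<lambda>n. \<tau>\<^sup>2 * (A + real (k n) / real n * B)) \<longlonglongrightarrow> 1" .
  show "eventually (\<lambda>n. \<tau>\<^sup>2 * (A + real (k n) / real n * B) = (\<tau> / sqrt (real n))\<^sup>2 * (real n * A + real (k n) * B)) sequentially"
    using eventually_gt_at_top[of 0]
  proof eventually_elim
    case (elim n)
    have "(\<tau> / sqrt (real n))\<^sup>2 * (real n * A + real (k n) * B) = \<tau>\<^sup>2 * ((real n * A + real (k n) * B) / real n)"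
      by (simp add: power_divide)
    also have "(real n * A + real (k n) * B) / real n = A + real (k n) / real n * B"
      using elim by (simp add: add_divide_distrib)
    finally show ?case ..
  qed
qed

lemma scaled_mean_tendsto:
  assumes reg: "regime c \<tau> st k" and \<tau>: "\<tau> > 0"
  shows "(\<lambda>n. \<tau> / sqrt (real n) * (real (k n) * B - real n * (c * B))) \<longlonglongrightarrow> st * B"
proof -
  have "(\<lambda>n. \<tau> * B * ((real (k n) - c * real n) / sqrt (real n))) \<longlonglongrightarrow> \<tau> * B * (st / \<tau>)"
    by (intro tendsto_intros reg[unfolded regime_iff])
  moreover have "\<tau> * B * ((real (k n) - c * real n) / sqrt (real n)) =
      \<tau> / sqrt (real n) * (real (k n) * B - real n * (c * B))" for n
  proof -
    have "real (k n) * B - real n * (c * B) = (real (k n) - c * real n) * B" by (simp add: algebra_simps)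
    then show ?thesis by simp
  qed
  ultimately show ?thesis using \<tau> by (simp only:) (simp add: mult.commute)
qed

lemma grid_point: "i \<in> {1..n} \<Longrightarrow> real i / real n \<in> {0..1}"
  by (auto simp: divide_le_eq_1)

text \<open>By the critical condition the sum of the array is, up to O(1), - (k - c n) times the
  integral of 1 / g, which the regime turns into - s after rescaling.\<close>

lemma right_corner_scaling:
  assumes f: "pw_lipschitz \<I> L f" and g: "pw_lipschitz \<J> L' g" and \<delta>: "\<delta> > 0" "\<forall>t\<in>{0..1}. g t \<ge> \<delta>" and c: "c > 0"
    and crit: "integral {0..1} f = c * integral {0..1} (\<lambda>t. 1 / g t)" and reg: "regime c (tau_right f g c) st k"
  shows "\<exists>M. scaling (\<lambda>n. n + k n) (\<lambda>n. joint n (\<lambda>i. f (real i / real n)) (\<lambda>j. g (real j / real (k n))))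
    (\<lambda>n. tau_right f g c / sqrt (real n)) M (st * integral {0..1} (\<lambda>t. 1 / g t))"
    "tau_right f g c > 0"
proof -
  let ?G = "integral {0..1} (\<lambda>t. 1 / g t)" and ?\<tau> = "tau_right f g c"
  obtain L1 where r: "pw_lipschitz \<J> L1 (\<lambda>t. 1 / g t)"
    using pw_lipschitz_inverse[OF g \<delta>(1) bspec[OF \<delta>(2)]] by blast
  have S: "sqnorm2 f + c * sqnorm2 (\<lambda>t. 1 / g t) > 0"
    using sqnorm2_nonneg[OF f] reciprocal_integral_pos(2)[OF g \<delta>] c by (simp add: add_nonneg_pos)
  then show \<tau>: "?\<tau> > 0" by (simp add: tau_right_def)
  show "\<exists>M. scaling (\<lambda>n. n + k n) (\<lambda>n. joint n (\<lambda>i. f (real i / real n)) (\<lambda>j. g (real j / real (k n))))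
    (\<lambda>n. ?\<tau> / sqrt (real n)) M (st * ?G)"
  proof (rule corner_scaling[OF f r])
    have "?\<tau> / sqrt (real n) * (real n * integral {0..1} f - real (k n) * ?G) =
        - (?\<tau> / sqrt (real n) * (real (k n) * ?G - real n * (c * ?G)))" for n
      unfolding crit mult_minus_right[symmetric] minus_diff_eq ..
    then show "(\<lambda>n. ?\<tau> / sqrt (real n) * (real n * integral {0..1} f - real (k n) * ?G)) \<longlonglongrightarrow> - (st * ?G)"
      using tendsto_minus[OF scaled_mean_tendsto[OF reg \<tau>, of ?G]] by (simp only:)
    show "(\<lambda>n. (?\<tau> / sqrt (real n))\<^sup>2 * (real n * sqnorm2 f + real (k n) * sqnorm2 (\<lambda>t. 1 / g t))) \<longlonglongrightarrow> 1"
      by (rule scaled_norm_tendsto[OF regime_ratio[OF reg] S tau_right_def])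
  qed (use \<tau> in simp)
qed

text \<open>Now \<open>g\<close> supplies the positive entries and \<open>f\<close> the entries - 1
  / f, so the sum of the array is, up to O(1), + (k - c n) times the integral of \<open>g\<close>;
  hence the opposite sign of \<open>s\<close>.\<close>

lemma left_corner_scaling:
  assumes f: "pw_lipschitz \<I> L f" and g: "pw_lipschitz \<J> L' g" and \<delta>: "\<delta> > 0" "\<forall>t\<in>{0..1}. f t \<ge> \<delta>" and c: "c > 0"
    and crit: "integral {0..1} (\<lambda>t. 1 / f t) = c * integral {0..1} g" and reg: "regime c (tau_left f g c) st k"
  shows "\<exists>M. scaling (\<lambda>n. k n + n) (\<lambda>n. joint (k n) (\<lambda>j. g (real j / real (k n))) (\<lambda>i. f (real i / real n)))
    (\<lambda>n. tau_left f g c / sqrt (real n)) M (- st * integral {0..1} g)"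
    "tau_left f g c > 0"
proof -
  let ?G = "integral {0..1} g" and ?\<tau> = "tau_left f g c"
  obtain L1 where r: "pw_lipschitz \<I> L1 (\<lambda>t. 1 / f t)"
    using pw_lipschitz_inverse[OF f \<delta>(1) bspec[OF \<delta>(2)]] by blast
  have S: "sqnorm2 (\<lambda>t. 1 / f t) + c * sqnorm2 g > 0"
    using sqnorm2_nonneg[OF g] reciprocal_integral_pos(2)[OF f \<delta>] c by (simp add: add_pos_nonneg)
  then show \<tau>: "?\<tau> > 0" by (simp add: tau_left_def)
  show "\<exists>M. scaling (\<lambda>n. k n + n) (\<lambda>n. joint (k n) (\<lambda>j. g (real j / real (k n))) (\<lambda>i. f (real i / real n)))
    (\<lambda>n. ?\<tau> / sqrt (real n)) M (- st * ?G)"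
  proof (rule corner_scaling[OF g r])
    show "(\<lambda>n. ?\<tau> / sqrt (real n) * (real (k n) * ?G - real n * integral {0..1} (\<lambda>t. 1 / f t))) \<longlonglongrightarrow> - (- st * ?G)"
      unfolding crit using scaled_mean_tendsto[OF reg \<tau>, of ?G] by simp
    show "(\<lambda>n. (?\<tau> / sqrt (real n))\<^sup>2 * (real (k n) * sqnorm2 g + real n * sqnorm2 (\<lambda>t. 1 / f t))) \<longlonglongrightarrow> 1"
      using scaled_norm_tendsto[OF regime_ratio[OF reg] S tau_left_def] by (simp only: add.commute)
  qed (use \<tau> in simp)
qed

theorem theorem1p7:
  fixes f g :: "real \<Rightarrow> real" and c st :: real
  assumes f_C1: "piecewise_C1 f" and g_C1: "piecewise_C1 g"
    and f_pos: "\<And>s. s \<in> {0..1} \<Longrightarrow> f s > 0"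
    and g_nonneg: "\<And>s. s \<in> {0..1} \<Longrightarrow> g s \<ge> 0"
    and c_pos: "c > 0"
  shows
    "(finite_norm2 f \<longrightarrow> finite_norm2_inverse g \<longrightarrow>
       (let \<tau> = tau_right f g c; s = st * integral {0..1} (\<lambda>t. 1 / g t) in
        (\<forall>k :: nat \<Rightarrow> nat.
          (integral {0..1} f = c * integral {0..1} (\<lambda>t. 1 / g t) \<and> regime c \<tau> st k) \<longleftrightarrow>
          ((\<lambda>n. real (k n) / real n) \<longlonglongrightarrow> c \<and>
           (\<lambda>n. (\<Sum>i<n. f (real i / real n)) -
                ((\<Sum>j<k n. 1 / g (real j / real (k n))) - s / \<tau> * sqrt (real n)))
             \<in> o(\<lambda>n. sqrt (real n)))) \<and>
        (integral {0..1} f = c * integral {0..1} (\<lambda>t. 1 / g t) \<longrightarrow>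
          t_plus f g c = c \<and>
          (\<forall>k :: nat \<Rightarrow> nat. regime c \<tau> st k \<longrightarrow>
            (let x = (\<lambda>n i. f (real i / real n)); y = (\<lambda>n j. g (real j / real (k n))) in
             (\<forall>\<gamma>z \<gamma>w. (\<forall>n. kernel_contours n (k n) (x n) (y n) (\<gamma>z n) (\<gamma>w n)) \<longrightarrow>
               (\<forall>l\<ge>1. \<forall>l'\<ge>1.
                 (\<lambda>n. complex_of_real (real n powr ((real l - real l') / 2)) *
                    corr_kernel (\<gamma>z n) (\<gamma>w n) n (k n) (x n) (y n)
                      (int (k n) - int l) (int (k n) - int l'))
                 \<longlonglongrightarrow> complex_of_real (\<tau> powi (int l - int l') *
                      sqrt (fact (l - 1) / fact (l' - 1)) * hermite_kernel s l l')) \<and>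
               ((\<forall>\<^sub>F n in sequentially. int (k n) = \<lfloor>c * real n + st / \<tau> * sqrt (real n)\<rfloor>) \<longrightarrow>
                (\<forall>l\<ge>1. \<forall>l'\<ge>1.
                 (\<lambda>n. complex_of_real (real n powr ((real l - real l') / 2)) *
                    corr_kernel (\<gamma>z n) (\<gamma>w n) n (k n) (x n) (y n)
                      (\<lfloor>c * real n + st / \<tau> * sqrt (real n)\<rfloor> - int l)
                      (\<lfloor>c * real n + st / \<tau> * sqrt (real n)\<rfloor> - int l'))
                 \<longlonglongrightarrow> complex_of_real (\<tau> powi (int l - int l') *
                      sqrt (fact (l - 1) / fact (l' - 1)) * hermite_kernel s l l')))) \<and>
             (\<forall>\<Delta> :: nat.
               (\<lambda>n. measure_pmf.prob (skew_howe_pmf n (k n) (x n) (y n))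
                      {\<mu>. int (\<mu> 0) - int (k n) \<le> - int \<Delta>})
               \<longlonglongrightarrow> hermite_gap_det s \<Delta>))))))
     \<and>
     (finite_norm2_inverse f \<longrightarrow> finite_norm2 g \<longrightarrow>
       integral {0..1} (\<lambda>t. 1 / f t) = c * integral {0..1} g \<longrightarrow>
       (let \<tau> = tau_left f g c; s = - st * integral {0..1} g in
        t_minus f g c = -1 \<and>
        (\<forall>k :: nat \<Rightarrow> nat. regime c \<tau> st k \<longrightarrow>
          (let x = (\<lambda>n i. f (real i / real n)); y = (\<lambda>n j. g (real j / real (k n))) in
           (\<forall>\<gamma>z \<gamma>w. (\<forall>n. kernel_contours n (k n) (x n) (y n) (\<gamma>z n) (\<gamma>w n)) \<longrightarrow>
             (\<forall>l\<ge>1. \<forall>l'\<ge>1.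
               (\<lambda>n. complex_of_real (real n powr ((real l - real l') / 2)) *
                  ((if l = l' then 1 else 0) -
                   corr_kernel (\<gamma>z n) (\<gamma>w n) n (k n) (x n) (y n)
                     (- int n + int l - 1) (- int n + int l' - 1)))
               \<longlonglongrightarrow> complex_of_real ((- \<tau>) powi (int l - int l') *
                    sqrt (fact (l - 1) / fact (l' - 1)) * hermite_kernel s l l'))) \<and>
           (\<forall>\<Delta> :: nat.
             (\<lambda>n. measure_pmf.prob (skew_howe_pmf n (k n) (x n) (y n))
                    {\<mu>. int (conj_partition \<mu> 0) - int n \<le> - int \<Delta>})
             \<longlonglongrightarrow> hermite_gap_det s \<Delta>)))))"
proof -
  obtain \<I> L where pf: "pw_lipschitz \<I> L f" using piecewise_C1_pw_lipschitz[OF f_C1] by blast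
  obtain \<J> L' where pg: "pw_lipschitz \<J> L' g" using piecewise_C1_pw_lipschitz[OF g_C1] by blast
  have fx: "f (real i / real n) > 0" if "i \<in> {1..n}" for i n by (rule f_pos[OF grid_point[OF that]])
  have gy: "g (real j / real n) \<ge> 0" if "j \<in> {1..n}" for j n by (rule g_nonneg[OF grid_point[OF that]])
  show ?thesis
  proof (intro conjI impI, goal_cases)
    case 1
    \<comment> \<open>Finiteness of the norm of 1 / g is used here once and for all: it bounds
      \<open>g\<close> away from 0, so that 1 / g is as regular as \<open>g\<close>.\<close>
    obtain \<delta> where \<delta>: "\<delta> > 0" "\<forall>t\<in>{0..1}. g t \<ge> \<delta>"
      using finite_norm2_inverse_lower_bound[OF g_C1 g_nonneg 1(2)] by blast
    obtain L1 where pr: "pw_lipschitz \<J> L1 (\<lambda>t. 1 / g t)"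
      using pw_lipschitz_inverse[OF pg \<delta>(1) bspec[OF \<delta>(2)]] by blast
    note G = reciprocal_integral_pos[OF pg \<delta>]
    have g0: "g t > 0" if "t \<in> {0..1}" for t using \<delta> that by (auto intro: less_le_trans)
    have gy0: "g (real j / real n) > 0" if "j \<in> {1..n}" for j n by (rule g0[OF grid_point[OF that]])
    show ?case
      unfolding Let_def
    proof (intro conjI allI impI, goal_cases)
      case (1 k)
      show ?case by (rule critical_condition_iff[OF pf pr G(1)])
    next
      case 2
      have "sqnorm2 f + c * sqnorm2 (\<lambda>t. 1 / g t) > 0"
        using sqnorm2_nonneg[OF pf] G(2) c_pos by (simp add: add_nonneg_pos)
      from t_plus_eq[OF pf pr g0 c_pos 2 this] show ?case by blast
    next
      case (3 k \<gamma>z \<gamma>w l l')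
      obtain M where sc: "scaling (\<lambda>n. n + k n) (\<lambda>n. joint n (\<lambda>i. f (real i / real n)) (\<lambda>j. g (real j / real (k n))))
          (\<lambda>n. tau_right f g c / sqrt (real n)) M (st * integral {0..1} (\<lambda>t. 1 / g t))"
        using right_corner_scaling(1)[OF pf pg \<delta> c_pos 3(1,2)] by blast
      show ?case
        by (rule right_corner_kernel[OF sc right_corner_scaling(2)[OF pf pg \<delta> c_pos 3(1,2)] less_imp_le[OF fx] gy0
              ratio_at_top[OF regime_ratio[OF 3(2)] c_pos] 3(3)[rule_format] 3(4,5)])
    next
      \<comment> \<open>Once k is equal to the floor, both ways of writing the positions agree, so
        this limit is the previous one.\<close>
      case (4 k \<gamma>z \<gamma>w l l')
      obtain M where sc: "scaling (\<lambda>n. n + k n) (\<lambda>n. joint n (\<lambda>i. f (real i / real n)) (\<lambda>j. g (real j / real (k n))))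
          (\<lambda>n. tau_right f g c / sqrt (real n)) M (st * integral {0..1} (\<lambda>t. 1 / g t))"
        using right_corner_scaling(1)[OF pf pg \<delta> c_pos 4(1,2)] by blast
      show ?case
        by (rule Lim_transform_eventually,
            rule right_corner_kernel[OF sc right_corner_scaling(2)[OF pf pg \<delta> c_pos 4(1,2)] less_imp_le[OF fx] gy0
              ratio_at_top[OF regime_ratio[OF 4(2)] c_pos] 4(3)[rule_format] 4(5,6)],
            assumption+, rule eventually_mono[OF 4(4)], simp only:)
    next
      case (5 k \<Delta>)
      obtain M where sc: "scaling (\<lambda>n. n + k n) (\<lambda>n. joint n (\<lambda>i. f (real i / real n)) (\<lambda>j. g (real j / real (k n))))
          (\<lambda>n. tau_right f g c / sqrt (real n)) M (st * integral {0..1} (\<lambda>t. 1 / g t))"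
        using right_corner_scaling(1)[OF pf pg \<delta> c_pos 5(1,2)] by blast
      show ?case
        by (rule right_corner_probability[OF sc right_corner_scaling(2)[OF pf pg \<delta> c_pos 5(1,2)] less_imp_le[OF fx] gy0
              ratio_at_top[OF regime_ratio[OF 5(2)] c_pos]])
    qed
  next
    case 2
    obtain \<delta> where \<delta>: "\<delta> > 0" "\<forall>t\<in>{0..1}. f t \<ge> \<delta>"
      using finite_norm2_inverse_lower_bound[OF f_C1 less_imp_le[OF f_pos] 2(1)] by blast
    obtain L1 where pr: "pw_lipschitz \<I> L1 (\<lambda>t. 1 / f t)"
      using pw_lipschitz_inverse[OF pf \<delta>(1) bspec[OF \<delta>(2)]] by blast
    note crit = 2(3)
    show ?case
      unfolding Let_def
    proof (intro conjI allI impI, goal_cases)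
      case 1
      have "sqnorm2 (\<lambda>t. 1 / f t) + c * sqnorm2 g > 0"
        using sqnorm2_nonneg[OF pg] reciprocal_integral_pos(2)[OF pf \<delta>] c_pos by (simp add: add_pos_nonneg)
      from t_minus_eq[OF pg pr f_pos c_pos crit this] show ?case by blast
    next
      case (2 k \<gamma>z \<gamma>w l l')
      obtain M where sc: "scaling (\<lambda>n. k n + n) (\<lambda>n. joint (k n) (\<lambda>j. g (real j / real (k n))) (\<lambda>i. f (real i / real n)))
          (\<lambda>n. tau_left f g c / sqrt (real n)) M (- st * integral {0..1} g)"
        using left_corner_scaling(1)[OF pf pg \<delta> c_pos crit 2(1)] by blast
      show ?case
        by (rule left_corner_kernel[OF sc left_corner_scaling(2)[OF pf pg \<delta> c_pos crit 2(1)] fx gy 2(2)[rule_format] 2(3,4)])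
    next
      case (3 k \<Delta>)
      obtain M where sc: "scaling (\<lambda>n. k n + n) (\<lambda>n. joint (k n) (\<lambda>j. g (real j / real (k n))) (\<lambda>i. f (real i / real n)))
          (\<lambda>n. tau_left f g c / sqrt (real n)) M (- st * integral {0..1} g)"
        using left_corner_scaling(1)[OF pf pg \<delta> c_pos crit 3(1)] by blast
      show ?case
        by (rule left_corner_probability[OF sc left_corner_scaling(2)[OF pf pg \<delta> c_pos crit 3(1)] fx gy])
    qed
  qed
qed


end
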